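(* Let $k\ge r\ge 2$ be integers. (i) Let $s\ge 1$ and let $F$ be a graph that consists of $s$ components with chromatic number $k+1$, each of them having a color-critical edge, and any number of components with chromatic number at most $k$. Then for all sufficiently large $n$, $$\mathrm{ex}_r(n,F^{(r)+})=|E(T_r(n,k,s-1))|.$$ (ii) For all sufficiently large $n$, $$\mathrm{ex}_r(n,B_{k+1,1}^{(r)+})=|E(\mathcal{H}_r(n,k))|.$$
   Context: An $r$-graph is an $r$-uniform hypergraph. Given a graph $F$ and $r\ge 2$, the $r$-uniform expansion $F^{(r)+}$ is the $r$-graph obtained from $F$ by adding $r-2$ new vertices to each edge of $F$, so that the $(r-2)|E(F)|$ new vertices are pairwise distinct and not in $V(F)$. $\mathrm{ex}_r(n,\mathcal{F})$ is the largest number of hyperedges in an $n$-vertex $r$-graph containing no copy of $\mathcal{F}$ as a (not necessarily induced) subhypergraph. An edge of a graph is color-critical if deleting it decreases the chromatic number of the graph. A complete $k$-partite $r$-graph with parts $V_1,\dots,V_k$ has as hyperedges all $r$-sets of vertices that contain at most one vertex from each part. $T_r(n,k)$ is the complete balanced $k$-partite $n$-vertex $r$-graph, i.e. each part has order $\lfloor n/k\rfloor$ or $\lceil n/k\rceil$. $T_r(n,k,i)$ is the $n$-vertex $r$-graph obtained by taking a copy of $T_r(n-i,k)$, adding $i$ new vertices, and adding as a hyperedge each $r$-set (of the $n$ vertices) that contains at least one of those $i$ vertices. $B_{k+1,1}$ is the graph consisting of two copies of $K_{k+1}$ sharing exactly one vertex. For an integer $m$ with $2\le m\le n$, let $\mathcal{H}(m)$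 be the complete $k$-partite $n$-vertex $r$-graph with one part $V_1$ of order $m$ and $k-1$ parts $V_2,\dots,V_k$, each of order $\lfloor \frac{n-m}{k-1}\rfloor$ or $\lceil \frac{n-m}{k-1}\rceil$. Let $u,v$ be two distinct vertices of $V_1$. Let $\mathcal{H}'(m)$ be the $r$-graph obtained from $\mathcal{H}(m)$ by adding as hyperedges each $r$-set that contains both $u$ and $v$, and each $r$-set that contains $u$ and $r-1$ vertices from parts other than $V_1$. $\mathcal{H}_r(n,k)$ denotes an $\mathcal{H}'(m)$ having the most hyperedges over all choices of $m$. *)

theory Defs
  imports Complex_Main
begin

record 'a hypergraph =
  verts :: "'a set"
  edges :: "'a set set"

definition r_graph :: "nat \<Rightarrow> 'a hypergraph \<Rightarrow> bool" where
  "r_graph r H \<longleftrightarrow> finite (verts H) \<and> (\<forall>e\<in>edges H. e \<subseteq> verts H \<and> card e = r)"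

text \<open>A graph is a 2-graph; in particular graphs are finite and simple.\<close>

abbreviation graph :: "'a hypergraph \<Rightarrow> bool" where
  "graph \<equiv> r_graph 2"

definition contains_copy :: "'b hypergraph \<Rightarrow> 'a hypergraph \<Rightarrow> bool" where
  "contains_copy G F \<longleftrightarrow>
     (\<exists>f. inj_on f (verts F) \<and> f ` verts F \<subseteq> verts G \<and> (\<forall>e\<in>edges F. f ` e \<in> edges G))"

text \<open>Host vertices are natural numbers; this loses no generality, as every finite hypergraph is
  isomorphic to one on a finite set of natural numbers. The set below is finite, and it is nonempty
  whenever \<open>F\<close> has a hyperedge.\<close>

definition ex_number :: "nat \<Rightarrow> nat \<Rightarrow> 'a hypergraph \<Rightarrow> nat" where
  "ex_number r n F =
     Max {card (edges G) | G :: nat hypergraph.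
            r_graph r G \<and> card (verts G) = n \<and> \<not> contains_copy G F}"

text \<open>The new vertices attached to the edge \<open>e\<close> are the \<open>Inr (e, i)\<close> with \<open>i < r - 2\<close>.\<close>

definition expansion :: "nat \<Rightarrow> 'a hypergraph \<Rightarrow> ('a + 'a set \<times> nat) hypergraph" where
  "expansion r F =
     \<lparr>verts = Inl ` verts F \<union> Inr ` (edges F \<times> {..<r - 2}),
      edges = (\<lambda>e. Inl ` e \<union> Inr ` ({e} \<times> {..<r - 2})) ` edges F\<rparr>"

definition proper_coloring :: "'a hypergraph \<Rightarrow> nat \<Rightarrow> ('a \<Rightarrow> nat) \<Rightarrow> bool" where
  "proper_coloring G c f \<longleftrightarrow>
     f ` verts G \<subseteq> {..<c} \<and> (\<forall>u v. {u, v} \<in> edges G \<longrightarrow> f u \<noteq> f v)"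

definition chromatic_number :: "'a hypergraph \<Rightarrow> nat" where
  "chromatic_number G = (LEAST c. \<exists>f. proper_coloring G c f)"

definition delete_edge :: "'a hypergraph \<Rightarrow> 'a set \<Rightarrow> 'a hypergraph" where
  "delete_edge G e = G\<lparr>edges := edges G - {e}\<rparr>"

definition color_critical :: "'a hypergraph \<Rightarrow> 'a set \<Rightarrow> bool" where
  "color_critical G e \<longleftrightarrow>
     e \<in> edges G \<and> chromatic_number (delete_edge G e) < chromatic_number G"

definition connected_rel :: "'a hypergraph \<Rightarrow> ('a \<times> 'a) set" where
  "connected_rel G =
     {(u, v). u \<in> verts G \<and> v \<in> verts G \<and> (u, v) \<in> {(x, y). {x, y} \<in> edges G}\<^sup>*}"

definition induced :: "'a hypergraph \<Rightarrow> 'a set \<Rightarrow> 'a hypergraph" where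
  "induced G C = \<lparr>verts = C, edges = {e \<in> edges G. e \<subseteq> C}\<rparr>"

definition components :: "'a hypergraph \<Rightarrow> 'a hypergraph set" where
  "components G = induced G ` (verts G // connected_rel G)"

text \<open>The parts are \<open>P 0, \<dots>, P (k - 1)\<close>, which are meant to be pairwise disjoint.\<close>

definition complete_partite :: "nat \<Rightarrow> nat \<Rightarrow> (nat \<Rightarrow> 'a set) \<Rightarrow> 'a hypergraph" where
  "complete_partite r k P =
     \<lparr>verts = (\<Union>j<k. P j),
      edges = {e. e \<subseteq> (\<Union>j<k. P j) \<and> card e = r \<and> (\<forall>j<k. card (e \<inter> P j) \<le> 1)}\<rparr>"

text \<open>Residue classes split an interval of length \<open>N\<close> in \<open>q\<close> parts as evenly as possible;
  \<open>balanced_part_card\<close> below confirms the part sizes.\<close>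

definition balanced_part :: "nat \<Rightarrow> nat \<Rightarrow> nat \<Rightarrow> nat \<Rightarrow> nat set" where
  "balanced_part a N q j = {a + x | x. x < N \<and> x mod q = j}"

definition turan :: "nat \<Rightarrow> nat \<Rightarrow> nat \<Rightarrow> nat hypergraph" where
  "turan r n k = complete_partite r k (balanced_part 0 n k)"

text \<open>\<open>T_r(n,k,i)\<close>: the \<open>i\<close> added vertices are \<open>n - i, \<dots>, n - 1\<close> (for \<open>i \<le> n\<close>).\<close>

definition turan_plus :: "nat \<Rightarrow> nat \<Rightarrow> nat \<Rightarrow> nat \<Rightarrow> nat hypergraph" where
  "turan_plus r n k i =
     \<lparr>verts = verts (turan r (n - i) k) \<union> {n - i..<n},
      edges = edges (turan r (n - i) k) \<union>
        {e. e \<subseteq> {..<n} \<and> card e = r \<and> e \<inter> {n - i..<n} \<noteq> {}}\<rparr>"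

text \<open>The two cliques have vertex sets \<open>{0..k}\<close> and \<open>{k..2 * k}\<close> and share the vertex \<open>k\<close>.\<close>

definition two_cliques :: "nat \<Rightarrow> nat hypergraph" where
  "two_cliques k =
     \<lparr>verts = {0..2 * k},
      edges = {e. card e = 2 \<and> (e \<subseteq> {0..k} \<or> e \<subseteq> {k..2 * k})}\<rparr>"

text \<open>\<open>\<H>(m)\<close> and \<open>\<H>'(m)\<close>: the special part is \<open>V\<^sub>1 = {..<m}\<close> (index \<open>0\<close>), the distinguished
  vertices are \<open>u = 0\<close> and \<open>v = 1\<close>, and the remaining \<open>k - 1\<close> parts partition \<open>{m..<n}\<close>.\<close>

definition H_base :: "nat \<Rightarrow> nat \<Rightarrow> nat \<Rightarrow> nat \<Rightarrow> nat hypergraph" where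
  "H_base r n k m =
     complete_partite r k
       (\<lambda>j. if j = 0 then {..<m} else balanced_part m (n - m) (k - 1) (j - 1))"

definition H_prime :: "nat \<Rightarrow> nat \<Rightarrow> nat \<Rightarrow> nat \<Rightarrow> nat hypergraph" where
  "H_prime r n k m =
     \<lparr>verts = verts (H_base r n k m),
      edges = edges (H_base r n k m)
        \<union> {e. e \<subseteq> {..<n} \<and> card e = r \<and> 0 \<in> e \<and> 1 \<in> e}
        \<union> {e. e \<subseteq> {..<n} \<and> card e = r \<and> 0 \<in> e \<and> card (e \<inter> {m..<n}) = r - 1}\<rparr>"

definition H_extremal :: "nat \<Rightarrow> nat \<Rightarrow> nat \<Rightarrow> nat hypergraph" where
  "H_extremal r n k =
     H_prime r n k (ARG_MAX (\<lambda>m. card (edges (H_prime r n k m))) m. 2 \<le> m \<and> m \<le> n)"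

lemma balanced_part_Union:
  assumes "q > 0"
  shows "(\<Union>j<q. balanced_part a N q j) = {a..<a + N}"
proof -
  have "x \<in> (\<Union>j<q. balanced_part a N q j)" if "a \<le> x" "x < a + N" for x
    using that assms unfolding balanced_part_def
    by (auto intro!: exI[of _ "x - a"] bexI[of _ "(x - a) mod q"])
  then show ?thesis by (auto simp: balanced_part_def)
qed

lemma balanced_part_card:
  assumes "j < q"
  shows "int (card (balanced_part a N q j)) \<in> {\<lfloor>N / q\<rfloor>, \<lceil>N / q\<rceil>}"
proof -
  let ?c = "if j < N mod q then N div q + 1 else N div q"
  have N: "N = q * (N div q) + N mod q" by simp
  have R: "N mod q < q" using assms by simp
  have iff: "q * x + j < N \<longleftrightarrow> x < ?c" for x
  proof -
    consider "x < N div q" | "x = N div q" | "x > N div q" by linarith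
    then show ?thesis
    proof cases
      case 1
      then have "q * Suc x \<le> q * (N div q)" by (intro mult_le_mono) auto
      then have "q * x + q \<le> q * (N div q)" by simp
      then have "q * x + j < N" using assms N by linarith
      then show ?thesis using 1 by simp
    next
      case 2
      then have "q * x + j < N \<longleftrightarrow> j < N mod q" using N by (metis nat_add_left_cancel_less)
      then show ?thesis using 2 by simp
    next
      case 3
      then have "q * Suc (N div q) \<le> q * x" by (intro mult_le_mono) auto
      then have "q * (N div q) + q \<le> q * x" by simp
      then have "\<not> q * x + j < N" using N R by linarith
      then show ?thesis using 3 by simp
    qed
  qed
  have "balanced_part a N q j = (\<lambda>x. a + (q * x + j)) ` {..<?c}"
  proof (intro set_eqI iffI)
    fix y assume "y \<in> balanced_part a N q j"
    then obtain x where x: "y = a + x" "x < N" "x mod q = j"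
      by (auto simp: balanced_part_def)
    then have eq: "x = q * (x div q) + j" by (metis mult_div_mod_eq)
    then have "x div q < ?c" using iff x(2) by metis
    then show "y \<in> (\<lambda>x. a + (q * x + j)) ` {..<?c}"
      using eq x(1) by (intro image_eqI[of _ _ "x div q"]) simp_all
  next
    fix y assume "y \<in> (\<lambda>x. a + (q * x + j)) ` {..<?c}"
    then obtain x where "y = a + (q * x + j)" "x < ?c" by blast
    then show "y \<in> balanced_part a N q j" using iff assms by (auto simp: balanced_part_def)
  qed
  moreover have "inj_on (\<lambda>x. a + (q * x + j)) {..<?c}" using assms by (auto simp: inj_on_def)
  ultimately have c: "card (balanced_part a N q j) = ?c" by (simp add: card_image)
  have fl: "\<lfloor>real N / real q\<rfloor> = int (N div q)" by (rule floor_divide_of_nat_eq)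
  show ?thesis
  proof (cases "j < N mod q")
    case True
    then have "\<not> q dvd N" by auto
    then have "real N / real q \<noteq> of_int \<lfloor>real N / real q\<rfloor>"
      using assms fl
      by (simp add: nonzero_divide_eq_eq flip: of_nat_mult) (metis dvd_triv_right)
    then have "\<lceil>real N / real q\<rceil> = int (N div q) + 1"
      using fl by (simp add: ceiling_altdef)
    then show ?thesis using c True by simp
  next
    case False
    then show ?thesis using c fl by simp
  qed
qed

end

theory Submission
  imports Defs "HOL-Analysis.Convex" "HOL-Library.Disjoint_Sets" "HOL-Computational_Algebra.Polynomial"
    "HOL-Combinatorics.Transposition"
begin

text \<open>A pair of vertices is robust if no bounded vertex set disjoint from the pair meets every hyperedge
  through it; a pair that is not robust has small codegree, and any graph of robust pairs extends
  greedily to its expansion. It thus suffices to find suitable blow-ups of cliques in the graph of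
  robust pairs.

  By deleting vertices of small degree one may assume that all degrees are almost those of the
  extremal construction. Moon--Moser inequalities for clique counts, together with a supersaturation
  argument, then split the vertices into \<open>k\<close> parts with
  almost all pairs between different parts robust, a set \<open>S\<close> of vertices whose
  neighbourhoods contain a blow-up of \<open>K\<^sub>k\<close>, and a set \<open>X\<close> of vertices of smaller robust degree that lie in
  many bad hyperedges, that is, hyperedges meeting some part twice. Every vertex of \<open>S\<close> and every bad
  hyperedge carries one critical component, so in (i) the set \<open>S\<close> and a matching of bad hyperedges
  together have at most \<open>s - 1\<close> members; hence all but few hyperedges that are not transversal meet a
  set of at most \<open>s - 1\<close> vertices. In (ii) the set \<open>S\<close> is empty and, for \<open>r \<ge> 3\<close>, bad hyperedges pairwise
  intersect, so either they are few or they share a vertex \<open>u\<close>; the hyperedges through \<open>u\<close> meeting the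
  part of \<open>u\<close> again form an intersecting family outside \<open>u\<close>, as two of them sharing only \<open>u\<close> would
  yield two cliques with a common vertex.\<close>

section \<open>Elementary symmetric functions of part sizes\<close>

text \<open>Avoiding boundedly many vertices suffices for robustness, because a copy of the
  expansion has at most |V(F)| + r |E(F)| vertices; this is the value later given to
  \<open>w\<close>. Non-robust pairs have codegree O(n^(r-3)), and 0 if \<open>r = 2\<close>, so
  almost all hyperedges at a typical vertex \<open>v\<close> are (r-1)-cliques of robust neighbours
  of \<open>v\<close>. If those neighbours contain no blow-up of a \<open>k\<close>-clique, the
  clique density bound for \<open>k - 1\<close> classes forces about (1 - 1/k) n of them. This lower
  bound on robust degrees starts the stability argument. The obstacle is exactness, so each error
  must be compared with the right power of n. Transversal hyperedges are counted exactly by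
  elementary symmetric functions of the part sizes, which balancing maximises. The remaining
  uncontrolled hyperedges number O(n^(r-2)), while deviating from the extremal structure costs a
  binomial coefficient of order n^(r-1). For the second construction the optimal order of the
  special part has no convenient closed form; its growth in n is therefore obtained from Euler's
  identity and a comparison with the balanced partition.\<close>

definition esym :: "('i \<Rightarrow> nat) \<Rightarrow> 'i set \<Rightarrow> nat \<Rightarrow> nat" where
  "esym b J p = coeff (\<Prod>j\<in>J. [:1, b j:]) p"

lemma esym_empty [simp]: "esym b {} p = (if p = 0 then 1 else 0)"
  by (simp add: esym_def)

lemma esym_0 [simp]: "finite J \<Longrightarrow> esym b J 0 = 1"
  by (induction J rule: finite_induct) (auto simp: esym_def coeff_pCons)

lemma esym_insert:
  assumes "finite J" "j \<notin> J"
  shows "esym b (insert j J) (Suc p) = esym b J (Suc p) + b j * esym b J p"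
  using assms by (simp add: esym_def)

lemma esym_remove:
  assumes "finite J" "j \<in> J"
  shows "esym b J (Suc p) = esym b (J - {j}) (Suc p) + b j * esym b (J - {j}) p"
  using esym_insert[of "J - {j}" j b p] assms by (simp add: insert_absorb)

lemma esym_cong:
  assumes "\<And>j. j \<in> J \<Longrightarrow> b j = c j"
  shows "esym b J p = esym c J p"
  using assms by (simp add: esym_def cong: prod.cong)

lemma esym_reindex:
  assumes "inj_on f I"
  shows "esym b (f ` I) p = esym (\<lambda>i. b (f i)) I p"
  using assms by (simp add: esym_def prod.reindex)

lemma esym_mono:
  assumes "finite J" "\<And>j. j \<in> J \<Longrightarrow> b j \<le> c j"
  shows "esym b J p \<le> esym c J p"
  using assms
proof (induction J arbitrary: p rule: finite_induct)
  case (insert j J)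
  show ?case
  proof (cases p)
    case (Suc q)
    have "b j * esym b J q \<le> c j * esym c J q"
      using insert by (intro mult_mono) auto
    moreover have "esym b J (Suc q) \<le> esym c J (Suc q)" using insert by auto
    ultimately have "esym b J (Suc q) + b j * esym b J q \<le> esym c J (Suc q) + c j * esym c J q"
      by (rule add_mono[rotated])
    then show ?thesis using insert Suc by (simp add: esym_insert)
  qed (use insert in auto)
qed auto

lemma esym_const:
  assumes "finite J"
  shows "esym (\<lambda>_. M) J p = (card J choose p) * M ^ p"
  using assms
proof (induction J arbitrary: p rule: finite_induct)
  case (insert j J)
  then show ?case
    by (cases p) (auto simp: esym_insert algebra_simps)
qed auto

text \<open>A transversal \<open>p\<close>-set of disjoint sets of sizes \<open>b j\<close> is a
  \<open>p\<close>-set of their union. The algebraic proof adds one part at a time,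
  \<open>step\<close> being the two lowest terms of Vandermonde's convolution.\<close>

lemma esym_le_binomial:
  assumes "finite J"
  shows "esym b J p \<le> (\<Sum>j\<in>J. b j) choose p"
  using assms
proof (induction J arbitrary: p rule: finite_induct)
  case (insert j J)
  have step: "(x choose Suc q) + m * (x choose q) \<le> (m + x) choose Suc q" for x q m :: nat
  proof (induction m)
    case (Suc m)
    have "x choose q \<le> (m + x) choose q" by (rule binomial_right_mono) simp
    then show ?case using Suc by simp
  qed simp
  show ?case
  proof (cases p)
    case (Suc q)
    have "esym b J (Suc q) + b j * esym b J q
      \<le> ((\<Sum>j\<in>J. b j) choose Suc q) + b j * ((\<Sum>j\<in>J. b j) choose q)"
      using insert by (intro add_mono mult_le_mono) auto
    also have "\<dots> \<le> (b j + (\<Sum>j\<in>J. b j)) choose Suc q" by (rule step)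
    finally show ?thesis using insert Suc by (simp add: esym_insert)
  qed (use insert in auto)
qed auto

text \<open>Euler's identity for the homogeneous polynomial \<open>esym\<close> of degree \<open>p + 1\<close>.\<close>

lemma esym_euler:
  assumes "finite J"
  shows "(\<Sum>j\<in>J. b j * esym b (J - {j}) p) = Suc p * esym b J (Suc p)"
  using assms
proof (induction J arbitrary: p rule: finite_induct)
  case (insert i J)
  have *: "insert i J - {j} = insert i (J - {j})" if "j \<in> J" for j using insert that by auto
  have "(\<Sum>j\<in>insert i J. b j * esym b (insert i J - {j}) p)
     = b i * esym b J p + (\<Sum>j\<in>J. b j * esym b (insert i (J - {j})) p)"
    using insert * by (simp cong: sum.cong)
  also have "\<dots> = Suc p * esym b (insert i J) (Suc p)"
  proof (cases p)
    case 0
    then show ?thesis using insert insert.IH[of 0]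
      by (simp add: esym_insert algebra_simps)
  next
    case (Suc q)
    have "(\<Sum>j\<in>J. b j * esym b (insert i (J - {j})) (Suc q))
      = (\<Sum>j\<in>J. b j * esym b (J - {j}) (Suc q)) + b i * (\<Sum>j\<in>J. b j * esym b (J - {j}) q)"
      using insert.hyps by (simp add: esym_insert algebra_simps sum.distrib sum_distrib_left)
    also have "\<dots> = Suc (Suc q) * esym b J (Suc (Suc q)) + b i * (Suc q * esym b J (Suc q))"
      by (simp only: insert.IH)
    finally show ?thesis using insert.hyps Suc by (simp add: esym_insert algebra_simps)
  qed
  finally show ?case .
qed auto

text \<open>Moving one unit from a part that is larger than its target to one that is smaller never
  decreases \<open>esym\<close>, because the two parts of a balanced target differ by at most one.\<close>

lemma esym_le_balanced:
  fixes b c :: "'i \<Rightarrow> nat"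
  assumes J: "finite J" and sum: "(\<Sum>j\<in>J. b j) = (\<Sum>j\<in>J. c j)"
    and bal: "\<And>i j. i \<in> J \<Longrightarrow> j \<in> J \<Longrightarrow> c i \<le> Suc (c j)"
  shows "esym b J p \<le> esym c J p"
  using sum
proof (induction "\<Sum>j\<in>J. b j - c j" arbitrary: b rule: less_induct)
  case less
  show ?case
  proof (cases "\<forall>j\<in>J. b j \<le> c j")
    case True
    then show ?thesis using J by (intro esym_mono) auto
  next
    case False
    then obtain i where i: "i \<in> J" "b i > c i" by auto
    have "\<exists>j\<in>J. b j < c j"
    proof (rule ccontr)
      assume "\<not> ?thesis"
      then have "(\<Sum>j\<in>J. c j) < (\<Sum>j\<in>J. b j)" using i J by (intro sum_strict_mono_ex1) auto
      then show False using less.prems by simp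
    qed
    then obtain j where j: "j \<in> J" "b j < c j" by auto
    have ij: "i \<noteq> j" using i j by auto
    \<comment> \<open>One unit moves from \<open>i\<close> to \<open>j\<close>. The measure counts
      only excesses over the target: it drops by one at \<open>i\<close> and stays 0 at
      \<open>j\<close>.\<close>
    define b' where "b' = b(i := b i - 1, j := b j + 1)"
    define J' where "J' = J - {i} - {j}"
    have J': "finite J'" "i \<notin> J'" "j \<notin> J'" using J by (auto simp: J'_def)
    have JJ: "J = insert i (insert j J')" using i j ij by (auto simp: J'_def)
    have b'J: "x \<in> J' \<Longrightarrow> b' x = b x" for x using J' by (auto simp: b'_def)
    have sumJ: "(\<Sum>x\<in>J'. b' x) = (\<Sum>x\<in>J'. b x)" "(\<Sum>x\<in>J'. b' x - c x) = (\<Sum>x\<in>J'. b x - c x)"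
      using b'J by (auto cong: sum.cong)
    have s: "(\<Sum>x\<in>J. b' x) = (\<Sum>x\<in>J. b x)"
      using ij J' i j sumJ by (simp add: JJ) (simp add: b'_def)
    have d: "(\<Sum>x\<in>J. b' x - c x) < (\<Sum>x\<in>J. b x - c x)"
      using ij J' i j sumJ by (simp add: JJ) (simp add: b'_def)
    have IH: "esym b' J p \<le> esym c J p" using less.hyps[OF d] s less.prems by simp
    \<comment> \<open>Balance enters here: \<open>b j < c j \<le> Suc (c i) \<le> b i\<close>. Hence
      the product of the two sizes does not drop while their sum stays fixed, and
      \<open>esym\<close> depends on the two sizes only through sum and product.\<close>
    have ge: "b j \<le> b i - 1" using bal[OF i(1) j(1)] bal[OF j(1) i(1)] i j by linarith
    obtain x where x: "b i = Suc x" using i(2) by (cases "b i") auto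
    have e: "esym b' J' q = esym b J' q" for q using b'J by (intro esym_cong) auto
    have "esym b J p \<le> esym b' J p"
    proof (cases p)
      case (Suc q)
      show ?thesis
      proof (cases q)
        case 0
        have "b' i + b' j = b i + b j" using x ij by (simp add: b'_def)
        then show ?thesis using Suc 0 J' ij by (simp add: JJ esym_insert e)
      next
        case (Suc q')
        have "b i * b j \<le> b' i * b' j" "b' i + b' j = b i + b j"
          using x ij ge by (auto simp: b'_def)
        then have "b i * (b j * E2) + (b i * E1 + b j * E1) \<le> b' i * (b' j * E2) + (b' i * E1 + b' j * E1)" for E1 E2
          by (metis add_mono_thms_linordered_semiring(3) mult.assoc add_mult_distrib mult_le_mono1)
        from this[of "esym b J' q'" "esym b J' (Suc q')"] show ?thesis using Suc \<open>p = Suc q\<close> J' ij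
          by (simp add: JJ esym_insert e algebra_simps)
      qed
    qed (use J in auto)
    then show ?thesis using IH by simp
  qed
qed

section \<open>Counting transversal sets\<close>

definition transversals :: "('i \<Rightarrow> 'a set) \<Rightarrow> 'i set \<Rightarrow> nat \<Rightarrow> 'a set set" where
  "transversals P J p = {e. e \<subseteq> (\<Union>j\<in>J. P j) \<and> card e = p \<and> (\<forall>j\<in>J. card (e \<inter> P j) \<le> 1)}"

text \<open>A new part \<open>P i\<close> splits the transversals into those avoiding
  \<open>P i\<close> and those with exactly one vertex there; this is the recursion
  \<open>esym_insert\<close>.\<close>

lemma card_transversals:
  assumes "finite J" "\<And>j. j \<in> J \<Longrightarrow> finite (P j)" "disjoint_family_on P J"
  shows "card (transversals P J p) = esym (\<lambda>j. card (P j)) J p"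
  using assms
proof (induction J arbitrary: p rule: finite_induct)
  case empty
  have "transversals P {} p = (if p = 0 then {{}} else {})" by (auto simp: transversals_def)
  then show ?case by simp
next
  case (insert i J)
  let ?U = "\<Union>j\<in>J. P j"
  have finU: "finite ?U" using insert by auto
  have djJ: "disjoint_family_on P J" using insert.prems by (auto simp: disjoint_family_on_def)
  have dj: "P i \<inter> ?U = {}" using insert.prems insert.hyps by (fastforce simp: disjoint_family_on_def)
  have fin: "finite (transversals P J q)" for q
    by (rule finite_subset[of _ "Pow ?U"]) (use finU in \<open>auto simp: transversals_def\<close>)
  show ?case
  proof (cases p)
    case 0
    have "transversals P (insert i J) 0 = {{}}"
    proof -
      have "finite (\<Union>j\<in>insert i J. P j)" using insert by auto
      then show ?thesis unfolding transversals_def by (auto dest: finite_subset)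
    qed
    then show ?thesis using 0 insert by simp
  next
    case (Suc q)
    let ?A = "transversals P J (Suc q)"
    let ?B = "(\<lambda>(x, e). insert x e) ` (P i \<times> transversals P J q)"
    have "transversals P (insert i J) (Suc q) = ?A \<union> ?B"
    proof (intro equalityI subsetI)
      fix e assume e: "e \<in> transversals P (insert i J) (Suc q)"
      then have eU: "e \<subseteq> P i \<union> ?U" and ce: "card e = Suc q" and c1: "card (e \<inter> P i) \<le> 1"
        and cj: "\<forall>j\<in>J. card (e \<inter> P j) \<le> 1" by (auto simp: transversals_def)
      have fe: "finite e" using ce card.infinite by fastforce
      show "e \<in> ?A \<union> ?B"
      proof (cases "e \<inter> P i = {}")
        case True
        then show ?thesis using eU ce cj by (auto simp: transversals_def)
      next
        case False
        then have "card (e \<inter> P i) = 1" using c1 fe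
          by (metis Int_commute One_nat_def card_gt_0_iff finite_Int le_antisym less_eq_Suc_le)
        then obtain x where x: "e \<inter> P i = {x}" by (auto simp: card_1_singleton_iff)
        have "e - {x} \<in> transversals P J q"
        proof -
          have "x \<in> e" using x by auto
          then have "card (e - {x}) = q" using ce fe by simp
          moreover have "\<forall>j\<in>J. card ((e - {x}) \<inter> P j) \<le> 1"
          proof
            fix j assume "j \<in> J"
            then have "card (e \<inter> P j) \<le> 1" using cj by auto
            moreover have "card ((e - {x}) \<inter> P j) \<le> card (e \<inter> P j)" using fe by (intro card_mono) auto
            ultimately show "card ((e - {x}) \<inter> P j) \<le> 1" by simp
          qed
          ultimately show ?thesis using eU x by (auto simp: transversals_def)
        qed
        moreover have "insert x (e - {x}) = e" "x \<in> P i" using x by auto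
        ultimately show ?thesis by (intro UnI2 image_eqI[of _ _ "(x, e - {x})"]) auto
      qed
    next
      fix e assume "e \<in> ?A \<union> ?B"
      then show "e \<in> transversals P (insert i J) (Suc q)"
      proof
        assume e: "e \<in> ?A"
        then have "e \<inter> P i = {}" using dj by (auto simp: transversals_def)
        then show ?thesis using e by (auto simp: transversals_def)
      next
        assume "e \<in> ?B"
        then obtain x f where xf: "x \<in> P i" "f \<in> transversals P J q" "e = insert x f" by auto
        have f: "f \<subseteq> ?U" "finite f" "card f = q" "\<forall>j\<in>J. card (f \<inter> P j) \<le> 1"
          using xf finU by (auto simp: transversals_def intro: finite_subset)
        have xf': "x \<notin> f" using f dj xf by auto
        have "e \<inter> P i = {x}" using f(1) dj xf by auto
        moreover have "e \<inter> P j = f \<inter> P j" if "j \<in> J" for j using dj xf that by auto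
        ultimately show ?thesis using f xf' xf by (auto simp: transversals_def)
      qed
    qed
    moreover have "?A \<inter> ?B = {}" using dj by (auto simp: transversals_def)
    moreover have "inj_on (\<lambda>(x, e). insert x e) (P i \<times> transversals P J q)"
    proof (rule inj_onI, clarify)
      fix x e y f assume a: "x \<in> P i" "e \<in> transversals P J q" "y \<in> P i" "f \<in> transversals P J q"
        "insert x e = insert y f"
      have "e \<subseteq> ?U" "f \<subseteq> ?U" using a by (auto simp: transversals_def)
      then have d: "e \<inter> P i = {}" "f \<inter> P i = {}" using dj by auto
      have "insert x e \<inter> P i = {x}" "insert y f \<inter> P i = {y}" using a d by auto
      then have xy: "x = y" using a(5) by auto
      have "e = insert x e - P i" "f = insert y f - P i" using a d by auto
      then show "x = y \<and> e = f" using a(5) xy by simp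
    qed
    ultimately have "card (transversals P (insert i J) (Suc q)) = card ?A + card (P i) * card (transversals P J q)"
      using fin insert.prems by (simp add: card_Un_disjoint card_image card_cartesian_product)
    then show ?thesis using Suc insert djJ by (simp add: esym_insert)
  qed
qed

lemma edges_complete_partite: "edges (complete_partite r k P) = transversals P {..<k} r"
  by (auto simp: complete_partite_def transversals_def)

lemma transversals_memI:
  assumes "finite e" "card e = p" "e \<subseteq> (\<Union>j\<in>J. P j)"
    and "\<And>j x y. j \<in> J \<Longrightarrow> x \<in> e \<Longrightarrow> y \<in> e \<Longrightarrow> x \<in> P j \<Longrightarrow> y \<in> P j \<Longrightarrow> x = y"
  shows "e \<in> transversals P J p"
proof -
  have "card (e \<inter> P j) \<le> 1" if "j \<in> J" for j
    using assms(1,4) that by (simp add: card_le_Suc0_iff_eq)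
  then show ?thesis using assms by (auto simp: transversals_def)
qed

lemma transversals_memD:
  assumes "e \<in> transversals P J p" "finite e" "j \<in> J" "x \<in> e" "y \<in> e" "x \<in> P j" "y \<in> P j"
  shows "x = y"
proof -
  have "card (e \<inter> P j) \<le> 1" using assms by (auto simp: transversals_def)
  then show ?thesis using assms by (auto simp: card_le_Suc0_iff_eq)
qed

lemma card_supersets_le:
  assumes "finite V" "card A \<le> r" "finite A"
  shows "card {e. e \<subseteq> V \<and> card e = r \<and> A \<subseteq> e} \<le> card V ^ (r - card A)"
proof -
  have le: "N choose m \<le> N ^ m" for N m :: nat
    by (cases "m \<le> N") (simp_all add: binomial_le_pow binomial_eq_0)
  let ?X = "{e. e \<subseteq> V \<and> card e = r \<and> A \<subseteq> e}"
  have "card ?X \<le> card {f. f \<subseteq> V \<and> card f = r - card A}"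
  proof (rule card_inj_on_le[where f = "\<lambda>e. e - A"])
    show "inj_on (\<lambda>e. e - A) ?X"
      by (rule inj_onI) blast
    show "(\<lambda>e. e - A) ` ?X \<subseteq> {f. f \<subseteq> V \<and> card f = r - card A}"
      using assms by (auto simp: card_Diff_subset)
    show "finite {f. f \<subseteq> V \<and> card f = r - card A}" using assms by simp
  qed
  also have "\<dots> = card V choose (r - card A)" using assms by (simp add: n_subsets)
  also have "\<dots> \<le> card V ^ (r - card A)" by (rule le)
  finally show ?thesis .
qed

section \<open>Clique counts and blow-ups\<close>

lemma card_lists_le:
  assumes "finite V"
  shows "card {xs. length xs = k \<and> set xs \<subseteq> V} = card V ^ k"
    and "finite {xs. length xs = k \<and> set xs \<subseteq> V}"
  using assms card_lists_length_eq[of V k] finite_lists_length_eq[of V k]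
  by (simp_all add: conj_commute)

text \<open>Double counting followed by pigeonhole: a point of \<open>Y\<close> lies on average in
  at least c |I| of the sets, so a fraction c/2 of \<open>Y\<close> lies in at least
  \<open>T\<close> of them. Each such point selects a \<open>T\<close>-subset of \<open>I\<close>,
  and there are at most 2^|I| of these.\<close>

lemma exists_popular_subset:
  fixes R :: "'i \<Rightarrow> 'b set" and c :: real
  assumes I: "finite I" "I \<noteq> {}" and Y: "finite Y" and R: "\<And>i. i \<in> I \<Longrightarrow> R i \<subseteq> Y"
    and c: "0 < c" and dense: "\<And>i. i \<in> I \<Longrightarrow> c * card Y \<le> card (R i)"
    and T: "2 * T \<le> c * card I" and TI: "T \<le> card I"
  shows "\<exists>A\<subseteq>I. card A = T \<and> c / 2 / 2 ^ card I * card Y \<le> card {y\<in>Y. \<forall>i\<in>A. y \<in> R i}"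
proof -
  define d where "d y = card {i\<in>I. y \<in> R i}" for y
  define Y' where "Y' = {y\<in>Y. T \<le> d y}"
  have "(\<Sum>y\<in>Y. d y) = (\<Sum>y\<in>Y. \<Sum>i\<in>I. if y \<in> R i then 1 else 0)"
    using I by (simp add: d_def sum.inter_filter[symmetric])
  also have "\<dots> = (\<Sum>i\<in>I. \<Sum>y\<in>Y. if y \<in> R i then 1 else 0)" by (rule sum.swap)
  also have "\<dots> = (\<Sum>i\<in>I. card (R i))"
  proof (rule sum.cong)
    fix i assume "i \<in> I"
    then have "{y\<in>Y. y \<in> R i} = R i" using R by auto
    then show "(\<Sum>y\<in>Y. if y \<in> R i then 1 else 0) = card (R i)"
      using Y by (simp add: sum.inter_filter[symmetric])
  qed simp
  finally have "real (\<Sum>y\<in>Y. d y) = (\<Sum>i\<in>I. real (card (R i)))" by simp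
  also have "\<dots> \<ge> (\<Sum>i\<in>I. c * card Y)" using dense by (intro sum_mono) auto
  finally have lo: "card I * (c * card Y) \<le> real (\<Sum>y\<in>Y. d y)" by simp
  have "(\<Sum>y\<in>Y. d y) \<le> (\<Sum>y\<in>Y. T + (if y \<in> Y' then card I else 0))"
  proof (rule sum_mono)
    fix y assume "y \<in> Y"
    have "d y \<le> card I" unfolding d_def using I by (intro card_mono) auto
    then show "d y \<le> T + (if y \<in> Y' then card I else 0)" using \<open>y \<in> Y\<close> by (auto simp: Y'_def)
  qed
  also have "\<dots> = card Y * T + card Y' * card I"
    using Y by (simp add: sum.distrib sum.inter_filter[symmetric] Y'_def)
  finally have hi: "real (\<Sum>y\<in>Y. d y) \<le> card Y * T + card Y' * card I"
    by (metis of_nat_le_iff of_nat_add of_nat_mult)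
  have "2 * real T * card Y \<le> c * card I * card Y" using T by (intro mult_right_mono) auto
  then have "card I * (c * card Y) \<le> 2 * (card Y' * card I)" using lo hi by (simp add: algebra_simps)
  then have Y': "c / 2 * card Y \<le> card Y'"
    using I by (simp add: card_gt_0_iff algebra_simps mult_le_cancel_left)
  define F where "F A = {y\<in>Y. \<forall>i\<in>A. y \<in> R i}" for A
  define \<A> where "\<A> = {A. A \<subseteq> I \<and> card A = T}"
  have fA: "finite \<A>" using I by (auto simp: \<A>_def intro: finite_subset[of _ "Pow I"])
  have cA: "card \<A> \<le> 2 ^ card I"
    using card_mono[of "Pow I" \<A>] I by (auto simp: \<A>_def card_Pow)
  have cov: "Y' \<subseteq> (\<Union>A\<in>\<A>. F A)"
  proof
    fix y assume y: "y \<in> Y'"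
    then have "T \<le> card {i\<in>I. y \<in> R i}" by (auto simp: Y'_def d_def)
    then obtain A where "A \<subseteq> {i\<in>I. y \<in> R i}" "card A = T" by (meson obtain_subset_with_card_n)
    then show "y \<in> (\<Union>A\<in>\<A>. F A)" using y by (auto simp: \<A>_def F_def Y'_def)
  qed
  have fF: "finite (F A)" for A using Y by (simp add: F_def)
  have "\<exists>A\<in>\<A>. c / 2 / 2 ^ card I * card Y \<le> card (F A)"
  proof (rule ccontr)
    assume "\<not> ?thesis"
    then have lt: "\<And>A. A \<in> \<A> \<Longrightarrow> card (F A) < c / 2 / 2 ^ card I * card Y" by auto
    have "card Y' \<le> card (\<Union>A\<in>\<A>. F A)" using cov fA fF by (intro card_mono) auto
    also have "\<dots> \<le> (\<Sum>A\<in>\<A>. card (F A))" by (rule card_UN_le[OF fA])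
    finally have le: "real (card Y') \<le> (\<Sum>A\<in>\<A>. real (card (F A)))" by (metis of_nat_le_iff of_nat_sum)
    obtain A0 where "A0 \<subseteq> I" "card A0 = T" using TI by (meson obtain_subset_with_card_n)
    then have ne: "\<A> \<noteq> {}" by (auto simp: \<A>_def)
    have "(\<Sum>A\<in>\<A>. real (card (F A))) < (\<Sum>A\<in>\<A>. c / 2 / 2 ^ card I * card Y)"
      using ne fA lt by (intro sum_strict_mono) auto
    also have "\<dots> \<le> 2 ^ card I * (c / 2 / 2 ^ card I * card Y)"
    proof -
      have "real (card \<A>) \<le> 2 ^ card I" using cA by (metis of_nat_le_iff of_nat_numeral of_nat_power)
      then have "real (card \<A>) * (c / 2 / 2 ^ card I * card Y) \<le> 2 ^ card I * (c / 2 / 2 ^ card I * card Y)"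
        using c by (intro mult_right_mono) auto
      then show ?thesis by simp
    qed
    also have "\<dots> = c / 2 * card Y" by simp
    finally show False using le Y' by linarith
  qed
  then show ?thesis unfolding \<A>_def F_def by blast
qed

text \<open>Erdos' theorem on complete \<open>k\<close>-partite subhypergraphs, for relations given
  as sets of lists, so that the induction peels off the head. Among boundedly many heads with dense
  links, \<open>T\<close> heads share a dense set of tails, and the induction hypothesis applies to
  these tails.\<close>

lemma dense_relation_contains_box:
  fixes c :: real
  assumes "c > 0"
  shows "\<exists>n0. \<forall>(V :: 'a set) R. finite V \<longrightarrow> n0 \<le> card V \<longrightarrow> R \<subseteq> {xs. length xs = k \<and> set xs \<subseteq> V}
     \<longrightarrow> c * card V ^ k \<le> card R
     \<longrightarrow> (\<exists>As. length As = k \<and> (\<forall>A\<in>set As. A \<subseteq> V \<and> card A = T) \<and> listset As \<subseteq> R)"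
  using assms
proof (induction k arbitrary: c)
  case 0
  have "[] \<in> R" if "R \<subseteq> {xs. length xs = 0 \<and> set xs \<subseteq> V}" "c \<le> card R" for R :: "'a list set" and V
  proof -
    have "R \<noteq> {}" using that(2) 0 by auto
    then show ?thesis using that(1) by auto
  qed
  then show ?case by (intro exI[of _ 0]) auto
next
  case (Suc k)
  \<comment> \<open>\<open>L\<close> heads are enough for \<open>exists_popular_subset\<close> at
    link density c/2. Their number must be a constant, because that lemma loses a factor
    2^L.\<close>
  define L where "L = Suc (max T (nat \<lceil>4 * T / c\<rceil>))"
  have L: "2 * T \<le> c / 2 * L"
  proof -
    have "4 * T / c \<le> L" unfolding L_def by linarith
    then show ?thesis using Suc.prems by (simp add: field_simps)
  qed
  \<comment> \<open>The density left for the tails: c/2 from the choice of the heads, a further 1/2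
    and 1/2^L from the popular subset.\<close>
  define c' where "c' = c / 4 / 2 ^ L"
  have "c' > 0" using Suc.prems by (simp add: c'_def)
  then obtain n1 where n1: "\<And>(V :: 'a set) R. finite V \<Longrightarrow> n1 \<le> card V \<Longrightarrow> R \<subseteq> {xs. length xs = k \<and> set xs \<subseteq> V}
     \<Longrightarrow> c' * card V ^ k \<le> card R
     \<Longrightarrow> (\<exists>As. length As = k \<and> (\<forall>A\<in>set As. A \<subseteq> V \<and> card A = T) \<and> listset As \<subseteq> R)"
    using Suc.IH by blast
  define n0 where "n0 = Suc (max n1 (nat \<lceil>2 * L / c\<rceil>))"
  show ?case
  proof (intro exI[of _ n0] allI impI)
    fix V :: "'a set" and R
    assume V: "finite V" "n0 \<le> card V" and R: "R \<subseteq> {xs. length xs = Suc k \<and> set xs \<subseteq> V}"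
      and dense: "c * card V ^ Suc k \<le> card R"
    define Y where "Y = {xs. length xs = k \<and> set xs \<subseteq> V}"
    have Y: "finite Y" "card Y = card V ^ k" using V card_lists_le[of V k] by (auto simp: Y_def)
    define Rv where "Rv v = {xs. v # xs \<in> R}" for v
    have RvY: "Rv v \<subseteq> Y" for v using R unfolding Rv_def Y_def by fastforce
    have finRv: "finite (Rv v)" for v using RvY Y finite_subset by blast
    \<comment> \<open>Heads with link density at least c/2. By averaging they make up at least a c/2
      share of \<open>V\<close>, hence number at least \<open>L\<close>.\<close>
    define I0 where "I0 = {v\<in>V. c / 2 * card Y \<le> card (Rv v)}"
    have "R \<subseteq> (\<Union>v\<in>V. (#) v ` Rv v)"
    proof
      fix xs assume "xs \<in> R"
      then have x: "length xs = Suc k" "set xs \<subseteq> V" using R by auto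
      then obtain v ys where "xs = v # ys" by (cases xs) auto
      then show "xs \<in> (\<Union>v\<in>V. (#) v ` Rv v)" using x \<open>xs \<in> R\<close> by (auto simp: Rv_def)
    qed
    then have "card R \<le> card (\<Union>v\<in>V. (#) v ` Rv v)" using V finRv by (intro card_mono) auto
    also have "\<dots> \<le> (\<Sum>v\<in>V. card ((#) v ` Rv v))" by (rule card_UN_le[OF V(1)])
    also have "\<dots> = (\<Sum>v\<in>V. card (Rv v))" by (intro sum.cong refl card_image) auto
    finally have "real (card R) \<le> (\<Sum>v\<in>V. real (card (Rv v)))" by (metis of_nat_le_iff of_nat_sum)
    also have "\<dots> \<le> (\<Sum>v\<in>V. c / 2 * card Y + (if v \<in> I0 then real (card Y) else 0))"
    proof (rule sum_mono)
      fix v assume "v \<in> V"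
      have "card (Rv v) \<le> card Y" using card_mono[OF Y(1) RvY] .
      then show "real (card (Rv v)) \<le> c / 2 * card Y + (if v \<in> I0 then real (card Y) else 0)"
        using Suc.prems \<open>v \<in> V\<close> by (auto simp: I0_def intro: order_trans[of _ "real (card Y)"])
    qed
    also have "\<dots> = c / 2 * card V * card Y + card I0 * card Y"
      using V by (simp add: sum.distrib sum.inter_filter[symmetric] I0_def algebra_simps)
    finally have "c * card V ^ Suc k \<le> c / 2 * card V * card Y + card I0 * card Y" using dense by simp
    then have "(c / 2 * card V) * card Y \<le> card I0 * card Y" using Y by (simp add: algebra_simps)
    moreover have "card Y > 0" using Y V by (simp add: n0_def)
    ultimately have "c / 2 * card V \<le> card I0" by simp
    moreover have "L \<le> c / 2 * card V"
    proof -
      have "2 * L / c \<le> card V" using V unfolding n0_def by linarith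
      then show ?thesis using Suc.prems by (simp add: field_simps)
    qed
    ultimately have "L \<le> card I0" by linarith
    then obtain I where I: "I \<subseteq> I0" "card I = L" by (meson obtain_subset_with_card_n)
    have finI: "finite I" "I \<noteq> {}" using I V by (auto simp: I0_def L_def intro: card_ge_0_finite)
    have "\<exists>A\<subseteq>I. card A = T \<and> c / 2 / 2 / 2 ^ card I * card Y \<le> card {y\<in>Y. \<forall>i\<in>A. y \<in> Rv i}"
    proof (rule exists_popular_subset[OF finI Y(1) RvY])
      show "2 * real T \<le> c / 2 * card I" using I L by simp
      show "c / 2 * card Y \<le> card (Rv i)" if "i \<in> I" for i using that I by (auto simp: I0_def)
      show "T \<le> card I" using I by (simp add: L_def)
    qed (use Suc.prems in simp)
    then obtain A where A: "A \<subseteq> I" "card A = T"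
      "c' * card V ^ k \<le> card {y\<in>Y. \<forall>i\<in>A. y \<in> Rv i}"
      using I Y by (auto simp: c'_def)
    have "\<exists>As. length As = k \<and> (\<forall>A\<in>set As. A \<subseteq> V \<and> card A = T)
       \<and> listset As \<subseteq> {y\<in>Y. \<forall>i\<in>A. y \<in> Rv i}"
    proof (rule n1)
      show "n1 \<le> card V" using V by (simp add: n0_def)
      show "{y\<in>Y. \<forall>i\<in>A. y \<in> Rv i} \<subseteq> {xs. length xs = k \<and> set xs \<subseteq> V}" by (auto simp: Y_def)
    qed (use V A in auto)
    then obtain As where As: "length As = k" "\<forall>A\<in>set As. A \<subseteq> V \<and> card A = T"
      "listset As \<subseteq> {y\<in>Y. \<forall>i\<in>A. y \<in> Rv i}" by blast
    have "A \<subseteq> V" using A I by (auto simp: I0_def)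
    moreover have "listset (A # As) \<subseteq> R" using As(3) by (auto simp: set_Cons_def Rv_def)
    ultimately show "\<exists>As. length As = Suc k \<and> (\<forall>A\<in>set As. A \<subseteq> V \<and> card A = T) \<and> listset As \<subseteq> R"
      using As A by (intro exI[of _ "A # As"]) auto
  qed
qed

section \<open>Cliques, blow-ups and the clique density bound\<close>

definition common_nbrs :: "('a \<Rightarrow> 'a \<Rightarrow> bool) \<Rightarrow> 'a set \<Rightarrow> 'a set \<Rightarrow> 'a set" where
  "common_nbrs D U x = {v\<in>U. \<forall>z\<in>x. D v z}"

definition cliques :: "('a \<Rightarrow> 'a \<Rightarrow> bool) \<Rightarrow> 'a set \<Rightarrow> nat \<Rightarrow> 'a set set" where
  "cliques D U p = {x. x \<subseteq> U \<and> finite x \<and> card x = p \<and> pairwise D x}"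

text \<open>Different sets \<open>A i\<close> are disjoint as soon as \<open>D\<close> is
  irreflexive; inside one set nothing is prescribed.\<close>

definition has_blowup :: "('a \<Rightarrow> 'a \<Rightarrow> bool) \<Rightarrow> 'a set \<Rightarrow> nat \<Rightarrow> nat \<Rightarrow> bool" where
  "has_blowup D U k t \<longleftrightarrow> (\<exists>A :: nat \<Rightarrow> 'a set. (\<forall>i<k. A i \<subseteq> U \<and> card (A i) = t)
     \<and> (\<forall>i<k. \<forall>j<k. i \<noteq> j \<longrightarrow> (\<forall>x\<in>A i. \<forall>y\<in>A j. D x y)))"

lemma finite_cliques [simp]: "finite U \<Longrightarrow> finite (cliques D U p)"
  by (rule finite_subset[of _ "Pow U"]) (auto simp: cliques_def)

lemma listset_nth:
  "listset As = {xs. length xs = length As \<and> (\<forall>i<length As. xs ! i \<in> As ! i)}"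
proof (induction As)
  case (Cons A As)
  show ?case
  proof (intro equalityI subsetI)
    fix xs assume "xs \<in> listset (A # As)"
    then show "xs \<in> {xs. length xs = length (A # As) \<and> (\<forall>i<length (A # As). xs ! i \<in> (A # As) ! i)}"
      using Cons by (auto simp: set_Cons_def nth_Cons split: nat.split)
  next
    fix xs assume a: "xs \<in> {xs. length xs = length (A # As) \<and> (\<forall>i<length (A # As). xs ! i \<in> (A # As) ! i)}"
    then obtain y ys where "xs = y # ys" by (cases xs) auto
    then show "xs \<in> listset (A # As)" using a Cons by (fastforce simp: set_Cons_def)
  qed
qed auto

text \<open>Listing cliques in all orders turns many cliques into a dense relation. Its boxes are
  blow-ups: any two entries from different factors of a box occur together in one listed
  clique.\<close>

lemma many_cliques_imp_blowup:
  fixes c :: real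
  assumes "c > 0" "T > 0"
  shows "\<exists>n0. \<forall>(U :: 'a set) D. finite U \<longrightarrow> n0 \<le> card U \<longrightarrow> symp D \<longrightarrow>
     c * card U ^ k \<le> card (cliques D U k) \<longrightarrow> has_blowup D U k T"
proof -
  obtain n0 where n0: "\<And>(V :: 'a set) R. finite V \<Longrightarrow> n0 \<le> card V \<Longrightarrow> R \<subseteq> {xs. length xs = k \<and> set xs \<subseteq> V}
     \<Longrightarrow> c * card V ^ k \<le> card R
     \<Longrightarrow> (\<exists>As. length As = k \<and> (\<forall>A\<in>set As. A \<subseteq> V \<and> card A = T) \<and> listset As \<subseteq> R)"
    using dense_relation_contains_box[OF assms(1), where T = T and k = k] by blast
  show ?thesis
  proof (intro exI[of _ n0] allI impI)
    fix U :: "'a set" and D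
    assume U: "finite U" "n0 \<le> card U" "symp D" "c * card U ^ k \<le> card (cliques D U k)"
    define R where "R = {xs. distinct xs \<and> set xs \<in> cliques D U k}"
    have RL: "R \<subseteq> {xs. length xs = k \<and> set xs \<subseteq> U}"
      by (auto simp: R_def cliques_def distinct_card)
    have finR: "finite R" using RL card_lists_le(2)[OF U(1)] by (rule finite_subset)
    have "cliques D U k \<subseteq> set ` R"
    proof
      fix x assume x: "x \<in> cliques D U k"
      then obtain xs where "set xs = x" "distinct xs"
        using finite_distinct_list[of x] by (auto simp: cliques_def)
      then show "x \<in> set ` R" using x by (auto simp: R_def)
    qed
    then have "card (cliques D U k) \<le> card R"
      using finR by (meson card_image_le card_mono finite_imageI le_trans)
    then have "c * card U ^ k \<le> card R" using U(4) by linarith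
    then obtain As where As: "length As = k" "\<forall>A\<in>set As. A \<subseteq> U \<and> card A = T" "listset As \<subseteq> R"
      using n0[OF U(1,2) RL] by blast
    have ne: "As ! i \<noteq> {}" if "i < k" for i using As that assms(2) by (metis card.empty nat_less_le nth_mem)
    show "has_blowup D U k T"
      unfolding has_blowup_def
    proof (intro exI[of _ "\<lambda>i. As ! i"] conjI allI impI ballI)
      fix i j x y assume ij: "i < k" "j < k" "i \<noteq> j" and xy: "x \<in> As ! i" "y \<in> As ! j"
      \<comment> \<open>A member of the box through \<open>x\<close> and \<open>y\<close> with
        arbitrary other coordinates; it lists a clique, which gives \<open>D x y\<close>.\<close>
      define xs where "xs = (map (\<lambda>l. SOME z. z \<in> As ! l) [0..<k])[i := x, j := y]"
      have "xs \<in> listset As"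
        unfolding listset_nth
      proof (intro CollectI conjI allI impI)
        fix l assume "l < length As"
        then have l: "l < k" using As(1) by simp
        have "(SOME z. z \<in> As ! l) \<in> As ! l" using ne[OF l] by (simp add: some_in_eq)
        then show "xs ! l \<in> As ! l" using l xy ij by (auto simp: xs_def nth_list_update)
      qed (simp add: xs_def As(1))
      then have xs: "distinct xs" "pairwise D (set xs)" using As(3) by (auto simp: R_def cliques_def)
      have l: "length xs = k" "xs ! i = x" "xs ! j = y" using ij by (auto simp: xs_def)
      then have "x \<noteq> y" using nth_eq_iff_index_eq[OF xs(1), of i j] ij by simp
      moreover have "x \<in> set xs" "y \<in> set xs" using nth_mem[of i xs] nth_mem[of j xs] l ij by auto
      ultimately show "D x y" using xs(2) by (simp add: pairwise_def)
    qed (use As in auto)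
  qed
qed


text \<open>Both equations count pairs of a clique and one of its vertices, read as a smaller clique
  with a common neighbour. The weighted form, with \<open>g\<close> the number of common neighbours,
  produces the sum of squares in the Moon-Moser inequality.\<close>

lemma card_Suc_cliques:
  assumes "finite U" "symp D" "irreflp D"
  shows "Suc j * card (cliques D U (Suc j)) = (\<Sum>x\<in>cliques D U j. card (common_nbrs D U x))"
    and "(\<Sum>x\<in>cliques D U (Suc j). \<Sum>a\<in>x. g (x - {a})) =
         (\<Sum>y\<in>cliques D U j. card (common_nbrs D U y) * g y)"
proof -
  have bij: "bij_betw (\<lambda>(x, a). (x - {a}, a)) (SIGMA x:cliques D U (Suc j). x)
      (SIGMA y:cliques D U j. common_nbrs D U y)"
  proof (rule bij_betw_byWitness[where f' = "\<lambda>(y, a). (insert a y, a)"], safe)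
    fix x a assume x: "x \<in> cliques D U (Suc j)" "a \<in> x"
    show "x - {a} \<in> cliques D U j" using x by (auto simp: cliques_def pairwise_def)
    show "a \<in> common_nbrs D U (x - {a})" using x by (auto simp: cliques_def pairwise_def common_nbrs_def)
  next
    fix y a assume y: "y \<in> cliques D U j" "a \<in> common_nbrs D U y"
    have "a \<notin> y" using y assms(3) by (auto simp: common_nbrs_def irreflp_def)
    then show "insert a y \<in> cliques D U (Suc j)" using y assms(2)
      by (auto simp: cliques_def pairwise_insert common_nbrs_def symp_def)
  qed (use assms(3) in \<open>auto simp: common_nbrs_def irreflp_def\<close>)
  have fc: "finite (common_nbrs D U y)" for y using assms(1) by (simp add: common_nbrs_def)
  have fx: "finite x" "card x = i" if "x \<in> cliques D U i" for x i using that by (auto simp: cliques_def)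
  have gen: "(\<Sum>x\<in>cliques D U (Suc j). \<Sum>a\<in>x. g (x - {a})) =
         (\<Sum>y\<in>cliques D U j. card (common_nbrs D U y) * g y)" for g :: "'a set \<Rightarrow> nat"
  proof -
    have "(\<Sum>x\<in>cliques D U (Suc j). \<Sum>a\<in>x. g (x - {a})) =
       (\<Sum>(x, a)\<in>(SIGMA x:cliques D U (Suc j). x). g (x - {a}))"
      using assms fx by (intro sum.Sigma) auto
    also have "\<dots> = (\<Sum>(y, a)\<in>(SIGMA y:cliques D U j. common_nbrs D U y). g y)"
      using sum.reindex_bij_betw[OF bij, of "\<lambda>(y, a). g y"] by (simp add: case_prod_beta)
    also have "\<dots> = (\<Sum>y\<in>cliques D U j. \<Sum>a\<in>common_nbrs D U y. g y)"
      using assms fc by (intro sum.Sigma[symmetric]) auto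
    finally show ?thesis by simp
  qed
  show "(\<Sum>x\<in>cliques D U (Suc j). \<Sum>a\<in>x. g (x - {a})) =
         (\<Sum>y\<in>cliques D U j. card (common_nbrs D U y) * g y)" by (rule gen)
  show "Suc j * card (cliques D U (Suc j)) = (\<Sum>x\<in>cliques D U j. card (common_nbrs D U x))"
    using gen[of "\<lambda>_. 1"] fx by (simp add: mult.commute)
qed

text \<open>For a (j+1)-clique \<open>x\<close>, consider the common neighbourhoods of the sets
  \<open>x - {a}\<close>. A vertex adjacent to all of \<open>x\<close> is in j+1 of them, any other
  vertex in at most one. Summed over \<open>x\<close>, the left side becomes a sum of squares, to
  which Cauchy-Schwarz applies.\<close>

lemma moon_moser:
  fixes \<kappa> :: "nat \<Rightarrow> real"
  assumes "finite U" "symp D" "irreflp D"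
  defines "\<kappa> \<equiv> \<lambda>j. real (card (cliques D U j))"
  shows "(Suc j * \<kappa> (Suc j))\<^sup>2 \<le> \<kappa> j * (card U * \<kappa> (Suc j) + j * (Suc (Suc j) * \<kappa> (Suc (Suc j))))"
proof -
  let ?d = "\<lambda>x. card (common_nbrs D U x)"
  have "(\<Sum>a\<in>x. ?d (x - {a})) \<le> card U + j * ?d x" if x: "x \<in> cliques D U (Suc j)" for x
  proof -
    have fx: "finite x" "card x = Suc j" using x by (auto simp: cliques_def)
    have "(\<Sum>a\<in>x. ?d (x - {a})) = (\<Sum>a\<in>x. \<Sum>v\<in>U. if \<forall>z\<in>x - {a}. D v z then 1 else 0)"
      using assms(1) by (simp add: common_nbrs_def sum.inter_filter[symmetric])
    also have "\<dots> = (\<Sum>v\<in>U. \<Sum>a\<in>x. if \<forall>z\<in>x - {a}. D v z then 1 else 0)" by (rule sum.swap)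
    also have "\<dots> \<le> (\<Sum>v\<in>U. 1 + j * (if \<forall>z\<in>x. D v z then 1 else 0))"
    proof (rule sum_mono)
      fix v assume "v \<in> U"
      have e: "(\<Sum>a\<in>x. if \<forall>z\<in>x - {a}. D v z then 1 else 0) = card {a\<in>x. \<forall>z\<in>x - {a}. D v z}"
        using fx by (simp add: sum.inter_filter[symmetric])
      show "(\<Sum>a\<in>x. if \<forall>z\<in>x - {a}. D v z then 1 else 0) \<le> 1 + j * (if \<forall>z\<in>x. D v z then 1 else 0)"
      proof (cases "\<forall>z\<in>x. D v z")
        case True
        then show ?thesis using fx card_mono[OF fx(1), of "{a\<in>x. \<forall>z\<in>x - {a}. D v z}"] unfolding e by simp
      next
        case False
        then obtain b where "b \<in> x" "\<not> D v b" by auto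
        then have "{a\<in>x. \<forall>z\<in>x - {a}. D v z} \<subseteq> {b}" by auto
        then have "card {a\<in>x. \<forall>z\<in>x - {a}. D v z} \<le> 1" using card_mono[of "{b}"] by simp
        then show ?thesis unfolding e by simp
      qed
    qed
    also have "\<dots> = card U + j * ?d x"
      using assms(1) by (simp only: sum.distrib common_nbrs_def card_eq_sum sum.inter_filter sum_distrib_left)
    finally show ?thesis .
  qed
  then have "(\<Sum>x\<in>cliques D U (Suc j). \<Sum>a\<in>x. ?d (x - {a})) \<le> (\<Sum>x\<in>cliques D U (Suc j). card U + j * ?d x)"
    by (rule sum_mono)
  then have "(\<Sum>y\<in>cliques D U j. ?d y * ?d y) \<le> card (cliques D U (Suc j)) * card U + j * (Suc (Suc j) * card (cliques D U (Suc (Suc j))))"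
    unfolding card_Suc_cliques(2)[OF assms(1-3), where g = ?d and j = j] card_Suc_cliques(1)[OF assms(1-3)]
    by (simp add: sum.distrib sum_distrib_left)
  then have sq: "(\<Sum>y\<in>cliques D U j. (real (?d y))\<^sup>2) \<le> card U * \<kappa> (Suc j) + j * (Suc (Suc j) * \<kappa> (Suc (Suc j)))"
    unfolding \<kappa>_def power2_eq_square
    by (simp only: of_nat_mult[symmetric] of_nat_add[symmetric] of_nat_sum[symmetric] of_nat_le_iff)
       (simp only: mult.commute)
  have "Suc j * \<kappa> (Suc j) = (\<Sum>y\<in>cliques D U j. real (?d y))"
    unfolding \<kappa>_def of_nat_mult[symmetric] card_Suc_cliques(1)[OF assms(1-3)] by simp
  then have "(Suc j * \<kappa> (Suc j))\<^sup>2 \<le> (\<Sum>y\<in>cliques D U j. (real (?d y))\<^sup>2) * card (cliques D U j)"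
    by (metis sum_squared_le_sum_of_squares)
  also have "\<dots> \<le> (card U * \<kappa> (Suc j) + j * (Suc (Suc j) * \<kappa> (Suc (Suc j)))) * \<kappa> j"
    using sq by (auto simp: \<kappa>_def intro!: mult_right_mono)
  finally show ?thesis by (simp add: mult.commute)
qed

text \<open>If some ratio \<open>x (i + 1) / x i\<close> exceeds its Turan value \<open>1 - i / q\<close> by \<open>\<theta>\<close>, the
  Moon--Moser inequality propagates this excess to all later ratios.\<close>

lemma moon_moser_sequence:
  fixes x :: "nat \<Rightarrow> real"
  assumes x0: "x 0 = 1" and nonneg: "\<And>j. 0 \<le> x j" and dec: "\<And>j. x (Suc j) \<le> x j"
    and mm: "\<And>j. Suc j * (x (Suc j))\<^sup>2 \<le> x j * (x (Suc j) + j * x (Suc (Suc j)))"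
    and pq: "1 \<le> p" "p \<le> q" and \<epsilon>: "0 < \<epsilon>"
    and big: "(\<Prod>j<p. 1 - real j / q) + \<epsilon> < x p"
  shows "(\<epsilon> / p) ^ (q + 2) \<le> x (Suc q)"
proof -
  \<comment> \<open>If no ratio exceeded its Turan value by this additive amount, the errors of the
    first \<open>p\<close> steps would add up to at most p \<theta> = \<epsilon>, contradicting
    \<open>big\<close>.\<close>
  define \<theta> where "\<theta> = \<epsilon> / p"
  have \<theta>: "\<theta> > 0" using pq \<epsilon> by (simp add: \<theta>_def)
  have le1: "x j \<le> 1" for j by (induction j) (use x0 dec order_trans in auto)
  have "\<exists>j<p. (1 - real j / q) * x j + \<theta> < x (Suc j)"
  proof (rule ccontr)
    assume "\<not> ?thesis"
    then have a: "\<And>j. j < p \<Longrightarrow> x (Suc j) \<le> (1 - real j / q) * x j + \<theta>" by force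
    have "i \<le> p \<Longrightarrow> x i \<le> (\<Prod>j<i. 1 - real j / q) + i * \<theta>" for i
    proof (induction i)
      case (Suc i)
      have r: "0 \<le> 1 - i / q" "1 - i / q \<le> 1" using Suc.prems pq by (auto simp: field_simps)
      have "x (Suc i) \<le> (1 - i / q) * x i + \<theta>" using a Suc by simp
      also have "\<dots> \<le> (1 - i / q) * ((\<Prod>j<i. 1 - real j / q) + i * \<theta>) + \<theta>"
        using Suc r by (intro add_right_mono mult_left_mono) auto
      also have "\<dots> \<le> (\<Prod>j<Suc i. 1 - real j / q) + Suc i * \<theta>"
        using mult_right_mono[OF r(2), of "i * \<theta>"] \<theta> by (simp add: algebra_simps)
      finally show ?case .
    qed (simp add: x0)
    from this[of p] big pq show False by (simp add: \<theta>_def)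
  qed
  then obtain j where j: "j < p" "(1 - real j / q) * x j + \<theta> < x (Suc j)" by auto
  \<comment> \<open>At index 0 the Turan ratio is 1 and cannot be exceeded. A positive index matters
    since the Moon-Moser inequality carries the next term with the factor \<open>i\<close>, which is
    cancelled below.\<close>
  have "j \<noteq> 0" using j(2) x0 \<theta> le1[of "Suc 0"] by (intro notI) auto
  have rj: "0 \<le> 1 - j / q" using j pq by (auto simp: field_simps)
  have xj: "\<theta> \<le> x (Suc j)" using j(2) rj nonneg[of j] by (smt (verit) mult_nonneg_nonneg)
  have \<theta>1: "\<theta> \<le> 1" using xj le1[of "Suc j"] by linarith
  have step: "0 < x (Suc i) \<and> (1 - i / q + \<theta>) * x i \<le> x (Suc i)" if "j \<le> i" "i \<le> q" for i
    using that
  proof (induction i rule: dec_induct)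
    case base
    have "\<theta> * x j \<le> \<theta>" using le1[of j] \<theta> by (simp add: mult_left_le)
    moreover have "(1 - j / q + \<theta>) * x j = (1 - j / q) * x j + \<theta> * x j" by (rule distrib_right)
    ultimately show ?case using j(2) xj \<theta> by linarith
  next
    case (step i)
    then have IH: "0 < x (Suc i)" "(1 - i / q + \<theta>) * x i \<le> x (Suc i)" by auto
    have i0: "i > 0" using step \<open>j \<noteq> 0\<close> by simp
    have xi: "x i > 0" using IH(1) dec[of i] by linarith
    have "Suc i * ((1 - i / q + \<theta>) * x i) * x (Suc i) \<le> Suc i * x (Suc i) * x (Suc i)"
      using IH by (intro mult_right_mono mult_left_mono) auto
    also have "\<dots> \<le> x i * (x (Suc i) + i * x (Suc (Suc i)))" using mm[of i] by (simp add: power2_eq_square mult.assoc)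
    finally have "x i * (Suc i * (1 - i / q + \<theta>) * x (Suc i)) \<le> x i * (x (Suc i) + i * x (Suc (Suc i)))"
      by (simp add: algebra_simps)
    then have 1: "Suc i * (1 - i / q + \<theta>) * x (Suc i) \<le> x (Suc i) + i * x (Suc (Suc i))" using xi by simp
    \<comment> \<open>The identity that preserves the excess: the Turan value moves from 1 - i/q to
      1 - (i+1)/q, and one extra \<theta> is even left over.\<close>
    have 2: "Suc i * (1 - i / q + \<theta>) - 1 = i * (1 - Suc i / q + \<theta>) + \<theta>"
      using step pq by (simp add: field_simps)
    have "i * ((1 - Suc i / q + \<theta>) * x (Suc i)) \<le> (Suc i * (1 - i / q + \<theta>) - 1) * x (Suc i)"
      unfolding 2 using IH \<theta> by (simp add: algebra_simps)
    also have "\<dots> \<le> i * x (Suc (Suc i))" using 1 by (simp add: algebra_simps)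
    finally have 3: "(1 - Suc i / q + \<theta>) * x (Suc i) \<le> x (Suc (Suc i))" using i0 by simp
    have "real (Suc i) / q \<le> 1" using step pq by simp
    then have "0 < 1 - Suc i / q + \<theta>" using \<theta> by linarith
    then have "0 < (1 - Suc i / q + \<theta>) * x (Suc i)" using IH(1) by simp
    then show ?case using 3 by linarith
  qed
  \<comment> \<open>Up to index \<open>q\<close> the Turan values are nonnegative, so each ratio
    from \<open>j\<close> on is at least \<theta>.\<close>
  have pow: "\<theta> ^ (Suc i - j) \<le> x (Suc i)" if "j \<le> i" "i \<le> q" for i
    using that
  proof (induction i rule: dec_induct)
    case base
    then show ?case using xj by simp
  next
    case (step i)
    have "\<theta> * x (Suc i) \<le> (1 - Suc i / q + \<theta>) * x (Suc i)"
      using step nonneg pq by (intro mult_right_mono) (auto simp: field_simps)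
    also have "\<dots> \<le> x (Suc (Suc i))" using \<open>\<And>i. j \<le> i \<Longrightarrow> i \<le> q \<Longrightarrow> _\<close>[of "Suc i"] step by auto
    finally have "\<theta> * x (Suc i) \<le> x (Suc (Suc i))" .
    moreover have "\<theta> * \<theta> ^ (Suc i - j) \<le> \<theta> * x (Suc i)" using step \<theta> by (intro mult_left_mono) auto
    moreover have "\<theta> ^ (Suc (Suc i) - j) = \<theta> * \<theta> ^ (Suc i - j)" using step by (simp add: Suc_diff_le)
    ultimately show ?case by linarith
  qed
  have "\<theta> ^ (q + 2) \<le> \<theta> ^ (Suc q - j)" using \<theta> \<theta>1 by (intro power_decreasing) auto
  also have "\<dots> \<le> x (Suc q)" using pow[of q] j pq by simp
  finally show ?thesis by (simp add: \<theta>_def)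
qed

text \<open>The sequence lemma is applied to the numbers of ordered \<open>j\<close>-cliques divided
  by |U|^j. Exceeding the Turan value gives a positive density of (q+1)-cliques and thus a blow-up.
  The error is measured by \<open>n\<close> rather than |U| because \<open>U\<close> will be a
  neighbourhood of unknown size.\<close>

lemma card_cliques_le:
  fixes \<epsilon> :: real
  assumes pq: "1 \<le> p" "p \<le> q" and \<epsilon>: "0 < \<epsilon>" and t: "0 < t"
  shows "\<exists>n0. \<forall>n\<ge>n0. \<forall>(U :: 'a set) D. finite U \<longrightarrow> card U \<le> n \<longrightarrow> symp D \<longrightarrow> irreflp D \<longrightarrow>
    \<not> has_blowup D U (Suc q) t \<longrightarrow>
    fact p * real (card (cliques D U p)) \<le> (\<Prod>j<p. 1 - real j / real q) * real (card U) ^ p + \<epsilon> * real n ^ p"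
proof -
  define c where "c = (\<epsilon> / p) ^ (q + 2) / fact (Suc q)"
  have c: "c > 0" using pq \<epsilon> by (simp add: c_def)
  obtain m0 where m0: "\<And>(U :: 'a set) D. finite U \<Longrightarrow> m0 \<le> card U \<Longrightarrow> symp D \<Longrightarrow>
     c * card U ^ Suc q \<le> card (cliques D U (Suc q)) \<Longrightarrow> has_blowup D U (Suc q) t"
    using many_cliques_imp_blowup[OF c t, of "Suc q"] by blast
  \<comment> \<open>If |U| is below the threshold \<open>m0\<close> of supersaturation, the trivial
    bound |U|^p is at most the constant m0^p, which \<epsilon> n absorbs.\<close>
  define n0 where "n0 = Suc (nat \<lceil>real m0 ^ p / \<epsilon>\<rceil>)"
  have prod0: "0 \<le> (\<Prod>j<p. 1 - real j / q)" using pq by (intro prod_nonneg) (auto simp: field_simps)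
  show ?thesis
  proof (intro exI[of _ n0] allI impI)
    fix n and U :: "'a set" and D
    assume n: "n0 \<le> n" and U: "finite U" "card U \<le> n" and D: "symp D" "irreflp D"
      and nb: "\<not> has_blowup D U (Suc q) t"
    define \<kappa> where "\<kappa> j = real (card (cliques D U j))" for j
    have triv: "fact (Suc j) * \<kappa> (Suc j) \<le> card U * (fact j * \<kappa> j)" for j
    proof -
      have "Suc j * \<kappa> (Suc j) = (\<Sum>y\<in>cliques D U j. real (card (common_nbrs D U y)))"
        unfolding \<kappa>_def of_nat_mult[symmetric] card_Suc_cliques(1)[OF U(1) D] by simp
      also have "\<dots> \<le> (\<Sum>y\<in>cliques D U j. real (card U))"
        using U by (intro sum_mono) (auto simp: common_nbrs_def intro!: card_mono)
      finally have "Suc j * \<kappa> (Suc j) \<le> card U * \<kappa> j" by (simp add: \<kappa>_def mult.commute)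
      then have "fact j * (Suc j * \<kappa> (Suc j)) \<le> fact j * (card U * \<kappa> j)" by (rule mult_left_mono) simp
      then show ?thesis by (simp add: algebra_simps)
    qed
    have \<kappa>0: "\<kappa> 0 = 1"
    proof -
      have "cliques D U 0 = {{}}" by (auto simp: cliques_def)
      then show ?thesis by (simp add: \<kappa>_def)
    qed
    show "fact p * real (card (cliques D U p)) \<le> (\<Prod>j<p. 1 - real j / real q) * real (card U) ^ p + \<epsilon> * real n ^ p"
    proof (cases "m0 \<le> card U \<and> 0 < card U")
      case False
      have triv': "fact j * \<kappa> j \<le> card U ^ j" for j
      proof (induction j)
        case (Suc j)
        have "fact (Suc j) * \<kappa> (Suc j) \<le> card U * (fact j * \<kappa> j)" by (rule triv)
        also have "\<dots> \<le> card U * real (card U) ^ j" using Suc by (intro mult_left_mono) auto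
        finally show ?case by simp
      qed (simp add: \<kappa>0)
      have "fact p * \<kappa> p \<le> real (card U) ^ p" using triv'[of p] by simp
      also have "\<dots> \<le> real m0 ^ p" using False by (intro power_mono) auto
      also have "\<dots> \<le> \<epsilon> * n"
      proof -
        have "real m0 ^ p / \<epsilon> \<le> n" using n unfolding n0_def by linarith
        then show ?thesis using \<epsilon> by (simp add: field_simps)
      qed
      also have "\<dots> \<le> \<epsilon> * n ^ p"
      proof -
        have "n ^ 1 \<le> n ^ p" using n pq by (intro power_increasing) (auto simp: n0_def)
        then show ?thesis using \<epsilon> by (simp flip: of_nat_power)
      qed
      finally show ?thesis using prod0 by (simp add: \<kappa>_def add_increasing)
    next
      case True
      define m where "m = real (card U)"
      have m: "m > 0" using True by (simp add: m_def)
      define x where "x j = fact j * \<kappa> j / m ^ j" for j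
      have x\<kappa>: "fact j * \<kappa> j = x j * m ^ j" for j using m by (simp add: x_def)
      have "x p \<le> (\<Prod>j<p. 1 - real j / q) + \<epsilon>"
      proof (rule ccontr)
        assume "\<not> ?thesis"
        then have big: "(\<Prod>j<p. 1 - real j / q) + \<epsilon> < x p" by simp
        have hx: "(\<epsilon> / p) ^ (q + 2) \<le> x (Suc q)"
        proof (rule moon_moser_sequence[where x = x, OF _ _ _ _ pq \<epsilon> big])
          show "x 0 = 1" using \<kappa>0 by (simp add: x_def)
          show "0 \<le> x j" for j using m by (simp add: x_def \<kappa>_def)
          show "x (Suc j) \<le> x j" for j
            using triv[of j] m unfolding x\<kappa> by (simp add: m_def[symmetric] algebra_simps)
          show "Suc j * (x (Suc j))\<^sup>2 \<le> x j * (x (Suc j) + j * x (Suc (Suc j)))" for j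
          proof -
            have "(fact j)\<^sup>2 * (Suc j * \<kappa> (Suc j))\<^sup>2 \<le>
               (fact j)\<^sup>2 * (\<kappa> j * (m * \<kappa> (Suc j) + j * (Suc (Suc j) * \<kappa> (Suc (Suc j)))))"
              unfolding m_def \<kappa>_def by (intro mult_left_mono moon_moser U D) auto
            then have "Suc j * ((fact j)\<^sup>2 * (Suc j * \<kappa> (Suc j))\<^sup>2) \<le>
               Suc j * ((fact j)\<^sup>2 * (\<kappa> j * (m * \<kappa> (Suc j) + j * (Suc (Suc j) * \<kappa> (Suc (Suc j))))))"
              by (rule mult_left_mono) simp
            then have "Suc j * (fact (Suc j) * \<kappa> (Suc j))\<^sup>2
               \<le> (fact j * \<kappa> j) * (m * (fact (Suc j) * \<kappa> (Suc j)) + j * (fact (Suc (Suc j)) * \<kappa> (Suc (Suc j))))"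
              by (simp only: fact_Suc of_nat_mult) (simp only: algebra_simps power2_eq_square)
            then have "m ^ j * m ^ Suc (Suc j) * (Suc j * (x (Suc j))\<^sup>2)
               \<le> m ^ j * m ^ Suc (Suc j) * (x j * (x (Suc j) + j * x (Suc (Suc j))))"
              unfolding x\<kappa> by (simp only: power_Suc power2_eq_square algebra_simps)
            then show ?thesis using m by simp
          qed
        qed
        have "c * m ^ Suc q \<le> \<kappa> (Suc q)"
        proof -
          have "(\<epsilon> / p) ^ (q + 2) * m ^ Suc q \<le> x (Suc q) * m ^ Suc q"
            using m hx by (intro mult_right_mono) auto
          then have "(\<epsilon> / p) ^ (q + 2) * m ^ Suc q \<le> \<kappa> (Suc q) * fact (Suc q)"
            using x\<kappa>[of "Suc q"] by (metis mult.commute)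
          then have "(\<epsilon> / p) ^ (q + 2) * m ^ Suc q / fact (Suc q) \<le> \<kappa> (Suc q)"
            by (subst pos_divide_le_eq) auto
          then show ?thesis by (simp only: c_def times_divide_eq_left)
        qed
        then have "has_blowup D U (Suc q) t" using True U D m0 by (simp add: m_def \<kappa>_def)
        then show False using nb by simp
      qed
      then have "x p * m ^ p \<le> ((\<Prod>j<p. 1 - real j / q) + \<epsilon>) * m ^ p" using m by (intro mult_right_mono) auto
      also have "\<dots> \<le> (\<Prod>j<p. 1 - real j / q) * m ^ p + \<epsilon> * n ^ p"
        using U \<epsilon> m by (auto simp: m_def algebra_simps intro!: mult_left_mono power_mono)
      finally show ?thesis using x\<kappa>[of p] by (simp add: \<kappa>_def m_def)
    qed
  qed
qed

section \<open>Robust pairs\<close>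

text \<open>In a 2-graph this is adjacency, whatever the value of \<open>w\<close>.\<close>

definition robust :: "nat \<Rightarrow> 'a hypergraph \<Rightarrow> 'a \<Rightarrow> 'a \<Rightarrow> bool" where
  "robust w G x y \<longleftrightarrow> x \<noteq> y \<and> (\<forall>W. finite W \<longrightarrow> card W \<le> w \<longrightarrow> x \<notin> W \<longrightarrow> y \<notin> W \<longrightarrow>
     (\<exists>e\<in>edges G. x \<in> e \<and> y \<in> e \<and> e \<inter> W = {}))"

lemma symp_robust: "symp (robust w G)"
  by (rule sympI) (auto simp: robust_def conj_ac)

lemma irreflp_robust: "irreflp (robust w G)"
  by (auto simp: irreflp_def robust_def)

lemma r_graphD:
  assumes "r_graph r G"
  shows "finite (verts G)" "e \<in> edges G \<Longrightarrow> e \<subseteq> verts G" "e \<in> edges G \<Longrightarrow> card e = r"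
    "e \<in> edges G \<Longrightarrow> finite e" "finite (edges G)"
  using assms unfolding r_graph_def
  by (auto intro: finite_subset) (meson Pow_iff finite_Pow_iff finite_subset subsetI)

text \<open>The blocking set \<open>W\<close> supplies a third vertex, so at most w n^(r-3)
  hyperedges contain the pair. Multiplication by n^2 lets one formula also cover
  \<open>r = 2\<close>, where the codegree is 0.\<close>

lemma codegree_light:
  assumes G: "r_graph r G" and r: "2 \<le> r" and xy: "x \<noteq> y" "\<not> robust w G x y"
  shows "card {e\<in>edges G. x \<in> e \<and> y \<in> e} * card (verts G) ^ 2 \<le> w * card (verts G) ^ (r - 1)"
proof -
  let ?n = "card (verts G)"
  obtain W where W: "finite W" "card W \<le> w" "x \<notin> W" "y \<notin> W"
    and none: "\<And>e. e \<in> edges G \<Longrightarrow> x \<in> e \<Longrightarrow> y \<in> e \<Longrightarrow> e \<inter> W \<noteq> {}"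
    using xy unfolding robust_def by blast
  show ?thesis
  proof (cases "r = 2")
    case True
    have "{e\<in>edges G. x \<in> e \<and> y \<in> e} = {}"
    proof (rule ccontr)
      assume "{e\<in>edges G. x \<in> e \<and> y \<in> e} \<noteq> {}"
      then obtain e where e: "e \<in> edges G" "x \<in> e" "y \<in> e" by auto
      then have "card e = 2" "finite e" using r_graphD[OF G] True by auto
      moreover have "{x, y} \<subseteq> e" "card {x, y} = 2" using e xy by auto
      ultimately have "e = {x, y}" by (metis card_subset_eq)
      then show False using none[of e] e W by auto
    qed
    then show ?thesis by (simp only: card.empty mult_zero_left le0)
  next
    case False
    then have r3: "3 \<le> r" using r by simp
    have "{e\<in>edges G. x \<in> e \<and> y \<in> e} \<subseteq> (\<Union>z\<in>W. {e. e \<subseteq> verts G \<and> card e = r \<and> {x, y, z} \<subseteq> e})"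
    proof
      fix e assume "e \<in> {e\<in>edges G. x \<in> e \<and> y \<in> e}"
      then have e: "e \<in> edges G" "x \<in> e" "y \<in> e" by auto
      then obtain z where "z \<in> e" "z \<in> W" using none by blast
      then show "e \<in> (\<Union>z\<in>W. {e. e \<subseteq> verts G \<and> card e = r \<and> {x, y, z} \<subseteq> e})"
        using e r_graphD(2,3)[OF G e(1)] by auto
    qed
    then have "card {e\<in>edges G. x \<in> e \<and> y \<in> e}
        \<le> card (\<Union>z\<in>W. {e. e \<subseteq> verts G \<and> card e = r \<and> {x, y, z} \<subseteq> e})"
      using W r_graphD(1)[OF G] by (intro card_mono) auto
    also have "\<dots> \<le> (\<Sum>z\<in>W. card {e. e \<subseteq> verts G \<and> card e = r \<and> {x, y, z} \<subseteq> e})"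
      by (rule card_UN_le[OF W(1)])
    also have "\<dots> \<le> (\<Sum>z\<in>W. ?n ^ (r - 3))"
    proof (rule sum_mono)
      fix z assume "z \<in> W"
      then have "card {x, y, z} = 3" using W xy by (subst card_3_iff) auto
      then show "card {e. e \<subseteq> verts G \<and> card e = r \<and> {x, y, z} \<subseteq> e} \<le> ?n ^ (r - 3)"
        using card_supersets_le[of "verts G" "{x, y, z}" r] r3 r_graphD(1)[OF G] by simp
    qed
    also have "\<dots> \<le> w * ?n ^ (r - 3)" using W by simp
    finally have "card {e\<in>edges G. x \<in> e \<and> y \<in> e} * ?n ^ 2 \<le> w * ?n ^ (r - 3) * ?n ^ 2"
      by (rule mult_le_mono1)
    also have "\<dots> = w * ?n ^ (r - 3 + 2)" by (simp add: power_add power2_eq_square)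
    also have "r - 3 + 2 = r - 1" using r3 by simp
    finally show ?thesis .
  qed
qed

text \<open>Each vertex loses at most one candidate to every earlier image and at most
  \<open>B z\<close> to every earlier \<open>R\<close>-neighbour. The bound varies with
  \<open>z\<close> because candidates inside a blow-up are completely joined, while candidates
  inside parts are only almost completely joined.\<close>

lemma greedy_embedding:
  assumes Z: "finite Z" "card Z \<le> N" and D: "symp D" and R: "symp R"
    and fin: "\<And>z. z \<in> Z \<Longrightarrow> finite (Cd z)"
    and miss: "\<And>z z' a. z \<in> Z \<Longrightarrow> z' \<in> Z \<Longrightarrow> z \<noteq> z' \<Longrightarrow> R z z' \<Longrightarrow> a \<in> Cd z' \<Longrightarrow>
        card {b\<in>Cd z. \<not> D a b} \<le> B z"
    and big: "\<And>z. z \<in> Z \<Longrightarrow> N * Suc (B z) < card (Cd z)"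
  shows "\<exists>f. inj_on f Z \<and> (\<forall>z\<in>Z. f z \<in> Cd z) \<and> (\<forall>z\<in>Z. \<forall>z'\<in>Z. z \<noteq> z' \<longrightarrow> R z z' \<longrightarrow> D (f z) (f z'))"
  using Z fin miss big
proof (induction Z rule: finite_induct)
  case (insert z Z)
  obtain f where f: "inj_on f Z" "\<forall>z\<in>Z. f z \<in> Cd z"
    "\<forall>z\<in>Z. \<forall>z'\<in>Z. z \<noteq> z' \<longrightarrow> R z z' \<longrightarrow> D (f z) (f z')"
  proof -
    have "\<exists>f. inj_on f Z \<and> (\<forall>z\<in>Z. f z \<in> Cd z) \<and> (\<forall>z\<in>Z. \<forall>z'\<in>Z. z \<noteq> z' \<longrightarrow> R z z' \<longrightarrow> D (f z) (f z'))"
    proof (rule insert.IH)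
      show "card Z \<le> N" using insert.hyps insert.prems(1) by simp
      show "finite (Cd x)" "N * Suc (B x) < card (Cd x)" if "x \<in> Z" for x
        using insert.prems(2,4)[of x] that by auto
      show "card {b\<in>Cd x. \<not> D a b} \<le> B x"
        if "x \<in> Z" "z' \<in> Z" "x \<noteq> z'" "R x z'" "a \<in> Cd z'" for x z' a
        using insert.prems(3)[of x z' a] that by auto
    qed
    then show ?thesis using that by blast
  qed
  define bad where "bad = f ` Z \<union> (\<Union>z'\<in>{z'\<in>Z. R z z'}. {b\<in>Cd z. \<not> D (f z') b})"
  have "card bad \<le> card (f ` Z) + card (\<Union>z'\<in>{z'\<in>Z. R z z'}. {b\<in>Cd z. \<not> D (f z') b})"
    unfolding bad_def by (rule card_Un_le)
  also have "\<dots> \<le> card Z + (\<Sum>z'\<in>{z'\<in>Z. R z z'}. card {b\<in>Cd z. \<not> D (f z') b})"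
    using insert.hyps by (intro add_mono card_image_le card_UN_le) auto
  also have "\<dots> \<le> card Z + (\<Sum>z'\<in>{z'\<in>Z. R z z'}. B z)"
  proof (intro add_left_mono sum_mono)
    fix z' assume "z' \<in> {z'\<in>Z. R z z'}"
    then show "card {b\<in>Cd z. \<not> D (f z') b} \<le> B z"
      using insert.prems(3)[of z z' "f z'"] insert.hyps f(2) by auto
  qed
  also have "\<dots> \<le> card Z + card Z * B z"
    using insert.hyps by (auto intro!: card_mono)
  also have "\<dots> \<le> N * Suc (B z)" using insert.prems(1) insert.hyps by (simp add: add_mono mult_le_mono)
  also have "\<dots> < card (Cd z)" using insert.prems by auto
  finally have lt: "card bad < card (Cd z)" .
  have "finite bad" using insert.hyps insert.prems by (auto simp: bad_def)
  then have "\<not> Cd z \<subseteq> bad" using lt by (metis card_mono leD)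
  then obtain b where b: "b \<in> Cd z" "b \<notin> bad" by auto
  define g where "g = f(z := b)"
  have gZ: "g x = f x" if "x \<in> Z" for x using that insert.hyps by (auto simp: g_def)
  have "inj_on g (insert z Z)"
    using f(1) b insert.hyps by (auto simp: g_def inj_on_def bad_def)
  moreover have "\<forall>z\<in>insert z Z. g z \<in> Cd z" using f(2) b insert.hyps by (auto simp: g_def)
  moreover have "D b (f z')" "D (f z') b" if "z' \<in> Z" "R z z'" for z'
    using b that D by (auto simp: bad_def symp_def)
  then have "\<forall>x\<in>insert z Z. \<forall>y\<in>insert z Z. x \<noteq> y \<longrightarrow> R x y \<longrightarrow> D (g x) (g y)"
    using f(3) R insert.hyps by (auto simp: g_def symp_def)
  ultimately show ?case by blast
qed auto

lemma graph_edgeE: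
  assumes "graph F" "e \<in> edges F"
  obtains x y where "e = {x, y}" "x \<noteq> y" "x \<in> verts F" "y \<in> verts F"
  using assms by (auto simp: r_graph_def card_2_iff)

text \<open>The r-2 new vertices of an edge \<open>e\<close> are mapped onto the rest of
  \<open>h e\<close>. Injectivity follows from the disjointness of these rests and from
  \<open>h e\<close> meeting the image of \<open>verts F\<close> only in the image of
  \<open>e\<close>.\<close>

lemma contains_expansion_hyperedges:
  assumes F: "graph F" and G: "r_graph r G" and r: "2 \<le> r"
    and f: "inj_on f (verts F)" "f ` verts F \<subseteq> verts G"
    and h: "\<And>e. e \<in> edges F \<Longrightarrow> h e \<in> edges G" "\<And>e. e \<in> edges F \<Longrightarrow> h e \<inter> f ` verts F = f ` e"
    and dj: "\<And>e e'. e \<in> edges F \<Longrightarrow> e' \<in> edges F \<Longrightarrow> e \<noteq> e' \<Longrightarrow> (h e - f ` e) \<inter> (h e' - f ` e') = {}"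
  shows "contains_copy G (expansion r F)"
proof -
  have "\<exists>g. bij_betw g {..<r - 2} (h e - f ` e)" if e: "e \<in> edges F" for e
  proof -
    have sub: "f ` e \<subseteq> h e" using h(2)[OF e] by auto
    have "e \<subseteq> verts F" "card e = 2" using F e by (auto simp: r_graph_def)
    then have "card (f ` e) = 2" using f(1) by (metis card_image inj_on_subset)
    moreover have "finite (h e)" "card (h e) = r" using r_graphD[OF G] h(1)[OF e] by auto
    ultimately have "card (h e - f ` e) = r - 2" using sub by (simp add: card_Diff_subset finite_subset)
    then show ?thesis using \<open>finite (h e)\<close> by (metis bij_betw_iff_card card_lessThan finite_Diff finite_lessThan)
  qed
  then obtain g where g: "\<And>e. e \<in> edges F \<Longrightarrow> bij_betw (g e) {..<r - 2} (h e - f ` e)" by metis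
  define \<phi> where "\<phi> = case_sum f (\<lambda>(e, i). g e i)"
  have img: "g e i \<in> h e - f ` e" if "e \<in> edges F" "i < r - 2" for e i
    using g that by (auto simp: bij_betw_def)
  have imgF: "g e i \<notin> f ` verts F" if "e \<in> edges F" "i < r - 2" for e i
    using img[OF that] h(2)[OF that(1)] by auto
  have "inj_on \<phi> (verts (expansion r F))"
  proof (rule inj_onI)
    fix p q assume p: "p \<in> verts (expansion r F)" and q: "q \<in> verts (expansion r F)" and eq: "\<phi> p = \<phi> q"
    have cases: "(\<exists>v\<in>verts F. p = Inl v) \<or> (\<exists>e\<in>edges F. \<exists>i<r - 2. p = Inr (e, i))"
      if "p \<in> verts (expansion r F)" for p using that by (auto simp: expansion_def)
    show "p = q"
    proof (cases p; cases q)
      fix a b assume "p = Inr a" "q = Inr b"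
      then obtain e i e' i' where ei: "e \<in> edges F" "i < r - 2" "e' \<in> edges F" "i' < r - 2"
        "p = Inr (e, i)" "q = Inr (e', i')" using cases[OF p] cases[OF q] by auto
      then have eq': "g e i = g e' i'" using eq by (simp add: \<phi>_def)
      have m: "g e i \<in> h e - f ` e" "g e i \<in> h e' - f ` e'" using img[OF ei(1,2)] img[OF ei(3,4)] eq' by simp_all
      have ee: "e = e'"
      proof (rule ccontr)
        assume "e \<noteq> e'"
        from dj[OF ei(1,3) this] m show False by blast
      qed
      have "inj_on (g e) {..<r - 2}" using g[OF ei(1)] by (simp add: bij_betw_def)
      then have "i = i'" using eq' ei ee by (auto simp: inj_on_def)
      then show ?thesis using ei ee by simp
    next
      fix a b assume "p = Inl a" "q = Inl b"
      then show ?thesis using cases[OF p] cases[OF q] eq f(1) by (auto simp: \<phi>_def inj_on_def)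
    next
      fix a b assume "p = Inl a" "q = Inr b"
      then obtain v e i where vei: "v \<in> verts F" "e \<in> edges F" "i < r - 2" "p = Inl v" "q = Inr (e, i)"
        using cases[OF p] cases[OF q] by auto
      then have "f v = g e i" using eq by (simp add: \<phi>_def)
      then show ?thesis using imgF[OF vei(2,3)] vei(1) by (metis imageI)
    next
      fix a b assume "p = Inr a" "q = Inl b"
      then obtain v e i where vei: "v \<in> verts F" "e \<in> edges F" "i < r - 2" "q = Inl v" "p = Inr (e, i)"
        using cases[OF p] cases[OF q] by auto
      then have "f v = g e i" using eq by (simp add: \<phi>_def)
      then show ?thesis using imgF[OF vei(2,3)] vei(1) by (metis imageI)
    qed
  qed
  moreover have "\<phi> ` verts (expansion r F) \<subseteq> verts G"
  proof -
    have "g e i \<in> verts G" if "e \<in> edges F" "i < r - 2" for e i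
      using img[OF that] r_graphD(2)[OF G h(1)[OF that(1)]] by auto
    then show ?thesis using f(2) by (auto simp: \<phi>_def expansion_def)
  qed
  moreover have "\<phi> ` E \<in> edges G" if E: "E \<in> edges (expansion r F)" for E
  proof -
    obtain e where e: "e \<in> edges F" "E = Inl ` e \<union> Inr ` ({e} \<times> {..<r - 2})"
      using E by (auto simp: expansion_def)
    have "\<phi> ` E = f ` e \<union> g e ` {..<r - 2}" unfolding e(2)
      by (force simp: \<phi>_def image_Un image_image)
    also have "\<dots> = f ` e \<union> (h e - f ` e)" using g[OF e(1)] by (simp add: bij_betw_def)
    also have "\<dots> = h e" using h(2)[OF e(1)] by auto
    finally show ?thesis using h(1)[OF e(1)] by simp
  qed
  ultimately show ?thesis unfolding contains_copy_def by blast
qed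

text \<open>The hyperedges for \<open>M\<close> are prescribed; those for \<open>S\<close> are
  chosen one at a time, each through a robust pair and avoiding everything used before.\<close>

lemma extend_hyperedges:
  assumes F: "graph F" and G: "r_graph r G" and w: "card (verts F) + r * card (edges F) \<le> w"
    and f: "inj_on f (verts F)" and S: "finite S" "M \<union> S \<subseteq> edges F" "M \<inter> S = {}"
    and h: "\<And>e. e \<in> M \<Longrightarrow> h e \<in> edges G \<and> h e \<inter> f ` verts F = f ` e"
    and dj: "\<And>e e'. e \<in> M \<Longrightarrow> e' \<in> M \<Longrightarrow> e \<noteq> e' \<Longrightarrow> (h e - f ` e) \<inter> (h e' - f ` e') = {}"
    and D: "\<And>x y. {x, y} \<in> S \<Longrightarrow> robust w G (f x) (f y)"
  shows "\<exists>h'. (\<forall>e\<in>M \<union> S. h' e \<in> edges G \<and> h' e \<inter> f ` verts F = f ` e) \<and>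
     (\<forall>e\<in>M \<union> S. \<forall>e'\<in>M \<union> S. e \<noteq> e' \<longrightarrow> (h' e - f ` e) \<inter> (h' e' - f ` e') = {})"
  using S D
proof (induction S rule: finite_induct)
  case empty
  show ?case
    using h dj by (intro exI[of _ h]) auto
next
  case (insert e S)
  obtain h' where h': "\<forall>e\<in>M \<union> S. h' e \<in> edges G \<and> h' e \<inter> f ` verts F = f ` e"
     "\<forall>e\<in>M \<union> S. \<forall>e'\<in>M \<union> S. e \<noteq> e' \<longrightarrow> (h' e - f ` e) \<inter> (h' e' - f ` e') = {}"
    using insert.IH insert.prems by auto
  have eF: "e \<in> edges F" using insert.prems by auto
  then obtain x y where xy: "e = {x, y}" "x \<noteq> y" "x \<in> verts F" "y \<in> verts F"
    by (rule graph_edgeE[OF F])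
  \<comment> \<open>All vertices in use except the two endpoints. There are at most |V(F)| + r
    |E(F)| of them, hence at most \<open>w\<close>, and robustness provides a hyperedge avoiding
    them.\<close>
  define W where "W = (f ` verts F \<union> (\<Union>e\<in>M \<union> S. h' e)) - {f x, f y}"
  have fF: "finite (verts F)" "finite (edges F)" using r_graphD[OF F] by auto
  have MS: "M \<union> S \<subseteq> edges F" using insert.prems by auto
  then have fMS: "finite (M \<union> S)" using fF finite_subset by blast
  have fh: "\<And>e. e \<in> M \<union> S \<Longrightarrow> finite (h' e)" using h'(1) r_graphD(4)[OF G] by blast
  have finW: "finite W" using fF fMS fh by (auto simp: W_def)
  have "card W \<le> card (f ` verts F \<union> (\<Union>e\<in>M \<union> S. h' e))"
    unfolding W_def using fF fMS fh by (intro card_mono) auto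
  also have "\<dots> \<le> card (f ` verts F) + card (\<Union>e\<in>M \<union> S. h' e)" by (rule card_Un_le)
  also have "\<dots> \<le> card (verts F) + (\<Sum>e\<in>M \<union> S. card (h' e))"
    using fMS fF by (intro add_mono card_image_le card_UN_le)
  also have "(\<Sum>e\<in>M \<union> S. card (h' e)) = (\<Sum>e\<in>M \<union> S. r)"
    using h'(1) r_graphD(3)[OF G] by (intro sum.cong) auto
  also have "\<dots> \<le> r * card (edges F)" using card_mono[OF fF(2) MS] by simp
  finally have "card W \<le> w" using w by simp
  moreover have "robust w G (f x) (f y)" using insert.prems xy by auto
  ultimately obtain e0 where e0: "e0 \<in> edges G" "f x \<in> e0" "f y \<in> e0" "e0 \<inter> W = {}"
  proof -
    have "f x \<notin> W" "f y \<notin> W" by (auto simp: W_def)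
    then show ?thesis
      using that finW \<open>card W \<le> w\<close> \<open>robust w G (f x) (f y)\<close> unfolding robust_def by blast
  qed
  define h2 where "h2 = h'(e := e0)"
  have eMS: "e \<notin> M \<union> S" using insert by auto
  have 1: "e0 \<inter> f ` verts F = f ` e" using e0 xy by (auto simp: W_def)
  have 2: "(e0 - f ` e) \<inter> (h' e' - f ` e') = {}" if "e' \<in> M \<union> S" for e'
  proof -
    have "h' e' \<subseteq> W \<union> {f x, f y}" using that by (auto simp: W_def)
    then show ?thesis using e0(4) xy(1) by auto
  qed
  show ?case
  proof (intro exI[of _ h2] conjI ballI impI)
    fix e1 assume "e1 \<in> M \<union> insert e S"
    then consider "e1 = e" | "e1 \<in> M \<union> S" "e1 \<noteq> e" using eMS by auto
    then have "h2 e1 \<in> edges G \<and> h2 e1 \<inter> f ` verts F = f ` e1"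
      using h'(1) 1 e0(1) by cases (simp_all add: h2_def)
    then show "h2 e1 \<in> edges G" "h2 e1 \<inter> f ` verts F = f ` e1" by auto
  next
    fix e1 e2 assume e12: "e1 \<in> M \<union> insert e S" "e2 \<in> M \<union> insert e S" "e1 \<noteq> e2"
    have E: "e1 \<in> M \<union> S \<or> e1 = e" "e2 \<in> M \<union> S \<or> e2 = e" using e12 by auto
    show "(h2 e1 - f ` e1) \<inter> (h2 e2 - f ` e2) = {}"
    proof (cases "e1 = e")
      case True
      then have "e2 \<in> M \<union> S" "e2 \<noteq> e" using E e12 by auto
      then show ?thesis using 2[of e2] True by (simp add: h2_def)
    next
      case False
      then have m1: "e1 \<in> M \<union> S" using E by auto
      show ?thesis
      proof (cases "e2 = e")
        case True
        then show ?thesis using 2[OF m1] False by (auto simp: h2_def)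
      next
        case False
        then have "e2 \<in> M \<union> S" using E by auto
        then have "(h' e1 - f ` e1) \<inter> (h' e2 - f ` e2) = {}" using h'(2) m1 e12(3) by blast
        then show ?thesis using \<open>e1 \<noteq> e\<close> False by (simp add: h2_def)
      qed
    qed
  qed
qed

text \<open>The common frame of all embeddings below. The vertices of \<open>P0\<close> are placed
  in advance by \<open>f0\<close>, and the edges in \<open>M\<close> get prescribed hyperedges whose
  pairs may fail to be robust. Every other vertex is placed greedily in its candidate set
  \<open>Cd z\<close>, after which all remaining edges are robust pairs.\<close>

lemma contains_expansionI:
  fixes F :: "'a hypergraph" and G :: "'b hypergraph"
  assumes F: "graph F" and G: "r_graph r G" and r: "2 \<le> r"
    and w: "card (verts F) + r * card (edges F) \<le> w"
    and M: "M \<subseteq> edges F" "\<Union>M \<subseteq> P0" and P0: "P0 \<subseteq> verts F"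
    and f0: "inj_on f0 P0" "f0 ` P0 \<subseteq> verts G"
    and h: "\<And>e. e \<in> M \<Longrightarrow> h e \<in> edges G" "\<And>e. e \<in> M \<Longrightarrow> h e \<inter> f0 ` P0 = f0 ` e"
    and dj: "\<And>e e'. e \<in> M \<Longrightarrow> e' \<in> M \<Longrightarrow> e \<noteq> e' \<Longrightarrow> (h e - f0 ` e) \<inter> (h e' - f0 ` e') = {}"
    and pre: "\<And>u v. u \<in> P0 \<Longrightarrow> v \<in> P0 \<Longrightarrow> {u, v} \<in> edges F \<Longrightarrow> {u, v} \<notin> M \<Longrightarrow> robust w G (f0 u) (f0 v)"
    and Cd: "\<And>z. z \<in> verts F - P0 \<Longrightarrow> Cd z \<subseteq> verts G"
      "\<And>z. z \<in> verts F - P0 \<Longrightarrow> Cd z \<inter> f0 ` P0 = {}"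
      "\<And>z e. z \<in> verts F - P0 \<Longrightarrow> e \<in> M \<Longrightarrow> Cd z \<inter> h e = {}"
    and mixed: "\<And>u z b. u \<in> P0 \<Longrightarrow> z \<in> verts F - P0 \<Longrightarrow> {u, z} \<in> edges F \<Longrightarrow> b \<in> Cd z \<Longrightarrow> robust w G (f0 u) b"
    and miss: "\<And>z z' a. z \<in> verts F - P0 \<Longrightarrow> z' \<in> verts F - P0 \<Longrightarrow> {z, z'} \<in> edges F \<Longrightarrow> a \<in> Cd z' \<Longrightarrow>
        card {b\<in>Cd z. \<not> robust w G a b} \<le> B z"
    and big: "\<And>z. z \<in> verts F - P0 \<Longrightarrow> card (verts F) * Suc (B z) < card (Cd z)"
  shows "contains_copy G (expansion r F)"
proof -
  have fF: "finite (verts F)" "finite (edges F)" using r_graphD[OF F] by auto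
  have finCd: "finite (Cd z)" if "z \<in> verts F - P0" for z
    using Cd(1)[OF that] r_graphD(1)[OF G] finite_subset by blast
  have "\<exists>f. inj_on f (verts F - P0) \<and> (\<forall>z\<in>verts F - P0. f z \<in> Cd z) \<and>
     (\<forall>z\<in>verts F - P0. \<forall>z'\<in>verts F - P0. z \<noteq> z' \<longrightarrow> {z, z'} \<in> edges F \<longrightarrow> robust w G (f z) (f z'))"
  proof (rule greedy_embedding[where N = "card (verts F)" and B = B and R = "\<lambda>z z'. {z, z'} \<in> edges F", OF _ _ symp_robust])
    show "card (verts F - P0) \<le> card (verts F)" using fF by (intro card_mono) auto
    show "symp (\<lambda>z z'. {z, z'} \<in> edges F)" by (simp add: symp_def insert_commute)
  qed (use miss big finCd fF in auto)
  then obtain f1 where f1: "inj_on f1 (verts F - P0)" "\<forall>z\<in>verts F - P0. f1 z \<in> Cd z"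
    "\<forall>z\<in>verts F - P0. \<forall>z'\<in>verts F - P0. z \<noteq> z' \<longrightarrow> {z, z'} \<in> edges F \<longrightarrow> robust w G (f1 z) (f1 z')"
    by blast
  define f where "f v = (if v \<in> P0 then f0 v else f1 v)" for v
  have fP: "f v = f0 v" if "v \<in> P0" for v using that by (simp add: f_def)
  have fN: "f v = f1 v" if "v \<in> verts F - P0" for v using that by (simp add: f_def)
  have fim: "f ` verts F = f0 ` P0 \<union> f1 ` (verts F - P0)"
  proof -
    have "f ` verts F = f ` P0 \<union> f ` (verts F - P0)"
      using P0 by (simp add: Un_absorb1 flip: image_Un)
    also have "f ` P0 = f0 ` P0" using fP by (intro image_cong) auto
    also have "f ` (verts F - P0) = f1 ` (verts F - P0)" using fN by (intro image_cong) auto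
    finally show ?thesis .
  qed
  have fe: "f ` e = f0 ` e" if "e \<in> M" for e using that M fP by (intro image_cong) auto
  have inj: "inj_on f (verts F)"
  proof -
    have "inj_on f (P0 \<union> (verts F - P0))"
    proof (rule inj_on_Un[THEN iffD2], intro conjI)
      show "inj_on f P0" using f0(1) inj_on_cong[of P0 f f0] fP by blast
      show "inj_on f (verts F - P0)" using f1(1) inj_on_cong[of "verts F - P0" f f1] fN by blast
      show "f ` (P0 - (verts F - P0)) \<inter> f ` (verts F - P0 - P0) = {}"
      proof -
        have "f z \<notin> f ` P0" if z: "z \<in> verts F - P0" for z
        proof -
          have "f z \<in> Cd z" using f1(2) fN z by simp
          moreover have "f ` P0 = f0 ` P0" using fP by (intro image_cong) auto
          ultimately show ?thesis using Cd(2)[OF z] by blast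
        qed
        then have "\<forall>y\<in>f ` (verts F - P0). y \<notin> f ` P0" by simp
        then have "f ` P0 \<inter> f ` (verts F - P0) = {}" by blast
        moreover have "P0 - (verts F - P0) = P0" "verts F - P0 - P0 = verts F - P0" by auto
        ultimately show ?thesis by simp
      qed
    qed
    then show ?thesis using P0 by (simp add: Un_absorb1)
  qed
  have f1v: "f1 z \<in> verts G" if "z \<in> verts F - P0" for z using f1(2) Cd(1) that by blast
  have fG: "f ` verts F \<subseteq> verts G" unfolding fim using f0(2) f1v by auto
  have hf: "h e \<in> edges G \<and> h e \<inter> f ` verts F = f ` e" if "e \<in> M" for e
  proof -
    have "f1 z \<notin> h e" if z: "z \<in> verts F - P0" for z
      using Cd(3)[OF z \<open>e \<in> M\<close>] f1(2) z by blast
    then have "h e \<inter> f1 ` (verts F - P0) = {}" by blast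
    then have "h e \<inter> f ` verts F = h e \<inter> f0 ` P0" unfolding fim by blast
    then show ?thesis using h[OF that] fe[OF that] by simp
  qed
  have rob: "robust w G (f x) (f y)" if xy: "{x, y} \<in> edges F - M" for x y
  proof -
    have v: "x \<in> verts F" "y \<in> verts F" "x \<noteq> y"
      using graph_edgeE[OF F, of "{x, y}"] xy by (auto simp: doubleton_eq_iff)
    have e: "{x, y} \<in> edges F" "{y, x} \<in> edges F" using xy by (auto simp: insert_commute)
    consider "x \<in> P0 \<and> y \<in> P0" | "x \<in> P0 \<and> y \<notin> P0" | "x \<notin> P0 \<and> y \<in> P0" | "x \<notin> P0 \<and> y \<notin> P0" by blast
    then show ?thesis
    proof cases
      case 1
      then show ?thesis using pre[of x y] xy by (simp add: fP)
    next
      case 2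
      then show ?thesis using mixed[of x y "f1 y"] e v f1(2) by (simp add: f_def)
    next
      case 3
      then have "robust w G (f y) (f x)" using mixed[of y x "f1 x"] e v f1(2) by (simp add: f_def)
      then show ?thesis using symp_robust by (meson sympD)
    next
      case 4
      then show ?thesis using f1(3) v e by (simp add: f_def)
    qed
  qed
  have MF: "M \<union> (edges F - M) = edges F" using M(1) by auto
  have "\<exists>h'. (\<forall>e\<in>M \<union> (edges F - M). h' e \<in> edges G \<and> h' e \<inter> f ` verts F = f ` e) \<and>
     (\<forall>e\<in>M \<union> (edges F - M). \<forall>e'\<in>M \<union> (edges F - M). e \<noteq> e' \<longrightarrow> (h' e - f ` e) \<inter> (h' e' - f ` e') = {})"
  proof (rule extend_hyperedges[OF F G w inj, where h = h])
    show "finite (edges F - M)" using fF by simp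
    show "M \<union> (edges F - M) \<subseteq> edges F" using MF by simp
    show "M \<inter> (edges F - M) = {}" by blast
    show "h e \<in> edges G \<and> h e \<inter> f ` verts F = f ` e" if "e \<in> M" for e using hf[OF that] .
    show "(h e - f ` e) \<inter> (h e' - f ` e') = {}" if "e \<in> M" "e' \<in> M" "e \<noteq> e'" for e e'
      unfolding fe[OF that(1)] fe[OF that(2)] by (rule dj[OF that])
    show "robust w G (f x) (f y)" if "{x, y} \<in> edges F - M" for x y using rob[OF that] .
  qed
  then obtain h' where h': "(\<forall>e\<in>edges F. h' e \<in> edges G \<and> h' e \<inter> f ` verts F = f ` e) \<and>
     (\<forall>e\<in>edges F. \<forall>e'\<in>edges F. e \<noteq> e' \<longrightarrow> (h' e - f ` e) \<inter> (h' e' - f ` e') = {})"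
    unfolding MF by (rule exE)
  show ?thesis
  proof (rule contains_expansion_hyperedges[OF F G r inj fG, where h = h'])
    show "h' e \<in> edges G" "h' e \<inter> f ` verts F = f ` e" if "e \<in> edges F" for e
      using conjunct1[OF h'] that by blast+
    show "(h' e - f ` e) \<inter> (h' e' - f ` e') = {}" if "e \<in> edges F" "e' \<in> edges F" "e \<noteq> e'" for e e'
      using conjunct2[OF h', rule_format, OF that] .
  qed
qed

section \<open>Almost regular graphs without blow-ups\<close>

definition nbh :: "('a \<Rightarrow> 'a \<Rightarrow> bool) \<Rightarrow> 'a set \<Rightarrow> 'a \<Rightarrow> 'a set" where
  "nbh D V v = {u\<in>V. D v u}"

lemma has_blowupI:
  assumes "\<And>i. i < k \<Longrightarrow> A i \<subseteq> U" "\<And>i. i < k \<Longrightarrow> t \<le> card (A i)"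
    and "\<And>i j x y. i < k \<Longrightarrow> j < k \<Longrightarrow> i \<noteq> j \<Longrightarrow> x \<in> A i \<Longrightarrow> y \<in> A j \<Longrightarrow> D x y"
  shows "has_blowup D U k t"
proof -
  have "\<exists>B. B \<subseteq> A i \<and> card B = t" if "i < k" for i
    using obtain_subset_with_card_n[OF assms(2)[OF that]] by metis
  then obtain B where B: "\<And>i. i < k \<Longrightarrow> B i \<subseteq> A i \<and> card (B i) = t" by metis
  show ?thesis unfolding has_blowup_def
  proof (intro exI[of _ B] conjI allI impI ballI)
    fix i assume "i < k"
    then show "B i \<subseteq> U" "card (B i) = t" using B assms(1) by blast+
  next
    fix i j x y assume ij: "i < k" "j < k" "i \<noteq> j" "x \<in> B i" "y \<in> B j"
    then have "x \<in> A i" "y \<in> A j" using B by blast+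
    then show "D x y" using assms(3) ij by blast
  qed
qed

lemma has_blowupE:
  assumes "has_blowup D U k t"
  obtains A :: "nat \<Rightarrow> 'a set" where "\<And>i. i < k \<Longrightarrow> A i \<subseteq> U" "\<And>i. i < k \<Longrightarrow> card (A i) = t"
    "\<And>i j x y. i < k \<Longrightarrow> j < k \<Longrightarrow> i \<noteq> j \<Longrightarrow> x \<in> A i \<Longrightarrow> y \<in> A j \<Longrightarrow> D x y"
proof -
  from assms obtain A :: "nat \<Rightarrow> 'a set" where A: "(\<forall>i<k. A i \<subseteq> U \<and> card (A i) = t)
     \<and> (\<forall>i<k. \<forall>j<k. i \<noteq> j \<longrightarrow> (\<forall>x\<in>A i. \<forall>y\<in>A j. D x y))"
    unfolding has_blowup_def by (rule exE)
  show ?thesis by (rule that[of A]) (use A in blast)+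
qed

text \<open>A clique of fewer than \<open>k\<close> vertices has at least \<delta> |U| extensions,
  and a (j+1)-clique arises from j+1 \<le> k smaller ones. So each step multiplies the count by at
  least \<delta> |U| / k.\<close>

lemma card_cliques_ge:
  fixes \<delta> :: real
  assumes U: "finite U" and D: "symp D" "irreflp D" and \<delta>: "0 \<le> \<delta>" and k: "0 < k"
    and ext: "\<And>j x. j < k \<Longrightarrow> x \<in> cliques D U j \<Longrightarrow> \<delta> * card U \<le> card (common_nbrs D U x)"
  shows "(\<delta> / k) ^ k * real (card U) ^ k \<le> card (cliques D U k)"
proof -
  have "j \<le> k \<Longrightarrow> (\<delta> / k * card U) ^ j \<le> card (cliques D U j)" for j
  proof (induction j)
    case 0
    have "cliques D U 0 = {{}}" by (auto simp: cliques_def)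
    then show ?case by simp
  next
    case (Suc j)
    have "real (Suc j) * card (cliques D U (Suc j)) = (\<Sum>x\<in>cliques D U j. real (card (common_nbrs D U x)))"
      using card_Suc_cliques(1)[OF U D, of j] by (metis of_nat_mult of_nat_sum)
    also have "\<dots> \<ge> (\<Sum>x\<in>cliques D U j. \<delta> * card U)" using ext[of j] Suc.prems by (intro sum_mono) auto
    finally have 1: "card (cliques D U j) * (\<delta> * card U) \<le> real (Suc j) * card (cliques D U (Suc j))" by simp
    have "(\<delta> / k * card U) ^ j * (\<delta> * card U) \<le> card (cliques D U j) * (\<delta> * card U)"
      using Suc \<delta> by (intro mult_right_mono) auto
    also have "\<dots> \<le> real (Suc j) * card (cliques D U (Suc j))" by (rule 1)
    also have "\<dots> \<le> real k * real (card (cliques D U (Suc j)))" using Suc.prems by (intro mult_right_mono) auto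
    finally have "(\<delta> / k * card U) ^ j * (\<delta> * card U) / k \<le> card (cliques D U (Suc j))"
      using k by (simp add: field_simps)
    then show ?case by (simp add: mult.commute)
  qed
  from this[of k] show ?thesis by (simp only: power_mult_distrib le_refl)
qed

text \<open>Fewer than \<open>k\<close> vertices together miss at most (k-1)(1/k + \<epsilon>) n
  vertices. A positive share of common neighbours remains, so cliques can be grown up to size
  \<open>k\<close> in many ways.\<close>

lemma near_regular_imp_blowup:
  fixes \<epsilon> :: real
  assumes k: "2 \<le> k" and \<epsilon>: "0 < \<epsilon>" "\<epsilon> \<le> 1 / (4 * (real k)\<^sup>2)" and T: "0 < T"
  shows "\<exists>n0. \<forall>(V :: 'a set) D Ex. finite V \<longrightarrow> n0 \<le> card V \<longrightarrow> symp D \<longrightarrow> irreflp D \<longrightarrow>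
    Ex \<subseteq> V \<longrightarrow> card Ex \<le> c \<longrightarrow> (\<forall>v\<in>V - Ex. (1 - 1 / k - \<epsilon>) * card V \<le> card (nbh D V v)) \<longrightarrow>
    has_blowup D (V - Ex) k T"
proof -
  \<comment> \<open>Ideally n/k common neighbours remain; the term (k-1) \<epsilon> n and the
    exceptional set may each take n/(4k) of them.\<close>
  define \<delta> where "\<delta> = 1 / (2 * real k)"
  have "(\<delta> / k) ^ k > 0" using k by (simp add: \<delta>_def)
  from many_cliques_imp_blowup[OF this T] obtain m0 where
    m0: "\<And>(U :: 'a set) D. finite U \<Longrightarrow> m0 \<le> card U \<Longrightarrow> symp D \<Longrightarrow>
     (\<delta> / k) ^ k * real (card U ^ k) \<le> card (cliques D U k) \<Longrightarrow> has_blowup D U k T"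
    by blast
  show ?thesis
  proof (intro exI[of _ "m0 + 4 * k * c"] allI impI)
    fix V :: "'a set" and D Ex
    assume V: "finite V" "m0 + 4 * k * c \<le> card V" and D: "symp D" "irreflp D"
      and Ex: "Ex \<subseteq> V" "card Ex \<le> c" and deg: "\<forall>v\<in>V - Ex. (1 - 1 / k - \<epsilon>) * card V \<le> card (nbh D V v)"
    define U where "U = V - Ex"
    define n where "n = real (card V)"
    have U: "finite U" "card U = card V - card Ex" using V Ex by (auto simp: U_def card_Diff_subset finite_subset)
    have Ul: "card V \<le> card U + c" "card U \<le> card V" using U Ex by auto
    have "1 * c \<le> 4 * k * c" using k by (intro mult_le_mono1) simp
    then have m: "m0 \<le> card U" using V Ul by linarith
    have "real (4 * k * c) \<le> n" using V unfolding n_def by linarith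
    then have c4: "c \<le> n / (4 * k)" using k by (simp add: field_simps)
    have "\<delta> * card U \<le> card (common_nbrs D U x)" if j: "j < k" and x: "x \<in> cliques D U j" for j x
    proof -
      have x': "finite x" "card x = j" "x \<subseteq> U" using x by (auto simp: cliques_def)
      have miss: "card (U - nbh D V z) \<le> (1 / k + \<epsilon>) * n" if "z \<in> x" for z
      proof -
        have "card (U - nbh D V z) \<le> card (V - nbh D V z)" using V by (intro card_mono) (auto simp: U_def)
        also have "\<dots> = card V - card (nbh D V z)" using V by (intro card_Diff_subset) (auto simp: nbh_def)
        finally have "card (U - nbh D V z) + card (nbh D V z) \<le> card V"
          using card_mono[OF V(1), of "nbh D V z"] by (auto simp: nbh_def)
        then have "real (card (U - nbh D V z)) + card (nbh D V z) \<le> n" unfolding n_def by linarith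
        moreover have "(1 - 1 / k - \<epsilon>) * n \<le> card (nbh D V z)" using deg that x' by (auto simp: n_def U_def)
        ultimately show ?thesis by (simp add: algebra_simps)
      qed
      have "U \<subseteq> common_nbrs D U x \<union> (\<Union>z\<in>x. U - nbh D V z)"
        using D(1) by (auto simp: common_nbrs_def nbh_def U_def symp_def)
      then have "card U \<le> card (common_nbrs D U x \<union> (\<Union>z\<in>x. U - nbh D V z))"
        using U x' by (intro card_mono) (auto simp: common_nbrs_def)
      also have "\<dots> \<le> card (common_nbrs D U x) + card (\<Union>z\<in>x. U - nbh D V z)" by (rule card_Un_le)
      also have "\<dots> \<le> card (common_nbrs D U x) + (\<Sum>z\<in>x. card (U - nbh D V z))"
        by (intro add_left_mono card_UN_le x')
      finally have "real (card U) \<le> card (common_nbrs D U x) + (\<Sum>z\<in>x. real (card (U - nbh D V z)))"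
        by (metis of_nat_add of_nat_le_iff of_nat_sum)
      also have "\<dots> \<le> card (common_nbrs D U x) + (\<Sum>z\<in>x. (1 / k + \<epsilon>) * n)"
        by (intro add_left_mono sum_mono miss)
      also have "\<dots> = card (common_nbrs D U x) + j * ((1 / k + \<epsilon>) * n)" using x' by simp
      also have "\<dots> \<le> card (common_nbrs D U x) + (real k - 1) * ((1 / k + \<epsilon>) * n)"
        using j \<epsilon> by (intro add_left_mono mult_right_mono) (auto simp: n_def)
      finally have 1: "n - c - (real k - 1) * ((1 / k + \<epsilon>) * n) \<le> card (common_nbrs D U x)"
        using Ul by (simp add: n_def)
      have "(real k - 1) * \<epsilon> \<le> k * (1 / (4 * (real k)\<^sup>2))" using \<epsilon> k by (intro mult_mono) auto
      also have "\<dots> = 1 / (4 * k)" using k by (simp add: power2_eq_square)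
      finally have "(real k - 1) * \<epsilon> * n \<le> 1 / (4 * k) * n" by (intro mult_right_mono) (auto simp: n_def)
      moreover have "(real k - 1) * ((1 / k + \<epsilon>) * n) = n - n / k + (real k - 1) * \<epsilon> * n"
        using k by (simp add: field_simps)
      ultimately have "n / k - 1 / (4 * k) * n - c \<le> card (common_nbrs D U x)" using 1 by linarith
      moreover have "n / k - 1 / (4 * k) * n - n / (4 * k) = \<delta> * n" using k by (simp add: \<delta>_def field_simps)
      ultimately have "\<delta> * n \<le> card (common_nbrs D U x)" using c4 by linarith
      moreover have "\<delta> * card U \<le> \<delta> * n" using Ul by (intro mult_left_mono) (auto simp: n_def \<delta>_def)
      ultimately show ?thesis by linarith
    qed
    then have "(\<delta> / k) ^ k * real (card U) ^ k \<le> card (cliques D U k)"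
      using k by (intro card_cliques_ge U D) (auto simp: \<delta>_def)
    then show "has_blowup D (V - Ex) k T" using m0[OF U(1) m D(1)] by (simp add: U_def)
  qed
qed

text \<open>A blow-up \<open>A\<close> of the \<open>k\<close>-clique with large sets serves as a
  probe. A vertex without a blow-up in its neighbourhood has fewer than \<open>t\<close> neighbours
  in some \<open>A i\<close>, while the degree condition makes the average number of neighbours in
  the probe close to (k-1) T. So almost every vertex sees nearly all of the other sets
  \<open>A j\<close>, and the deficient index \<open>i\<close> becomes its class.\<close>

lemma near_regular_partition:
  fixes \<gamma> :: real
  assumes k: "2 \<le> k" and t: "1 \<le> t" and \<gamma>: "0 < \<gamma>"
  shows "\<exists>\<epsilon>>0. \<forall>c. \<exists>n0. \<forall>(V :: 'a set) D Ex. finite V \<longrightarrow> n0 \<le> card V \<longrightarrow> symp D \<longrightarrow> irreflp D \<longrightarrow>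
    Ex \<subseteq> V \<longrightarrow> card Ex \<le> c \<longrightarrow> (\<forall>v\<in>V - Ex. (1 - 1 / real k - \<epsilon>) * card V \<le> card (nbh D V v)) \<longrightarrow>
    (\<forall>v\<in>V - Ex. \<not> has_blowup D (nbh D V v) k t) \<longrightarrow>
    (\<exists>Q. disjoint_family_on Q {..<k} \<and> (\<forall>i<k. Q i \<subseteq> V - Ex \<and> (1 / real k - \<gamma>) * card V \<le> card (Q i) \<and>
       card (Q i) \<le> (1 / real k + \<gamma>) * card V \<and>
       (\<forall>x\<in>Q i. \<forall>j<k. j \<noteq> i \<longrightarrow> card (Q j - nbh D V x) \<le> \<gamma> * card V)))"
proof -
  \<comment> \<open>A member of a class may miss \<eta> T + t vertices of another probe set. With
    this value t + 1 such members still have \<open>t\<close> common neighbours there, as recorded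
    in \<open>Tt\<close>.\<close>
  define \<eta> where "\<eta> = 1 / (4 * (real t + 1))"
  define \<gamma>' where "\<gamma>' = \<gamma> / (real k + 2)"
  \<comment> \<open>The first summand is for \<open>Tt\<close>; the second makes the slack
    \<open>t\<close> per vertex small against \<eta> T when \<open>Y\<close> is counted.\<close>
  define T where "T = 4 * (t + 1) ^ 2 + nat \<lceil>3 * t / (\<eta> * \<gamma>')\<rceil>"
  define \<epsilon> where "\<epsilon> = min (1 / (4 * (real k)\<^sup>2)) (min (\<gamma>' / 2) (\<gamma>' * \<eta> / (3 * k)))"
  have \<eta>: "0 < \<eta>" "\<eta> < 1" "(real t + 1) * \<eta> = 1 / 4" using t by (auto simp: \<eta>_def)
  have \<gamma>': "0 < \<gamma>'" using \<gamma> k by (simp add: \<gamma>'_def)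
  have T0: "T > 0" by (simp add: T_def)
  have T1: "4 * (real t + 1)\<^sup>2 \<le> T" unfolding T_def by (simp add: add.commute)
  have "3 * t / (\<eta> * \<gamma>') \<le> T" unfolding T_def by linarith
  then have T2: "t \<le> \<gamma>' / 3 * (\<eta> * T)" using \<eta> \<gamma>' by (simp add: field_simps)
  have \<epsilon>: "0 < \<epsilon>" "\<epsilon> \<le> 1 / (4 * (real k)\<^sup>2)" "\<epsilon> \<le> \<gamma>' / 2" "\<epsilon> \<le> \<gamma>' * \<eta> / (3 * k)"
    using k \<gamma>' \<eta> by (auto simp: \<epsilon>_def)
  have \<epsilon>3: "k * \<epsilon> \<le> \<gamma>' / 3 * \<eta>" using \<epsilon>(4) k by (simp add: field_simps)
  show ?thesis
  proof (intro exI[of _ \<epsilon>] conjI allI \<epsilon>(1))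
    fix c :: nat
    obtain n1 where n1: "\<And>(V :: 'a set) D Ex. finite V \<Longrightarrow> n1 \<le> card V \<Longrightarrow> symp D \<Longrightarrow> irreflp D \<Longrightarrow>
      Ex \<subseteq> V \<Longrightarrow> card Ex \<le> c \<Longrightarrow> (\<forall>v\<in>V - Ex. (1 - 1 / k - \<epsilon>) * card V \<le> card (nbh D V v)) \<Longrightarrow>
      has_blowup D (V - Ex) k T"
      using near_regular_imp_blowup[OF k \<epsilon>(1,2) T0, of c] by blast
    define n0 where "n0 = n1 + nat \<lceil>3 * c * k / (\<eta> * \<gamma>')\<rceil> + nat \<lceil>2 * t / \<gamma>'\<rceil> + nat \<lceil>c / \<gamma>'\<rceil>"
    show "\<exists>n0. \<forall>(V :: 'a set) D Ex. finite V \<longrightarrow> n0 \<le> card V \<longrightarrow> symp D \<longrightarrow> irreflp D \<longrightarrow>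
    Ex \<subseteq> V \<longrightarrow> card Ex \<le> c \<longrightarrow> (\<forall>v\<in>V - Ex. (1 - 1 / real k - \<epsilon>) * card V \<le> card (nbh D V v)) \<longrightarrow>
    (\<forall>v\<in>V - Ex. \<not> has_blowup D (nbh D V v) k t) \<longrightarrow>
    (\<exists>Q. disjoint_family_on Q {..<k} \<and> (\<forall>i<k. Q i \<subseteq> V - Ex \<and> (1 / real k - \<gamma>) * card V \<le> card (Q i) \<and>
       card (Q i) \<le> (1 / real k + \<gamma>) * card V \<and>
       (\<forall>x\<in>Q i. \<forall>j<k. j \<noteq> i \<longrightarrow> card (Q j - nbh D V x) \<le> \<gamma> * card V)))"
    proof (intro exI[of _ n0] allI impI)
      fix V :: "'a set" and D Ex
      assume V: "finite V" "n0 \<le> card V" and D: "symp D" "irreflp D"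
        and Ex: "Ex \<subseteq> V" "card Ex \<le> c"
        and deg: "\<forall>v\<in>V - Ex. (1 - 1 / real k - \<epsilon>) * card V \<le> card (nbh D V v)"
        and nob: "\<forall>v\<in>V - Ex. \<not> has_blowup D (nbh D V v) k t"
      define n where "n = real (card V)"
      have "3 * c * k / (\<eta> * \<gamma>') \<le> n" using V unfolding n_def n0_def by linarith
      then have nc: "c * k \<le> \<gamma>' / 3 * n * \<eta>" using \<eta> \<gamma>' by (simp add: field_simps)
      have "2 * t / \<gamma>' \<le> n" using V unfolding n_def n0_def by linarith
      then have nt: "t \<le> \<gamma>' / 2 * n" using \<gamma>' by (simp add: field_simps)
      have "c / \<gamma>' \<le> n" using V unfolding n_def n0_def by linarith
      then have nc': "c \<le> \<gamma>' * n" using \<gamma>' by (simp add: field_simps)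
      have n: "0 \<le> n" by (simp add: n_def)
      let ?nb = "nbh D V"
      have nbV: "?nb v \<subseteq> V" "finite (?nb v)" for v using V by (auto simp: nbh_def)
      have "has_blowup D (V - Ex) k T" using V by (intro n1 D Ex deg) (auto simp: n0_def)
      then obtain A :: "nat \<Rightarrow> 'a set" where A: "\<And>i. i < k \<Longrightarrow> A i \<subseteq> V - Ex" "\<And>i. i < k \<Longrightarrow> card (A i) = T"
        and AA: "\<And>i j x y. i < k \<Longrightarrow> j < k \<Longrightarrow> i \<noteq> j \<Longrightarrow> x \<in> A i \<Longrightarrow> y \<in> A j \<Longrightarrow> D x y"
        by (rule has_blowupE) blast
      have finA: "finite (A i)" if "i < k" for i using A(1)[OF that] V finite_subset by blast
      have djA: "A i \<inter> A j = {}" if "i < k" "j < k" "i \<noteq> j" for i j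
        using AA[OF that] D(2) by (auto simp: irreflp_def)
      define a where "a v i = card (?nb v \<inter> A i)" for v i
      define d where "d v = (\<Sum>i<k. a v i)" for v
      have aT: "a v i \<le> T" if "i < k" for v i
        using card_mono[OF finA[OF that], of "?nb v \<inter> A i"] A(2)[OF that] by (simp add: a_def)
      have dble: "(\<Sum>v\<in>V. d v) = (\<Sum>i<k. \<Sum>z\<in>A i. card (?nb z))"
      proof -
        have "(\<Sum>v\<in>V. a v i) = (\<Sum>z\<in>A i. card (?nb z))" if i: "i < k" for i
        proof -
          have "(\<Sum>v\<in>V. a v i) = (\<Sum>v\<in>V. \<Sum>z\<in>A i. if D v z then 1 else 0)"
          proof (rule sum.cong)
            fix v assume "v \<in> V"
            have "?nb v \<inter> A i = {z\<in>A i. D v z}" using A(1)[OF i] by (auto simp: nbh_def)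
            then show "a v i = (\<Sum>z\<in>A i. if D v z then 1 else 0)"
              using finA[OF i] by (simp add: a_def sum.inter_filter[symmetric])
          qed simp
          also have "\<dots> = (\<Sum>z\<in>A i. \<Sum>v\<in>V. if D v z then 1 else 0)" by (rule sum.swap)
          also have "\<dots> = (\<Sum>z\<in>A i. card (?nb z))"
          proof (rule sum.cong)
            fix z
            have "?nb z = {v\<in>V. D v z}" using D(1) by (auto simp: nbh_def symp_def)
            then show "(\<Sum>v\<in>V. if D v z then 1 else 0) = card (?nb z)"
              using V by (simp add: sum.inter_filter[symmetric])
          qed simp
          finally show ?thesis .
        qed
        then show ?thesis unfolding d_def by (subst sum.swap) simp
      qed
      have low: "k * (T * ((1 - 1 / k - \<epsilon>) * n)) \<le> real (\<Sum>v\<in>V. d v)"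
      proof -
        have "(\<Sum>i<k. \<Sum>z\<in>A i. (1 - 1 / k - \<epsilon>) * n) \<le> (\<Sum>i<k. \<Sum>z\<in>A i. real (card (?nb z)))"
          using deg A(1) by (intro sum_mono) (auto simp: n_def)
        then show ?thesis unfolding dble using A(2) by simp
      qed
      have small: "\<exists>i<k. a v i < t" if v: "v \<in> V - Ex" for v
      proof (rule ccontr)
        assume "\<not> ?thesis"
        then have "\<And>i. i < k \<Longrightarrow> t \<le> card (?nb v \<inter> A i)" by (force simp: a_def)
        then have "has_blowup D (?nb v) k t" using AA by (intro has_blowupI[of k "\<lambda>i. ?nb v \<inter> A i"]) auto
        then show False using nob v by auto
      qed
      have dle: "d v \<le> (real k - 1) * T + t" if v: "v \<in> V - Ex" for v
      proof -
        obtain i where i: "i < k" "a v i < t" using small[OF v] by auto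
        have "d v = a v i + (\<Sum>j\<in>{..<k} - {i}. a v j)" unfolding d_def using i by (subst sum.remove[of _ i]) auto
        also have "\<dots> \<le> t + (\<Sum>j\<in>{..<k} - {i}. T)" using i aT by (intro add_mono sum_mono) auto
        finally have "d v \<le> t + (k - 1) * T" using i by simp
        then have "real (d v) \<le> t + real (k - 1) * T" by (metis of_nat_add of_nat_le_iff of_nat_mult)
        then show ?thesis using k by (simp add: of_nat_diff)
      qed
      \<comment> \<open>Vertices seeing markedly less of the probe than (k-1) T. Each costs about
        \<eta> T in the total, which is close to its maximum, so \<open>Y\<close> is small.\<close>
      define Y where "Y = {v\<in>V - Ex. d v < (real k - 1 - \<eta>) * T}"
      have Ybd: "card Y \<le> \<gamma>' * n"
      proof -
        have dle': "d v \<le> (real k - 1) * T + t + (if v \<in> Ex then real k * T else 0) - (if v \<in> Y then \<eta> * T else 0)"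
          if "v \<in> V" for v
        proof (cases "v \<in> Ex")
          case True
          have "d v \<le> (\<Sum>i<k. T)" unfolding d_def using aT by (intro sum_mono) auto
          then have "d v \<le> k * T" by simp
          then have "real (d v) \<le> real k * T" by (simp flip: of_nat_mult)
          moreover have "0 \<le> (real k - 1) * T" using k by simp
          ultimately show ?thesis using True by (auto simp: Y_def)
        next
          case False
          show ?thesis
          proof (cases "v \<in> Y")
            case True
            then have "d v < (real k - 1 - \<eta>) * T" by (auto simp: Y_def)
            then show ?thesis using True False by (auto simp: algebra_simps)
          qed (use dle[of v] that False in auto)
        qed
        have ExV: "{v\<in>V. v \<in> Ex} = Ex" "{v\<in>V. v \<in> Y} = Y" using Ex by (auto simp: Y_def)
        have "real (\<Sum>v\<in>V. d v) \<le> (\<Sum>v\<in>V. (real k - 1) * T + t + (if v \<in> Ex then real k * T else 0) - (if v \<in> Y then \<eta> * T else 0))"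
          unfolding of_nat_sum using dle' by (intro sum_mono) auto
        also have "\<dots> = n * ((real k - 1) * T + t) + card Ex * (real k * T) - card Y * (\<eta> * T)"
          using V by (simp add: sum.distrib sum_subtractf sum.inter_filter[symmetric] ExV n_def)
        finally have "k * (T * ((1 - 1 / k - \<epsilon>) * n)) + card Y * (\<eta> * T)
          \<le> n * ((real k - 1) * T + t) + card Ex * (real k * T)" using low by linarith
        moreover have "k * (T * ((1 - 1 / k - \<epsilon>) * n)) = n * (real k - 1) * T - k * \<epsilon> * (T * n)"
          using k by (simp add: field_simps)
        ultimately have 1: "card Y * (\<eta> * T) \<le> n * t + k * \<epsilon> * (T * n) + card Ex * (real k * T)"
          by (simp add: algebra_simps)
        have "card Ex * (real k * T) \<le> real c * (real k * T)" using Ex by (intro mult_right_mono) auto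
        also have "\<dots> = real (c * k) * T" by simp
        also have "\<dots> \<le> (\<gamma>' / 3 * n * \<eta>) * T" using nc by (intro mult_right_mono) auto
        finally have 2: "card Ex * (real k * T) \<le> \<gamma>' / 3 * n * (\<eta> * T)" by simp
        have 3: "n * t \<le> n * (\<gamma>' / 3 * (\<eta> * T))" using T2 n by (intro mult_left_mono) auto
        have 4: "k * \<epsilon> * (T * n) \<le> \<gamma>' / 3 * \<eta> * (T * n)" using \<epsilon>3 n by (intro mult_right_mono) auto
        have "card Y * (\<eta> * T) \<le> (\<gamma>' * n) * (\<eta> * T)" using 1 2 3 4 by (simp add: algebra_simps)
        then show ?thesis using \<eta> T0 by simp
      qed
      have Tt: "2 * real t \<le> (1 - \<eta>) * T" "(real t + 1) * (\<eta> * T + t) + t \<le> T"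
      proof -
        have "\<eta> \<le> 1 / 4" using t by (simp add: \<eta>_def field_simps)
        then have "3 / 4 * real T \<le> (1 - \<eta>) * T" by (intro mult_right_mono) auto
        moreover have "2 * real t \<le> 3 * (real t + 1)\<^sup>2" by (simp add: power2_eq_square algebra_simps)
        ultimately show "2 * real t \<le> (1 - \<eta>) * T" using T1 by linarith
        have "(real t + 1) * (\<eta> * T + t) + t = ((real t + 1) * \<eta>) * T + (real t + 1) * t + t"
          by (simp add: algebra_simps)
        also have "\<dots> = T / 4 + (real t + 1) * t + t" unfolding \<eta>(3) by simp
        finally have "(real t + 1) * (\<eta> * T + t) + t = T / 4 + (real t + 1) * t + t" .
        moreover have "(real t + 1) * t + t \<le> 3 * (real t + 1)\<^sup>2"
          by (simp add: power2_eq_square algebra_simps)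
        ultimately show "(real t + 1) * (\<eta> * T + t) + t \<le> T" using T1 by linarith
      qed
      define Q where "Q i = {v\<in>V - Ex - Y. a v i < t}" for i
      have QV: "Q i \<subseteq> V - Ex" for i by (auto simp: Q_def)
      have finQ: "finite (Q i)" for i using QV V finite_subset by blast
      \<comment> \<open>With fewer than \<open>t\<close> neighbours in \<open>A i\<close> and at
        least (k-1-\<eta>) T in total, no other probe set can be missed by more than \<eta> T +
        t.\<close>
      have Qa: "T - (\<eta> * T + t) \<le> a v j" if v: "v \<in> Q i" and ij: "i < k" "j < k" "i \<noteq> j" for v i j
      proof -
        have "d v = a v i + (a v j + (\<Sum>l\<in>{..<k} - {i} - {j}. a v l))"
          unfolding d_def using ij by (simp add: sum.remove)
        also have "\<dots> \<le> t + (a v j + (\<Sum>l\<in>{..<k} - {i} - {j}. T))"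
          using v ij aT by (intro add_mono sum_mono) (auto simp: Q_def)
        also have "\<dots> = t + (a v j + (k - 2) * T)" using ij by (simp add: numeral_2_eq_2)
        finally have "real (d v) \<le> t + (a v j + real (k - 2) * T)"
          by (metis of_nat_add of_nat_le_iff of_nat_mult)
        then have "real (d v) \<le> t + (a v j + (real k - 2) * T)" using k by (simp add: of_nat_diff)
        moreover have "(real k - 1 - \<eta>) * T \<le> d v" using v by (auto simp: Q_def Y_def)
        ultimately show ?thesis by (simp add: algebra_simps)
      qed
      have djQ: "disjoint_family_on Q {..<k}"
        unfolding disjoint_family_on_def
      proof (intro ballI impI, rule ccontr)
        fix i j assume ij: "i \<in> {..<k}" "j \<in> {..<k}" "i \<noteq> j" and "Q i \<inter> Q j \<noteq> {}"
        then obtain v where v: "v \<in> Q i" "v \<in> Q j" by auto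
        have "T - (\<eta> * T + t) \<le> a v j" using Qa[OF v(1)] ij by auto
        moreover have "real (a v j) < t" using v by (auto simp: Q_def)
        ultimately show False using Tt(1) by (simp add: algebra_simps)
      qed
      have cov: "V - Ex - Y \<subseteq> (\<Union>i<k. Q i)" using small by (fastforce simp: Q_def)
      \<comment> \<open>Otherwise \<open>t\<close> neighbours of \<open>x\<close> in its own class,
        together with the common neighbours of these and \<open>x\<close> in the other probe sets,
        form a blow-up in the neighbourhood of \<open>x\<close>.\<close>
      have few: "card (Q i \<inter> ?nb x) < t" if i: "i < k" and x: "x \<in> Q i" for i x
      proof (rule ccontr)
        assume "\<not> ?thesis"
        then obtain Z where Z: "Z \<subseteq> Q i \<inter> ?nb x" "card Z = t" by (meson not_less obtain_subset_with_card_n)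
        have finZ: "finite Z" using Z finQ finite_subset by blast
        define Bl where "Bl j = (if j = i then Z else {y\<in>A j. \<forall>z\<in>insert x Z. D z y})" for j
        have "t \<le> card {y\<in>A j. \<forall>z\<in>insert x Z. D z y}" if j: "j < k" "j \<noteq> i" for j
        proof -
          have 1: "A j \<subseteq> {y\<in>A j. \<forall>z\<in>insert x Z. D z y} \<union> (\<Union>z\<in>insert x Z. A j - ?nb z)"
            using A(1)[OF j(1)] by (auto simp: nbh_def)
          have "T \<le> card ({y\<in>A j. \<forall>z\<in>insert x Z. D z y} \<union> (\<Union>z\<in>insert x Z. A j - ?nb z))"
            unfolding A(2)[OF j(1), symmetric] using finA[OF j(1)] finZ by (intro card_mono 1) auto
          also have "\<dots> \<le> card {y\<in>A j. \<forall>z\<in>insert x Z. D z y} + card (\<Union>z\<in>insert x Z. A j - ?nb z)"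
            by (rule card_Un_le)
          also have "\<dots> \<le> card {y\<in>A j. \<forall>z\<in>insert x Z. D z y} + (\<Sum>z\<in>insert x Z. card (A j - ?nb z))"
            using finZ by (intro add_left_mono card_UN_le) auto
          finally have "T \<le> card {y\<in>A j. \<forall>z\<in>insert x Z. D z y} + (\<Sum>z\<in>insert x Z. card (A j - ?nb z))" .
          from of_nat_mono[OF this, where 'a = real]
          have "real T \<le> card {y\<in>A j. \<forall>z\<in>insert x Z. D z y} + (\<Sum>z\<in>insert x Z. real (card (A j - ?nb z)))"
            by (simp only: of_nat_add of_nat_sum)
          moreover have "(\<Sum>z\<in>insert x Z. real (card (A j - ?nb z))) \<le> (\<Sum>z\<in>insert x Z. \<eta> * T + t)"
          proof (rule sum_mono)
            fix z assume "z \<in> insert x Z"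
            then have "z \<in> Q i" using x Z by auto
            then have "T - (\<eta> * T + t) \<le> a z j" using Qa i j by auto
            moreover have "card (A j - ?nb z) = T - a z j"
              using finA[OF j(1)] A(2)[OF j(1)] by (simp add: a_def card_Diff_subset_Int Int_commute)
            ultimately show "real (card (A j - ?nb z)) \<le> \<eta> * T + t" using aT[OF j(1), of z] by (simp add: of_nat_diff)
          qed
          moreover have "(\<Sum>z\<in>insert x Z. \<eta> * T + t) = real (card (insert x Z)) * (\<eta> * T + t)" by simp
          moreover have "real (card (insert x Z)) * (\<eta> * T + t) \<le> (real t + 1) * (\<eta> * T + t)"
            using Z(2) finZ \<eta> by (intro mult_right_mono) (auto simp: card_insert_if)
          ultimately show ?thesis using Tt(2) by linarith
        qed
        then have big: "t \<le> card (Bl j)" if "j < k" for j using that Z(2) by (simp add: Bl_def)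
        have "has_blowup D (?nb x) k t"
        proof (rule has_blowupI[of k Bl])
          fix j assume j: "j < k"
          show "Bl j \<subseteq> ?nb x"
          proof (cases "j = i")
            case True
            then show ?thesis using Z(1) by (simp add: Bl_def)
          next
            case False
            then show ?thesis using A(1)[OF j] by (auto simp: Bl_def nbh_def)
          qed
        next
          fix j l y z assume jl: "j < k" "l < k" "j \<noteq> l" and yz: "y \<in> Bl j" "z \<in> Bl l"
          show "D y z"
          proof (cases "j = i")
            case True
            then show ?thesis using yz jl by (simp add: Bl_def)
          next
            case False
            then have y: "y \<in> A j" "\<forall>z\<in>Z. D z y" using yz by (simp_all add: Bl_def)
            show ?thesis
            proof (cases "l = i")
              case True
              then show ?thesis using y yz(2) sympD[OF D(1)] by (simp add: Bl_def)
            next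
              case False
              then have "z \<in> A l" using yz by (simp add: Bl_def)
              then show ?thesis using AA jl y by blast
            qed
          qed
        qed (rule big)
        moreover have "x \<in> V - Ex" using x QV by blast
        ultimately show False using nob by auto
      qed
      have nonadj: "card (V - ?nb x) \<le> (1 / k + \<epsilon>) * n" if "x \<in> V - Ex" for x
      proof -
        have "card (V - ?nb x) = card V - card (?nb x)" using nbV V by (intro card_Diff_subset) auto
        moreover have "card (?nb x) \<le> card V" using V nbV by (intro card_mono) auto
        ultimately have "real (card (V - ?nb x)) = n - card (?nb x)" by (simp add: n_def of_nat_diff)
        moreover have "(1 - 1 / k - \<epsilon>) * n \<le> card (?nb x)" using deg that by (auto simp: n_def)
        ultimately show ?thesis by (simp add: algebra_simps)
      qed
      have Qup: "card (Q i) \<le> (1 / k + \<gamma>') * n" if i: "i < k" for i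
      proof (cases "Q i = {}")
        case True
        then show ?thesis using n \<gamma>' by simp
      next
        case False
        then obtain x where x: "x \<in> Q i" by auto
        have "card (Q i) \<le> card (Q i \<inter> ?nb x) + card (V - ?nb x)"
        proof -
          have "card (Q i) \<le> card ((Q i \<inter> ?nb x) \<union> (V - ?nb x))" using V QV finQ by (intro card_mono) auto
          then show ?thesis using card_Un_le le_trans by blast
        qed
        then have "real (card (Q i)) \<le> t + (1 / k + \<epsilon>) * n"
          using few[OF i x] nonadj[of x] x QV by (auto simp: subset_iff)
        moreover have "\<epsilon> * n \<le> \<gamma>' / 2 * n" using \<epsilon> n by (intro mult_right_mono) auto
        ultimately show ?thesis using nt by (simp add: algebra_simps)
      qed
      \<comment> \<open>The lower bound follows from the upper bounds for the other k-1 classes,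
        since only \<open>Y\<close> and \<open>Ex\<close> are left uncovered.\<close>
      have Qlow: "(1 / k - (k + 1) * \<gamma>') * n \<le> card (Q i)" if i: "i < k" for i
      proof -
        have "card V \<le> card ((\<Union>i<k. Q i) \<union> (Y \<union> Ex))"
          using cov V finQ Ex by (intro card_mono) (auto simp: Y_def intro: finite_subset)
        also have "\<dots> \<le> card (\<Union>i<k. Q i) + (card Y + card Ex)"
          by (meson add_left_mono card_Un_le le_trans)
        also have "\<dots> \<le> (\<Sum>i<k. card (Q i)) + (card Y + card Ex)" by (intro add_right_mono card_UN_le) simp
        finally have "card V \<le> card (Q i) + (\<Sum>j\<in>{..<k} - {i}. card (Q j)) + (card Y + card Ex)"
          using i by (simp add: sum.remove)
        from of_nat_mono[OF this, where 'a = real]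
        have "n \<le> card (Q i) + (\<Sum>j\<in>{..<k} - {i}. real (card (Q j))) + (card Y + card Ex)"
          unfolding n_def by (simp only: of_nat_add of_nat_sum)
        moreover have "(\<Sum>j\<in>{..<k} - {i}. real (card (Q j))) \<le> (\<Sum>j\<in>{..<k} - {i}. (1 / k + \<gamma>') * n)"
          using Qup by (intro sum_mono) auto
        moreover have "(\<Sum>j\<in>{..<k} - {i}. (1 / k + \<gamma>') * n) = (real k - 1) * ((1 / k + \<gamma>') * n)"
          using i by (simp add: of_nat_diff)
        moreover have "(real k - 1) * ((1 / k + \<gamma>') * n) = n - n / k + (real k - 1) * \<gamma>' * n"
          using k by (simp add: field_simps)
        moreover have "(1 / k - (k + 1) * \<gamma>') * n = n / k - (real k - 1) * \<gamma>' * n - 2 * (\<gamma>' * n)"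
          by (simp add: algebra_simps)
        moreover have "real (card Ex) \<le> \<gamma>' * n" using Ex(2) nc' by linarith
        ultimately show ?thesis using Ybd by linarith
      qed
      \<comment> \<open>The roughly n/k non-neighbours of \<open>x\<close> are almost exhausted by
        its own class, so few are left for the others.\<close>
      have Qmiss: "card (Q j - ?nb x) \<le> \<gamma> * n" if i: "i < k" and x: "x \<in> Q i" and j: "j < k" "j \<noteq> i" for i x j
      proof -
        have dj: "Q i \<inter> Q j = {}" using djQ i j by (auto simp: disjoint_family_on_def)
        have "card (Q i - ?nb x) + card (Q j - ?nb x) = card ((Q i - ?nb x) \<union> (Q j - ?nb x))"
          using dj finQ by (intro card_Un_disjoint[symmetric]) auto
        also have "\<dots> \<le> card (V - ?nb x)" using V QV by (intro card_mono) auto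
        finally have 1: "real (card (Q i - ?nb x)) + card (Q j - ?nb x) \<le> (1 / k + \<epsilon>) * n"
          using nonadj[of x] x QV[of i] by (auto simp: subset_iff)
        have "card (Q i) = card (Q i \<inter> ?nb x) + card (Q i - ?nb x)"
          using finQ by (metis card_Int_Diff)
        then have "real (card (Q i)) - t \<le> card (Q i - ?nb x)" using few[OF i x] by simp
        moreover have "\<epsilon> * n \<le> \<gamma>' / 2 * n" using \<epsilon> n by (intro mult_right_mono) auto
        ultimately have "card (Q j - ?nb x) \<le> (real k + 2) * \<gamma>' * n"
          using 1 Qlow[OF i] nt by (simp add: algebra_simps)
        then show ?thesis using k by (simp add: \<gamma>'_def)
      qed
      have \<gamma>\<gamma>: "(k + 1) * \<gamma>' \<le> \<gamma>" "\<gamma>' \<le> \<gamma>" using \<gamma> k by (auto simp: \<gamma>'_def field_simps)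
      show "\<exists>Q. disjoint_family_on Q {..<k} \<and> (\<forall>i<k. Q i \<subseteq> V - Ex \<and> (1 / real k - \<gamma>) * card V \<le> card (Q i) \<and>
       card (Q i) \<le> (1 / real k + \<gamma>) * card V \<and>
       (\<forall>x\<in>Q i. \<forall>j<k. j \<noteq> i \<longrightarrow> card (Q j - nbh D V x) \<le> \<gamma> * card V))"
      proof (intro exI[of _ Q] conjI allI impI ballI djQ QV)
        fix i assume i: "i < k"
        have "(1 / k - \<gamma>) * n \<le> (1 / k - (k + 1) * \<gamma>') * n" using \<gamma>\<gamma> n by (intro mult_right_mono) auto
        then show "(1 / real k - \<gamma>) * card V \<le> card (Q i)" using Qlow[OF i] by (simp add: n_def)
        have "(1 / k + \<gamma>') * n \<le> (1 / k + \<gamma>) * n" using \<gamma>\<gamma> n by (intro mult_right_mono) auto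
        then show "card (Q i) \<le> (1 / real k + \<gamma>) * card V" using Qup[OF i] by (simp add: n_def)
      qed (use Qmiss in \<open>auto simp: n_def\<close>)
    qed
  qed
qed

section \<open>Degrees and bad hyperedges\<close>

definition deg :: "'a hypergraph \<Rightarrow> 'a \<Rightarrow> nat" where
  "deg G v = card {e\<in>edges G. v \<in> e}"

text \<open>The product of Turan ratios is the falling factorial of \<open>q\<close> over q^p, which
  converts the clique density into the binomial coefficient of the degree condition.\<close>

lemma prod_falling_binomial:
  assumes "0 < q"
  shows "(\<Prod>j<p. 1 - real j / real q) * real q ^ p = fact p * real (q choose p)"
proof -
  have "(\<Prod>j<p. 1 - real j / real q) * real q ^ p = (\<Prod>j<p. (1 - real j / real q) * real q)"
    by (simp add: prod.distrib)
  also have "\<dots> = (\<Prod>j<p. real q - real j)"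
    using assms by (intro prod.cong) (auto simp: field_simps)
  also have "\<dots> = fact p * (real q gchoose p)"
    by (simp add: gbinomial_mult_fact lessThan_atLeast0)
  also have "\<dots> = fact p * real (q choose p)" by (simp add: binomial_gbinomial)
  finally show ?thesis .
qed

text \<open>There are at most n^2 pairs, and each non-robust one has codegree at most w
  n^(r-3).\<close>

lemma card_light_edges:
  assumes G: "r_graph r G" and r: "2 \<le> r"
  shows "card {e\<in>edges G. \<exists>x\<in>e. \<exists>y\<in>e. x \<noteq> y \<and> \<not> robust w G x y} \<le> w * card (verts G) ^ (r - 1)"
proof -
  let ?n = "card (verts G)" and ?V = "verts G"
  let ?L = "{e\<in>edges G. \<exists>x\<in>e. \<exists>y\<in>e. x \<noteq> y \<and> \<not> robust w G x y}"
  let ?P = "{p\<in>?V \<times> ?V. fst p \<noteq> snd p \<and> \<not> robust w G (fst p) (snd p)}"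
  let ?C = "\<lambda>p. {e\<in>edges G. fst p \<in> e \<and> snd p \<in> e}"
  have fin: "finite ?V" "finite (edges G)" using r_graphD[OF G] by auto
  have "?L \<subseteq> (\<Union>p\<in>?P. ?C p)" using r_graphD(2)[OF G] by fastforce
  then have "card ?L \<le> card (\<Union>p\<in>?P. ?C p)" using fin by (intro card_mono) auto
  also have "\<dots> \<le> (\<Sum>p\<in>?P. card (?C p))" using fin by (intro card_UN_le) auto
  finally have "card ?L * ?n ^ 2 \<le> (\<Sum>p\<in>?P. card (?C p)) * ?n ^ 2" by (rule mult_le_mono1)
  also have "\<dots> = (\<Sum>p\<in>?P. card (?C p) * ?n ^ 2)" by (rule sum_distrib_right)
  also have "\<dots> \<le> (\<Sum>p\<in>?P. w * ?n ^ (r - 1))"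
    using codegree_light[OF G r] by (intro sum_mono) auto
  also have "\<dots> \<le> ?n ^ 2 * (w * ?n ^ (r - 1))"
  proof -
    have "card ?P \<le> card (?V \<times> ?V)" using fin by (intro card_mono) auto
    then show ?thesis by (simp add: card_cartesian_product power2_eq_square)
  qed
  finally have le: "card ?L * ?n ^ 2 \<le> (w * ?n ^ (r - 1)) * ?n ^ 2" by (simp only: mult.commute)
  show ?thesis
  proof (cases "?n = 0")
    case True
    then have "?V = {}" using fin by simp
    then have "?L = {}" using r_graphD(2)[OF G] by fastforce
    then show ?thesis by (simp only: card.empty le0)
  next
    case False
    then show ?thesis using le by simp
  qed
qed

lemma sum_deg:
  assumes G: "r_graph r G" and A: "A \<subseteq> edges G"
  shows "(\<Sum>v\<in>verts G. card {e\<in>A. v \<in> e}) = r * card A"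
proof -
  have fin: "finite (verts G)" "finite A" using r_graphD[OF G] A finite_subset by auto
  have "(\<Sum>v\<in>verts G. card {e\<in>A. v \<in> e}) = (\<Sum>v\<in>verts G. \<Sum>e\<in>A. if v \<in> e then 1 else 0)"
    using fin by (simp add: sum.inter_filter[symmetric])
  also have "\<dots> = (\<Sum>e\<in>A. \<Sum>v\<in>verts G. if v \<in> e then 1 else 0)" by (rule sum.swap)
  also have "\<dots> = (\<Sum>e\<in>A. r)"
  proof (rule sum.cong)
    fix e assume "e \<in> A"
    then have e: "e \<in> edges G" using A by auto
    have "{v\<in>verts G. v \<in> e} = e" using r_graphD(2)[OF G e] by auto
    then show "(\<Sum>v\<in>verts G. if v \<in> e then 1 else 0) = r"
      using fin r_graphD(3)[OF G e] by (simp add: sum.inter_filter[symmetric])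
  qed simp
  finally show ?thesis by simp
qed

text \<open>Outside the few vertices \<open>L\<close>, the link of \<open>v\<close> consists almost
  entirely of (r-1)-cliques of robust neighbours. If \<open>v\<close> has d of them and they contain
  no blow-up, the clique bound with q = k-1 and p = r-1 allows essentially (q choose p) (d/q)^p such
  cliques, so the degree condition forces d close to q n/k.\<close>

lemma robust_degree_large:
  fixes \<epsilon> :: real
  assumes r: "2 \<le> r" "r \<le> k" and t: "1 \<le> t" and \<epsilon>: "0 < \<epsilon>" "\<epsilon> \<le> 1"
  shows "\<exists>c n0. \<forall>G :: 'a hypergraph. r_graph r G \<longrightarrow> n0 \<le> card (verts G) \<longrightarrow>
    (\<forall>v\<in>verts G. (1 - \<epsilon> / 2) * real ((k - 1) choose (r - 1)) * (real (card (verts G)) / k) ^ (r - 1) \<le> deg G v) \<longrightarrow>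
    (\<exists>L\<subseteq>verts G. card L \<le> c \<and> (\<forall>v\<in>verts G - L.
       \<not> has_blowup (robust w G) (nbh (robust w G) (verts G) v) k t \<longrightarrow>
       (1 - 1 / real k - \<epsilon>) * card (verts G) \<le> card (nbh (robust w G) (verts G) v)))"
proof -
  define p where "p = r - 1"
  define q where "q = k - 1"
  have pq: "1 \<le> p" "p \<le> q" "Suc q = k" "0 < q" using r by (auto simp: p_def q_def)
  define \<Phi> where "\<Phi> = fact p * real (q choose p)"
  have \<Phi>: "\<Phi> > 0" using pq by (simp add: \<Phi>_def)
  \<comment> \<open>\<open>e1\<close> pays for hyperedges with a non-robust pair and
    \<open>e3\<close> for the error of the clique bound; by \<open>esum\<close> both together use up
    the second half of \<epsilon>.\<close>
  define e1 where "e1 = \<epsilon> / 2 * \<Phi> / (real k ^ p * 2 * fact p)"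
  define e3 where "e3 = \<epsilon> / 2 * \<Phi> / (real k ^ p * 2)"
  have e: "e1 > 0" "e3 > 0" using \<epsilon> \<Phi> pq by (auto simp: e1_def e3_def)
  have esum: "(fact p * e1 + e3) * real k ^ p = \<epsilon> / 2 * \<Phi>"
    using pq by (simp add: e1_def e3_def field_simps)
  obtain n0 where n0: "\<And>n (U :: 'a set) D. n0 \<le> n \<Longrightarrow> finite U \<Longrightarrow> card U \<le> n \<Longrightarrow> symp D \<Longrightarrow> irreflp D \<Longrightarrow>
    \<not> has_blowup D U (Suc q) t \<Longrightarrow>
    fact p * real (card (cliques D U p)) \<le> (\<Prod>j<p. 1 - real j / real q) * real (card U) ^ p + e3 * real n ^ p"
  proof -
    have "0 < t" using t by simp
    from card_cliques_le[OF pq(1,2) e(2) this] show ?thesis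
      by (elim exE) (rule that, blast)
  qed
  define c where "c = nat \<lceil>r * w / e1\<rceil>"
  show ?thesis
  proof (rule exI[of _ c], rule exI[of _ "Suc n0"], intro allI impI)
    fix G :: "'a hypergraph"
    assume G: "r_graph r G" and big: "Suc n0 \<le> card (verts G)"
      and mindeg: "\<forall>v\<in>verts G. (1 - \<epsilon> / 2) * real ((k - 1) choose (r - 1)) * (real (card (verts G)) / k) ^ (r - 1) \<le> deg G v"
    define V where "V = verts G"
    define n where "n = real (card V)"
    define D where "D = robust w G"
    define E where "E = {e\<in>edges G. \<exists>x\<in>e. \<exists>y\<in>e. x \<noteq> y \<and> \<not> D x y}"
    have n: "n > 0" using big by (simp add: n_def V_def)
    have fin: "finite V" "finite (edges G)" using r_graphD[OF G] by (auto simp: V_def)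
    \<comment> \<open>Only w n^p hyperedges contain a non-robust pair, so boundedly many vertices
      can lie in e1 n^p of them.\<close>
    define L where "L = {v\<in>V. e1 * n ^ p \<le> card {e\<in>E. v \<in> e}}"
    have "card L \<le> c"
    proof -
      have "card E \<le> w * card (verts G) ^ (r - 1)" unfolding E_def D_def by (rule card_light_edges[OF G r(1)])
      then have cE: "real (card E) \<le> w * n ^ p"
        unfolding n_def V_def p_def by (metis of_nat_le_iff of_nat_mult of_nat_power)
      have "card L * (e1 * n ^ p) = (\<Sum>v\<in>L. e1 * n ^ p)" by simp
      also have "\<dots> \<le> (\<Sum>v\<in>L. real (card {e\<in>E. v \<in> e}))" by (intro sum_mono) (auto simp: L_def)
      also have "\<dots> \<le> (\<Sum>v\<in>V. real (card {e\<in>E. v \<in> e}))"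
        using fin by (intro sum_mono2) (auto simp: L_def)
      also have "\<dots> = real (r * card E)"
        using sum_deg[OF G, of E] by (simp add: V_def E_def flip: of_nat_sum)
      also have "\<dots> \<le> r * (w * n ^ p)" using cE by (simp add: mult_left_mono)
      finally have "card L * e1 \<le> r * w" using n by simp
      then have "card L \<le> r * w / e1" using e by (simp add: field_simps)
      then show ?thesis unfolding c_def by linarith
    qed
    moreover have "(1 - 1 / real k - \<epsilon>) * n \<le> card (nbh D V v)"
      if v: "v \<in> V - L" and nb: "\<not> has_blowup D (nbh D V v) k t" for v
    proof -
      define d where "d = real (card (nbh D V v))"
      have U: "finite (nbh D V v)" "card (nbh D V v) \<le> card V" using fin by (auto simp: nbh_def intro!: card_mono)
      define Ev where "Ev = {e\<in>edges G. v \<in> e}"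
      have "card (Ev - E) \<le> card (cliques D (nbh D V v) p)"
      proof (rule card_inj_on_le[where f = "\<lambda>e. e - {v}"])
        show "inj_on (\<lambda>e. e - {v}) (Ev - E)"
          by (rule inj_onI) (auto simp: Ev_def)
        show "(\<lambda>e. e - {v}) ` (Ev - E) \<subseteq> cliques D (nbh D V v) p"
        proof clarify
          fix e assume "e \<in> Ev" "e \<notin> E"
          then have e: "e \<in> edges G" "v \<in> e" and h: "\<And>x y. x \<in> e \<Longrightarrow> y \<in> e \<Longrightarrow> x \<noteq> y \<Longrightarrow> D x y"
            by (auto simp: Ev_def E_def)
          have "e \<subseteq> V" "card e = r" "finite e" using r_graphD[OF G] e by (auto simp: V_def)
          then show "e - {v} \<in> cliques D (nbh D V v) p"
            using e h by (auto simp: cliques_def nbh_def pairwise_def p_def)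
        qed
        show "finite (cliques D (nbh D V v) p)" using U by simp
      qed
      moreover have "card Ev \<le> card (Ev - E) + card {e\<in>E. v \<in> e}"
      proof -
        have "Ev \<subseteq> (Ev - E) \<union> {e\<in>E. v \<in> e}" by (auto simp: Ev_def)
        then have "card Ev \<le> card ((Ev - E) \<union> {e\<in>E. v \<in> e})"
          using fin by (intro card_mono) (auto simp: Ev_def E_def)
        then show ?thesis using card_Un_le le_trans by blast
      qed
      moreover have "card {e\<in>E. v \<in> e} < e1 * n ^ p" using v by (auto simp: L_def)
      ultimately have "deg G v - e1 * n ^ p \<le> card (cliques D (nbh D V v) p)"
        by (simp add: deg_def Ev_def)
      moreover have "(1 - \<epsilon> / 2) * real (q choose p) * (n / k) ^ p \<le> deg G v"
        using mindeg v by (auto simp: V_def n_def p_def q_def)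
      ultimately have "fact p * ((1 - \<epsilon> / 2) * real (q choose p) * (n / k) ^ p - e1 * n ^ p)
          \<le> fact p * real (card (cliques D (nbh D V v) p))" by (intro mult_left_mono) auto
      also have "\<dots> \<le> (\<Prod>j<p. 1 - real j / real q) * d ^ p + e3 * n ^ p"
        unfolding d_def n_def using n0[of "card V" "nbh D V v" D] U big nb pq
        by (simp add: D_def symp_robust irreflp_robust V_def)
      also have "(\<Prod>j<p. 1 - real j / real q) * d ^ p = \<Phi> * (d / q) ^ p"
        using prod_falling_binomial[OF pq(4), of p] pq by (simp add: \<Phi>_def power_divide field_simps)
      finally have "(1 - \<epsilon> / 2) * \<Phi> * (n / k) ^ p \<le> \<Phi> * (d / q) ^ p + (fact p * e1 + e3) * n ^ p"
        by (simp add: \<Phi>_def algebra_simps)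
      also have "(fact p * e1 + e3) * n ^ p = (fact p * e1 + e3) * real k ^ p * (n / k) ^ p"
        using pq by (simp add: power_divide)
      also have "\<dots> = \<epsilon> / 2 * \<Phi> * (n / k) ^ p" unfolding esum by simp
      finally have "\<Phi> * ((1 - \<epsilon>) * (n / k) ^ p) \<le> \<Phi> * (d / q) ^ p" by (simp add: algebra_simps)
      then have 1: "(1 - \<epsilon>) * (n / k) ^ p \<le> (d / q) ^ p" using \<Phi> by simp
      \<comment> \<open>Replacing the factor 1 - \<epsilon> by its \<open>p\<close>-th power allows
        \<open>p\<close>-th roots to be taken.\<close>
      have "(1 - \<epsilon>) ^ p \<le> (1 - \<epsilon>) ^ 1" using \<epsilon> pq by (intro power_decreasing) auto
      then have "((1 - \<epsilon>) * (n / k)) ^ p \<le> (1 - \<epsilon>) * (n / k) ^ p"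
        unfolding power_mult_distrib using n by (intro mult_right_mono) auto
      then have "((1 - \<epsilon>) * (n / k)) ^ p \<le> (d / q) ^ p" using 1 by linarith
      then have "((1 - \<epsilon>) * (n / k)) ^ Suc (p - 1) \<le> (d / q) ^ Suc (p - 1)" using pq by simp
      then have "(1 - \<epsilon>) * (n / k) \<le> d / q"
        by (rule power_le_imp_le_base) (simp add: d_def)
      then have "q * ((1 - \<epsilon>) * (n / k)) \<le> d" using pq by (simp add: field_simps)
      moreover have "(1 - 1 / real k - \<epsilon>) * n \<le> q * ((1 - \<epsilon>) * (n / k))"
      proof -
        have qk: "real q = real k - 1" using pq by auto
        have "k \<noteq> 0" using pq by auto
        then have "q * ((1 - \<epsilon>) * (n / k)) = (1 - 1 / real k - \<epsilon>) * n + \<epsilon> / k * n"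
          unfolding qk by (simp add: field_simps)
        then show ?thesis using \<epsilon> n by simp
      qed
      ultimately show ?thesis by (simp add: d_def)
    qed
    moreover have "L \<subseteq> V" by (auto simp: L_def)
    ultimately show "\<exists>L\<subseteq>verts G. card L \<le> c \<and> (\<forall>v\<in>verts G - L.
       \<not> has_blowup (robust w G) (nbh (robust w G) (verts G) v) k t \<longrightarrow>
       (1 - 1 / real k - \<epsilon>) * card (verts G) \<le> card (nbh (robust w G) (verts G) v))"
      unfolding V_def n_def D_def by blast
  qed
qed


lemma power_diff_le:
  fixes a b :: real
  assumes "0 \<le> a" "a \<le> b" "b \<le> 1"
  shows "b ^ m \<le> a ^ m + m * (b - a)"
proof (induction m)
  case (Suc m)
  have b1: "b ^ m \<le> 1" using assms by (intro power_le_one) auto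
  have "b ^ Suc m = a * b ^ m + (b - a) * b ^ m" by (simp add: algebra_simps)
  also have "\<dots> \<le> a * (a ^ m + m * (b - a)) + (b - a) * 1"
    using assms Suc b1 by (intro add_mono mult_left_mono) auto
  also have "\<dots> \<le> a ^ Suc m + (m * (b - a) + (b - a))"
  proof -
    have "a * (m * (b - a)) \<le> 1 * (m * (b - a))" using assms by (intro mult_right_mono) auto
    then show ?thesis by (simp add: algebra_simps)
  qed
  finally show ?case by (simp add: algebra_simps)
qed simp

definition bad :: "nat \<Rightarrow> (nat \<Rightarrow> 'a set) \<Rightarrow> 'a set \<Rightarrow> bool" where
  "bad k P e \<longleftrightarrow> (\<exists>i<k. \<exists>x\<in>e \<inter> P i. \<exists>y\<in>e \<inter> P i. x \<noteq> y)"

text \<open>The greedy embedding applied to \<open>k t\<close> abstract vertices (part, copy),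
  joined whenever their parts differ.\<close>

lemma dense_parts_imp_blowup:
  assumes D: "symp D" and fin: "\<And>i. i < k \<Longrightarrow> finite (Q i)" and QU: "\<And>i. i < k \<Longrightarrow> Q i \<subseteq> U"
    and miss: "\<And>i j x. i < k \<Longrightarrow> j < k \<Longrightarrow> i \<noteq> j \<Longrightarrow> x \<in> Q i \<Longrightarrow> card {y\<in>Q j. \<not> D x y} \<le> B"
    and big: "\<And>i. i < k \<Longrightarrow> k * t * Suc B < card (Q i)"
  shows "has_blowup D U k t"
proof -
  let ?Z = "{..<k} \<times> {..<t}"
  have "\<exists>f. inj_on f ?Z \<and> (\<forall>z\<in>?Z. f z \<in> Q (fst z)) \<and>
     (\<forall>z\<in>?Z. \<forall>z'\<in>?Z. z \<noteq> z' \<longrightarrow> fst z \<noteq> fst z' \<longrightarrow> D (f z) (f z'))"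
  proof (rule greedy_embedding[where N = "k * t" and B = "\<lambda>_. B" and R = "\<lambda>z z'. fst z \<noteq> fst z'", OF _ _ D])
    show "symp (\<lambda>z z' :: nat \<times> nat. fst z \<noteq> fst z')" by (auto simp: symp_def)
    show "card {b\<in>Q (fst z). \<not> D a b} \<le> B"
      if "z \<in> ?Z" "z' \<in> ?Z" "fst z \<noteq> fst z'" "a \<in> Q (fst z')" for z z' a
      using miss[of "fst z'" "fst z" a] that by auto
  qed (use fin big in auto)
  then obtain f where f': "inj_on f ?Z \<and> (\<forall>z\<in>?Z. f z \<in> Q (fst z)) \<and>
     (\<forall>z\<in>?Z. \<forall>z'\<in>?Z. z \<noteq> z' \<longrightarrow> fst z \<noteq> fst z' \<longrightarrow> D (f z) (f z'))"
    by (rule exE)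
  have f: "inj_on f ?Z" "\<And>i a. i < k \<Longrightarrow> a < t \<Longrightarrow> f (i, a) \<in> Q i"
     "\<And>i a j b. i < k \<Longrightarrow> j < k \<Longrightarrow> a < t \<Longrightarrow> b < t \<Longrightarrow> i \<noteq> j \<Longrightarrow> D (f (i, a)) (f (j, b))"
    using f' by force+
  show ?thesis
  proof (rule has_blowupI[of k "\<lambda>i. f ` ({i} \<times> {..<t})"])
    fix i assume i: "i < k"
    show "f ` ({i} \<times> {..<t}) \<subseteq> U" using f(2)[OF i] QU[OF i] by auto
    have "inj_on f ({i} \<times> {..<t})" using f(1) i by (auto intro: inj_on_subset)
    then show "t \<le> card (f ` ({i} \<times> {..<t}))" by (simp add: card_image card_cartesian_product)
  next
    fix i j x y assume ij: "i < k" "j < k" "i \<noteq> j" "x \<in> f ` ({i} \<times> {..<t})" "y \<in> f ` ({j} \<times> {..<t})"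
    then obtain a b where "x = f (i, a)" "y = f (j, b)" "a < t" "b < t" by auto
    then show "D x y" using f(3)[of i j a b] ij by auto
  qed
qed

lemma card_edges_meeting_le:
  assumes G: "r_graph r G" and r: "2 \<le> r" and Z: "Z \<subseteq> verts G" "v \<in> verts G"
  shows "card {e\<in>edges G. v \<in> e \<and> (\<exists>y\<in>e. y \<noteq> v \<and> y \<in> Z)} \<le> card Z * card (verts G) ^ (r - 2)"
proof -
  have fin: "finite (verts G)" "finite Z" using r_graphD[OF G] Z finite_subset by auto
  let ?S = "\<lambda>y. {e. e \<subseteq> verts G \<and> card e = r \<and> {v, y} \<subseteq> e}"
  have "{e\<in>edges G. v \<in> e \<and> (\<exists>y\<in>e. y \<noteq> v \<and> y \<in> Z)} \<subseteq> (\<Union>y\<in>Z - {v}. ?S y)"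
    using r_graphD(2,3)[OF G] by auto
  then have "card {e\<in>edges G. v \<in> e \<and> (\<exists>y\<in>e. y \<noteq> v \<and> y \<in> Z)} \<le> card (\<Union>y\<in>Z - {v}. ?S y)"
    using fin by (intro card_mono) auto
  also have "\<dots> \<le> (\<Sum>y\<in>Z - {v}. card (?S y))" using fin by (intro card_UN_le) auto
  also have "\<dots> \<le> (\<Sum>y\<in>Z - {v}. card (verts G) ^ (r - 2))"
  proof (rule sum_mono)
    fix y assume "y \<in> Z - {v}"
    then have "card {v, y} = 2" by auto
    then show "card (?S y) \<le> card (verts G) ^ (r - 2)"
      using card_supersets_le[of "verts G" "{v, y}" r] r fin by simp
  qed
  also have "\<dots> = card (Z - {v}) * card (verts G) ^ (r - 2)" by simp
  also have "\<dots> \<le> card Z * card (verts G) ^ (r - 2)"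
    using fin by (intro mult_le_mono1 card_mono) auto
  finally show ?thesis .
qed

lemma card_light_link_le:
  assumes G: "r_graph r G" and r: "2 \<le> r" and v: "v \<in> verts G"
  shows "card {e\<in>edges G. v \<in> e \<and> (\<exists>y\<in>e. y \<noteq> v \<and> \<not> robust w G v y)} * card (verts G) \<le> w * card (verts G) ^ (r - 1)"
proof -
  let ?n = "card (verts G)"
  let ?S = "\<lambda>y. {e\<in>edges G. v \<in> e \<and> y \<in> e}"
  let ?Y = "{y\<in>verts G. y \<noteq> v \<and> \<not> robust w G v y}"
  let ?A = "{e\<in>edges G. v \<in> e \<and> (\<exists>y\<in>e. y \<noteq> v \<and> \<not> robust w G v y)}"
  have fin: "finite (verts G)" "finite (edges G)" using r_graphD[OF G] by auto
  have "?A \<subseteq> (\<Union>y\<in>?Y. ?S y)" using r_graphD(2)[OF G] by auto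
  then have "card ?A \<le> card (\<Union>y\<in>?Y. ?S y)" using fin by (intro card_mono) auto
  also have "\<dots> \<le> (\<Sum>y\<in>?Y. card (?S y))" using fin by (intro card_UN_le) auto
  finally have "card ?A * ?n ^ 2 \<le> (\<Sum>y\<in>?Y. card (?S y)) * ?n ^ 2" by (rule mult_le_mono1)
  also have "\<dots> = (\<Sum>y\<in>?Y. card (?S y) * ?n ^ 2)" by (rule sum_distrib_right)
  also have "\<dots> \<le> (\<Sum>y\<in>?Y. w * ?n ^ (r - 1))"
    using codegree_light[OF G r] by (intro sum_mono) auto
  also have "\<dots> = card ?Y * (w * ?n ^ (r - 1))" by simp
  also have "\<dots> \<le> ?n * (w * ?n ^ (r - 1))" using fin by (intro mult_le_mono1 card_mono) auto
  finally have "(card ?A * ?n) * ?n \<le> (w * ?n ^ (r - 1)) * ?n" by (simp add: power2_eq_square mult.commute mult.left_commute)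
  moreover have "?n > 0" using v fin by (auto simp: card_gt_0_iff)
  ultimately show ?thesis by simp
qed

section \<open>The structure of near-extremal hypergraphs\<close>

text \<open>The approximate classes \<open>Q\<close> are enlarged by every vertex that behaves like
  a member of one of them. A vertex left over, in \<open>X\<close>, has few neighbours in one class
  and misses a positive share of a second one, so its degree can only be reached with many bad
  hyperedges. The bound \<open>c0\<close> makes \<open>S\<close> part of an exceptional set of
  bounded size, as the partition lemma requires.\<close>

lemma structure_lemma:
  fixes \<gamma> :: real
  assumes r: "2 \<le> r" "r \<le> k" and t: "1 \<le> t" and \<gamma>: "0 < \<gamma>" "\<gamma> \<le> 1 / real k"
  shows "\<exists>\<epsilon>>0. \<exists>\<beta>>0. \<exists>n0. \<forall>G :: 'a hypergraph. r_graph r G \<longrightarrow> n0 \<le> card (verts G) \<longrightarrow>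
    (\<forall>v\<in>verts G. (1 - \<epsilon>) * real ((k - 1) choose (r - 1)) * (real (card (verts G)) / real k) ^ (r - 1) \<le> real (deg G v)) \<longrightarrow>
    card {v\<in>verts G. has_blowup (robust w G) (nbh (robust w G) (verts G) v) k t} \<le> c0 \<longrightarrow>
    (\<exists>P X S. S = {v\<in>verts G. has_blowup (robust w G) (nbh (robust w G) (verts G) v) k t} \<and>
      disjoint_family_on P {..<k} \<and> X \<inter> (\<Union>i<k. P i) = {} \<and> X \<union> (\<Union>i<k. P i) = verts G - S \<and>
      (\<forall>i<k. (1 / real k - \<gamma>) * real (card (verts G)) \<le> real (card (P i))) \<and>
      (\<forall>i<k. \<forall>j<k. i \<noteq> j \<longrightarrow> (\<forall>x\<in>P i. real (card (P j - nbh (robust w G) (verts G) x)) \<le> \<gamma> * real (card (verts G)))) \<and>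
      (\<forall>v\<in>X. \<beta> * real (card (verts G)) ^ (r - 1) \<le> real (card {e\<in>edges G. v \<in> e \<and> e \<inter> S = {} \<and> bad k P e}) \<and>
        (\<exists>i<k. real (card (nbh (robust w G) (verts G) v)) \<le> real (card (verts G)) - real (card (P i)) - \<beta> * real (card (verts G)))))"
proof -
  \<comment> \<open>C (n/k)^(r-1) is the main term of a degree, \<open>g6\<close> the share of a
    foreign part that a member may miss, \<open>g3\<close> the precision demanded of
    \<open>Q\<close>, and \<open>g4\<close> the threshold for having few neighbours in a class.
    \<open>\<Lambda>\<close> collects the error terms per unit of \<open>g3\<close>, so that by
    \<open>budget\<close> they cost only \<beta>, half of the gain c6 g6.\<close>
  define C where "C = real ((k - 1) choose (r - 1))"
  define c6 where "c6 = (1 / real k) ^ (r - 2)"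
  define g6 where "g6 = \<gamma> / 2"
  define \<Lambda> where "\<Lambda> = C + C * r + 3 + 2 * k + 2 * (real k * t)"
  define g3 where "g3 = c6 * g6 / (2 * \<Lambda>)"
  define g4 where "g4 = 2 * (real k * t) * g3"
  define \<beta> where "\<beta> = c6 * g6 / 2"
  have k: "2 \<le> k" using r by simp
  have C: "C \<ge> 1"
  proof -
    have "1 \<le> (k - 1) choose (r - 1)" using r by (simp add: Suc_le_eq)
    from of_nat_mono[OF this, where 'a = real] show ?thesis by (simp add: C_def)
  qed
  have c6: "0 < c6" "c6 \<le> 1" using k by (auto simp: c6_def intro!: power_le_one)
  have g6: "0 < g6" "g6 \<le> 1 / (2 * k)" using \<gamma> by (auto simp: g6_def)
  have \<Lambda>: "\<Lambda> > 0" using C unfolding \<Lambda>_def by (intro add_pos_nonneg) auto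
  have g3: "0 < g3" using c6 g6 \<Lambda> by (simp add: g3_def)
  have \<Lambda>g: "\<Lambda> * g3 = \<beta>" using \<Lambda> by (simp add: g3_def \<beta>_def)
  have \<beta>: "0 < \<beta>" "\<beta> \<le> g6 / 2" using c6 g6 by (auto simp: \<beta>_def mult_left_le_one_le)
  have budget: "C * g3 + C * r * g3 + 3 * g3 + 2 * k * g3 + g4 = \<beta>"
    unfolding \<Lambda>g[symmetric] g4_def \<Lambda>_def by (simp add: algebra_simps)
  have nn: "0 \<le> C * g3" "0 \<le> C * r * g3" "0 \<le> real k * g3" "0 \<le> g4" using C g3 by (auto simp: g4_def)
  have kg3: "k * g3 + g4 + \<beta> \<le> g6" using budget nn g3 \<beta> by linarith
  have g3s: "g3 \<le> g6" "g4 + 2 * g3 \<le> g6 / 2" "g3 \<le> 1 / (2 * k)" using budget nn g3 \<beta> g6 by linarith+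
  from near_regular_partition[OF k t g3, where 'a = 'a]
  obtain \<epsilon>2 where part: "0 < \<epsilon>2 \<and> (\<forall>c. \<exists>n0. \<forall>(V :: 'a set) D Ex. finite V \<longrightarrow> n0 \<le> card V \<longrightarrow> symp D \<longrightarrow> irreflp D \<longrightarrow>
    Ex \<subseteq> V \<longrightarrow> card Ex \<le> c \<longrightarrow> (\<forall>v\<in>V - Ex. (1 - 1 / real k - \<epsilon>2) * card V \<le> card (nbh D V v)) \<longrightarrow>
    (\<forall>v\<in>V - Ex. \<not> has_blowup D (nbh D V v) k t) \<longrightarrow>
    (\<exists>Q. disjoint_family_on Q {..<k} \<and> (\<forall>i<k. Q i \<subseteq> V - Ex \<and> (1 / real k - g3) * card V \<le> card (Q i) \<and>
       card (Q i) \<le> (1 / real k + g3) * card V \<and>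
       (\<forall>x\<in>Q i. \<forall>j<k. j \<noteq> i \<longrightarrow> card (Q j - nbh D V x) \<le> g3 * card V))))"
    by (rule exE)
  have \<epsilon>2: "\<epsilon>2 > 0" by (rule conjunct1[OF part])
  define \<epsilon>3 where "\<epsilon>3 = min \<epsilon>2 1"
  have \<epsilon>3: "0 < \<epsilon>3" "\<epsilon>3 \<le> 1" "\<epsilon>3 \<le> \<epsilon>2" using \<epsilon>2 by (auto simp: \<epsilon>3_def)
  from robust_degree_large[OF r t \<epsilon>3(1,2), where w = w and 'a = 'a]
  obtain c1 n1 where dl': "\<forall>G :: 'a hypergraph. r_graph r G \<longrightarrow> n1 \<le> card (verts G) \<longrightarrow>
    (\<forall>v\<in>verts G. (1 - \<epsilon>3 / 2) * real ((k - 1) choose (r - 1)) * (real (card (verts G)) / k) ^ (r - 1) \<le> deg G v) \<longrightarrow>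
    (\<exists>L\<subseteq>verts G. card L \<le> c1 \<and> (\<forall>v\<in>verts G - L.
       \<not> has_blowup (robust w G) (nbh (robust w G) (verts G) v) k t \<longrightarrow>
       (1 - 1 / real k - \<epsilon>3) * card (verts G) \<le> card (nbh (robust w G) (verts G) v)))"
    by (elim exE)
  have dl: "\<And>G :: 'a hypergraph. r_graph r G \<Longrightarrow> n1 \<le> card (verts G) \<Longrightarrow>
    (\<forall>v\<in>verts G. (1 - \<epsilon>3 / 2) * real ((k - 1) choose (r - 1)) * (real (card (verts G)) / k) ^ (r - 1) \<le> deg G v) \<Longrightarrow>
    (\<exists>L\<subseteq>verts G. card L \<le> c1 \<and> (\<forall>v\<in>verts G - L.
       \<not> has_blowup (robust w G) (nbh (robust w G) (verts G) v) k t \<longrightarrow>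
       (1 - 1 / real k - \<epsilon>3) * card (verts G) \<le> card (nbh (robust w G) (verts G) v)))"
    by (rule dl'[THEN spec, THEN mp, THEN mp, THEN mp])
  from spec[OF conjunct2[OF part], of "c0 + c1"]
  obtain n2 where pt': "\<forall>(V :: 'a set) D Ex. finite V \<longrightarrow> n2 \<le> card V \<longrightarrow> symp D \<longrightarrow> irreflp D \<longrightarrow>
    Ex \<subseteq> V \<longrightarrow> card Ex \<le> c0 + c1 \<longrightarrow> (\<forall>v\<in>V - Ex. (1 - 1 / real k - \<epsilon>2) * card V \<le> card (nbh D V v)) \<longrightarrow>
    (\<forall>v\<in>V - Ex. \<not> has_blowup D (nbh D V v) k t) \<longrightarrow>
    (\<exists>Q. disjoint_family_on Q {..<k} \<and> (\<forall>i<k. Q i \<subseteq> V - Ex \<and> (1 / real k - g3) * card V \<le> card (Q i) \<and>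
       card (Q i) \<le> (1 / real k + g3) * card V \<and>
       (\<forall>x\<in>Q i. \<forall>j<k. j \<noteq> i \<longrightarrow> card (Q j - nbh D V x) \<le> g3 * card V)))"
    by (rule exE)
  have pt: "\<And>(V :: 'a set) D Ex. finite V \<Longrightarrow> n2 \<le> card V \<Longrightarrow> symp D \<Longrightarrow> irreflp D \<Longrightarrow>
    Ex \<subseteq> V \<Longrightarrow> card Ex \<le> c0 + c1 \<Longrightarrow> (\<forall>v\<in>V - Ex. (1 - 1 / real k - \<epsilon>2) * card V \<le> card (nbh D V v)) \<Longrightarrow>
    (\<forall>v\<in>V - Ex. \<not> has_blowup D (nbh D V v) k t) \<Longrightarrow>
    (\<exists>Q. disjoint_family_on Q {..<k} \<and> (\<forall>i<k. Q i \<subseteq> V - Ex \<and> (1 / real k - g3) * card V \<le> card (Q i) \<and>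
       card (Q i) \<le> (1 / real k + g3) * card V \<and>
       (\<forall>x\<in>Q i. \<forall>j<k. j \<noteq> i \<longrightarrow> card (Q j - nbh D V x) \<le> g3 * card V)))"
    by (rule pt'[THEN spec, THEN spec, THEN spec, THEN mp, THEN mp, THEN mp, THEN mp, THEN mp, THEN mp, THEN mp, THEN mp])
  define \<epsilon> where "\<epsilon> = min (\<epsilon>3 / 2) g3"
  have \<epsilon>: "\<epsilon> > 0" "\<epsilon> \<le> \<epsilon>3 / 2" "\<epsilon> \<le> g3" using \<epsilon>3 g3 by (auto simp: \<epsilon>_def)
  define n0 where "n0 = Suc (n1 + n2 + nat \<lceil>w / g3\<rceil> + nat \<lceil>2 / g3\<rceil>)"
  show ?thesis
  proof (rule exI[of _ \<epsilon>], rule conjI[OF \<epsilon>(1)], rule exI[of _ \<beta>], rule conjI[OF \<beta>(1)],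
      rule exI[of _ n0], intro allI impI)
    fix G :: "'a hypergraph"
    define V where "V = verts G"
    define n where "n = real (card V)"
    define D where "D = robust w G"
    define S where "S = {v\<in>V. has_blowup D (nbh D V v) k t}"
    let ?nb = "nbh D V"
    assume G: "r_graph r G" and big: "n0 \<le> card (verts G)"
      and md: "\<forall>v\<in>verts G. (1 - \<epsilon>) * real ((k - 1) choose (r - 1)) * (real (card (verts G)) / real k) ^ (r - 1) \<le> real (deg G v)"
      and S': "card {v\<in>verts G. has_blowup (robust w G) (nbh (robust w G) (verts G) v) k t} \<le> c0"
    have S: "card S \<le> c0" using S' by (simp add: S_def D_def V_def)
    have D: "symp D" "irreflp D" by (auto simp: D_def symp_robust irreflp_robust)
    have fin: "finite V" "finite (edges G)" using r_graphD[OF G] by (auto simp: V_def)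
    have n: "n > 0" using big by (simp add: n_def V_def n0_def)
    have "w / g3 \<le> n" using big unfolding n_def n0_def V_def by linarith
    then have nw: "w \<le> g3 * n" using g3 by (simp add: field_simps)
    have "2 / g3 < n" using big unfolding n_def n0_def V_def by linarith
    then have n2: "2 < g3 * n" using g3 by (simp add: field_simps)
    have mdV: "(1 - \<epsilon>) * C * (n / k) ^ (r - 1) \<le> deg G v" if "v \<in> V" for v
      using md that by (simp add: V_def n_def C_def)
    have "\<exists>L\<subseteq>verts G. card L \<le> c1 \<and> (\<forall>v\<in>verts G - L.
       \<not> has_blowup (robust w G) (nbh (robust w G) (verts G) v) k t \<longrightarrow>
       (1 - 1 / real k - \<epsilon>3) * card (verts G) \<le> card (nbh (robust w G) (verts G) v))"
    proof (rule dl[OF G])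
      show "n1 \<le> card (verts G)" using big by (simp add: n0_def)
      show "\<forall>v\<in>verts G. (1 - \<epsilon>3 / 2) * real ((k - 1) choose (r - 1)) * (real (card (verts G)) / k) ^ (r - 1) \<le> deg G v"
      proof
        fix v assume v: "v \<in> verts G"
        have "(1 - \<epsilon>3 / 2) * C * (n / k) ^ (r - 1) \<le> (1 - \<epsilon>) * C * (n / k) ^ (r - 1)"
          using \<epsilon> C n by (intro mult_right_mono) auto
        then show "(1 - \<epsilon>3 / 2) * real ((k - 1) choose (r - 1)) * (real (card (verts G)) / k) ^ (r - 1) \<le> deg G v"
          using mdV[of v] v by (simp add: V_def n_def C_def)
      qed
    qed
    then obtain L where L: "L \<subseteq> V" "card L \<le> c1"
      and Ldeg: "\<And>v. v \<in> V - L \<Longrightarrow> v \<notin> S \<Longrightarrow> (1 - 1 / real k - \<epsilon>3) * n \<le> card (?nb v)"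
      unfolding V_def[symmetric] D_def[symmetric] n_def S_def by auto
    define Ex where "Ex = S \<union> L"
    have Ex: "Ex \<subseteq> V" using L by (auto simp: Ex_def S_def)
    have cEx: "card Ex \<le> c0 + c1" using card_Un_le[of S L] S L unfolding Ex_def by linarith
    have "\<exists>Q. disjoint_family_on Q {..<k} \<and> (\<forall>i<k. Q i \<subseteq> V - Ex \<and> (1 / real k - g3) * card V \<le> card (Q i) \<and>
       card (Q i) \<le> (1 / real k + g3) * card V \<and>
       (\<forall>x\<in>Q i. \<forall>j<k. j \<noteq> i \<longrightarrow> card (Q j - nbh D V x) \<le> g3 * card V))"
    proof (rule pt[OF fin(1) _ D Ex cEx])
      show "n2 \<le> card V" using big by (simp add: n0_def V_def)
      show "\<forall>v\<in>V - Ex. (1 - 1 / real k - \<epsilon>2) * card V \<le> card (nbh D V v)"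
      proof
        fix v assume v: "v \<in> V - Ex"
        have "(1 - 1 / real k - \<epsilon>2) * n \<le> (1 - 1 / real k - \<epsilon>3) * n" using \<epsilon>3 n by (intro mult_right_mono) auto
        then show "(1 - 1 / real k - \<epsilon>2) * card V \<le> card (nbh D V v)"
          using Ldeg[of v] v by (auto simp: Ex_def n_def)
      qed
      show "\<forall>v\<in>V - Ex. \<not> has_blowup D (nbh D V v) k t" by (auto simp: Ex_def S_def)
    qed
    then obtain Q where Q': "disjoint_family_on Q {..<k} \<and> (\<forall>i<k. Q i \<subseteq> V - Ex \<and> (1 / real k - g3) * card V \<le> card (Q i) \<and>
       card (Q i) \<le> (1 / real k + g3) * card V \<and>
       (\<forall>x\<in>Q i. \<forall>j<k. j \<noteq> i \<longrightarrow> card (Q j - nbh D V x) \<le> g3 * card V))"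
      by (rule exE)
    have djQ: "disjoint_family_on Q {..<k}" and QV: "\<And>i. i < k \<Longrightarrow> Q i \<subseteq> V - Ex"
      and Qlow: "\<And>i. i < k \<Longrightarrow> (1 / real k - g3) * n \<le> card (Q i)"
      and Qup: "\<And>i. i < k \<Longrightarrow> card (Q i) \<le> (1 / real k + g3) * n"
      and Qmiss: "\<And>i x j. i < k \<Longrightarrow> x \<in> Q i \<Longrightarrow> j < k \<Longrightarrow> j \<noteq> i \<Longrightarrow> card (Q j - ?nb x) \<le> g3 * n"
      unfolding n_def using Q' by blast+
    have finQ: "finite (Q i)" if "i < k" for i using QV[OF that] fin finite_subset by blast
    have QS: "Q i \<inter> S = {}" if "i < k" for i using QV[OF that] by (auto simp: Ex_def)
    define R where "R = V - (\<Union>i<k. Q i)"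
    have Rbd: "card R \<le> k * g3 * n"
    proof -
      have "card (\<Union>i<k. Q i) = (\<Sum>i<k. card (Q i))"
        using finQ djQ by (intro card_UN_disjoint) (auto simp: disjoint_family_on_def)
      moreover have "(\<Union>i<k. Q i) \<subseteq> V" using QV by blast
      ultimately have "card R + (\<Sum>i<k. card (Q i)) = card V"
        using fin finQ card_mono[OF fin(1), of "\<Union>i<k. Q i"] unfolding R_def by (simp add: card_Diff_subset)
      then have 1: "card R + (\<Sum>i<k. real (card (Q i))) = n" unfolding n_def by (metis of_nat_add of_nat_sum)
      have "(\<Sum>i<k. (1 / real k - g3) * n) \<le> (\<Sum>i<k. real (card (Q i)))" using Qlow by (intro sum_mono) auto
      moreover have "(\<Sum>i<k. (1 / real k - g3) * n) = n - k * g3 * n" using k by (simp add: field_simps)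
      ultimately show ?thesis using 1 by linarith
    qed
    \<comment> \<open>A share \<open>g4\<close> in every class would let the greedy lemma build a
      blow-up in the neighbourhood: each of the \<open>k t\<close> vertices excludes about g3 n
      candidates, and the factor 2 in \<open>g4\<close> covers the rounding.\<close>
    have ex\<iota>: "\<exists>i<k. card (Q i \<inter> ?nb v) < g4 * n" if v: "v \<in> V - S" for v
    proof (rule ccontr)
      assume "\<not> ?thesis"
      then have a: "\<And>i. i < k \<Longrightarrow> g4 * n \<le> card (Q i \<inter> ?nb v)" by force
      have "has_blowup D (?nb v) k t"
      proof (rule dense_parts_imp_blowup[OF D(1), where Q = "\<lambda>i. Q i \<inter> ?nb v" and B = "nat \<lfloor>g3 * n\<rfloor>"])
        fix i assume i: "i < k"
        show "finite (Q i \<inter> ?nb v)" "Q i \<inter> ?nb v \<subseteq> ?nb v" using finQ[OF i] by auto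
        have "real (Suc (nat \<lfloor>g3 * n\<rfloor>)) \<le> g3 * n + 1" using g3 n by simp
        also have "\<dots> < 2 * (g3 * n)" using n2 by simp
        finally have "real (k * t) * real (Suc (nat \<lfloor>g3 * n\<rfloor>)) < real (k * t) * (2 * (g3 * n))"
          using k t by (intro mult_strict_left_mono) auto
        also have "\<dots> = g4 * n" by (simp add: g4_def)
        also have "\<dots> \<le> card (Q i \<inter> ?nb v)" by (rule a[OF i])
        finally show "k * t * Suc (nat \<lfloor>g3 * n\<rfloor>) < card (Q i \<inter> ?nb v)"
          by (simp only: of_nat_mult[symmetric] of_nat_less_iff)
      next
        fix i j x assume ij: "i < k" "j < k" "i \<noteq> j" and x: "x \<in> Q i \<inter> ?nb v"
        have "{y\<in>Q j \<inter> ?nb v. \<not> D x y} \<subseteq> Q j - ?nb x" by (auto simp: nbh_def)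
        then have "card {y\<in>Q j \<inter> ?nb v. \<not> D x y} \<le> card (Q j - ?nb x)" using finQ[OF ij(2)] by (intro card_mono) auto
        then show "card {y\<in>Q j \<inter> ?nb v. \<not> D x y} \<le> nat \<lfloor>g3 * n\<rfloor>"
          using Qmiss[of i x j] ij x by (simp add: le_nat_iff le_floor_iff)
      qed
      then show False using v by (auto simp: S_def)
    qed
    then obtain \<iota> where \<iota>: "\<And>v. v \<in> V - S \<Longrightarrow> \<iota> v < k" "\<And>v. v \<in> V - S \<Longrightarrow> card (Q (\<iota> v) \<inter> ?nb v) < g4 * n"
      by metis
    define P where "P i = {v\<in>V - S. \<iota> v = i \<and> (\<forall>j<k. j \<noteq> i \<longrightarrow> card (Q j - ?nb v) \<le> g6 * n)}" for i
    define X where "X = V - S - (\<Union>i<k. P i)"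
    have djP: "disjoint_family_on P {..<k}" by (auto simp: disjoint_family_on_def P_def)
    have PV: "P i \<subseteq> V - S" for i by (auto simp: P_def)
    have finP: "finite (P i)" for i using PV[of i] fin finite_subset by blast
    \<comment> \<open>A member of \<open>Q i\<close> cannot be deficient towards another class: its
      few neighbours and few non-neighbours there would not add up to the size of that
      class.\<close>
    have QP: "Q i \<subseteq> P i" if i: "i < k" for i
    proof
      fix x assume x: "x \<in> Q i"
      then have xV: "x \<in> V - S" using QV[OF i] by (auto simp: Ex_def)
      have small: "card (Q j - ?nb x) \<le> g3 * n" if "j < k" "j \<noteq> i" for j using Qmiss[OF i x that] .
      have "\<iota> x = i"
      proof (rule ccontr)
        assume ne: "\<iota> x \<noteq> i"
        define j where "j = \<iota> x"
        have j: "j < k" "j \<noteq> i" using \<iota>(1)[OF xV] ne by (auto simp: j_def)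
        have "card (Q j) = card (Q j \<inter> ?nb x) + card (Q j - ?nb x)" using finQ[OF j(1)] by (metis card_Int_Diff)
        then have "(1 / real k - g3) * n < g4 * n + g3 * n"
          using Qlow[OF j(1)] small[OF j] \<iota>(2)[OF xV] by (simp add: j_def)
        then have "(1 / real k - g3) * n < (g4 + g3) * n" by (simp add: algebra_simps)
        then have "1 / real k < g4 + 2 * g3" using n by (simp add: mult_less_cancel_right)
        moreover have "g6 / 2 \<le> 1 / real k" using g6 by (simp add: field_simps)
        ultimately show False using g3s by linarith
      qed
      moreover have "g3 * n \<le> g6 * n" using g3s n by (intro mult_right_mono) auto
      ultimately show "x \<in> P i" using xV small by (fastforce simp: P_def)
    qed
    have PQ: "P i - Q i \<subseteq> R" if i: "i < k" for i
    proof
      fix x assume x: "x \<in> P i - Q i"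
      have "x \<notin> Q j" if j: "j < k" for j
      proof
        assume "x \<in> Q j"
        then have "x \<in> P j" using QP[OF j] by blast
        then have "j = i" using x djP i j by (auto simp: disjoint_family_on_def)
        then show False using x \<open>x \<in> Q j\<close> by auto
      qed
      then show "x \<in> R" using x PV by (auto simp: R_def)
    qed
    have finR: "finite R" using fin by (simp add: R_def)
    have Pup: "card (P i) \<le> card (Q i) + k * g3 * n" if i: "i < k" for i
    proof -
      have "card (P i) \<le> card (Q i \<union> R)" using PQ[OF i] finQ[OF i] finR by (intro card_mono) auto
      then have "card (P i) \<le> card (Q i) + card R" using card_Un_le le_trans by blast
      then show ?thesis using Rbd by linarith
    qed
    have Plow: "(1 / real k - \<gamma>) * n \<le> card (P i)" if i: "i < k" for i
    proof -
      have "(1 / real k - \<gamma>) * n \<le> (1 / real k - g3) * n" using g3s g6 n by (intro mult_right_mono) (auto simp: g6_def)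
      moreover have "card (Q i) \<le> card (P i)" using QP[OF i] finP by (intro card_mono) auto
      ultimately show ?thesis using Qlow[OF i] by linarith
    qed
    have Pmiss: "card (P j - ?nb x) \<le> \<gamma> * n" if ij: "i < k" "j < k" "i \<noteq> j" and x: "x \<in> P i" for i j x
    proof -
      have "P j - ?nb x \<subseteq> (Q j - ?nb x) \<union> R" using PQ[OF ij(2)] by blast
      then have "card (P j - ?nb x) \<le> card ((Q j - ?nb x) \<union> R)" using finQ[OF ij(2)] finR by (intro card_mono) auto
      then have "card (P j - ?nb x) \<le> card (Q j - ?nb x) + card R" using card_Un_le le_trans by blast
      moreover have "card (Q j - ?nb x) \<le> g6 * n" using x ij by (auto simp: P_def)
      ultimately have "card (P j - ?nb x) \<le> g6 * n + k * g3 * n" using Rbd by linarith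
      also have "\<dots> \<le> \<gamma> * n"
      proof -
        have "k * g3 \<le> g6" using kg3 nn \<beta> by linarith
        then have "k * g3 * n \<le> g6 * n" using n by (intro mult_right_mono) auto
        then show ?thesis by (simp add: g6_def)
      qed
      finally show ?thesis .
    qed
    have XX: "\<beta> * n ^ (r - 1) \<le> card {e\<in>edges G. v \<in> e \<and> e \<inter> S = {} \<and> bad k P e} \<and>
        (\<exists>i<k. card (?nb v) \<le> n - card (P i) - \<beta> * n)" if vX: "v \<in> X" for v
    proof -
      have v: "v \<in> V - S" using vX by (auto simp: X_def)
      define i where "i = \<iota> v"
      have i: "i < k" "card (Q i \<inter> ?nb v) < g4 * n" using \<iota>[OF v] by (auto simp: i_def)
      obtain j where j: "j < k" "j \<noteq> i" "g6 * n < card (Q j - ?nb v)"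
        using vX v i(1) by (force simp: X_def P_def i_def)
      have p1: "n ^ (r - 1) = n * n ^ (r - 2)" using r by (simp add: Suc_diff_Suc numeral_2_eq_2 flip: power_Suc)
      show ?thesis
      proof
        have "card (?nb v) + (card (Q i - ?nb v) + card (Q j - ?nb v)) \<le> card V"
        proof -
          have "Q i \<inter> Q j = {}" using djQ i j by (auto simp: disjoint_family_on_def)
          then have "card (Q i - ?nb v) + card (Q j - ?nb v) = card ((Q i - ?nb v) \<union> (Q j - ?nb v))"
            using finQ i j by (intro card_Un_disjoint[symmetric]) auto
          moreover have "card (?nb v) + card ((Q i - ?nb v) \<union> (Q j - ?nb v)) = card (?nb v \<union> ((Q i - ?nb v) \<union> (Q j - ?nb v)))"
            using finQ i j fin by (intro card_Un_disjoint[symmetric]) (auto simp: nbh_def)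
          moreover have "card (?nb v \<union> ((Q i - ?nb v) \<union> (Q j - ?nb v))) \<le> card V"
            using fin QV[OF i(1)] QV[OF j(1)] by (intro card_mono) (auto simp: nbh_def)
          ultimately show ?thesis by simp
        qed
        then have "card (?nb v) + (real (card (Q i - ?nb v)) + card (Q j - ?nb v)) \<le> n" unfolding n_def by linarith
        moreover have "card (Q i) = card (Q i \<inter> ?nb v) + card (Q i - ?nb v)" using finQ[OF i(1)] by (metis card_Int_Diff)
        moreover have "(k * g3 + g4 + \<beta>) * n \<le> g6 * n" using kg3 n by (intro mult_right_mono) auto
        ultimately have "card (?nb v) \<le> n - card (P i) - \<beta> * n"
          using Pup[OF i(1)] i(2) j(3) by (simp add: algebra_simps)
        then show "\<exists>i<k. card (?nb v) \<le> n - card (P i) - \<beta> * n" using i(1) by blast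
      next
        \<comment> \<open>The hyperedges at \<open>v\<close> are split into those with a non-robust
          pair at \<open>v\<close>, those meeting the uncovered set \<open>R\<close>, those with a
          neighbour in the deficient class, the bad ones, and those whose other vertices are
          transversal to the neighbourhoods in the classes other than \<open>i\<close>. The first
          three are error terms.\<close>
        define E1 where "E1 = {e\<in>edges G. v \<in> e \<and> (\<exists>y\<in>e. y \<noteq> v \<and> \<not> D v y)}"
        define E2 where "E2 = {e\<in>edges G. v \<in> e \<and> (\<exists>y\<in>e. y \<noteq> v \<and> y \<in> R)}"
        define E3 where "E3 = {e\<in>edges G. v \<in> e \<and> (\<exists>y\<in>e. y \<noteq> v \<and> y \<in> Q i \<inter> ?nb v)}"
        define E4 where "E4 = {e\<in>edges G. v \<in> e \<and> e \<inter> S = {} \<and> bad k P e}"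
        define J where "J = {..<k} - {i}"
        define N where "N l = Q l \<inter> ?nb v" for l
        define E5 where "E5 = {e\<in>edges G. v \<in> e \<and> e - {v} \<in> transversals N J (r - 1)}"
        have sub: "{e\<in>edges G. v \<in> e} \<subseteq> E1 \<union> E2 \<union> E3 \<union> E4 \<union> E5"
        proof
          fix e assume "e \<in> {e\<in>edges G. v \<in> e}"
          then have e: "e \<in> edges G" "v \<in> e" by auto
          have eV: "e \<subseteq> V" "card e = r" "finite e" using r_graphD[OF G] e by (auto simp: V_def)
          show "e \<in> E1 \<union> E2 \<union> E3 \<union> E4 \<union> E5"
          proof (cases "e \<in> E1 \<union> E2 \<union> E3")
            case False
            then have a: "\<And>y. y \<in> e \<Longrightarrow> y \<noteq> v \<Longrightarrow> D v y" "\<And>y. y \<in> e \<Longrightarrow> y \<noteq> v \<Longrightarrow> y \<notin> R"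
              "\<And>y. y \<in> e \<Longrightarrow> y \<noteq> v \<Longrightarrow> y \<notin> Q i \<inter> ?nb v"
              using e by (auto simp: E1_def E2_def E3_def)
            have loc: "\<exists>l\<in>J. y \<in> N l" if y: "y \<in> e" "y \<noteq> v" for y
            proof -
              have yn: "y \<in> ?nb v" using a(1)[OF y] y eV by (auto simp: nbh_def)
              obtain l where l: "l < k" "y \<in> Q l" using a(2)[OF y] y eV by (auto simp: R_def)
              then have "l \<noteq> i" using a(3)[OF y] yn by auto
              then show ?thesis using l yn by (auto simp: J_def N_def)
            qed
            show ?thesis
            proof (cases "bad k P e")
              case True
              have "e \<inter> S = {}"
              proof -
                have "y \<notin> S" if ye: "y \<in> e" for y
                proof (cases "y = v")
                  case False
                  then obtain l where "l \<in> J" "y \<in> N l" using loc[OF ye False] by blast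
                  then show ?thesis using QS[of l] by (auto simp: J_def N_def)
                qed (use v in auto)
                then show ?thesis by blast
              qed
              then show ?thesis using e True by (auto simp: E4_def)
            next
              case False
              have "e - {v} \<in> transversals N J (r - 1)"
              proof (rule transversals_memI)
                show "finite (e - {v})" "card (e - {v}) = r - 1" using eV e by auto
                show "e - {v} \<subseteq> (\<Union>j\<in>J. N j)" using loc by blast
                fix l x y assume l: "l \<in> J" and xy: "x \<in> e - {v}" "y \<in> e - {v}" "x \<in> N l" "y \<in> N l"
                have "x \<in> P l" "y \<in> P l" using QP[of l] l xy by (auto simp: J_def N_def)
                then show "x = y" using False l xy by (auto simp: bad_def J_def)
              qed
              then show ?thesis using e by (auto simp: E5_def)
            qed
          qed blast
        qed
        have finE: "finite E1" "finite E2" "finite E3" "finite E4" "finite E5"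
          using fin by (auto simp: E1_def E2_def E3_def E4_def E5_def)
        have "deg G v \<le> card (E1 \<union> E2 \<union> E3 \<union> E4 \<union> E5)" unfolding deg_def using finE by (intro card_mono sub) auto
        also have "\<dots> \<le> card E1 + card E2 + card E3 + card E4 + card E5"
          using card_Un_le[of "E1 \<union> E2 \<union> E3 \<union> E4" E5] card_Un_le[of "E1 \<union> E2 \<union> E3" E4]
            card_Un_le[of "E1 \<union> E2" E3] card_Un_le[of E1 E2] by linarith
        finally have tot: "real (deg G v) \<le> card E1 + card E2 + card E3 + card E4 + card E5" by linarith
        have vV: "v \<in> verts G" using v by (auto simp: V_def)
        have b1: "card E1 \<le> g3 * n ^ (r - 1)"
        proof -
          have "card E1 * card (verts G) \<le> w * card (verts G) ^ (r - 1)"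
            unfolding E1_def D_def by (rule card_light_link_le[OF G r(1) vV])
          from of_nat_mono[OF this, where 'a = real]
          have "card E1 * n \<le> w * n ^ (r - 1)" by (simp add: n_def V_def)
          also have "\<dots> \<le> g3 * n * n ^ (r - 1)" using nw n by (intro mult_right_mono) auto
          also have "\<dots> = g3 * n ^ (r - 1) * n" by simp
          finally show ?thesis using n by (simp only: mult_le_cancel_right)
        qed
        have b2: "card E2 \<le> k * g3 * n ^ (r - 1)"
        proof -
          have "card E2 \<le> card R * card (verts G) ^ (r - 2)"
            unfolding E2_def using card_edges_meeting_le[OF G r(1) _ vV, of R] by (auto simp: R_def V_def)
          from of_nat_mono[OF this, where 'a = real]
          have "card E2 \<le> card R * n ^ (r - 2)" by (simp add: n_def V_def)
          also have "\<dots> \<le> k * g3 * n * n ^ (r - 2)" using Rbd n by (intro mult_right_mono) auto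
          finally show ?thesis by (simp only: p1 mult.assoc)
        qed
        have b3: "card E3 \<le> g4 * n ^ (r - 1)"
        proof -
          have "card E3 \<le> card (Q i \<inter> ?nb v) * card (verts G) ^ (r - 2)"
            unfolding E3_def using card_edges_meeting_le[OF G r(1) _ vV, of "Q i \<inter> ?nb v"] by (auto simp: nbh_def V_def)
          from of_nat_mono[OF this, where 'a = real]
          have "card E3 \<le> card (Q i \<inter> ?nb v) * n ^ (r - 2)" by (simp add: n_def V_def)
          also have "\<dots> \<le> g4 * n * n ^ (r - 2)" using i n by (intro mult_right_mono) auto
          finally show ?thesis by (simp only: p1 mult.assoc)
        qed
        define \<mu> where "\<mu> = 1 / real k + g3"
        have \<mu>1: "1 / real k \<le> \<mu>" "\<mu> \<le> 1" "0 \<le> \<mu>"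
        proof -
          have "1 / real k \<le> 1 / 2" using k by (simp add: field_simps)
          moreover have "1 / (2 * real k) \<le> 1 / 4" using k by (simp add: field_simps)
          ultimately show "\<mu> \<le> 1" using g3s(3) by (simp add: \<mu>_def)
        qed (use g3 in \<open>auto simp: \<mu>_def\<close>)
        \<comment> \<open>Among the k-1 sizes entering the transversal count, that of
          \<open>j\<close> is short by g6 n. This lowers the main term by at least c6 g6
          n^(r-1).\<close>
        have b5: "card E5 \<le> (C * \<mu> ^ (r - 1) - c6 * g6) * n ^ (r - 1)"
        proof -
          define b where "b l = card (N l)" for l
          define M where "M = nat \<lfloor>\<mu> * n\<rfloor>"
          have J: "finite J" "j \<in> J" "card (J - {j}) = k - 2" using i j by (auto simp: J_def)
          have bM: "b l \<le> M" if "l \<in> J" for l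
          proof -
            have l: "l < k" using that by (auto simp: J_def)
            have "b l \<le> card (Q l)" unfolding b_def N_def using finQ[OF l] by (intro card_mono) auto
            then have "b l \<le> \<mu> * n" using Qup[OF l] by (simp add: \<mu>_def)
            then show ?thesis by (simp add: M_def le_nat_iff le_floor_iff)
          qed
          have Mn: "real M \<le> \<mu> * n" using \<mu>1 n by (simp add: M_def)
          have bj: "b j \<le> (\<mu> - g6) * n"
          proof -
            have "card (Q j) = b j + card (Q j - ?nb v)" unfolding b_def N_def using finQ[OF j(1)] by (metis card_Int_Diff)
            then show ?thesis using Qup[OF j(1)] j(3) by (simp add: \<mu>_def algebra_simps)
          qed
          have "card E5 \<le> card (transversals N J (r - 1))"
          proof (rule card_inj_on_le[where f = "\<lambda>e. e - {v}"])
            show "inj_on (\<lambda>e. e - {v}) E5" by (rule inj_onI) (auto simp: E5_def)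
            show "(\<lambda>e. e - {v}) ` E5 \<subseteq> transversals N J (r - 1)" by (auto simp: E5_def)
            show "finite (transversals N J (r - 1))"
            proof (rule finite_subset)
              show "transversals N J (r - 1) \<subseteq> Pow (\<Union>j\<in>J. N j)" by (auto simp: transversals_def)
              show "finite (Pow (\<Union>j\<in>J. N j))" using finQ by (auto simp: J_def N_def)
            qed
          qed
          also have "\<dots> = esym b J (r - 1)"
            unfolding b_def
          proof (rule card_transversals[OF J(1)])
            show "finite (N l)" if "l \<in> J" for l using that finQ by (auto simp: N_def J_def)
            show "disjoint_family_on N J" using djQ by (auto simp: disjoint_family_on_def N_def J_def)
          qed
          also have "\<dots> = esym b (J - {j}) (r - 1) + b j * esym b (J - {j}) (r - 2)"
            using esym_remove[OF J(1,2), of b "r - 2"] r by (simp add: Suc_diff_Suc numeral_2_eq_2)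
          also have "\<dots> \<le> ((k - 2) choose (r - 1)) * M ^ (r - 1) + b j * (((k - 2) choose (r - 2)) * M ^ (r - 2))"
            unfolding J(3)[symmetric] esym_const[OF finite_Diff[OF J(1)], symmetric]
            using J bM by (intro add_mono mult_le_mono esym_mono) auto
          finally have "card E5 \<le> ((k - 2) choose (r - 1)) * M ^ (r - 1) + b j * (((k - 2) choose (r - 2)) * M ^ (r - 2))" .
          from of_nat_mono[OF this, where 'a = real]
          have "card E5 \<le> real ((k - 2) choose (r - 1)) * real M ^ (r - 1) + b j * (real ((k - 2) choose (r - 2)) * real M ^ (r - 2))"
            by simp
          also have "\<dots> \<le> real ((k - 2) choose (r - 1)) * (\<mu> * n) ^ (r - 1) + (\<mu> - g6) * n * (real ((k - 2) choose (r - 2)) * (\<mu> * n) ^ (r - 2))"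
            using Mn bj order_trans[OF of_nat_0_le_iff bj]
            by (intro add_mono mult_left_mono mult_mono power_mono) auto
          also have "\<dots> = (real ((k - 2) choose (r - 1)) * \<mu> ^ (r - 1) + (\<mu> - g6) * (real ((k - 2) choose (r - 2)) * \<mu> ^ (r - 2))) * n ^ (r - 1)"
            unfolding power_mult_distrib p1 by (simp only: algebra_simps)
          also have "real ((k - 2) choose (r - 1)) * \<mu> ^ (r - 1) + (\<mu> - g6) * (real ((k - 2) choose (r - 2)) * \<mu> ^ (r - 2))
             = C * \<mu> ^ (r - 1) - g6 * (real ((k - 2) choose (r - 2)) * \<mu> ^ (r - 2))"
          proof -
            obtain a b where ab: "k = a + 2" "r = b + 2" using k r by (metis le_add_diff_inverse2)
            show ?thesis unfolding C_def ab by (simp add: algebra_simps)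
          qed
          finally have 1: "card E5 \<le> (C * \<mu> ^ (r - 1) - g6 * (real ((k - 2) choose (r - 2)) * \<mu> ^ (r - 2))) * n ^ (r - 1)" .
          have "c6 = 1 * (1 / real k) ^ (r - 2)" by (simp add: c6_def)
          also have "\<dots> \<le> real ((k - 2) choose (r - 2)) * \<mu> ^ (r - 2)"
          proof -
            have "1 \<le> (k - 2) choose (r - 2)" using r by (simp add: Suc_le_eq)
            from of_nat_mono[OF this, where 'a = real] have "1 \<le> real ((k - 2) choose (r - 2))" by simp
            then show ?thesis using \<mu>1 k by (intro mult_mono power_mono) auto
          qed
          finally have "c6 * g6 \<le> g6 * (real ((k - 2) choose (r - 2)) * \<mu> ^ (r - 2))"
            using g6 by (simp add: mult.commute mult_left_mono)
          then have "(C * \<mu> ^ (r - 1) - g6 * (real ((k - 2) choose (r - 2)) * \<mu> ^ (r - 2))) * n ^ (r - 1)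
             \<le> (C * \<mu> ^ (r - 1) - c6 * g6) * n ^ (r - 1)" using n by (intro mult_right_mono) auto
          then show ?thesis using 1 by linarith
        qed
        have "C * \<mu> ^ (r - 1) \<le> C * ((1 / real k) ^ (r - 1) + (r - 1) * (\<mu> - 1 / real k))"
          using power_diff_le[of "1 / real k" \<mu> "r - 1"] \<mu>1 C by (intro mult_left_mono) auto
        also have "\<dots> \<le> C * ((1 / real k) ^ (r - 1) + r * g3)"
          using C g3 by (intro mult_left_mono add_left_mono) (auto simp: \<mu>_def intro!: mult_right_mono)
        finally have C\<mu>: "C * \<mu> ^ (r - 1) \<le> C * (1 / real k) ^ (r - 1) + C * r * g3" by (simp add: algebra_simps)
        have "\<epsilon> * (C * (1 / real k) ^ (r - 1)) \<le> g3 * (C * 1)"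
          using \<epsilon> C g3 k by (intro mult_mono mult_left_mono power_le_one) auto
        then have C\<epsilon>: "C * (1 / real k) ^ (r - 1) - C * g3 \<le> (1 - \<epsilon>) * C * (1 / real k) ^ (r - 1)"
          by (simp add: algebra_simps)
        have "(1 - \<epsilon>) * C * (1 / real k) ^ (r - 1) * n ^ (r - 1) \<le> deg G v"
          using mdV[of v] v by (simp add: power_divide)
        moreover have "(C * (1 / real k) ^ (r - 1) - C * g3) * n ^ (r - 1) \<le> (1 - \<epsilon>) * C * (1 / real k) ^ (r - 1) * n ^ (r - 1)"
          using C\<epsilon> n by (intro mult_right_mono) auto
        moreover have "(C * \<mu> ^ (r - 1) - c6 * g6) * n ^ (r - 1) \<le> (C * (1 / real k) ^ (r - 1) + C * r * g3 - c6 * g6) * n ^ (r - 1)"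
          using C\<mu> n by (intro mult_right_mono) auto
        ultimately have "(C * (1 / real k) ^ (r - 1) - C * g3) * n ^ (r - 1) \<le>
          g3 * n ^ (r - 1) + k * g3 * n ^ (r - 1) + g4 * n ^ (r - 1) + card E4 + (C * (1 / real k) ^ (r - 1) + C * r * g3 - c6 * g6) * n ^ (r - 1)"
          using tot b1 b2 b3 b5 by linarith
        then have "(c6 * g6 - (C * g3 + C * r * g3 + g3 + k * g3 + g4)) * n ^ (r - 1) \<le> card E4"
          by (simp add: algebra_simps)
        moreover have "\<beta> * n ^ (r - 1) \<le> (c6 * g6 - (C * g3 + C * r * g3 + g3 + k * g3 + g4)) * n ^ (r - 1)"
        proof (rule mult_right_mono)
          have "c6 * g6 = 2 * \<beta>" by (simp add: \<beta>_def)
          then show "\<beta> \<le> c6 * g6 - (C * g3 + C * r * g3 + g3 + k * g3 + g4)" using budget nn g3 by linarith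
        qed (use n in auto)
        ultimately show "\<beta> * n ^ (r - 1) \<le> card {e\<in>edges G. v \<in> e \<and> e \<inter> S = {} \<and> bad k P e}"
          unfolding E4_def by linarith
      qed
    qed
    show "\<exists>P X S. S = {v\<in>verts G. has_blowup (robust w G) (nbh (robust w G) (verts G) v) k t} \<and>
      disjoint_family_on P {..<k} \<and> X \<inter> (\<Union>i<k. P i) = {} \<and> X \<union> (\<Union>i<k. P i) = verts G - S \<and>
      (\<forall>i<k. (1 / real k - \<gamma>) * real (card (verts G)) \<le> real (card (P i))) \<and>
      (\<forall>i<k. \<forall>j<k. i \<noteq> j \<longrightarrow> (\<forall>x\<in>P i. real (card (P j - nbh (robust w G) (verts G) x)) \<le> \<gamma> * real (card (verts G)))) \<and>
      (\<forall>v\<in>X. \<beta> * real (card (verts G)) ^ (r - 1) \<le> real (card {e\<in>edges G. v \<in> e \<and> e \<inter> S = {} \<and> bad k P e}) \<and>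
        (\<exists>i<k. real (card (nbh (robust w G) (verts G) v)) \<le> real (card (verts G)) - real (card (P i)) - \<beta> * real (card (verts G))))"
    proof (rule exI[of _ P], rule exI[of _ X], rule exI[of _ S], intro conjI)
      show "S = {v\<in>verts G. has_blowup (robust w G) (nbh (robust w G) (verts G) v) k t}"
        by (simp add: S_def V_def D_def)
      show "X \<union> (\<Union>i<k. P i) = verts G - S" using PV by (auto simp: X_def V_def)
      show "X \<inter> (\<Union>i<k. P i) = {}" by (auto simp: X_def)
    qed (use djP Plow Pmiss XX in \<open>auto simp: n_def V_def D_def\<close>)
  qed
qed

section \<open>Critical components\<close>

lemma chromatic_number_le:
  assumes "proper_coloring G c f"
  shows "chromatic_number G \<le> c"
  unfolding chromatic_number_def using assms by (intro Least_le) blast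

text \<open>An injective colouring is proper because the ends of an edge differ, so the
  \<open>LEAST\<close> in the definition is attained; a colouring with fewer colours also counts as
  one with \<open>k\<close>.\<close>

lemma proper_coloring_chromatic:
  assumes fin: "finite (verts G)" and E: "\<And>u v. {u, v} \<in> edges G \<Longrightarrow> u \<in> verts G \<and> v \<in> verts G \<and> u \<noteq> v"
    and le: "chromatic_number G \<le> k"
  shows "\<exists>f. proper_coloring G k f"
proof -
  obtain g :: "'a \<Rightarrow> nat" where g: "bij_betw g (verts G) {..<card (verts G)}"
    using fin by (metis bij_betw_iff_card card_lessThan finite_lessThan)
  have "proper_coloring G (card (verts G)) g"
    using g E unfolding proper_coloring_def bij_betw_def inj_on_def by blast
  then have "\<exists>c f. proper_coloring G c f" by blast
  then have "\<exists>f. proper_coloring G (chromatic_number G) f"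
    unfolding chromatic_number_def by (rule LeastI_ex)
  then show ?thesis using le unfolding proper_coloring_def by (meson lessThan_subset_iff order_trans)
qed

text \<open>Components are reduced to labels \<open>comp v\<close>, and the colourings of all
  components are merged into one map \<open>col\<close> with \<open>k\<close> colours. It is proper
  except on one chosen edge from \<open>cx C\<close> to \<open>cy C\<close> for each critical label
  \<open>C \<in> K\<close>, which is the form the embeddings use.\<close>

locale critical_decomposition =
  fixes F :: "'a hypergraph" and k :: nat and K :: "'c set" and comp :: "'a \<Rightarrow> 'c"
    and cx cy :: "'c \<Rightarrow> 'a" and col :: "'a \<Rightarrow> nat"
  assumes graph_F: "graph F" and finite_K: "finite K"
    and comp_edge: "{u, v} \<in> edges F \<Longrightarrow> comp u = comp v"
    and cxy: "C \<in> K \<Longrightarrow> {cx C, cy C} \<in> edges F" "C \<in> K \<Longrightarrow> comp (cx C) = C" "C \<in> K \<Longrightarrow> col (cx C) = col (cy C)"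
    and col_lt: "v \<in> verts F \<Longrightarrow> col v < k"
    and col_edge: "{u, v} \<in> edges F \<Longrightarrow> (\<And>C. C \<in> K \<Longrightarrow> {u, v} \<noteq> {cx C, cy C}) \<Longrightarrow> col u \<noteq> col v"

text \<open>Each component is coloured separately: directly if its chromatic number is at most
  \<open>k\<close>, otherwise after deleting a critical edge.\<close>

lemma critical_decomposition_exists:
  fixes F :: "'a hypergraph"
  assumes F: "graph F" and k: "1 \<le> k"
    and crit: "\<forall>C\<in>components F. chromatic_number C = k + 1 \<longrightarrow> (\<exists>e. color_critical C e)"
    and rest: "\<forall>C\<in>components F. chromatic_number C \<noteq> k + 1 \<longrightarrow> chromatic_number C \<le> k"
  shows "\<exists>comp cx cy col. critical_decomposition F k {C \<in> components F. chromatic_number C = k + 1} comp cx cy col"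
proof -
  define K where "K = {C \<in> components F. chromatic_number C = k + 1}"
  let ?R = "{(x, y). {x, y} \<in> edges F}"
  have symR: "sym (?R\<^sup>*)" by (intro sym_rtrancl) (auto simp: sym_def insert_commute)
  have eq: "equiv (verts F) (connected_rel F)"
    unfolding equiv_def
  proof (intro conjI)
    show "connected_rel F \<subseteq> verts F \<times> verts F" by (auto simp: connected_rel_def)
    show "refl_on (verts F) (connected_rel F)" by (auto simp: refl_on_def connected_rel_def)
    show "sym (connected_rel F)" using symR by (auto simp: sym_def connected_rel_def)
    show "trans (connected_rel F)" by (auto simp: trans_def connected_rel_def)
  qed
  define cls where "cls v = connected_rel F `` {v}" for v
  define comp where "comp v = induced F (cls v)" for v
  have edgeV: "u \<in> verts F \<and> v \<in> verts F \<and> u \<noteq> v" if "{u, v} \<in> edges F" for u v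
    using graph_edgeE[OF F that] by (auto simp: doubleton_eq_iff)
  have compC: "comp v \<in> components F" if "v \<in> verts F" for v
    using that by (auto simp: comp_def cls_def components_def quotient_def)
  have cls_edge: "(u, v) \<in> connected_rel F" if "{u, v} \<in> edges F" for u v
    using edgeV[OF that] that by (auto simp: connected_rel_def)
  have comp_edge: "comp u = comp v" if "{u, v} \<in> edges F" for u v
    using equiv_class_eq[OF eq cls_edge[OF that]] by (simp add: comp_def cls_def)
  have edge_comp: "{u, v} \<in> edges (comp u)" if "{u, v} \<in> edges F" for u v
    using that cls_edge[OF that] edgeV[OF that] eq
    by (auto simp: comp_def induced_def cls_def equiv_def refl_on_def)
  have vcls: "v \<in> verts (comp v)" if "v \<in> verts F" for v
    using that eq by (auto simp: comp_def induced_def cls_def equiv_def refl_on_def)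
  have compI: "comp v = C" if C: "C \<in> components F" and v: "v \<in> verts C" for C v
  proof -
    obtain z where z: "z \<in> verts F" "C = induced F (cls z)"
      using C by (auto simp: components_def quotient_def cls_def)
    then have "(z, v) \<in> connected_rel F" using v by (auto simp: induced_def cls_def)
    then show ?thesis using equiv_class_eq[OF eq] z by (simp add: comp_def cls_def)
  qed
  have CF: "finite (verts C)" "\<And>e. e \<in> edges C \<Longrightarrow> e \<in> edges F" "verts C \<subseteq> verts F"
    "\<And>e. e \<in> edges C \<Longrightarrow> e \<subseteq> verts C" if C: "C \<in> components F" for C
  proof -
    obtain z where "C = induced F (cls z)" using C by (auto simp: components_def quotient_def cls_def)
    moreover have "cls z \<subseteq> verts F" for z by (auto simp: cls_def connected_rel_def)
    ultimately show "verts C \<subseteq> verts F" "\<And>e. e \<in> edges C \<Longrightarrow> e \<in> edges F" "\<And>e. e \<in> edges C \<Longrightarrow> e \<subseteq> verts C"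
      by (auto simp: induced_def)
    then show "finite (verts C)" using r_graphD(1)[OF F] finite_subset by blast
  qed
  have ex: "\<exists>f x y. (\<forall>v\<in>verts C. f v < k) \<and> (C \<in> K \<longrightarrow> {x, y} \<in> edges C \<and> f x = f y) \<and>
     (\<forall>u v. {u, v} \<in> edges C \<longrightarrow> (C \<in> K \<longrightarrow> {u, v} \<noteq> {x, y}) \<longrightarrow> f u \<noteq> f v)" if C: "C \<in> components F" for C
  proof (cases "C \<in> K")
    case False
    then have "chromatic_number C \<le> k" using rest C by (auto simp: K_def)
    moreover have "u \<in> verts C \<and> v \<in> verts C \<and> u \<noteq> v" if "{u, v} \<in> edges C" for u v
      using CF(2,4)[OF C that] edgeV by auto
    ultimately obtain f where "proper_coloring C k f"
      using proper_coloring_chromatic[OF CF(1)[OF C]] by blast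
    then show ?thesis using False unfolding proper_coloring_def by (intro exI[of _ f]) auto
  next
    case True
    then obtain e where e: "color_critical C e" "chromatic_number C = k + 1" using crit C by (auto simp: K_def)
    then have eC: "e \<in> edges C" and ch: "chromatic_number (delete_edge C e) \<le> k" by (auto simp: color_critical_def)
    obtain x y where xy: "e = {x, y}" using graph_edgeE[OF F CF(2)[OF C eC]] by metis
    have "u \<in> verts (delete_edge C e) \<and> v \<in> verts (delete_edge C e) \<and> u \<noteq> v" if "{u, v} \<in> edges (delete_edge C e)" for u v
    proof -
      have "{u, v} \<in> edges C" using that by (simp add: delete_edge_def)
      then show ?thesis using CF(2,4)[OF C] edgeV by (auto simp: delete_edge_def)
    qed
    moreover have "finite (verts (delete_edge C e))" using CF(1)[OF C] by (simp add: delete_edge_def)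
    ultimately obtain f where f: "proper_coloring (delete_edge C e) k f"
      using proper_coloring_chromatic ch by blast
    have fp: "f u \<noteq> f v" if "{u, v} \<in> edges C" "{u, v} \<noteq> {x, y}" for u v
      using f that by (auto simp: proper_coloring_def delete_edge_def xy)
    have fk: "f ` verts C \<subseteq> {..<k}" using f by (auto simp: proper_coloring_def delete_edge_def)
    \<comment> \<open>Otherwise the colouring would remain proper with the edge put back, giving
      chromatic number at most \<open>k\<close>.\<close>
    have "f x = f y"
    proof (rule ccontr)
      assume ne: "f x \<noteq> f y"
      have "f u \<noteq> f v" if "{u, v} \<in> edges C" for u v
      proof (cases "{u, v} = {x, y}")
        case True
        then show ?thesis using ne by (auto simp: doubleton_eq_iff)
      qed (use fp that in blast)
      then have "proper_coloring C k f" using fk by (auto simp: proper_coloring_def)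
      then show False using chromatic_number_le e(2) by fastforce
    qed
    then show ?thesis using fk fp eC True xy by (intro exI[of _ f] exI[of _ x] exI[of _ y]) auto
  qed
  define \<Phi> where "\<Phi> C f x y \<longleftrightarrow> (\<forall>v\<in>verts C. f v < k) \<and> (C \<in> K \<longrightarrow> {x, y} \<in> edges C \<and> f x = f y) \<and>
     (\<forall>u v. {u, v} \<in> edges C \<longrightarrow> (C \<in> K \<longrightarrow> {u, v} \<noteq> {x, y}) \<longrightarrow> f u \<noteq> f v)"
    for C :: "'a hypergraph" and f :: "'a \<Rightarrow> nat" and x y
  define fC where "fC C = (SOME f. \<exists>x y. \<Phi> C f x y)" for C
  define cx where "cx C = (SOME x. \<exists>y. \<Phi> C (fC C) x y)" for C
  define cy where "cy C = (SOME y. \<Phi> C (fC C) (cx C) y)" for C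
  have \<Phi>: "\<Phi> C (fC C) (cx C) (cy C)" if "C \<in> components F" for C
  proof -
    have "\<exists>f x y. \<Phi> C f x y" using ex[OF that] by (simp only: \<Phi>_def)
    then have "\<exists>x y. \<Phi> C (fC C) x y" unfolding fC_def by (rule someI_ex)
    then have "\<exists>y. \<Phi> C (fC C) (cx C) y" unfolding cx_def by (rule someI_ex)
    then show ?thesis unfolding cy_def by (rule someI_ex)
  qed
  have fC: "(\<forall>v\<in>verts C. fC C v < k) \<and> (C \<in> K \<longrightarrow> {cx C, cy C} \<in> edges C \<and> fC C (cx C) = fC C (cy C)) \<and>
     (\<forall>u v. {u, v} \<in> edges C \<longrightarrow> (C \<in> K \<longrightarrow> {u, v} \<noteq> {cx C, cy C}) \<longrightarrow> fC C u \<noteq> fC C v)"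
    if "C \<in> components F" for C using \<Phi>[OF that] by (simp only: \<Phi>_def)
  define col where "col v = fC (comp v) v" for v
  have "critical_decomposition F k K comp cx cy col"
  proof
    show "graph F" by (rule F)
    have "finite (verts F // connected_rel F)"
      using eq r_graphD(1)[OF F] by (intro finite_quotient) (auto simp: equiv_def)
    then show "finite K" by (auto simp: K_def components_def)
    show "comp u = comp v" if "{u, v} \<in> edges F" for u v by (rule comp_edge[OF that])
    fix C assume C: "C \<in> K"
    then have CC: "C \<in> components F" by (auto simp: K_def)
    have e: "{cx C, cy C} \<in> edges C" "fC C (cx C) = fC C (cy C)" using fC[OF CC] C by auto
    show "{cx C, cy C} \<in> edges F" by (rule CF(2)[OF CC e(1)])
    have "cx C \<in> verts C" "cy C \<in> verts C" using CF(4)[OF CC e(1)] by auto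
    then have c: "comp (cx C) = C" "comp (cy C) = C" using compI[OF CC] by auto
    then show "comp (cx C) = C" "col (cx C) = col (cy C)" using e by (auto simp: col_def)
  next
    show "col v < k" if "v \<in> verts F" for v
      using fC[OF compC[OF that]] vcls[OF that] by (auto simp: col_def)
    show "col u \<noteq> col v" if uv: "{u, v} \<in> edges F" and nc: "\<And>C. C \<in> K \<Longrightarrow> {u, v} \<noteq> {cx C, cy C}" for u v
    proof -
      have "comp u \<in> components F" using compC edgeV[OF uv] by auto
      moreover have "{u, v} \<in> edges (comp u)" by (rule edge_comp[OF uv])
      ultimately have "fC (comp u) u \<noteq> fC (comp u) v" using fC nc by blast
      then show ?thesis using comp_edge[OF uv] by (simp add: col_def)
    qed
  qed
  then show ?thesis unfolding K_def by blast
qed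

context critical_decomposition
begin

lemma edge_verts: "{u, v} \<in> edges F \<Longrightarrow> u \<in> verts F \<and> v \<in> verts F \<and> u \<noteq> v"
  using graph_edgeE[OF graph_F] by (metis doubleton_eq_iff)

lemma comp_cy: "C \<in> K \<Longrightarrow> comp (cy C) = C"
  using comp_edge cxy by metis

text \<open>The critical components in \<open>K1\<close> are embedded with \<open>cx C\<close> at a vertex \<open>cen C\<close> whose
  neighbourhood contains a blow-up \<open>A C\<close> of a \<open>k\<close>-clique; those in \<open>K2\<close> with their critical edge
  expanded to the hyperedge \<open>hb C\<close>.\<close>

lemma contains_expansion_critical:
  fixes G :: "'b hypergraph"
  assumes G: "r_graph r G" and r: "2 \<le> r"
    and w: "card (verts F) + r * card (edges F) \<le> w"
    and K: "K = K1 \<union> K2" "K1 \<inter> K2 = {}"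
    and W: "finite W" "cen ` K1 \<subseteq> W" "\<And>C. C \<in> K2 \<Longrightarrow> hb C \<subseteq> W"
    and t: "card (verts F) + card W < t"
    and cen: "inj_on cen K1" "\<And>C. C \<in> K1 \<Longrightarrow> cen C \<in> verts G"
    and A: "\<And>C i. C \<in> K1 \<Longrightarrow> i < k \<Longrightarrow> A C i \<subseteq> nbh (robust w G) (verts G) (cen C) \<and> card (A C i) = t"
      "\<And>C i j a b. C \<in> K1 \<Longrightarrow> i < k \<Longrightarrow> j < k \<Longrightarrow> i \<noteq> j \<Longrightarrow> a \<in> A C i \<Longrightarrow> b \<in> A C j \<Longrightarrow> robust w G a b"
    and hb: "\<And>C. C \<in> K2 \<Longrightarrow> hb C \<in> edges G" "\<And>C. C \<in> K2 \<Longrightarrow> ic C < k"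
      "\<And>C. C \<in> K2 \<Longrightarrow> pa C \<in> hb C \<inter> Q (ic C)" "\<And>C. C \<in> K2 \<Longrightarrow> pb C \<in> hb C \<inter> Q (ic C)" "\<And>C. C \<in> K2 \<Longrightarrow> pa C \<noteq> pb C"
      "\<And>C C'. C \<in> K2 \<Longrightarrow> C' \<in> K2 \<Longrightarrow> C \<noteq> C' \<Longrightarrow> hb C \<inter> hb C' = {}"
      "\<And>C C'. C \<in> K1 \<Longrightarrow> C' \<in> K2 \<Longrightarrow> cen C \<notin> hb C'"
    and Q: "\<And>i. i < k \<Longrightarrow> Q i \<subseteq> verts G"
      "\<And>i j a. i < k \<Longrightarrow> j < k \<Longrightarrow> i \<noteq> j \<Longrightarrow> a \<in> Q i \<Longrightarrow> card {b\<in>Q j. \<not> robust w G a b} \<le> B"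
      "\<And>i. i < k \<Longrightarrow> card (verts F) * Suc B + 2 * B + card W < card (Q i)"
  shows "contains_copy G (expansion r F)"
proof -
  let ?D = "robust w G"
  \<comment> \<open>In a component of \<open>K2\<close> two colours are exchanged so that the
    critical edge receives the colour \<open>ic C\<close>, the part in which the hyperedge
    \<open>hb C\<close> has two vertices.\<close>
  define col' where "col' v = (if comp v \<in> K2 then
      (if col v = col (cx (comp v)) then ic (comp v)
       else if col v = ic (comp v) then col (cx (comp v)) else col v) else col v)" for v
  define M where "M = (\<lambda>C. {cx C, cy C}) ` K2"
  \<comment> \<open>Fixed in advance: the vertex \<open>cx C\<close> alone for \<open>K1\<close>,
    both ends of the critical edge for \<open>K2\<close>.\<close>
  define P0 where "P0 = cx ` K1 \<union> cx ` K2 \<union> cy ` K2"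
  define f0 where "f0 v = (if comp v \<in> K1 then cen (comp v) else if v = cx (comp v) then pa (comp v) else pb (comp v))" for v
  define h where "h e = hb (comp (SOME v. v \<in> e))" for e
  define Cd where "Cd z = (if comp z \<in> K1 then A (comp z) (col z)
      else if comp z \<in> K2 then {b\<in>Q (col' z). ({cx (comp z), z} \<in> edges F \<longrightarrow> ?D (pa (comp z)) b) \<and>
          ({cy (comp z), z} \<in> edges F \<longrightarrow> ?D (pb (comp z)) b)}
      else Q (col z)) - W" for z
  define Bz where "Bz z = (if comp z \<in> K1 then 0 else B)" for z
  have KK: "\<And>C. C \<in> K1 \<Longrightarrow> C \<in> K" "\<And>C. C \<in> K2 \<Longrightarrow> C \<in> K" "\<And>C. C \<in> K2 \<Longrightarrow> C \<notin> K1" using K by auto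
  have cne: "cx C \<noteq> cy C" "cx C \<in> verts F" "cy C \<in> verts F" if "C \<in> K" for C
    using edge_verts[OF cxy(1)[OF that]] by auto
  have f0v: "f0 (cx C) = cen C" if "C \<in> K1" for C using that KK cxy(2) by (simp add: f0_def)
  have f0x: "f0 (cx C) = pa C" "f0 (cy C) = pb C" if "C \<in> K2" for C
    using that KK cxy(2) comp_cy cne[of C] by (auto simp: f0_def)
  have hM: "h {cx C, cy C} = hb C" if "C \<in> K2" for C
  proof -
    have "(SOME v. v \<in> {cx C, cy C}) \<in> {cx C, cy C}" by (rule someI[of _ "cx C"]) simp
    then show ?thesis using that KK cxy(2) comp_cy by (auto simp: h_def)
  qed
  have P0F: "P0 \<subseteq> verts F" using cne KK by (auto simp: P0_def)
  have P0K: "comp u \<in> K" "u = cx (comp u) \<or> (comp u \<in> K2 \<and> u = cy (comp u))" if "u \<in> P0" for u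
    using that KK cxy(2) comp_cy by (auto simp: P0_def)
  have f0W: "f0 ` P0 \<subseteq> W"
  proof
    fix b assume "b \<in> f0 ` P0"
    then consider C where "C \<in> K1" "b = f0 (cx C)" | C where "C \<in> K2" "b = f0 (cx C)" | C where "C \<in> K2" "b = f0 (cy C)"
      by (auto simp: P0_def)
    then show "b \<in> W"
    proof cases
      case 1
      then show ?thesis using W(2) f0v by auto
    next
      case 2
      then show ?thesis using W(3)[of C] f0x[of C] hb(3)[of C] by auto
    next
      case 3
      then show ?thesis using W(3)[of C] f0x[of C] hb(4)[of C] by auto
    qed
  qed
  have fix0: "comp u = comp v" if "u \<in> P0" "v \<in> P0" "f0 u = f0 v" for u v
  proof -
    have loc: "(comp u \<in> K1 \<and> f0 u = cen (comp u)) \<or> (comp u \<in> K2 \<and> f0 u \<in> hb (comp u))" if "u \<in> P0" for u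
      using P0K[OF that] K(1) f0v f0x hb(3,4) by (metis IntD1 Un_iff)
    from loc[OF that(1)] loc[OF that(2)] show ?thesis
      using that(3) cen(1) hb(6,7) by (metis disjoint_iff inj_on_def)
  qed
  have inj0: "inj_on f0 P0"
  proof (rule inj_onI)
    fix u v assume uv: "u \<in> P0" "v \<in> P0" "f0 u = f0 v"
    define C where "C = comp u"
    have c: "comp u = C" "comp v = C" using fix0[OF uv] by (auto simp: C_def)
    have "C \<in> K" using P0K[OF uv(1)] c by simp
    show "u = v"
    proof (cases "C \<in> K1")
      case True
      then show ?thesis using P0K(2)[OF uv(1)] P0K(2)[OF uv(2)] c KK(3) by auto
    next
      case False
      then have "C \<in> K2" using \<open>C \<in> K\<close> K by auto
      moreover have "u = cx C \<or> u = cy C" "v = cx C \<or> v = cy C"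
        using P0K(2)[OF uv(1)] P0K(2)[OF uv(2)] c by auto
      ultimately show ?thesis using uv(3) f0x hb(5)[of C] by metis
    qed
  qed
  \<comment> \<open>For components in \<open>K1\<close> the condition on \<open>u\<close> excludes
    the monochromatic edge from \<open>cx C\<close> to \<open>cy C\<close>. That edge causes no
    trouble, because all sets of the blow-up lie in the neighbourhood of the centre.\<close>
  have notcrit: "{u, z} \<noteq> {cx C, cy C}" if z: "z \<in> verts F - P0" and e: "{u, z} \<in> edges F" and nK1: "comp z \<in> K1 \<Longrightarrow> u \<notin> P0" and C: "C \<in> K" for u z C
  proof
    assume eq: "{u, z} = {cx C, cy C}"
    then have "z = cx C \<or> z = cy C" by (auto simp: doubleton_eq_iff)
    moreover have "cx C \<in> P0" using C K by (auto simp: P0_def)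
    ultimately have zy: "z = cy C" "u = cx C" using z eq by (auto simp: doubleton_eq_iff)
    show False
    proof (cases "C \<in> K2")
      case True
      then show ?thesis using zy z by (auto simp: P0_def)
    next
      case False
      then have "C \<in> K1" using C K by auto
      then have "comp z \<in> K1" using zy comp_cy C by simp
      then show False using nK1 zy \<open>cx C \<in> P0\<close> by auto
    qed
  qed
  have col'lt: "col' z < k" if "z \<in> verts F" for z
  proof (cases "comp z \<in> K2")
    case True
    then have "col (cx (comp z)) < k" using col_lt cne KK by auto
    then show ?thesis using True hb(2) col_lt[OF that] by (simp add: col'_def)
  qed (use col_lt that in \<open>simp add: col'_def\<close>)
  have col'ne: "col' u \<noteq> col' v" if "comp u = comp v" "col u \<noteq> col v" for u v
    using that by (auto simp: col'_def)
  have col'x: "col' (cx C) = ic C" "col' (cy C) = ic C" if "C \<in> K2" for C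
    using that KK cxy comp_cy by (auto simp: col'_def)
  show ?thesis
  proof (rule contains_expansionI[OF graph_F G r w, where M = M and ?P0.0 = P0 and ?f0.0 = f0 and h = h and Cd = Cd and B = Bz])
    show "M \<subseteq> edges F" using cxy(1) KK by (auto simp: M_def)
    show "\<Union>M \<subseteq> P0" by (auto simp: M_def P0_def)
    show "P0 \<subseteq> verts F" by (rule P0F)
    show "inj_on f0 P0" by (rule inj0)
    show "f0 ` P0 \<subseteq> verts G"
    proof
      fix b assume "b \<in> f0 ` P0"
      then consider C where "C \<in> K1" "b = f0 (cx C)" | C where "C \<in> K2" "b = f0 (cx C)" | C where "C \<in> K2" "b = f0 (cy C)"
        by (auto simp: P0_def)
      then show "b \<in> verts G"
      proof cases
        case 1
        then show ?thesis using f0v cen(2) by simp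
      next
        case 2
        then show ?thesis using f0x hb(2,3) Q(1) by (metis IntD2 subsetD)
      next
        case 3
        then show ?thesis using f0x hb(2,4) Q(1) by (metis IntD2 subsetD)
      qed
    qed
  next
    fix e assume "e \<in> M"
    then obtain C where C: "C \<in> K2" "e = {cx C, cy C}" by (auto simp: M_def)
    show "h e \<in> edges G" using hM hb(1) C by simp
    have "f0 u \<in> f0 ` e" if u: "u \<in> P0" "f0 u \<in> hb C" for u
    proof -
      have "comp u = C"
      proof (cases "comp u \<in> K1")
        case True
        then have "f0 u = cen (comp u)" by (simp add: f0_def)
        then show ?thesis using hb(7)[OF True C(1)] u by simp
      next
        case False
        then have k2: "comp u \<in> K2" using P0K(1)[OF u(1)] K by auto
        then have "f0 u \<in> hb (comp u)" using P0K(2)[OF u(1)] f0x hb(3,4) by (metis IntD1)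
        then show ?thesis using hb(6)[OF k2 C(1)] u by auto
      qed
      then show ?thesis using P0K(2)[OF u(1)] C(2) by auto
    qed
    moreover have "f0 ` e \<subseteq> hb C" using C f0x hb(3,4) by auto
    moreover have "e \<subseteq> P0" using C by (auto simp: P0_def)
    ultimately show "h e \<inter> f0 ` P0 = f0 ` e" using hM[OF C(1)] C(2) by auto
  next
    fix e e' assume "e \<in> M" "e' \<in> M" "e \<noteq> e'"
    then obtain C C' where "C \<in> K2" "e = {cx C, cy C}" "C' \<in> K2" "e' = {cx C', cy C'}" "C \<noteq> C'" by (auto simp: M_def)
    then have "h e \<inter> h e' = {}" using hM hb(6) by simp
    then show "(h e - f0 ` e) \<inter> (h e' - f0 ` e') = {}" by blast
  next
    fix u v assume u: "u \<in> P0" and v: "v \<in> P0" and e: "{u, v} \<in> edges F" and nM: "{u, v} \<notin> M"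
    have "comp u = comp v" "u \<noteq> v" using comp_edge[OF e] edge_verts[OF e] by auto
    then have "comp u \<in> K2 \<and> {u, v} = {cx (comp u), cy (comp u)}" using P0K(2)[OF u] P0K(2)[OF v] by auto
    then have "{u, v} \<in> M" by (auto simp: M_def)
    then show "robust w G (f0 u) (f0 v)" using nM by simp
  next
    fix z assume z: "z \<in> verts F - P0"
    have ck: "col z < k" "col' z < k" using z col_lt col'lt by auto
    show "Cd z \<subseteq> verts G"
      using Q(1)[OF ck(1)] Q(1)[OF ck(2)] A(1)[of "comp z" "col z"] ck by (auto simp: Cd_def nbh_def split: if_splits)
    show "Cd z \<inter> f0 ` P0 = {}" using f0W by (auto simp: Cd_def)
    show "Cd z \<inter> h e = {}" if "e \<in> M" for e
    proof -
      have "h e \<subseteq> W" using that hM W(3) by (auto simp: M_def)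
      then show ?thesis by (auto simp: Cd_def)
    qed
    have finQ: "finite (Q i)" if "i < k" for i using Q(1)[OF that] r_graphD(1)[OF G] finite_subset by blast
    have sub: "m < card (S - W)" if "m + card W < card S" for m and S :: "'b set"
    proof -
      have "card S - card W \<le> card (S - W)" by (rule diff_card_le_card_Diff[OF W(1)])
      then show ?thesis using that by linarith
    qed
    show "card (verts F) * Suc (Bz z) < card (Cd z)"
    proof (cases "comp z \<in> K1")
      case True
      then have "Cd z = A (comp z) (col z) - W" by (simp add: Cd_def)
      moreover have "card (verts F) * Suc (Bz z) + card W < card (A (comp z) (col z))"
        using A(1)[OF True ck(1)] t True by (simp add: Bz_def)
      ultimately show ?thesis using sub by simp
    next
      case n1: False
      show ?thesis
      proof (cases "comp z \<in> K2")
        case True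
        define C where "C = comp z"
        have C: "C \<in> K2" "C \<notin> K1" "C \<in> K" using True n1 KK by (auto simp: C_def)
        define S where "S = {b\<in>Q (col' z). ({cx C, z} \<in> edges F \<longrightarrow> ?D (pa C) b) \<and> ({cy C, z} \<in> edges F \<longrightarrow> ?D (pb C) b)}"
        \<comment> \<open>A vertex adjacent to an end of the critical edge goes to a part other than
          \<open>ic C\<close>, so each end excludes at most \<open>B\<close> candidates; this
          explains the summand 2 B in the size condition.\<close>
        have ne: "col' z \<noteq> ic C" if e: "{c, z} \<in> edges F" and c: "c = cx C \<or> c = cy C" for c
        proof -
          have cc: "comp c = comp z" using comp_edge[OF e] .
          have "col c \<noteq> col z" using notcrit[OF z e] n1 by (intro col_edge[OF e]) auto
          then have "col' c \<noteq> col' z" using col'ne cc by blast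
          then show ?thesis using col'x[OF C(1)] c by auto
        qed
        have miss1: "card {b\<in>Q (col' z). \<not> ({c, z} \<in> edges F \<longrightarrow> ?D p b)} \<le> B"
          if c: "c = cx C \<or> c = cy C" and p: "p \<in> Q (ic C)" for c p
        proof (cases "{c, z} \<in> edges F")
          case True
          then have "{b\<in>Q (col' z). \<not> ({c, z} \<in> edges F \<longrightarrow> ?D p b)} = {b\<in>Q (col' z). \<not> ?D p b}" by simp
          moreover have "card {b\<in>Q (col' z). \<not> ?D p b} \<le> B"
            using Q(2)[of "ic C" "col' z" p] hb(2)[OF C(1)] ck ne[OF True c] p by auto
          ultimately show ?thesis by simp
        qed simp
        have "Q (col' z) \<subseteq> S \<union> ({b\<in>Q (col' z). \<not> ({cx C, z} \<in> edges F \<longrightarrow> ?D (pa C) b)} \<union> {b\<in>Q (col' z). \<not> ({cy C, z} \<in> edges F \<longrightarrow> ?D (pb C) b)})"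
          by (auto simp: S_def)
        then have "card (Q (col' z)) \<le> card (S \<union> ({b\<in>Q (col' z). \<not> ({cx C, z} \<in> edges F \<longrightarrow> ?D (pa C) b)} \<union> {b\<in>Q (col' z). \<not> ({cy C, z} \<in> edges F \<longrightarrow> ?D (pb C) b)}))"
          using finQ[OF ck(2)] by (intro card_mono) (auto simp: S_def)
        also have "\<dots> \<le> card S + (card {b\<in>Q (col' z). \<not> ({cx C, z} \<in> edges F \<longrightarrow> ?D (pa C) b)} + card {b\<in>Q (col' z). \<not> ({cy C, z} \<in> edges F \<longrightarrow> ?D (pb C) b)})"
          by (meson add_left_mono card_Un_le le_trans)
        also have "\<dots> \<le> card S + (B + B)"
          using hb(3,4)[OF C(1)] by (intro add_left_mono add_mono miss1) auto
        finally have "card (verts F) * Suc B + card W < card S" using Q(3)[OF ck(2)] by linarith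
        moreover have "Cd z = S - W" using C by (simp add: Cd_def S_def C_def)
        ultimately show ?thesis using sub n1 by (simp add: Bz_def)
      next
        case False
        then have "Cd z = Q (col z) - W" using n1 by (simp add: Cd_def)
        moreover have "card (verts F) * Suc B + card W < card (Q (col z))" using Q(3)[OF ck(1)] by linarith
        ultimately show ?thesis using sub n1 by (simp add: Bz_def)
      qed
    qed
  next
    fix u z b assume u: "u \<in> P0" and z: "z \<in> verts F - P0" and e: "{u, z} \<in> edges F" and b: "b \<in> Cd z"
    have c: "comp u = comp z" by (rule comp_edge[OF e])
    show "robust w G (f0 u) b"
    proof (cases "comp z \<in> K1")
      case True
      then have "f0 u = cen (comp z)" "b \<in> A (comp z) (col z)" using c b by (auto simp: f0_def Cd_def)
      then show ?thesis using A(1)[OF True, of "col z"] col_lt z by (auto simp: nbh_def)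
    next
      case False
      then have k2: "comp z \<in> K2" using P0K(1)[OF u] c K by auto
      have "u = cx (comp z) \<or> u = cy (comp z)" using P0K(2)[OF u] c by auto
      then show ?thesis using f0x[OF k2] b e k2 False by (auto simp: Cd_def)
    qed
  next
    fix z z' a assume z: "z \<in> verts F - P0" and z': "z' \<in> verts F - P0" and e: "{z, z'} \<in> edges F" and a: "a \<in> Cd z'"
    have c: "comp z = comp z'" by (rule comp_edge[OF e])
    have cne': "col z \<noteq> col z'" using notcrit[OF z' e] z by (intro col_edge[OF e]) auto
    have ck: "col z < k" "col' z < k" "col z' < k" "col' z' < k" using z z' col_lt col'lt by auto
    have finQ: "finite (Q i)" if "i < k" for i using Q(1)[OF that] r_graphD(1)[OF G] finite_subset by blast
    show "card {b\<in>Cd z. \<not> robust w G a b} \<le> Bz z"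
    proof (cases "comp z \<in> K1")
      case True
      have "?D a b" if b: "b \<in> Cd z" for b
        using A(2)[OF True ck(3,1)] cne' a b True c by (auto simp: Cd_def)
      then have "{b\<in>Cd z. \<not> robust w G a b} = {}" by blast
      then show ?thesis by (simp only: card.empty le0)
    next
      case n1: False
      have c': "col' z \<noteq> col' z'" using col'ne[OF c cne'] .
      have in': "Cd v \<subseteq> Q (col' v)" if "comp v \<notin> K1" for v
        using that by (auto simp: Cd_def col'_def)
      have "a \<in> Q (col' z')" using in'[of z'] n1 c a by auto
      then have "card {b\<in>Q (col' z). \<not> robust w G a b} \<le> B" using Q(2)[OF ck(4,2)] c' by auto
      moreover have "card {b\<in>Cd z. \<not> robust w G a b} \<le> card {b\<in>Q (col' z). \<not> robust w G a b}"
        using in'[OF n1] finQ[OF ck(2)] by (intro card_mono) auto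
      ultimately show ?thesis using n1 by (simp add: Bz_def)
    qed
  qed
qed

end

section \<open>The extremal constructions\<close>

definition del_vertex :: "'a hypergraph \<Rightarrow> 'a \<Rightarrow> 'a hypergraph" where
  "del_vertex G v = \<lparr>verts = verts G - {v}, edges = {e\<in>edges G. v \<notin> e}\<rparr>"

lemma r_graph_del_vertex: "r_graph r G \<Longrightarrow> r_graph r (del_vertex G v)"
  by (auto simp: r_graph_def del_vertex_def)

lemma contains_copy_del_vertex: "contains_copy (del_vertex G v) F \<Longrightarrow> contains_copy G F"
  unfolding contains_copy_def del_vertex_def by fastforce

lemma card_edges_del_vertex:
  assumes "r_graph r G"
  shows "card (edges G) = card (edges (del_vertex G v)) + deg G v"
proof -
  have "{e\<in>edges G. v \<notin> e} \<union> {e\<in>edges G. v \<in> e} = edges G" by auto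
  moreover have "card ({e\<in>edges G. v \<notin> e} \<union> {e\<in>edges G. v \<in> e}) = card {e\<in>edges G. v \<notin> e} + card {e\<in>edges G. v \<in> e}"
    using r_graphD(5)[OF assms] by (intro card_Un_disjoint) auto
  ultimately show ?thesis by (simp add: del_vertex_def deg_def)
qed

lemma card_edges_le: "r_graph r G \<Longrightarrow> card (edges G) \<le> card (verts G) choose r"
  using card_mono[of "{e. e \<subseteq> verts G \<and> card e = r}" "edges G"]
  by (auto simp: r_graph_def n_subsets)

text \<open>Deleting a vertex of small degree increases the excess over \<open>t n\<close>, and the excess at \<open>n0\<close>
  vertices is bounded.\<close>

lemma progressive_induction:
  fixes t :: "nat \<Rightarrow> nat" and \<delta> :: "nat \<Rightarrow> real" and F :: "'b hypergraph"
  assumes base: "\<And>G :: nat hypergraph. n0 \<le> card (verts G) \<Longrightarrow> r_graph r G \<Longrightarrow> \<not> contains_copy G F \<Longrightarrow>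
      (\<forall>v\<in>verts G. \<delta> (card (verts G)) \<le> deg G v) \<Longrightarrow> card (edges G) \<le> t (card (verts G))"
    and step: "\<And>n. n0 \<le> n \<Longrightarrow> t n + \<delta> (Suc n) \<le> t (Suc n)"
  shows "\<exists>N. \<forall>n\<ge>N. \<forall>G :: nat hypergraph. r_graph r G \<longrightarrow> card (verts G) = n \<longrightarrow> \<not> contains_copy G F \<longrightarrow>
      card (edges G) \<le> t n"
proof -
  \<comment> \<open>The permitted excess over \<open>t n\<close> is \<open>n0 choose r\<close> at n
    = n0 and decreases by one with each further vertex. The subtraction is truncated, so for large
    \<open>n\<close> the excess is 0.\<close>
  have main: "r_graph r G \<Longrightarrow> card (verts G) = n \<Longrightarrow> \<not> contains_copy G F \<Longrightarrow>
      card (edges G) \<le> t n + ((n0 choose r) - (n - n0))" if "n0 \<le> n" for n and G :: "nat hypergraph"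
    using that
  proof (induction n arbitrary: G rule: dec_induct)
    case base
    have "card (edges G) \<le> card (verts G) choose r" by (rule card_edges_le[OF base(1)])
    then show ?case unfolding base(2) by linarith
  next
    case (step n)
    show ?case
    proof (cases "\<forall>v\<in>verts G. \<delta> (card (verts G)) \<le> deg G v")
      case True
      then show ?thesis using assms(1)[of G] step by simp
    next
      case False
      then obtain v where v: "v \<in> verts G" "deg G v < \<delta> (Suc n)" using step by force
      have "card (edges (del_vertex G v)) \<le> t n + ((n0 choose r) - (n - n0))"
      proof (rule step.IH)
        show "r_graph r (del_vertex G v)" by (rule r_graph_del_vertex[OF step.prems(1)])
        show "card (verts (del_vertex G v)) = n" using v(1) step.prems(2) by (simp add: del_vertex_def)
        show "\<not> contains_copy (del_vertex G v) F" using step.prems(3) contains_copy_del_vertex[of G v F] by (rule contrapos_nn)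
      qed
      \<comment> \<open>Degree strictly below the threshold gives a strict inequality of naturals,
        which is the gain of one unit.\<close>
      moreover have "t n + deg G v < t (Suc n)" using assms(2)[OF step.hyps(1)] v(2) by linarith
      ultimately show ?thesis using card_edges_del_vertex[OF step.prems(1), of v] step.hyps by linarith
    qed
  qed
  show ?thesis
  proof (intro exI[of _ "n0 + (n0 choose r)"] allI impI)
    fix n and G :: "nat hypergraph"
    assume "n0 + (n0 choose r) \<le> n" "r_graph r G" "card (verts G) = n" "\<not> contains_copy G F"
    then show "card (edges G) \<le> t n" using main[of n G] by simp
  qed
qed

lemma ex_numberI:
  fixes F :: "'b hypergraph" and H :: "nat hypergraph"
  assumes le: "\<And>G :: nat hypergraph. r_graph r G \<Longrightarrow> card (verts G) = n \<Longrightarrow> \<not> contains_copy G F \<Longrightarrow> card (edges G) \<le> t"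
    and H: "r_graph r H" "card (verts H) = n" "\<not> contains_copy H F" "card (edges H) = t"
  shows "ex_number r n F = t"
  unfolding ex_number_def
proof (rule Max_eqI)
  have "{card (edges G) | G :: nat hypergraph. r_graph r G \<and> card (verts G) = n \<and> \<not> contains_copy G F} \<subseteq> {..t}"
    using le by auto
  then show "finite {card (edges G) | G :: nat hypergraph. r_graph r G \<and> card (verts G) = n \<and> \<not> contains_copy G F}"
    using finite_subset by blast
qed (use le H in auto)

section \<open>The Turan-type construction\<close>

definition bal :: "nat \<Rightarrow> nat \<Rightarrow> nat \<Rightarrow> nat" where
  "bal N q j = card (balanced_part 0 N q j)"

lemma card_balanced_part: "card (balanced_part a N q j) = bal N q j"
proof -
  have "balanced_part a N q j = (\<lambda>x. a + x) ` balanced_part 0 N q j"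
    by (auto simp: balanced_part_def)
  then show ?thesis by (simp add: bal_def card_image)
qed

lemma finite_balanced_part [simp]: "finite (balanced_part a N q j)"
  by (rule finite_subset[of _ "{a..<a + N}"]) (auto simp: balanced_part_def)

lemma disjoint_balanced_part: "disjoint_family_on (balanced_part a N q) J"
  by (auto simp: disjoint_family_on_def balanced_part_def)

lemma bal_Suc: "bal (Suc N) q j = bal N q j + (if N mod q = j then 1 else 0)"
proof -
  have "balanced_part 0 (Suc N) q j = (if N mod q = j then insert N (balanced_part 0 N q j) else balanced_part 0 N q j)"
    by (auto simp: balanced_part_def less_Suc_eq)
  moreover have "N \<notin> balanced_part 0 N q j" by (auto simp: balanced_part_def)
  ultimately show ?thesis by (simp add: bal_def)
qed

lemma sum_bal: "q > 0 \<Longrightarrow> (\<Sum>j<q. bal N q j) = N"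
proof -
  assume q: "q > 0"
  have "card (\<Union>j<q. balanced_part 0 N q j) = (\<Sum>j<q. bal N q j)"
    unfolding bal_def by (rule card_UN_disjoint) (auto simp: balanced_part_def)
  then show ?thesis using balanced_part_Union[OF q, of 0 N] by simp
qed

lemma bal_bounds:
  assumes "j < q"
  shows "N div q \<le> bal N q j" "bal N q j \<le> Suc (N div q)"
proof -
  have fl: "\<lfloor>real N / real q\<rfloor> = int (N div q)" by (rule floor_divide_of_nat_eq)
  have "\<lceil>real N / real q\<rceil> \<le> \<lfloor>real N / real q\<rfloor> + 1" "\<lfloor>real N / real q\<rfloor> \<le> \<lceil>real N / real q\<rceil>" by linarith+
  then have "int (N div q) \<le> int (bal N q j) \<and> int (bal N q j) \<le> int (N div q) + 1"
    using balanced_part_card[OF assms, of 0 N] fl by (auto simp: bal_def)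
  then show "N div q \<le> bal N q j" "bal N q j \<le> Suc (N div q)" by linarith+
qed

lemma esym_le_bal:
  assumes q: "q > 0" and s: "(\<Sum>j<q. b j) = N"
  shows "esym b {..<q} p \<le> esym (bal N q) {..<q} p"
proof (rule esym_le_balanced)
  show "sum b {..<q} = sum (bal N q) {..<q}" using s sum_bal[OF q] by simp
  show "bal N q i \<le> Suc (bal N q j)" if "i \<in> {..<q}" "j \<in> {..<q}" for i j
    using bal_bounds(1)[of j q N] bal_bounds(2)[of i q N] that by auto
qed simp

lemma card_meeting_subsets:
  assumes "finite V" "S \<subseteq> V"
  shows "card {e. e \<subseteq> V \<and> card e = r \<and> e \<inter> S \<noteq> {}} + (card (V - S) choose r) = card V choose r"
proof -
  have eq: "{e. e \<subseteq> V \<and> card e = r} = {e. e \<subseteq> V \<and> card e = r \<and> e \<inter> S \<noteq> {}} \<union> {e. e \<subseteq> V - S \<and> card e = r}"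
    by auto
  have "card {e. e \<subseteq> V \<and> card e = r} = card {e. e \<subseteq> V \<and> card e = r \<and> e \<inter> S \<noteq> {}} + card {e. e \<subseteq> V - S \<and> card e = r}"
    unfolding eq using assms by (intro card_Un_disjoint) auto
  then show ?thesis using assms by (simp add: n_subsets)
qed

definition turan_val :: "nat \<Rightarrow> nat \<Rightarrow> nat \<Rightarrow> nat \<Rightarrow> nat" where
  "turan_val r n k i = esym (bal (n - i) k) {..<k} r + ((n choose r) - ((n - i) choose r))"

lemma verts_turan: "k > 0 \<Longrightarrow> verts (turan r N k) = {..<N}"
  using balanced_part_Union[of k 0 N] by (auto simp: turan_def complete_partite_def)

lemma turan_plus_props:
  assumes "k > 0" "i \<le> n"
  shows "verts (turan_plus r n k i) = {..<n}" "r_graph r (turan_plus r n k i)"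
    "card (edges (turan_plus r n k i)) = turan_val r n k i"
proof -
  have U: "(\<Union>j<k. balanced_part 0 (n - i) k j) = {..<n - i}"
    unfolding balanced_part_Union[OF assms(1)] by auto
  show V: "verts (turan_plus r n k i) = {..<n}"
    unfolding turan_plus_def hypergraph.select_convs verts_turan[OF assms(1)] using assms(2) by auto
  have eT: "edges (turan r (n - i) k) = transversals (balanced_part 0 (n - i) k) {..<k} r"
    by (simp add: turan_def edges_complete_partite)
  have eTs: "e \<subseteq> {..<n - i} \<and> card e = r" if "e \<in> edges (turan r (n - i) k)" for e
    using that U by (auto simp: eT transversals_def)
  show "r_graph r (turan_plus r n k i)"
    unfolding r_graph_def V
  proof (intro conjI ballI)
    fix e assume "e \<in> edges (turan_plus r n k i)"
    then have "e \<in> edges (turan r (n - i) k) \<or> (e \<subseteq> {..<n} \<and> card e = r)"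
      unfolding turan_plus_def hypergraph.select_convs by blast
    then consider "e \<in> edges (turan r (n - i) k)" | "e \<subseteq> {..<n}" "card e = r" by blast
    then have "e \<subseteq> {..<n} \<and> card e = r"
    proof cases
      case 1
      have "{..<n - i} \<subseteq> {..<n}" by (rule lessThan_subset_iff[THEN iffD2]) (rule diff_le_self)
      then show ?thesis using eTs[OF 1] by (meson subset_trans)
    qed simp
    then show "e \<subseteq> {..<n}" "card e = r" by simp_all
  qed simp
  let ?M = "{e. e \<subseteq> {..<n} \<and> card e = r \<and> e \<inter> {n - i..<n} \<noteq> {}}"
  have "card (edges (turan_plus r n k i)) = card (edges (turan r (n - i) k)) + card ?M"
  proof -
    have fT: "finite (edges (turan r (n - i) k))"
      by (rule finite_subset[of _ "Pow {..<n - i}"]) (use eTs in auto)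
    have fM: "finite ?M" by (rule finite_subset[of _ "Pow {..<n}"]) auto
    have "edges (turan r (n - i) k) \<inter> ?M = {}"
    proof -
      have "e \<notin> ?M" if "e \<in> edges (turan r (n - i) k)" for e
      proof -
        have "e \<subseteq> {..<n - i}" using eTs[OF that] by simp
        then have "e \<inter> {n - i..<n} = {}" by auto
        then show ?thesis by simp
      qed
      then show ?thesis by blast
    qed
    then have "card (edges (turan r (n - i) k) \<union> ?M) = card (edges (turan r (n - i) k)) + card ?M"
      by (rule card_Un_disjoint[OF fT fM])
    then show ?thesis by (simp add: turan_plus_def)
  qed
  moreover have "card (edges (turan r (n - i) k)) = esym (bal (n - i) k) {..<k} r"
    unfolding eT by (simp add: card_transversals disjoint_balanced_part card_balanced_part)
  moreover have "card ?M = (n choose r) - ((n - i) choose r)"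
  proof -
    have "{..<n} - {n - i..<n} = {..<n - i}" using assms by auto
    moreover have "{n - i..<n} \<subseteq> {..<n}" by auto
    ultimately show ?thesis using card_meeting_subsets[of "{..<n}" "{n - i..<n}" r] by simp
  qed
  ultimately show "card (edges (turan_plus r n k i)) = turan_val r n k i" by (simp add: turan_val_def)
qed

lemma componentD:
  assumes F: "graph F" and C: "C \<in> components F"
  shows "edges C = {e\<in>edges F. e \<subseteq> verts C}" "verts C \<subseteq> verts F"
    and "v \<in> verts C \<Longrightarrow> C = induced F (connected_rel F `` {v})"
proof -
  obtain z where z: "z \<in> verts F" "C = induced F (connected_rel F `` {z})"
    using C by (auto simp: components_def quotient_def)
  show "edges C = {e\<in>edges F. e \<subseteq> verts C}" "verts C \<subseteq> verts F"
    using z by (auto simp: induced_def connected_rel_def)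
  have "sym ({(x, y). {x, y} \<in> edges F}\<^sup>*)" by (intro sym_rtrancl) (auto simp: sym_def insert_commute)
  then have sym: "(x, y) \<in> {(x, y). {x, y} \<in> edges F}\<^sup>* \<Longrightarrow> (y, x) \<in> {(x, y). {x, y} \<in> edges F}\<^sup>*" for x y
    by (auto simp: sym_def)
  assume v: "v \<in> verts C"
  have "connected_rel F `` {z} = connected_rel F `` {v}"
    using v z sym by (auto simp: induced_def connected_rel_def intro: rtrancl_trans)
  then show "C = induced F (connected_rel F `` {v})" using z by simp
qed

text \<open>A component of chromatic number k + 1, taken with its new vertices, cannot avoid the
  \<open>i\<close> added vertices, as otherwise the parts of the Turan hypergraph would colour it
  with \<open>k\<close> colours. Different components use different added vertices, and there are
  more than \<open>i\<close> such components.\<close>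

lemma turan_plus_free:
  fixes F :: "'a hypergraph"
  assumes F: "graph F" and r: "2 \<le> r" and k: "k > 0" and i: "i \<le> n"
    and K: "i < card {C \<in> components F. chromatic_number C = k + 1}"
  shows "\<not> contains_copy (turan_plus r n k i) (expansion r F)"
proof
  assume "contains_copy (turan_plus r n k i) (expansion r F)"
  then obtain f where inj: "inj_on f (verts (expansion r F))"
    and fE: "\<And>e. e \<in> edges (expansion r F) \<Longrightarrow> f ` e \<in> edges (turan_plus r n k i)"
    unfolding contains_copy_def by blast
  define K where "K = {C \<in> components F. chromatic_number C = k + 1}"
  define X where "X C = Inl ` verts C \<union> Inr ` (edges C \<times> {..<r - 2})" for C :: "'a hypergraph"
  have XV: "X C \<subseteq> verts (expansion r F)" if "C \<in> K" for C
    using componentD[OF F, of C] that by (auto simp: X_def expansion_def K_def)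
  have ex: "\<exists>p\<in>X C. f p \<in> {n - i..<n}" if C: "C \<in> K" for C
  proof (rule ccontr)
    assume none: "\<not> ?thesis"
    have CC: "C \<in> components F" "chromatic_number C = k + 1" using C by (auto simp: K_def)
    \<comment> \<open>Parts are residue classes, so this is the colouring that the embedding
      induces.\<close>
    define c where "c u = f (Inl u) mod k" for u
    have "c u \<noteq> c v" if uv: "{u, v} \<in> edges C" for u v
    proof
      assume eq: "c u = c v"
      define e where "e = Inl ` {u, v} \<union> Inr ` ({{u, v}} \<times> {..<r - 2})"
      have uvF: "{u, v} \<in> edges F" using uv componentD(1)[OF F CC(1)] by auto
      have uvC: "{u, v} \<subseteq> verts C" using uv componentD(1)[OF F CC(1)] by auto
      have eX: "e \<subseteq> X C" using uv uvC by (auto simp: e_def X_def)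
      have "e \<in> edges (expansion r F)" unfolding e_def expansion_def hypergraph.select_convs
        by (rule image_eqI[where x = "{u, v}", OF refl uvF])
      from fE[OF this] have "f ` e \<in> edges (turan r (n - i) k)"
        using none eX by (auto simp: turan_plus_def)
      then have tr: "f ` e \<in> transversals (balanced_part 0 (n - i) k) {..<k} r"
        by (simp add: turan_def edges_complete_partite)
      have uve: "f (Inl u) \<in> f ` e" "f (Inl v) \<in> f ` e" by (auto simp: e_def)
      have lt: "f (Inl u) < n - i" "f (Inl v) < n - i"
        using tr uve by (auto simp: transversals_def balanced_part_def)
      have "f (Inl u) = f (Inl v)"
      proof (rule transversals_memD[OF tr _ _ uve])
        show "finite (f ` e)" by (simp add: e_def)
        show "c u \<in> {..<k}" using k by (simp add: c_def)
        show "f (Inl u) \<in> balanced_part 0 (n - i) k (c u)" "f (Inl v) \<in> balanced_part 0 (n - i) k (c u)"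
          using lt eq by (auto simp: balanced_part_def c_def)
      qed
      moreover have "Inl u \<in> verts (expansion r F)" "Inl v \<in> verts (expansion r F)"
        using XV[OF C] uvC by (auto simp: X_def)
      ultimately have "u = v" using inj by (auto simp: inj_on_def)
      then show False using uvF F by (auto simp: r_graph_def)
    qed
    then have "proper_coloring C k c" using k by (auto simp: proper_coloring_def c_def)
    then have "chromatic_number C \<le> k"
      unfolding chromatic_number_def by (intro Least_le) blast
    then show False using CC by simp
  qed
  then obtain p where p: "\<And>C. C \<in> K \<Longrightarrow> p C \<in> X C \<and> f (p C) \<in> {n - i..<n}" by metis
  have "inj_on (\<lambda>C. f (p C)) K"
  proof (rule inj_onI)
    fix C C' assume CC: "C \<in> K" "C' \<in> K" "f (p C) = f (p C')"
    have m: "p C \<in> X C" "p C' \<in> X C'" using p CC by auto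
    then have pe: "p C = p C'" using inj XV CC by (auto simp: inj_on_def)
    have comps: "C \<in> components F" "C' \<in> components F" using CC by (auto simp: K_def)
    have "\<exists>v. v \<in> verts C \<and> v \<in> verts C'"
    proof (cases "p C")
      case (Inl v)
      then show ?thesis using m pe by (auto simp: X_def)
    next
      case (Inr q)
      then obtain e j where e: "e \<in> edges C" "e \<in> edges C'" using m pe by (auto simp: X_def)
      then have "e \<in> edges F" "e \<subseteq> verts C" "e \<subseteq> verts C'" using componentD(1)[OF F] comps by auto
      moreover obtain x y where "e = {x, y}" using graph_edgeE[OF F \<open>e \<in> edges F\<close>] by metis
      ultimately show ?thesis by auto
    qed
    then show "C = C'" using componentD(3)[OF F comps(1)] componentD(3)[OF F comps(2)] by metis
  qed
  then have "card K \<le> card {n - i..<n}" using p by (intro card_inj_on_le) auto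
  then show False using K i by (simp add: K_def)
qed

section \<open>The construction for two cliques\<close>

definition H_val :: "nat \<Rightarrow> nat \<Rightarrow> nat \<Rightarrow> nat \<Rightarrow> nat" where
  "H_val r n k m = esym (\<lambda>j. if j = 0 then m - 1 else bal (n - m) (k - 1) (j - 1)) {..<k} r
     + ((n - m) choose (r - 1)) + ((n - 2) choose (r - 2))"

definition H_part :: "nat \<Rightarrow> nat \<Rightarrow> nat \<Rightarrow> nat \<Rightarrow> nat set" where
  "H_part n k m j = (if j = 0 then {..<m} else balanced_part m (n - m) (k - 1) (j - 1))"

lemma H_part_Union:
  assumes "2 \<le> k" "m \<le> n"
  shows "(\<Union>j<k. H_part n k m j) = {..<n}"
proof -
  have "(\<Union>j<k. H_part n k m j) = {..<m} \<union> (\<Union>j<k - 1. balanced_part m (n - m) (k - 1) j)"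
  proof (intro equalityI subsetI)
    fix x assume "x \<in> {..<m} \<union> (\<Union>j<k - 1. balanced_part m (n - m) (k - 1) j)"
    then consider "x < m" | j where "j < k - 1" "x \<in> balanced_part m (n - m) (k - 1) j" by auto
    then show "x \<in> (\<Union>j<k. H_part n k m j)"
    proof cases
      case 1
      then show ?thesis using assms by (intro UN_I[of 0]) (auto simp: H_part_def)
    next
      case 2
      then show ?thesis by (intro UN_I[of "Suc j"]) (auto simp: H_part_def)
    qed
  next
    fix x assume "x \<in> (\<Union>j<k. H_part n k m j)"
    then obtain j where j: "j < k" "x \<in> H_part n k m j" by auto
    then show "x \<in> {..<m} \<union> (\<Union>j<k - 1. balanced_part m (n - m) (k - 1) j)"
      by (cases j) (auto simp: H_part_def)
  qed
  also have "\<dots> = {..<n}" using balanced_part_Union[of "k - 1" m "n - m"] assms by auto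
  finally show ?thesis .
qed

lemma H_part_disjoint: "disjoint_family_on (H_part n k m) {..<k}"
  unfolding disjoint_family_on_def
proof (intro ballI impI)
  fix i j assume "i \<in> {..<k}" "j \<in> {..<k}" "i \<noteq> j"
  then show "H_part n k m i \<inter> H_part n k m j = {}"
    by (cases i; cases j) (auto simp: H_part_def balanced_part_def)
qed

lemma H_prime_edges:
  assumes "2 \<le> k" "m \<le> n"
  shows "edges (H_prime r n k m) = transversals (H_part n k m) {..<k} r
     \<union> {e. e \<subseteq> {..<n} \<and> card e = r \<and> 0 \<in> e \<and> 1 \<in> e}
     \<union> {e. e \<subseteq> {..<n} \<and> card e = r \<and> 0 \<in> e \<and> card (e \<inter> {m..<n}) = r - 1}"
  by (simp add: H_prime_def H_base_def edges_complete_partite H_part_def[abs_def])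

text \<open>The summands of \<open>H_val\<close> count, in this order, the hyperedges avoiding u =
  0, which are transversal to the parts with u removed; those containing u but not v = 1, whose
  other vertices all lie outside \<open>V_1\<close>; and those containing both u and v.\<close>

lemma H_prime_props:
  assumes k: "2 \<le> k" and m: "2 \<le> m" "m \<le> n" and r: "2 \<le> r"
  shows "verts (H_prime r n k m) = {..<n}" "r_graph r (H_prime r n k m)"
    "card (edges (H_prime r n k m)) = H_val r n k m"
proof -
  show V: "verts (H_prime r n k m) = {..<n}"
    using H_part_Union[OF k m(2)] by (simp add: H_prime_def H_base_def complete_partite_def H_part_def[abs_def])
  show "r_graph r (H_prime r n k m)"
    unfolding r_graph_def V H_prime_edges[OF k m(2)] using H_part_Union[OF k m(2)] by (auto simp: transversals_def)
  let ?P = "H_part n k m"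
  define P' where "P' = ?P(0 := {1..<m})"
  define A where "A = transversals P' {..<k} r"
  define B where "B = {e. e \<subseteq> {..<n} \<and> card e = r \<and> {0, 1} \<subseteq> e}"
  define C where "C = insert 0 ` {f. f \<subseteq> {m..<n} \<and> card f = r - 1}"
  have P'P: "P' j \<subseteq> ?P j" for j by (auto simp: P'_def H_part_def)
  have P'z: "0 \<notin> P' j" if "j < k" for j
    using m by (auto simp: P'_def H_part_def balanced_part_def)
  have P'ne: "x \<in> P' j \<longleftrightarrow> x \<in> ?P j \<and> x \<noteq> 0" for x j
    using m by (auto simp: P'_def H_part_def balanced_part_def)
  have eq: "edges (H_prime r n k m) = A \<union> B \<union> C"
  proof (intro equalityI subsetI)
    fix e assume e: "e \<in> edges (H_prime r n k m)"
    have er: "e \<subseteq> {..<n}" "card e = r" "finite e"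
      using e r_graphD[OF \<open>r_graph r (H_prime r n k m)\<close>] V by auto
    show "e \<in> A \<union> B \<union> C"
    proof (cases "0 \<in> e")
      case False
      then have tr: "e \<in> transversals ?P {..<k} r" using e by (auto simp: H_prime_edges[OF k m(2)])
      have "e \<in> A" unfolding A_def
      proof (rule transversals_memI[OF er(3,2)])
        show "e \<subseteq> (\<Union>j<k. P' j)"
        proof
          fix x assume x: "x \<in> e"
          then obtain j where "j < k" "x \<in> ?P j" using tr by (auto simp: transversals_def)
          then show "x \<in> (\<Union>j<k. P' j)" using P'ne x False by (metis UN_I lessThan_iff)
        qed
        show "x = y" if "j \<in> {..<k}" "x \<in> e" "y \<in> e" "x \<in> P' j" "y \<in> P' j" for j x y
          using transversals_memD[OF tr er(3) that(1-3)] that P'P by blast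
      qed
      then show ?thesis by blast
    next
      case z: True
      show ?thesis
      proof (cases "1 \<in> e")
        case True
        then show ?thesis using z er by (auto simp: B_def)
      next
        case False
        have "e - {0} \<subseteq> {m..<n}"
        proof (cases "e \<in> transversals ?P {..<k} r")
          case True
          show ?thesis
          proof
            fix x assume x: "x \<in> e - {0}"
            have "\<not> x < m"
            proof
              assume "x < m"
              have "x = 0"
                by (rule transversals_memD[OF True er(3), of 0]) (use x z k m \<open>x < m\<close> in \<open>auto simp: H_part_def\<close>)
              then show False using x by simp
            qed
            then show "x \<in> {m..<n}" using x er by auto
          qed
        next
          case False
          then have c: "card (e \<inter> {m..<n}) = r - 1" using e \<open>1 \<notin> e\<close> by (auto simp: H_prime_edges[OF k m(2)])
          have "e \<inter> {m..<n} \<subseteq> e - {0}" using m by auto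
          moreover have "card (e - {0}) = r - 1" using er z by simp
          ultimately have "e \<inter> {m..<n} = e - {0}" using c er by (intro card_subset_eq) auto
          then show ?thesis by blast
        qed
        moreover have "card (e - {0}) = r - 1" "insert 0 (e - {0}) = e" using er z by auto
        ultimately show ?thesis unfolding C_def by (intro UnI2 image_eqI[of _ _ "e - {0}"]) auto
      qed
    qed
  next
    fix e assume "e \<in> A \<union> B \<union> C"
    then consider "e \<in> A" | "e \<in> B" | "e \<in> C" by blast
    then show "e \<in> edges (H_prime r n k m)"
    proof cases
      case 1
      then have ee: "e \<subseteq> (\<Union>j<k. P' j)" "card e = r" by (auto simp: A_def transversals_def)
      have sub: "(\<Union>j<k. P' j) \<subseteq> {..<n}" using P'P H_part_Union[OF k m(2)] by blast
      then have fe: "finite e" using ee finite_subset[of e "{..<n}"] by blast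
      have z: "0 \<notin> e" using ee P'z by blast
      have "e \<in> transversals ?P {..<k} r"
      proof (rule transversals_memI[OF fe ee(2)])
        show "e \<subseteq> (\<Union>j<k. ?P j)" using ee(1) P'P by blast
        show "x = y" if "j \<in> {..<k}" "x \<in> e" "y \<in> e" "x \<in> ?P j" "y \<in> ?P j" for j x y
        proof -
          have "x \<noteq> 0" "y \<noteq> 0" using that z by metis+
          then have "x \<in> P' j" "y \<in> P' j" using P'ne that by blast+
          then show ?thesis using transversals_memD[of e P' "{..<k}" r j x y] 1 fe that by (auto simp: A_def)
        qed
      qed
      then show ?thesis by (simp add: H_prime_edges[OF k m(2)])
    next
      case 2
      then show ?thesis by (auto simp: H_prime_edges[OF k m(2)] B_def)
    next
      case 3
      then obtain f where f: "e = insert 0 f" "f \<subseteq> {m..<n}" "card f = r - 1" by (auto simp: C_def)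
      have "0 \<notin> f" using f m by auto
      moreover have "finite f" using f(2) finite_subset by blast
      moreover have "e \<inter> {m..<n} = f" using f m by auto
      ultimately have "e \<subseteq> {..<n}" "card e = r" "0 \<in> e" "card (e \<inter> {m..<n}) = r - 1" using f m r by auto
      then show ?thesis by (simp add: H_prime_edges[OF k m(2)])
    qed
  qed
  have fin: "finite A" "finite B" "finite C"
  proof -
    have f: "finite (\<Union>j<k. P' j)" by (auto simp: P'_def H_part_def)
    show "finite A" by (rule finite_subset[of _ "Pow (\<Union>j<k. P' j)"]) (use f in \<open>auto simp: A_def transversals_def\<close>)
    show "finite B" by (rule finite_subset[of _ "Pow {..<n}"]) (auto simp: B_def)
    have "finite {f. f \<subseteq> {m..<n} \<and> card f = r - 1}" by simp
    then show "finite C" unfolding C_def by (rule finite_imageI)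
  qed
  have dj: "A \<inter> (B \<union> C) = {}" "B \<inter> C = {}"
  proof -
    have "0 \<notin> e" if "e \<in> A" for e using that P'z by (auto simp: A_def transversals_def)
    then show "A \<inter> (B \<union> C) = {}" by (auto simp: B_def C_def)
    have "1 \<notin> e" if "e \<in> C" for e using that m by (auto simp: C_def)
    then show "B \<inter> C = {}" by (auto simp: B_def)
  qed
  have "card (edges (H_prime r n k m)) = card A + (card B + card C)"
    unfolding eq Un_assoc using fin dj by (simp add: card_Un_disjoint)
  moreover have "card A = esym (\<lambda>j. if j = 0 then m - 1 else bal (n - m) (k - 1) (j - 1)) {..<k} r"
  proof -
    have "card A = esym (\<lambda>j. card (P' j)) {..<k} r" unfolding A_def
    proof (rule card_transversals)
      show "finite (P' j)" for j by (auto simp: P'_def H_part_def)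
      show "disjoint_family_on P' {..<k}"
        unfolding disjoint_family_on_def
      proof (intro ballI impI)
        fix i j assume "i \<in> {..<k}" "j \<in> {..<k}" "i \<noteq> j"
        then have "?P i \<inter> ?P j = {}" using H_part_disjoint[of n k m] unfolding disjoint_family_on_def by blast
        then show "P' i \<inter> P' j = {}" using P'P[of i] P'P[of j] by blast
      qed
    qed simp
    also have "\<dots> = esym (\<lambda>j. if j = 0 then m - 1 else bal (n - m) (k - 1) (j - 1)) {..<k} r"
      by (intro esym_cong) (auto simp: P'_def H_part_def card_balanced_part)
    finally show ?thesis .
  qed
  moreover have "card B = (n - 2) choose (r - 2)"
  proof -
    have "bij_betw (\<lambda>f. f \<union> {0, 1}) {f. f \<subseteq> {2..<n} \<and> card f = r - 2} B"
    proof (rule bij_betw_byWitness[where f' = "\<lambda>e. e - {0, 1}"])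
      have c: "card (f \<union> {0, 1}) = r" if "f \<subseteq> {2..<n}" "card f = r - 2" for f
      proof -
        have "finite f" using that(1) finite_subset by blast
        moreover have "f \<inter> {0, 1} = {}" using that(1) by auto
        ultimately have "card (f \<union> {0, 1}) = card f + card {0, 1 :: nat}" by (intro card_Un_disjoint) auto
        then show ?thesis using that r by simp
      qed
      show "(\<lambda>f. f \<union> {0, 1}) ` {f. f \<subseteq> {2..<n} \<and> card f = r - 2} \<subseteq> B"
        using c m by (auto simp: B_def)
      show "(\<lambda>e. e - {0, 1}) ` B \<subseteq> {f. f \<subseteq> {2..<n} \<and> card f = r - 2}"
      proof clarify
        fix e assume e: "e \<in> B"
        then have fe: "finite e" using finite_subset[of e "{..<n}"] by (auto simp: B_def)
        have "card (e - {0, 1}) = card e - card {0, 1 :: nat}" using e by (intro card_Diff_subset) (auto simp: B_def)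
        moreover have "e - {0, 1} \<subseteq> {2..<n}"
        proof
          fix x assume "x \<in> e - {0, 1}"
          then have "x < n" "x \<noteq> 0" "x \<noteq> 1" using e by (auto simp: B_def)
          then show "x \<in> {2..<n}" by auto
        qed
        ultimately show "e - {0, 1} \<subseteq> {2..<n} \<and> card (e - {0, 1}) = r - 2" using e by (simp add: B_def)
      qed
    qed (auto simp: B_def)
    then have "card {f. f \<subseteq> {2..<n} \<and> card f = r - 2} = card B" by (rule bij_betw_same_card)
    then have "card B = card {f. f \<subseteq> {2..<n} \<and> card f = r - 2}" by simp
    also have "\<dots> = (n - 2) choose (r - 2)" by (subst n_subsets) auto
    finally show ?thesis .
  qed
  moreover have "card C = (n - m) choose (r - 1)"
  proof -
    have "inj_on (insert 0) {f. f \<subseteq> {m..<n} \<and> card f = r - 1}"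
    proof (rule inj_onI, clarify)
      fix f g assume a: "f \<subseteq> {m..<n}" "g \<subseteq> {m..<n}" "insert 0 f = insert 0 g"
      have "0 \<notin> f" "0 \<notin> g" using a m by auto
      then show "f = g" using a(3) by (metis insert_ident)
    qed
    then show ?thesis by (simp add: C_def card_image n_subsets)
  qed
  ultimately show "card (edges (H_prime r n k m)) = H_val r n k m" by (simp add: H_val_def)
qed

lemma H_extremal_props:
  assumes k: "2 \<le> k" and n: "2 \<le> n" and r: "2 \<le> r"
  shows "\<exists>m. 2 \<le> m \<and> m \<le> n \<and> H_extremal r n k = H_prime r n k m \<and> card (edges (H_extremal r n k)) = H_val r n k m"
    "2 \<le> m \<Longrightarrow> m \<le> n \<Longrightarrow> H_val r n k m \<le> card (edges (H_extremal r n k))"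
proof -
  define f where "f m = card (edges (H_prime r n k m))" for m
  define M where "M = (ARG_MAX f m. 2 \<le> m \<and> m \<le> n)"
  have fv: "f m = H_val r n k m" if "2 \<le> m" "m \<le> n" for m
    using H_prime_props(3)[OF k that r] by (simp add: f_def)
  have "\<forall>m. 2 \<le> m \<and> m \<le> n \<longrightarrow> f m < Suc (n choose r)"
    using card_edges_le[OF H_prime_props(2)[OF k _ _ r]] H_prime_props(1)[OF k _ _ r]
    by (simp add: f_def less_Suc_eq_le)
  then have M: "(2 \<le> M \<and> M \<le> n) \<and> (\<forall>m. 2 \<le> m \<and> m \<le> n \<longrightarrow> f m \<le> f M)"
    unfolding M_def using n by (intro arg_max_nat_lemma[of _ 2]) auto
  have H: "H_extremal r n k = H_prime r n k M" by (simp add: H_extremal_def M_def f_def[abs_def])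
  show "\<exists>m. 2 \<le> m \<and> m \<le> n \<and> H_extremal r n k = H_prime r n k m \<and> card (edges (H_extremal r n k)) = H_val r n k m"
    using M H fv[of M] by (intro exI[of _ M]) (simp add: f_def)
  show "H_val r n k m \<le> card (edges (H_extremal r n k))" if "2 \<le> m" "m \<le> n"
  proof -
    have "f m \<le> f M" using M that by blast
    then show ?thesis using fv[OF that] H by (simp add: f_def)
  qed
qed

text \<open>Hyperedges avoiding u = 0 are transversal, so neither clique can be embedded without u.
  The two expanded cliques share only the vertex \<open>k\<close>, which is therefore mapped to u.
  The other \<open>k\<close> vertices of each clique then occupy all \<open>k\<close> parts, and the
  one in \<open>V_1\<close> is joined to u by a hyperedge that must contain v = 1. So v would also
  be the image of the shared vertex.\<close>

lemma H_prime_free: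
  assumes k: "2 \<le> k" and m: "2 \<le> m" "m \<le> n" and r: "2 \<le> r"
  shows "\<not> contains_copy (H_prime r n k m) (expansion r (two_cliques k))"
proof
  assume "contains_copy (H_prime r n k m) (expansion r (two_cliques k))"
  then obtain f where inj: "inj_on f (verts (expansion r (two_cliques k)))"
    and fE: "\<And>e. e \<in> edges (expansion r (two_cliques k)) \<Longrightarrow> f ` e \<in> edges (H_prime r n k m)"
    unfolding contains_copy_def by blast
  define idx where "idx x = (if x < m then 0 else Suc ((x - m) mod (k - 1)))" for x
  have idx: "idx x < k \<and> x \<in> H_part n k m (idx x)" if "x < n" for x
  proof (cases "x < m")
    case True
    then show ?thesis using k by (simp add: idx_def H_part_def)
  next
    case False
    have "(x - m) mod (k - 1) < k - 1" using k by (intro mod_less_divisor) simp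
    then have ik: "idx x < k" using False by (simp add: idx_def)
    have "x = m + (x - m)" "x - m < n - m" using False that by auto
    then have "x \<in> balanced_part m (n - m) (k - 1) ((x - m) mod (k - 1))"
      unfolding balanced_part_def by (intro CollectI exI[of _ "x - m"]) simp
    then show ?thesis using False ik by (simp add: idx_def H_part_def)
  qed
  define hy where "hy a b = Inl ` {a, b} \<union> Inr ` ({{a, b}} \<times> {..<r - 2})" for a b :: nat
  define X where "X c = Inl ` c \<union> Inr ` ({e. e \<subseteq> c \<and> card e = 2} \<times> {..<r - 2})" for c :: "nat set"
  define cl where "cl = {{0..k}, {k..2 * k}}"
  have XV: "X c \<subseteq> verts (expansion r (two_cliques k))" if "c \<in> cl" for c
    using that by (auto simp: X_def cl_def expansion_def two_cliques_def)
  have hyX: "hy a b \<subseteq> X c" if "a \<in> c" "b \<in> c" "a \<noteq> b" for a b c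
    using that by (auto simp: hy_def X_def)
  have hyE: "f ` hy a b \<in> edges (H_prime r n k m)" if "c \<in> cl" "a \<in> c" "b \<in> c" "a \<noteq> b" for a b c
  proof (rule fE)
    have "{a, b} \<in> edges (two_cliques k)" using that by (auto simp: cl_def two_cliques_def)
    then show "hy a b \<in> edges (expansion r (two_cliques k))"
      unfolding hy_def expansion_def hypergraph.select_convs
      by (rule image_eqI[where x = "{a, b}", OF refl])
  qed
  have cl: "card c = k + 1" "k \<in> c" "finite c" if "c \<in> cl" for c using that by (auto simp: cl_def)
  have part: "idx (f (Inl a)) \<noteq> idx (f (Inl b))" "f (Inl a) < n"
    if c: "c \<in> cl" "a \<in> c" "b \<in> c" "a \<noteq> b" and z: "0 \<notin> f ` hy a b" for a b c
  proof -
    have tr: "f ` hy a b \<in> transversals (H_part n k m) {..<k} r"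
      using hyE[OF c] z by (auto simp: H_prime_edges[OF k m(2)])
    have ab: "f (Inl a) \<in> f ` hy a b" "f (Inl b) \<in> f ` hy a b" by (auto simp: hy_def)
    then have lt: "f (Inl a) < n" "f (Inl b) < n"
      using tr H_part_Union[OF k m(2)] by (auto simp: transversals_def)
    then show "f (Inl a) < n" by simp
    show "idx (f (Inl a)) \<noteq> idx (f (Inl b))"
    proof
      assume "idx (f (Inl a)) = idx (f (Inl b))"
      then have "f (Inl a) = f (Inl b)"
        using idx[OF lt(1)] idx[OF lt(2)]
        by (intro transversals_memD[OF tr _ _ ab, of "idx (f (Inl a))"]) (auto simp: hy_def)
      moreover have "Inl a \<in> verts (expansion r (two_cliques k))" "Inl b \<in> verts (expansion r (two_cliques k))"
        using XV[OF c(1)] c by (auto simp: X_def)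
      ultimately show False using inj c(4) by (auto simp: inj_on_def)
    qed
  qed
  have zero: "0 \<in> f ` X c" if c: "c \<in> cl" for c
  proof (rule ccontr)
    assume z: "0 \<notin> f ` X c"
    have z': "0 \<notin> f ` hy a b" if "a \<in> c" "b \<in> c" "a \<noteq> b" for a b using z hyX[OF that] by blast
    have "inj_on (\<lambda>a. idx (f (Inl a))) c"
      using part(1)[OF c] z' by (auto simp: inj_on_def)
    moreover have "(\<lambda>a. idx (f (Inl a))) ` c \<subseteq> {..<k}"
    proof
      fix i assume "i \<in> (\<lambda>a. idx (f (Inl a))) ` c"
      then obtain a where a: "a \<in> c" "i = idx (f (Inl a))" by auto
      obtain b where b: "b \<in> c" "a \<noteq> b"
      proof -
        have "\<not> c \<subseteq> {a}" using cl[OF c] card_mono[of "{a}" c] k by auto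
        then show ?thesis using that by blast
      qed
      then have "f (Inl a) < n" using part(2)[OF c a(1) b] z' a by blast
      then show "i \<in> {..<k}" using idx a by simp
    qed
    ultimately have "card c \<le> card {..<k}" by (intro card_inj_on_le) auto
    then show False using cl[OF c] by simp
  qed
  have int: "X {0..k} \<inter> X {k..2 * k} = {Inl k}"
  proof -
    have no: False if e: "e \<subseteq> {0..k}" "e \<subseteq> {k..2 * k}" "card e = 2" for e
    proof -
      have "e \<subseteq> {0..k} \<inter> {k..2 * k}" using e(1,2) by blast
      also have "\<dots> = {k}" by auto
      finally have "card e \<le> 1" using card_mono[of "{k}" e] by simp
      then show False using e(3) by simp
    qed
    show ?thesis
    proof (intro equalityI subsetI)
      fix p assume p: "p \<in> X {0..k} \<inter> X {k..2 * k}"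
      show "p \<in> {Inl k}"
      proof (cases p)
        case (Inl a)
        then show ?thesis using p by (auto simp: X_def)
      next
        case (Inr q)
        then obtain e i where "q = (e, i)" by (cases q)
        then have "e \<subseteq> {0..k}" "e \<subseteq> {k..2 * k}" "card e = 2" using Inr p by (auto simp: X_def)
        then show ?thesis using no by blast
      qed
    qed (auto simp: X_def)
  qed
  have shared: "p = Inl k" if "p \<in> X {0..k}" "p' \<in> X {k..2 * k}" "f p = f p'" for p p'
  proof -
    have "p \<in> verts (expansion r (two_cliques k))" "p' \<in> verts (expansion r (two_cliques k))"
      using that XV by (auto simp: cl_def)
    then have "p = p'" using inj that(3) by (auto simp: inj_on_def)
    then show ?thesis using int that by blast
  qed
  obtain p p' where p: "p \<in> X {0..k}" "f p = 0" "p' \<in> X {k..2 * k}" "f p' = 0"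
    using zero[of "{0..k}"] zero[of "{k..2 * k}"] by (auto simp: cl_def image_iff)
  then have fk: "f (Inl k) = 0" using shared[of p p'] by simp
  have one: "1 \<in> f ` X c" if c: "c \<in> cl" for c
  proof -
    have z: "0 \<notin> f ` hy a b" if ab: "a \<in> c - {k}" "b \<in> c - {k}" "a \<noteq> b" for a b
    proof
      assume "0 \<in> f ` hy a b"
      then obtain q where q: "q \<in> hy a b" "f q = f (Inl k)" using fk by auto
      have "q \<in> X c" using hyX[of a c b] ab q by auto
      moreover have "Inl k \<in> X c" using cl(2)[OF c] by (simp add: X_def)
      ultimately have "q = Inl k" using inj_onD[OF inj q(2)] XV[OF c] by blast
      then show False using q ab by (auto simp: hy_def)
    qed
    have inj': "inj_on (\<lambda>a. idx (f (Inl a))) (c - {k})"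
    proof (rule inj_onI, rule ccontr)
      fix a b assume "a \<in> c - {k}" "b \<in> c - {k}" "idx (f (Inl a)) = idx (f (Inl b))" "a \<noteq> b"
      then show False using part(1)[OF c, of a b] z[of a b] by blast
    qed
    have other: "\<exists>b. b \<in> c - {k} \<and> a \<noteq> b" for a
    proof -
      have "\<not> c - {k} \<subseteq> {a}" using cl[OF c] card_mono[of "{a}" "c - {k}"] k by auto
      then show ?thesis by blast
    qed
    have im: "(\<lambda>a. idx (f (Inl a))) ` (c - {k}) \<subseteq> {..<k}"
    proof
      fix i assume "i \<in> (\<lambda>a. idx (f (Inl a))) ` (c - {k})"
      then obtain a where a: "a \<in> c - {k}" "i = idx (f (Inl a))" by auto
      obtain b where b: "b \<in> c - {k}" "a \<noteq> b" using other by blast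
      then have "f (Inl a) < n" using part(2)[OF c, of a b] z a by blast
      then show "i \<in> {..<k}" using idx a by simp
    qed
    have "card ((\<lambda>a. idx (f (Inl a))) ` (c - {k})) = k" using inj' cl[OF c] by (simp add: card_image)
    then have "(\<lambda>a. idx (f (Inl a))) ` (c - {k}) = {..<k}" using im by (intro card_subset_eq) auto
    then have "0 \<in> (\<lambda>a. idx (f (Inl a))) ` (c - {k})" using k by simp
    then obtain a where a': "0 = idx (f (Inl a))" "a \<in> c - {k}" by (rule imageE)
    then have a: "a \<in> c - {k}" "idx (f (Inl a)) = 0" by simp_all
    then have am: "f (Inl a) < m" by (auto simp: idx_def split: if_splits)
    have a0: "f (Inl a) \<noteq> 0"
    proof
      assume "f (Inl a) = 0"
      moreover have "Inl a \<in> X c" "Inl k \<in> X c" using a cl(2)[OF c] by (auto simp: X_def)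
      ultimately have "Inl a = (Inl k :: nat + nat set \<times> nat)"
        using fk inj_onD[OF inj, of "Inl a" "Inl k"] XV[OF c] by auto
      then show False using a by simp
    qed
    define E where "E = f ` hy k a"
    have E: "E \<in> edges (H_prime r n k m)" unfolding E_def using hyE[OF c cl(2)[OF c]] a by auto
    have mem: "0 \<in> E" "f (Inl a) \<in> E" "finite E" using fk by (auto simp: E_def hy_def image_iff intro: rev_bexI)
    have "1 \<in> E"
    proof (rule ccontr)
      assume n1: "1 \<notin> E"
      have "E \<notin> transversals (H_part n k m) {..<k} r"
      proof
        assume tr: "E \<in> transversals (H_part n k m) {..<k} r"
        have "0 = f (Inl a)" by (rule transversals_memD[OF tr mem(3), of 0]) (use mem am m k in \<open>auto simp: H_part_def\<close>)
        then show False using a0 by simp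
      qed
      then have c1: "card (E \<inter> {m..<n}) = r - 1" "card E = r" using E n1 by (auto simp: H_prime_edges[OF k m(2)])
      \<comment> \<open>Besides u a second vertex of \<open>E\<close> lies in \<open>V_1\<close>, so
        at most r-2 vertices of \<open>E\<close> lie outside it.\<close>
      have "E \<inter> {m..<n} \<subseteq> E - {0, f (Inl a)}" using m am by auto
      then have "card (E \<inter> {m..<n}) \<le> card (E - {0, f (Inl a)})" using mem by (intro card_mono) auto
      also have "\<dots> = r - 2" using mem a0 c1 by (subst card_Diff_subset) auto
      finally show False using c1 r by simp
    qed
    moreover have "E \<subseteq> f ` X c" unfolding E_def using hyX[OF cl(2)[OF c], of a] a by auto
    ultimately show ?thesis by blast
  qed
  obtain q q' where q: "q \<in> X {0..k}" "f q = 1" "q' \<in> X {k..2 * k}" "f q' = 1"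
    using one[of "{0..k}"] one[of "{k..2 * k}"] by (auto simp: cl_def image_iff)
  then have "f (Inl k) = 1" using shared[of q q'] by simp
  then show False using fk by simp
qed

section \<open>Matchings of hyperedges\<close>

text \<open>Only the terms 0 and \<open>p\<close>, respectively 0, 1 and \<open>p\<close>, of
  Vandermonde's convolution are kept; the lower bounds on \<open>p\<close> make them
  distinct.\<close>

lemma choose_add_ge:
  fixes x m p :: nat
  shows "1 \<le> p \<Longrightarrow> (x choose p) + (m choose p) \<le> (m + x) choose p"
    and "2 \<le> p \<Longrightarrow> (x choose p) + m * (x choose (p - 1)) + (m choose p) \<le> (m + x) choose p"
proof -
  have v: "(\<Sum>i\<in>I. (m choose i) * (x choose (p - i))) \<le> (m + x) choose p" if "I \<subseteq> {0..p}" for I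
    unfolding vandermonde[of m x p, symmetric, folded atLeast0AtMost] using that
    by (intro sum_mono2) (auto simp: atLeast0AtMost)
  show "1 \<le> p \<Longrightarrow> (x choose p) + (m choose p) \<le> (m + x) choose p"
    using v[of "{0, p}"] by simp
  show "2 \<le> p \<Longrightarrow> (x choose p) + m * (x choose (p - 1)) + (m choose p) \<le> (m + x) choose p"
    using v[of "{0, 1, p}"] by simp
qed

section \<open>Growth of the Turan-type counts\<close>

lemma turan_step:
  assumes "0 < k"
  shows "esym (bal (Suc N) k) {..<k} (Suc p) = esym (bal N k) {..<k} (Suc p) + esym (bal N k) ({..<k} - {N mod k}) p"
proof -
  \<comment> \<open>The new vertex \<open>N\<close> joins its residue class, and all other classes
    stay the same.\<close>
  let ?j = "N mod k"
  have j: "?j \<in> {..<k}" using assms by simp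
  have c: "esym (bal (Suc N) k) ({..<k} - {?j}) q = esym (bal N k) ({..<k} - {?j}) q" for q
    by (intro esym_cong) (auto simp: bal_Suc)
  have b: "bal (Suc N) k ?j = Suc (bal N k ?j)" by (simp add: bal_Suc)
  show ?thesis
    using esym_remove[OF _ j, of "bal (Suc N) k" p] esym_remove[OF _ j, of "bal N k" p]
    by (simp add: c b algebra_simps)
qed

lemma div_ge: "k > 0 \<Longrightarrow> real n / k - 1 \<le> real (n div k)"
proof -
  assume k: "k > 0"
  have "n div k * k + n mod k \<le> n div k * k + k" using mod_less_divisor[OF k, of n] by linarith
  then have "n \<le> n div k * k + k" by (simp only: div_mult_mod_eq)
  from of_nat_mono[OF this, where 'a = real] have "real n \<le> real (n div k) * k + k" by (simp only: of_nat_add of_nat_mult)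
  then show ?thesis using k by (simp add: field_simps)
qed

text \<open>Rounding down, the shift \<open>i\<close> and the passage from n to n + 1 change the
  base only by a factor close to 1; Bernoulli's inequality carries this over to the power.\<close>

lemma div_power_ge:
  fixes \<epsilon> :: real
  assumes k: "0 < k" and \<epsilon>: "0 < \<epsilon>" "\<epsilon> \<le> 1"
  shows "\<exists>n0. \<forall>n\<ge>n0. (1 - \<epsilon>) * (real (Suc n) / k) ^ p \<le> real ((n - i) div k) ^ p"
proof -
  define e where "e = \<epsilon> / Suc p"
  have e: "e > 0" "e \<le> 1" using \<epsilon> by (auto simp: e_def field_simps)
  define n0 where "n0 = i + nat \<lceil>(i + 1 + k) / e\<rceil>"
  show ?thesis
  proof (intro exI[of _ n0] allI impI)
    fix n assume n: "n0 \<le> n"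
    have "(i + 1 + k) / e \<le> n" using n unfolding n0_def by linarith
    then have ne: "i + 1 + k \<le> e * n" using e by (simp add: field_simps)
    have "(1 - e) * real (Suc n) \<le> real n - i - k"
      using ne e by (simp add: algebra_simps)
    then have "(1 - e) * real (Suc n) / k \<le> (real n - i - k) / k" by (rule divide_right_mono) simp
    also have "\<dots> = real (n - i) / k - 1" using n k by (simp add: n0_def of_nat_diff field_simps)
    also have "\<dots> \<le> real ((n - i) div k)" by (rule div_ge[OF k])
    finally have 1: "(1 - e) * (real (Suc n) / k) \<le> real ((n - i) div k)" by simp
    have "1 + p * (- e) \<le> (1 + (- e)) ^ p" using e by (intro Bernoulli_inequality) auto
    moreover have "p * e \<le> \<epsilon>" using \<epsilon> by (simp add: e_def field_simps)
    ultimately have "1 - \<epsilon> \<le> (1 - e) ^ p" by simp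
    then have "(1 - \<epsilon>) * (real (Suc n) / k) ^ p \<le> (1 - e) ^ p * (real (Suc n) / k) ^ p" by (intro mult_right_mono) auto
    also have "\<dots> = ((1 - e) * (real (Suc n) / k)) ^ p" by (simp only: power_mult_distrib)
    also have "\<dots> \<le> real ((n - i) div k) ^ p" using e by (intro power_mono 1) auto
    finally show "(1 - \<epsilon>) * (real (Suc n) / k) ^ p \<le> real ((n - i) div k) ^ p" .
  qed
qed

text \<open>A binomial coefficient of order n^p eventually beats every error term of order n^(p-1).
  The final comparisons take their large n from here.\<close>

lemma choose_dominates:
  fixes c :: real
  assumes k: "0 < k" and p: "1 \<le> p"
  shows "\<exists>n0. \<forall>n\<ge>n0. c * real n ^ (p - 1) \<le> real (((n - i) div k) choose p)"
proof -
  define q where "q = real (2 * k * p)"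
  have q: "q > 0" using k p by (simp add: q_def)
  define n0 where "n0 = 2 * (i + k) + 2 * k * p + nat \<lceil>c * q ^ p\<rceil>"
  show ?thesis
  proof (intro exI[of _ n0] allI impI)
    fix n assume n: "n0 \<le> n"
    define a where "a = (n - i) div k"
    have in': "i \<le> n" using n by (simp add: n0_def)
    have "2 * (i + k) \<le> n0" "2 * k * p \<le> n0" "nat \<lceil>c * q ^ p\<rceil> \<le> n0" by (simp_all add: n0_def)
    then have nn: "2 * (i + k) \<le> n" "2 * k * p \<le> n" "nat \<lceil>c * q ^ p\<rceil> \<le> n" using n by simp_all
    have "2 * (real i + k) \<le> n" using of_nat_mono[OF nn(1), where 'a = real] by simp
    then have "real n / 2 \<le> real (n - i) - k" using in' by (simp add: of_nat_diff)
    then have "real n / 2 / k \<le> (real (n - i) - k) / k" by (rule divide_right_mono) simp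
    also have "\<dots> = real (n - i) / k - 1" using k by (simp add: field_simps)
    also have "\<dots> \<le> a" unfolding a_def by (rule div_ge[OF k])
    finally have 1: "real n / (2 * k) \<le> a" by simp
    have "real (2 * k * p) \<le> n" using of_nat_mono[OF nn(2), where 'a = real] .
    then have "p \<le> real n / (2 * k)" using k by (simp add: field_simps)
    then have "p \<le> a" using 1 by linarith
    then have 2: "(real a / p) ^ p \<le> real (a choose p)" by (rule binomial_ge_n_over_k_pow_k)
    have "real n / q = (real n / (2 * k)) / p" by (simp add: q_def)
    also have "\<dots> \<le> real a / p" using 1 by (rule divide_right_mono) simp
    finally have "(real n / q) ^ p \<le> (real a / p) ^ p" using q by (intro power_mono) auto
    then have 3: "(real n / q) ^ p \<le> real (a choose p)" using 2 by linarith
    have "c * q ^ p \<le> n" using nn(3) by linarith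
    then have "c * q ^ p * real n ^ (p - 1) \<le> n * real n ^ (p - 1)" by (rule mult_right_mono) simp
    also have "\<dots> = real n ^ p" using p by (simp add: power_eq_if)
    finally have "c * real n ^ (p - 1) \<le> (real n / q) ^ p" using q by (simp add: power_divide field_simps)
    then show "c * real n ^ (p - 1) \<le> real (((n - i) div k) choose p)" using 3 by (simp add: a_def)
  qed
qed

text \<open>The step condition of \<open>progressive_induction\<close>. A vertex added to the Turan
  part lies in at least (k-1 choose r-1) (N div k)^(r-1) transversal hyperedges, where N = n - i,
  and the number of hyperedges meeting the \<open>i\<close> full vertices does not decrease.\<close>

lemma turan_val_step_n:
  fixes \<epsilon> :: real
  assumes r: "2 \<le> r" "r \<le> k" and \<epsilon>: "0 < \<epsilon>" "\<epsilon> \<le> 1"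
  shows "\<exists>n0. \<forall>n\<ge>n0. real (turan_val r n k i) + (1 - \<epsilon>) * real ((k - 1) choose (r - 1)) * (real (Suc n) / k) ^ (r - 1)
     \<le> real (turan_val r (Suc n) k i)"
proof -
  have k: "0 < k" using r by simp
  obtain n1 where n1: "\<forall>n\<ge>n1. (1 - \<epsilon>) * (real (Suc n) / k) ^ (r - 1) \<le> real ((n - i) div k) ^ (r - 1)"
    using div_power_ge[OF k \<epsilon>, of "r - 1" i] by blast
  show ?thesis
  proof (intro exI[of _ "n1 + i"] allI impI)
    fix n assume n: "n1 + i \<le> n"
    obtain p where p: "r = Suc p" using r by (cases r) auto
    define N where "N = n - i"
    have SN: "Suc n - i = Suc N" using n by (simp add: N_def Suc_diff_le)
    have e: "((k - 1) choose p) * (N div k) ^ p \<le> esym (bal N k) ({..<k} - {N mod k}) p"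
    proof -
      have "((k - 1) choose p) * (N div k) ^ p = esym (\<lambda>_. N div k) ({..<k} - {N mod k}) p"
        using k by (simp add: esym_const)
      also have "\<dots> \<le> esym (bal N k) ({..<k} - {N mod k}) p"
        by (intro esym_mono) (auto intro: bal_bounds)
      finally show ?thesis .
    qed
    have b: "(N choose Suc p) \<le> n choose Suc p" "(N choose p) \<le> n choose p"
      by (auto simp: N_def intro!: binomial_right_mono)
    have "turan_val r n k i + ((k - 1) choose p) * (N div k) ^ p \<le> turan_val r (Suc n) k i"
      using e b turan_step[OF k, of N p] unfolding turan_val_def SN p N_def[symmetric]
      by (simp only: binomial_Suc_Suc)
    from of_nat_mono[OF this, where 'a = real]
    have "turan_val r n k i + real ((k - 1) choose p) * real (N div k) ^ p \<le> turan_val r (Suc n) k i" by simp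
    moreover have "real ((k - 1) choose p) * ((1 - \<epsilon>) * (real (Suc n) / k) ^ p) \<le> real ((k - 1) choose p) * real (N div k) ^ p"
      using n1 n by (intro mult_left_mono) (auto simp: N_def p)
    ultimately show "real (turan_val r n k i) + (1 - \<epsilon>) * real ((k - 1) choose (r - 1)) * (real (Suc n) / k) ^ (r - 1)
     \<le> real (turan_val r (Suc n) k i)" unfolding p by (simp add: mult.assoc mult.left_commute)
  qed
qed

text \<open>Turning a vertex of the Turan part into a full vertex replaces its transversal link by
  all (r-1)-sets. The gain includes the (r-1)-sets inside its own former part.\<close>

lemma turan_val_step_i:
  assumes k: "0 < k" and r: "2 \<le> r" and i: "i < n"
  shows "turan_val r n k i + (((n - Suc i) div k) choose (r - 1)) \<le> turan_val r n k (Suc i)"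
proof -
  obtain p where p: "r = Suc p" "1 \<le> p" using r by (cases r) auto
  define N where "N = n - Suc i"
  have SN: "n - i = Suc N" using i by (simp add: N_def)
  let ?j = "N mod k"
  have j: "?j \<in> {..<k}" using k by simp
  define x where "x = (\<Sum>j\<in>{..<k} - {?j}. bal N k j)"
  have xb: "bal N k ?j + x = N" using sum_bal[OF k, of N] j unfolding x_def by (simp add: sum.remove)
  have "esym (bal N k) ({..<k} - {?j}) p + ((N div k) choose p) \<le> (x choose p) + (bal N k ?j choose p)"
    unfolding x_def using j by (intro add_mono esym_le_binomial binomial_right_mono bal_bounds) auto
  also have "\<dots> \<le> N choose p" using choose_add_ge(1)[OF p(2), of x "bal N k ?j"] xb by simp
  finally have 1: "esym (bal N k) ({..<k} - {?j}) p + ((N div k) choose p) \<le> N choose p" .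
  have 2: "(Suc N choose Suc p) \<le> n choose Suc p" using i by (intro binomial_right_mono) (simp add: N_def)
  show ?thesis
    using 1 2 turan_step[OF k, of N p] unfolding turan_val_def SN N_def[symmetric] p(1)
    by (simp only: binomial_Suc_Suc diff_Suc_1)
qed

lemma turan_val_mono:
  assumes "0 < k" "2 \<le> r" "i \<le> j" "j \<le> n"
  shows "turan_val r n k i \<le> turan_val r n k j"
  using assms(3,4)
proof (induction j rule: dec_induct)
  case (step j)
  then show ?case using turan_val_step_i[OF assms(1,2), of j n] by simp
qed simp

section \<open>Matchings and vertices of large degree\<close>

definition matching :: "'a set set \<Rightarrow> bool" where
  "matching M \<longleftrightarrow> (\<forall>e\<in>M. \<forall>e'\<in>M. e \<noteq> e' \<longrightarrow> e \<inter> e' = {})"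

lemma matching_subset: "matching M \<Longrightarrow> M' \<subseteq> M \<Longrightarrow> matching M'"
  unfolding matching_def by blast

lemma matching_insert:
  assumes "matching M" "\<And>e'. e' \<in> M \<Longrightarrow> e' \<inter> e = {}"
  shows "matching (insert e M)"
  unfolding matching_def
proof (intro ballI impI)
  fix a b assume "a \<in> insert e M" "b \<in> insert e M" "a \<noteq> b"
  then consider "a = e" "b \<in> M" | "b = e" "a \<in> M" | "a \<in> M" "b \<in> M" by auto
  then show "a \<inter> b = {}"
    using assms \<open>a \<noteq> b\<close> by cases (auto simp: matching_def Int_commute)
qed

lemma exists_edge_avoiding:
  assumes G: "r_graph r G" and r: "2 \<le> r" and v: "v \<in> verts G" and Z: "finite Z" "v \<notin> Z" "card Z \<le> L"
    and big: "L * card (verts G) ^ (r - 2) < deg G v"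
  shows "\<exists>e\<in>edges G. v \<in> e \<and> e \<inter> Z = {}"
proof (rule ccontr)
  assume none: "\<not> ?thesis"
  have "{e\<in>edges G. v \<in> e} \<subseteq> {e\<in>edges G. v \<in> e \<and> (\<exists>y\<in>e. y \<noteq> v \<and> y \<in> Z \<inter> verts G)}"
  proof
    fix e assume "e \<in> {e\<in>edges G. v \<in> e}"
    then have e: "e \<in> edges G" "v \<in> e" by auto
    then obtain y where y: "y \<in> e" "y \<in> Z" using none by auto
    then have "y \<noteq> v" "y \<in> verts G" using Z(2) r_graphD(2)[OF G e(1)] by auto
    then show "e \<in> {e\<in>edges G. v \<in> e \<and> (\<exists>y\<in>e. y \<noteq> v \<and> y \<in> Z \<inter> verts G)}" using e y by auto
  qed
  then have "deg G v \<le> card {e\<in>edges G. v \<in> e \<and> (\<exists>y\<in>e. y \<noteq> v \<and> y \<in> Z \<inter> verts G)}"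
    unfolding deg_def using r_graphD(5)[OF G] by (intro card_mono) auto
  also have "\<dots> \<le> card (Z \<inter> verts G) * card (verts G) ^ (r - 2)"
    using v by (intro card_edges_meeting_le[OF G r]) auto
  also have "\<dots> \<le> L * card (verts G) ^ (r - 2)"
    using Z card_mono[OF Z(1), of "Z \<inter> verts G"] by (intro mult_le_mono1) auto
  finally show False using big by simp
qed

text \<open>The vertices of \<open>S\<close> are served one after another. The budget r + 1 per
  vertex pays for the vertex itself, which the other hyperedges must avoid, and for the
  \<open>r\<close> vertices of its hyperedge.\<close>

lemma greedy_matching:
  assumes G: "r_graph r G" and r: "2 \<le> r"
    and S: "finite S" "S \<subseteq> verts G" "\<And>v. v \<in> S \<Longrightarrow> L * card (verts G) ^ (r - 2) < deg G v"
    and W: "finite W" "W \<inter> S = {}" "card W + (r + 1) * card S \<le> L"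
  shows "\<exists>g. \<forall>v\<in>S. g v \<in> edges G \<and> v \<in> g v \<and> g v \<inter> W = {} \<and> (\<forall>u\<in>S. u \<noteq> v \<longrightarrow> g u \<inter> g v = {})"
  using S W
proof (induction S arbitrary: W rule: finite_induct)
  case (insert v S)
  have "card (W \<union> S) \<le> L" using card_Un_le[of W S] insert.prems(5) insert.hyps by simp
  moreover have "v \<in> verts G" "v \<notin> W \<union> S" "finite (W \<union> S)" "L * card (verts G) ^ (r - 2) < deg G v"
    using insert.prems insert.hyps by auto
  ultimately have "\<exists>e\<in>edges G. v \<in> e \<and> e \<inter> (W \<union> S) = {}" by (intro exists_edge_avoiding[OF G r])
  then obtain e where e: "e \<in> edges G" "v \<in> e" "e \<inter> (W \<union> S) = {}" by blast
  have fe: "finite e" "card e = r" using r_graphD[OF G] e(1) by auto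
  have "\<exists>g. \<forall>v\<in>S. g v \<in> edges G \<and> v \<in> g v \<and> g v \<inter> (W \<union> e) = {} \<and> (\<forall>u\<in>S. u \<noteq> v \<longrightarrow> g u \<inter> g v = {})"
  proof (rule insert.IH)
    show "(W \<union> e) \<inter> S = {}" using insert.prems e by auto
    show "card (W \<union> e) + (r + 1) * card S \<le> L" using card_Un_le[of W e] fe insert.prems(5) insert.hyps by simp
  qed (use insert.prems fe in auto)
  then obtain g where g: "\<forall>v\<in>S. g v \<in> edges G \<and> v \<in> g v \<and> g v \<inter> (W \<union> e) = {} \<and> (\<forall>u\<in>S. u \<noteq> v \<longrightarrow> g u \<inter> g v = {})"
    by (rule exE)
  define h where "h = g(v := e)"
  have hS: "h u = g u" if "u \<in> S" for u using that insert.hyps by (auto simp: h_def)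
  have hv: "h v = e" by (simp add: h_def)
  have gu: "g u \<in> edges G" "u \<in> g u" "g u \<inter> W = {}" "g u \<inter> e = {}" if "u \<in> S" for u using g that by blast+
  have gg: "g u \<inter> g u' = {}" if "u \<in> S" "u' \<in> S" "u \<noteq> u'" for u u' using g that by blast
  have eW: "e \<inter> W = {}" using e by blast
  have 1: "h u \<in> edges G \<and> u \<in> h u \<and> h u \<inter> W = {}" if "u \<in> insert v S" for u
  proof (cases "u = v")
    case True
    then show ?thesis using hv e(1,2) eW by simp
  next
    case False
    then have uS: "u \<in> S" using that by simp
    show ?thesis using hS[OF uS] gu(1-3)[OF uS] by simp
  qed
  have 2: "h u \<inter> h u' = {}" if "u \<in> insert v S" "u' \<in> insert v S" "u \<noteq> u'" for u u'
  proof -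
    consider "u = v" "u' \<in> S" | "u' = v" "u \<in> S" | "u \<in> S" "u' \<in> S" using \<open>u \<in> insert v S\<close> \<open>u' \<in> insert v S\<close> \<open>u \<noteq> u'\<close> by auto
    then show ?thesis
    proof cases
      case 1
      then show ?thesis using hS hv gu(4)[of u'] by auto
    next
      case 2
      then show ?thesis using hS hv gu(4)[of u] by auto
    next
      case 3
      then show ?thesis using hS gg \<open>u \<noteq> u'\<close> by simp
    qed
  qed
  show ?case
  proof (rule exI[of _ h], intro ballI)
    fix u assume u: "u \<in> insert v S"
    show "h u \<in> edges G \<and> u \<in> h u \<and> h u \<inter> W = {} \<and> (\<forall>u'\<in>insert v S. u' \<noteq> u \<longrightarrow> h u' \<inter> h u = {})"
      using 1[OF u] 2[OF _ u] by simp
  qed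
qed auto

text \<open>Vertices of degree above L n^(r-2) extend greedily to disjoint hyperedges, even when one
  given hyperedge must be avoided. So there are at most \<open>b\<close> of them, and if there are
  exactly \<open>b\<close>, every hyperedge meets them. In general the hyperedges avoiding
  \<open>S\<close> are covered by the at most r b vertices of a largest matching among them, all of
  small degree.\<close>

lemma matching_structure:
  assumes G: "r_graph r G" and r: "2 \<le> r"
    and nm: "\<And>M. M \<subseteq> edges G \<Longrightarrow> matching M \<Longrightarrow> card M \<noteq> Suc b"
    and L: "r + (r + 1) * Suc b \<le> L"
  defines "S \<equiv> {v\<in>verts G. L * card (verts G) ^ (r - 2) < deg G v}"
  shows "card S \<le> b" "card S = b \<Longrightarrow> e \<in> edges G \<Longrightarrow> e \<inter> S \<noteq> {}"
    "card {e\<in>edges G. e \<inter> S = {}} \<le> r * b * (L * card (verts G) ^ (r - 2))"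
proof -
  have fin: "finite (verts G)" "finite (edges G)" "finite S" using r_graphD[OF G] by (auto simp: S_def)
  have gm: "\<exists>M\<subseteq>edges G. matching M \<and> card M = card S0 \<and> (\<forall>e\<in>M. e \<inter> W = {})"
    if S0: "S0 \<subseteq> S" and W: "finite W" "W \<inter> S0 = {}" "card W \<le> r" "card S0 \<le> Suc b" for S0 W
  proof -
    have "card W + (r + 1) * card S0 \<le> r + (r + 1) * Suc b" using W by (intro add_mono mult_le_mono2) auto
    then have cL: "card W + (r + 1) * card S0 \<le> L" using L by linarith
    have "\<exists>g. \<forall>v\<in>S0. g v \<in> edges G \<and> v \<in> g v \<and> g v \<inter> W = {} \<and> (\<forall>u\<in>S0. u \<noteq> v \<longrightarrow> g u \<inter> g v = {})"
      using S0 fin by (intro greedy_matching[OF G r _ _ _ W(1,2) cL]) (auto simp: S_def intro: finite_subset)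
    then obtain g where g: "\<And>v. v \<in> S0 \<Longrightarrow> g v \<in> edges G \<and> v \<in> g v \<and> g v \<inter> W = {}"
      "\<And>u v. u \<in> S0 \<Longrightarrow> v \<in> S0 \<Longrightarrow> u \<noteq> v \<Longrightarrow> g u \<inter> g v = {}" by blast
    have "inj_on g S0" by (rule inj_onI, rule ccontr) (use g in blast)
    then have "card (g ` S0) = card S0" by (rule card_image)
    moreover have "matching (g ` S0)" unfolding matching_def
    proof (intro ballI impI)
      fix e e' assume "e \<in> g ` S0" "e' \<in> g ` S0" "e \<noteq> e'"
      then obtain u v where "u \<in> S0" "v \<in> S0" "u \<noteq> v" "e = g u" "e' = g v" by auto
      then show "e \<inter> e' = {}" using g(2) by simp
    qed
    moreover have "g ` S0 \<subseteq> edges G" "\<forall>e\<in>g ` S0. e \<inter> W = {}" using g(1) by auto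
    ultimately show ?thesis by blast
  qed
  show le: "card S \<le> b"
  proof (rule ccontr)
    assume "\<not> card S \<le> b"
    then obtain S0 where "S0 \<subseteq> S" "card S0 = Suc b" by (meson not_less_eq_eq obtain_subset_with_card_n)
    then show False using gm[of S0 "{}"] nm by auto
  qed
  show "e \<inter> S \<noteq> {}" if cS: "card S = b" and e: "e \<in> edges G"
  proof
    assume eS: "e \<inter> S = {}"
    have "\<exists>M\<subseteq>edges G. matching M \<and> card M = card S \<and> (\<forall>e'\<in>M. e' \<inter> e = {})"
      using cS eS r_graphD(3,4)[OF G e] by (intro gm) auto
    then obtain M where M: "M \<subseteq> edges G" "matching M" "card M = b" "\<forall>e'\<in>M. e' \<inter> e = {}"
      using cS by blast
    have ne: "e \<noteq> {}" using r_graphD(3)[OF G e] r by auto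
    then have "e \<notin> M" using M by auto
    moreover have "finite M" using M fin finite_subset by blast
    ultimately have "card (insert e M) = Suc b" using M by simp
    moreover have "matching (insert e M)" using M(2,4) by (intro matching_insert) auto
    ultimately show False using nm[of "insert e M"] M e by auto
  qed
  show "card {e\<in>edges G. e \<inter> S = {}} \<le> r * b * (L * card (verts G) ^ (r - 2))"
  proof -
    let ?B = "{e\<in>edges G. e \<inter> S = {}}"
    have "card M < Suc (card ?B)" if "M \<subseteq> ?B \<and> matching M" for M
      using that fin by (auto simp: less_Suc_eq_le intro!: card_mono)
    then obtain M where M: "M \<subseteq> ?B \<and> matching M" and mx: "\<And>M'. M' \<subseteq> ?B \<and> matching M' \<Longrightarrow> card M' \<le> card M"
      using ex_has_greatest_nat[of "\<lambda>M. M \<subseteq> ?B \<and> matching M" "{}" card "Suc (card ?B)"]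
      by (auto simp: matching_def)
    have finM: "finite M" using M fin finite_subset[of M "edges G"] by auto
    have cM: "card M \<le> b"
    proof (rule ccontr)
      assume "\<not> card M \<le> b"
      then obtain M0 where "M0 \<subseteq> M" "card M0 = Suc b" by (meson not_less_eq_eq obtain_subset_with_card_n)
      moreover have "matching M0" using M \<open>M0 \<subseteq> M\<close> matching_subset by blast
      ultimately show False using nm[of M0] M by auto
    qed
    have hit: "\<exists>v\<in>\<Union>M. v \<in> e" if e: "e \<in> ?B" for e
    proof (rule ccontr)
      assume none: "\<not> ?thesis"
      have "e \<noteq> {}" using r_graphD(3)[OF G, of e] e r by auto
      then have "e \<notin> M" using none by blast
      then have "card (insert e M) = Suc (card M)" using finM by simp
      moreover have "e' \<inter> e = {}" if "e' \<in> M" for e' using none that by blast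
      then have "matching (insert e M)" using M by (intro matching_insert) auto
      ultimately show False using mx[of "insert e M"] M e by auto
    qed
    have MU: "\<Union>M \<subseteq> verts G - S"
    proof
      fix v assume "v \<in> \<Union>M"
      then obtain e where e: "e \<in> M" "v \<in> e" by blast
      then have "e \<in> edges G" "e \<inter> S = {}" using M by auto
      then show "v \<in> verts G - S" using e r_graphD(2)[OF G, of e] by blast
    qed
    have finU: "finite (\<Union>M)" by (rule finite_subset[OF MU]) (use fin in simp)
    have "?B \<subseteq> (\<Union>v\<in>\<Union>M. {e\<in>edges G. v \<in> e})"
    proof
      fix e assume e: "e \<in> ?B"
      obtain v where "v \<in> \<Union>M" "v \<in> e" using hit[OF e] by (rule bexE)
      then show "e \<in> (\<Union>v\<in>\<Union>M. {e\<in>edges G. v \<in> e})" using e by (intro UN_I[of v]) auto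
    qed
    then have "card ?B \<le> card (\<Union>v\<in>\<Union>M. {e\<in>edges G. v \<in> e})"
      using fin(2) finU by (intro card_mono finite_UN_I) simp_all
    also have "\<dots> \<le> (\<Sum>v\<in>\<Union>M. card {e\<in>edges G. v \<in> e})"
      by (rule card_UN_le[OF finU])
    also have "\<dots> \<le> (\<Sum>v\<in>\<Union>M. L * card (verts G) ^ (r - 2))"
    proof (rule sum_mono)
      fix v assume "v \<in> \<Union>M"
      then have "v \<in> verts G" "v \<notin> S" using MU by auto
      then show "card {e\<in>edges G. v \<in> e} \<le> L * card (verts G) ^ (r - 2)" by (simp add: S_def deg_def)
    qed
    also have "\<dots> = card (\<Union>M) * (L * card (verts G) ^ (r - 2))" by simp
    also have "\<dots> \<le> r * b * (L * card (verts G) ^ (r - 2))"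
    proof (rule mult_le_mono1)
      have "card (\<Union>M) \<le> (\<Sum>e\<in>M. card e)" by (rule card_Union_le_sum_card)
      also have "\<dots> = (\<Sum>e\<in>M. r)" using M r_graphD(3)[OF G] by (intro sum.cong) auto
      also have "\<dots> \<le> r * b" using cM by simp
      finally show "card (\<Union>M) \<le> r * b" .
    qed
    finally show ?thesis .
  qed
qed

section \<open>Graphs with critical components\<close>

lemma critical_upper_bound:
  fixes F :: "'a hypergraph"
  assumes cd: "critical_decomposition F k K cmp cx cy col"
    and r: "2 \<le> r" "r \<le> k" and s: "card K = s" "1 \<le> s"
  shows "\<exists>N. \<forall>n\<ge>N. \<forall>G :: nat hypergraph. r_graph r G \<longrightarrow> card (verts G) = n \<longrightarrow>
    \<not> contains_copy G (expansion r F) \<longrightarrow> card (edges G) \<le> turan_val r n k (s - 1)"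
proof -
  interpret critical_decomposition F k K cmp cx cy col by (rule cd)
  define f where "f = card (verts F)"
  define w where "w = f + r * card (edges F)"
  \<comment> \<open>Blow-ups need room for \<open>F\<close> besides the set \<open>W\<close>, which
    is made of centres and hyperedges, \<open>s\<close> in all, and so has at most r s
    vertices.\<close>
  define t where "t = f + r * s + s + 1"
  \<comment> \<open>Parts have at least (1/k - \<gamma>) n = (f + 3) \<gamma> n vertices, while an
    embedding needs f + 2 times the defect \<gamma> n plus a constant.\<close>
  define \<gamma> where "\<gamma> = 1 / (real k * (real f + 4))"
  have k: "2 \<le> k" "0 < k" using r by auto
  have t1: "1 \<le> t" by (simp add: t_def)
  have kf: "0 < real k * (real f + 4)" using k by (intro mult_pos_pos) auto
  have "real k * 1 \<le> real k * (real f + 4)" by (intro mult_left_mono) auto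
  then have "\<gamma> \<le> 1 / real k" unfolding \<gamma>_def using k kf by (intro divide_left_mono) auto
  then have \<gamma>: "0 < \<gamma>" "\<gamma> \<le> 1 / real k" using kf by (simp_all add: \<gamma>_def)
  have \<gamma>f: "(real f + 4) * \<gamma> = 1 / real k" using k kf by (simp add: \<gamma>_def)
  define c0 where "c0 = s - 1"
  from structure_lemma[OF r t1 \<gamma>, where w = w and ?c0.0 = c0 and 'a = nat]
  obtain \<epsilon>' \<beta> n1 where \<epsilon>': "0 < \<epsilon>'" and \<beta>: "0 < \<beta>" and struct:
    "\<forall>G :: nat hypergraph. r_graph r G \<longrightarrow> n1 \<le> card (verts G) \<longrightarrow>
    (\<forall>v\<in>verts G. (1 - \<epsilon>') * real ((k - 1) choose (r - 1)) * (real (card (verts G)) / real k) ^ (r - 1) \<le> real (deg G v)) \<longrightarrow>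
    card {v\<in>verts G. has_blowup (robust w G) (nbh (robust w G) (verts G) v) k t} \<le> c0 \<longrightarrow>
    (\<exists>P X S. S = {v\<in>verts G. has_blowup (robust w G) (nbh (robust w G) (verts G) v) k t} \<and>
      disjoint_family_on P {..<k} \<and> X \<inter> (\<Union>i<k. P i) = {} \<and> X \<union> (\<Union>i<k. P i) = verts G - S \<and>
      (\<forall>i<k. (1 / real k - \<gamma>) * real (card (verts G)) \<le> real (card (P i))) \<and>
      (\<forall>i<k. \<forall>j<k. i \<noteq> j \<longrightarrow> (\<forall>x\<in>P i. real (card (P j - nbh (robust w G) (verts G) x)) \<le> \<gamma> * real (card (verts G)))) \<and>
      (\<forall>v\<in>X. \<beta> * real (card (verts G)) ^ (r - 1) \<le> real (card {e\<in>edges G. v \<in> e \<and> e \<inter> S = {} \<and> bad k P e}) \<and>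
        (\<exists>i<k. real (card (nbh (robust w G) (verts G) v)) \<le> real (card (verts G)) - real (card (P i)) - \<beta> * real (card (verts G)))))"
    by (elim exE conjE)
  define \<epsilon> where "\<epsilon> = min \<epsilon>' 1"
  have \<epsilon>: "0 < \<epsilon>" "\<epsilon> \<le> 1" "\<epsilon> \<le> \<epsilon>'" using \<epsilon>' by (auto simp: \<epsilon>_def)
  define \<delta> where "\<delta> n = (1 - \<epsilon>) * real ((k - 1) choose (r - 1)) * (real n / k) ^ (r - 1)" for n :: nat
  obtain n2 where n2: "\<forall>n\<ge>n2. real (turan_val r n k (s - 1)) + \<delta> (Suc n) \<le> real (turan_val r (Suc n) k (s - 1))"
    using turan_val_step_n[OF r \<epsilon>(1,2), of "s - 1"] unfolding \<delta>_def by (rule exE)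
  define L where "L = r + (r + 1) * Suc s"
  obtain n3 where n3: "\<forall>n\<ge>n3. real (r * s * L) * real n ^ (r - 1 - 1) \<le> real (((n - s) div k) choose (r - 1))"
  proof -
    have "1 \<le> r - 1" using r by simp
    from choose_dominates[OF k(2) this, where c = "real (r * s * L)" and i = s] show ?thesis
      by (rule exE) (rule that)
  qed
  define n0 where "n0 = n1 + n2 + n3 + s + Suc (nat \<lceil>(f + r * s + 1) / \<gamma>\<rceil>) + nat \<lceil>L / \<beta>\<rceil>"
  show ?thesis
  proof (rule progressive_induction[where ?n0.0 = n0 and \<delta> = \<delta>])
    show "real (turan_val r n k (s - 1)) + \<delta> (Suc n) \<le> real (turan_val r (Suc n) k (s - 1))" if "n0 \<le> n" for n
      using n2 that by (simp add: n0_def)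
  next
    fix G :: "nat hypergraph"
    assume big: "n0 \<le> card (verts G)" and G: "r_graph r G" and free: "\<not> contains_copy G (expansion r F)"
      and md: "\<forall>v\<in>verts G. \<delta> (card (verts G)) \<le> real (deg G v)"
    define V where "V = verts G"
    define n where "n = card V"
    define D where "D = robust w G"
    define S where "S = {v\<in>V. has_blowup D (nbh D V v) k t}"
    have bign: "n1 \<le> n" "n3 \<le> n" "s < n" using big by (auto simp: n0_def n_def V_def)
    have fin: "finite V" "finite (edges G)" "finite S" using r_graphD[OF G] by (auto simp: V_def S_def)
    have SV: "S \<subseteq> V" by (auto simp: S_def)
    have wF: "card (verts F) + r * card (edges F) \<le> w" by (simp add: w_def f_def)
    have "\<exists>A. (\<forall>i<k. A i \<subseteq> nbh D V v \<and> card (A i) = t) \<and> (\<forall>i<k. \<forall>j<k. i \<noteq> j \<longrightarrow> (\<forall>x\<in>A i. \<forall>y\<in>A j. D x y))"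
      if "v \<in> S" for v using that by (simp add: S_def has_blowup_def)
    then obtain bl where bl: "\<And>v. v \<in> S \<Longrightarrow> (\<forall>i<k. bl v i \<subseteq> nbh D V v \<and> card (bl v i) = t) \<and>
        (\<forall>i<k. \<forall>j<k. i \<noteq> j \<longrightarrow> (\<forall>x\<in>bl v i. \<forall>y\<in>bl v j. D x y))" by metis
    have bl1: "bl v i \<subseteq> nbh D V v \<and> card (bl v i) = t" if "v \<in> S" "i < k" for v i using bl[OF that(1)] that(2) by blast
    have bl2: "D x y" if "v \<in> S" "i < k" "j < k" "i \<noteq> j" "x \<in> bl v i" "y \<in> bl v j" for v i j x y
      using bl[OF that(1)] that(2-) by blast
    \<comment> \<open>With \<open>s\<close> vertices in \<open>S\<close>, every critical component
      could be centred at one of them.\<close>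
    have cS: "card S \<le> c0"
    proof (rule ccontr)
      assume "\<not> card S \<le> c0"
      then have "s \<le> card S" using s by (simp add: c0_def)
      then obtain S0 where S0: "S0 \<subseteq> S" "card S0 = s" by (meson obtain_subset_with_card_n)
      have fS0: "finite S0" using S0 fin finite_subset by blast
      obtain cen where cen: "bij_betw cen K S0"
        using finite_same_card_bij[OF finite_K fS0] S0 s by auto
      have cenS: "cen C \<in> S" if "C \<in> K" for C using cen S0 that by (auto simp: bij_betw_def)
      \<comment> \<open>No partition is available at this point; components of chromatic number at
        most \<open>k\<close> are placed in the blow-up of one centre.\<close>
      obtain C0 where C0: "C0 \<in> K" using s by (metis card.empty ex_in_conv not_one_le_zero)
      have "contains_copy G (expansion r F)"
      proof (rule contains_expansion_critical[OF G r(1) wF, where ?K1.0 = K and ?K2.0 = "{}" and W = S0 and t = t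
            and cen = cen and A = "\<lambda>C. bl (cen C)" and Q = "bl (cen C0)" and B = 0])
        show "inj_on cen K" "cen ` K \<subseteq> S0" using cen by (auto simp: bij_betw_def)
        show "card (verts F) + card S0 < t" using S0 by (simp add: t_def f_def)
        show "cen C \<in> verts G" if "C \<in> K" for C using cenS[OF that] SV by (auto simp: V_def)
        show "bl (cen C) i \<subseteq> nbh (robust w G) (verts G) (cen C) \<and> card (bl (cen C) i) = t" if "C \<in> K" "i < k" for C i
          using bl1[OF cenS[OF that(1)] that(2)] by (simp add: D_def V_def)
        show "robust w G a b" if "C \<in> K" "i < k" "j < k" "i \<noteq> j" "a \<in> bl (cen C) i" "b \<in> bl (cen C) j" for C i j a b
          using bl2[OF cenS[OF that(1)] that(2-)] by (simp add: D_def)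
        show "bl (cen C0) i \<subseteq> verts G" if "i < k" for i
          using bl1[OF cenS[OF C0] that] by (auto simp: nbh_def V_def)
        show "card {b\<in>bl (cen C0) j. \<not> robust w G a b} \<le> 0" if "i < k" "j < k" "i \<noteq> j" "a \<in> bl (cen C0) i" for i j a
        proof -
          have "\<And>b. b \<in> bl (cen C0) j \<Longrightarrow> robust w G a b"
            using bl2[OF cenS[OF C0] that] by (simp add: D_def)
          then have "{b\<in>bl (cen C0) j. \<not> robust w G a b} = {}" by auto
          then show ?thesis by (simp only: card.empty le0)
        qed
        show "card (verts F) * Suc 0 + 2 * 0 + card S0 < card (bl (cen C0) i)" if "i < k" for i
          using bl1[OF cenS[OF C0] that] S0 by (simp add: t_def f_def)
      qed (use fS0 in auto)
      then show False using free by simp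
    qed
    have "\<forall>v\<in>verts G. (1 - \<epsilon>') * real ((k - 1) choose (r - 1)) * (real (card (verts G)) / real k) ^ (r - 1) \<le> real (deg G v)"
    proof
      fix v assume v: "v \<in> verts G"
      have "(1 - \<epsilon>') * (real ((k - 1) choose (r - 1)) * (real (card (verts G)) / real k) ^ (r - 1)) \<le> (1 - \<epsilon>) * (real ((k - 1) choose (r - 1)) * (real (card (verts G)) / real k) ^ (r - 1))"
        using \<epsilon> by (intro mult_right_mono) auto
      then show "(1 - \<epsilon>') * real ((k - 1) choose (r - 1)) * (real (card (verts G)) / real k) ^ (r - 1) \<le> real (deg G v)"
        using bspec[OF md v] by (simp add: \<delta>_def mult.assoc)
    qed
    from struct[THEN spec, THEN mp, THEN mp, THEN mp, THEN mp, OF G _ this] bign(1) cS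
    have "\<exists>P X S'. S' = S \<and>
      disjoint_family_on P {..<k} \<and> X \<inter> (\<Union>i<k. P i) = {} \<and> X \<union> (\<Union>i<k. P i) = V - S' \<and>
      (\<forall>i<k. (1 / real k - \<gamma>) * real n \<le> real (card (P i))) \<and>
      (\<forall>i<k. \<forall>j<k. i \<noteq> j \<longrightarrow> (\<forall>x\<in>P i. real (card (P j - nbh D V x)) \<le> \<gamma> * real n)) \<and>
      (\<forall>v\<in>X. \<beta> * real n ^ (r - 1) \<le> real (card {e\<in>edges G. v \<in> e \<and> e \<inter> S' = {} \<and> bad k P e}) \<and>
        (\<exists>i<k. real (card (nbh D V v)) \<le> real n - real (card (P i)) - \<beta> * real n))"
      unfolding S_def D_def n_def V_def by blast
    then obtain P X where djP: "disjoint_family_on P {..<k}" and XP: "X \<inter> (\<Union>i<k. P i) = {}"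
      and cov: "X \<union> (\<Union>i<k. P i) = V - S"
      and Plow: "\<And>i. i < k \<Longrightarrow> (1 / real k - \<gamma>) * real n \<le> real (card (P i))"
      and Pmiss: "\<And>i j x. i < k \<Longrightarrow> j < k \<Longrightarrow> i \<noteq> j \<Longrightarrow> x \<in> P i \<Longrightarrow> real (card (P j - nbh D V x)) \<le> \<gamma> * real n"
      and XB: "\<And>v. v \<in> X \<Longrightarrow> \<beta> * real n ^ (r - 1) \<le> real (card {e\<in>edges G. v \<in> e \<and> e \<inter> S = {} \<and> bad k P e})"
      by (elim exE conjE) simp
    have PV: "P i \<subseteq> V - S" if "i < k" for i using cov that by blast
    have finP: "finite (P i)" if "i < k" for i using finite_subset[OF PV[OF that]] fin by simp
    define B where "B = {e\<in>edges G. e \<inter> S = {} \<and> bad k P e}"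
    define H where "H = \<lparr>verts = V, edges = B\<rparr>"
    have H: "r_graph r H" using G by (auto simp: r_graph_def H_def B_def V_def)
    have Hs: "verts H = V" "edges H = B" by (simp_all add: H_def)
    \<comment> \<open>Of the at most s - 1 disjoint places for critical components, \<open>S\<close>
      takes |S|; \<open>b\<close> of them remain for bad hyperedges.\<close>
    define b where "b = s - 1 - card S"
    have sb: "s = card S + Suc b" using cS s by (simp add: b_def c0_def)
    \<comment> \<open>A matching of b + 1 bad hyperedges off \<open>S\<close>, together with the
      centres in \<open>S\<close>, would host all \<open>s\<close> critical components.\<close>
    have nomatch: "card M \<noteq> Suc b" if M: "M \<subseteq> edges H" "matching M" for M
    proof
      assume cM: "card M = Suc b"
      have MB: "\<And>e. e \<in> M \<Longrightarrow> e \<in> edges G \<and> e \<inter> S = {} \<and> bad k P e" using M(1) by (auto simp: Hs B_def)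
      have finM: "finite M" using cM by (intro card_ge_0_finite) simp
      obtain K1 where K1: "K1 \<subseteq> K" "card K1 = card S" using sb s by (metis le_add1 obtain_subset_with_card_n)
      define K2 where "K2 = K - K1"
      have fK: "finite K1" "finite K2" using finite_subset[OF K1(1) finite_K] finite_K by (auto simp: K2_def)
      have cK2: "card K2 = Suc b" unfolding K2_def using K1 fK s sb by (simp add: card_Diff_subset)
      obtain cen where cen: "bij_betw cen K1 S" using finite_same_card_bij[OF fK(1) fin(3) K1(2)] by auto
      obtain hb where hb: "bij_betw hb K2 M" using finite_same_card_bij[OF fK(2) finM] cK2 cM by auto
      have cenS: "cen C \<in> S" if "C \<in> K1" for C using cen that by (auto simp: bij_betw_def)
      have hbM: "hb C \<in> M" if "C \<in> K2" for C using hb that by (auto simp: bij_betw_def)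
      have "\<exists>i x y. i < k \<and> x \<in> hb C \<inter> P i \<and> y \<in> hb C \<inter> P i \<and> x \<noteq> y" if "C \<in> K2" for C
        using MB[OF hbM[OF that]] unfolding bad_def by blast
      then obtain ic pa pb where pab: "\<And>C. C \<in> K2 \<Longrightarrow> ic C < k \<and> pa C \<in> hb C \<inter> P (ic C) \<and> pb C \<in> hb C \<inter> P (ic C) \<and> pa C \<noteq> pb C"
        by metis
      define W where "W = S \<union> \<Union>M"
      have finW: "finite W"
        unfolding W_def using fin(3) finM MB r_graphD(4)[OF G] by blast
      have cW: "card W \<le> r * s"
      proof -
        have "card (\<Union>M) \<le> (\<Sum>e\<in>M. card e)" by (rule card_Union_le_sum_card)
        also have "\<dots> = (\<Sum>e\<in>M. r)" using MB r_graphD(3)[OF G] by (intro sum.cong) auto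
        also have "\<dots> = r * Suc b" using cM by (simp add: mult.commute)
        finally have "card W \<le> card S + r * Suc b" using card_Un_le[of S "\<Union>M"] unfolding W_def by linarith
        also have "\<dots> \<le> r * card S + r * Suc b" using r by (intro add_right_mono) simp
        also have "\<dots> = r * s" unfolding sb by (simp add: algebra_simps)
        finally show ?thesis .
      qed
      define Bn where "Bn = nat \<lfloor>\<gamma> * real n\<rfloor>"
      have Bn: "real Bn \<le> \<gamma> * real n" using \<gamma> by (simp add: Bn_def)
      have "contains_copy G (expansion r F)"
      proof (rule contains_expansion_critical[OF G r(1) wF, where ?K1.0 = K1 and ?K2.0 = K2 and W = W and t = t
            and cen = cen and A = "\<lambda>C. bl (cen C)" and Q = P and B = Bn and hb = hb and pa = pa and pb = pb and ic = ic])
        show "K = K1 \<union> K2" "K1 \<inter> K2 = {}" using K1 by (auto simp: K2_def)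
        show "finite W" by (rule finW)
        show "cen ` K1 \<subseteq> W" using cenS by (auto simp: W_def)
        show "hb C \<subseteq> W" if "C \<in> K2" for C using hbM[OF that] by (auto simp: W_def)
        show "card (verts F) + card W < t" using cW by (simp add: t_def f_def)
        show "inj_on cen K1" using cen by (simp add: bij_betw_def)
        show "cen C \<in> verts G" if "C \<in> K1" for C using cenS[OF that] SV by (auto simp: V_def)
        show "bl (cen C) i \<subseteq> nbh (robust w G) (verts G) (cen C) \<and> card (bl (cen C) i) = t" if "C \<in> K1" "i < k" for C i
          using bl1[OF cenS[OF that(1)] that(2)] by (simp add: D_def V_def)
        show "robust w G a b" if "C \<in> K1" "i < k" "j < k" "i \<noteq> j" "a \<in> bl (cen C) i" "b \<in> bl (cen C) j" for C i j a b
          using bl2[OF cenS[OF that(1)] that(2-)] by (simp add: D_def)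
        show "hb C \<in> edges G" if "C \<in> K2" for C using MB[OF hbM[OF that]] by simp
        show "ic C < k" "pa C \<in> hb C \<inter> P (ic C)" "pb C \<in> hb C \<inter> P (ic C)" "pa C \<noteq> pb C" if "C \<in> K2" for C
          using pab[OF that] by simp_all
        show "hb C \<inter> hb C' = {}" if "C \<in> K2" "C' \<in> K2" "C \<noteq> C'" for C C'
        proof -
          have "hb C \<noteq> hb C'" using hb that by (auto simp: bij_betw_def inj_on_def)
          then show ?thesis using M(2) hbM[OF that(1)] hbM[OF that(2)] by (simp add: matching_def)
        qed
        show "cen C \<notin> hb C'" if "C \<in> K1" "C' \<in> K2" for C C'
          using MB[OF hbM[OF that(2)]] cenS[OF that(1)] by blast
        show "P i \<subseteq> verts G" if "i < k" for i using PV[OF that] by (auto simp: V_def)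
        show "card {b\<in>P j. \<not> robust w G a b} \<le> Bn" if ij: "i < k" "j < k" "i \<noteq> j" and a: "a \<in> P i" for i j a
        proof -
          have "{b\<in>P j. \<not> robust w G a b} \<subseteq> P j - nbh D V a" by (auto simp: nbh_def D_def)
          then have "card {b\<in>P j. \<not> robust w G a b} \<le> card (P j - nbh D V a)"
            using finP[OF ij(2)] by (intro card_mono) auto
          then show ?thesis using Pmiss[OF ij a] by (simp add: Bn_def le_nat_iff le_floor_iff)
        qed
        show "card (verts F) * Suc Bn + 2 * Bn + card W < card (P i)" if "i < k" for i
        proof -
          have "(f + r * s + 1) / \<gamma> < real n"
          proof -
            have "Suc (nat \<lceil>(f + r * s + 1) / \<gamma>\<rceil>) \<le> n" using big by (simp add: n0_def n_def V_def)
            then show ?thesis by linarith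
          qed
          then have 1: "real (f + r * s + 1) < \<gamma> * real n" using \<gamma> by (simp add: field_simps)
          have "(1 / real k - \<gamma>) * real n = (real f + 3) * (\<gamma> * real n)"
            unfolding \<gamma>f[symmetric] by (simp add: algebra_simps)
          moreover have "(real f + 2) * real Bn \<le> (real f + 2) * (\<gamma> * real n)" using Bn by (intro mult_left_mono) auto
          ultimately have "(real f + 2) * real Bn + real (f + r * s + 1) < real (card (P i))"
            using Plow[OF that] 1 by (simp add: algebra_simps)
          moreover have "real ((f + 2) * Bn + (f + r * s + 1)) = (real f + 2) * real Bn + real (f + r * s + 1)"
            by (simp add: algebra_simps)
          ultimately have "real ((f + 2) * Bn + (f + r * s + 1)) < real (card (P i))" by linarith
          then have "(f + 2) * Bn + (f + r * s + 1) < card (P i)" by (simp only: of_nat_less_iff)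
          then show ?thesis using cW by (simp add: f_def algebra_simps)
        qed
      qed
      then show False using free by simp
    qed
    have Lb: "r + (r + 1) * Suc b \<le> L"
      unfolding L_def using sb by (intro add_left_mono mult_le_mono2) simp
    define S' where "S' = {v\<in>verts H. L * card (verts H) ^ (r - 2) < deg H v}"
    note ms = matching_structure[OF H r(1) nomatch Lb, folded S'_def]
    have S'V: "S' \<subseteq> V" by (auto simp: S'_def Hs)
    have S'S: "S' \<inter> S = {}"
    proof -
      have "deg H v = 0" if "v \<in> S" for v
      proof -
        have "{e\<in>edges H. v \<in> e} = {}" using that by (auto simp: Hs B_def)
        then show ?thesis by (simp only: deg_def card.empty)
      qed
      then show ?thesis by (auto simp: S'_def)
    qed
    \<comment> \<open>The structure lemma puts a vertex of \<open>X\<close> in \<beta> n^(r-1) bad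
      hyperedges, more than L n^(r-2), so it has large degree in \<open>H\<close>.\<close>
    have XS': "X \<subseteq> S'"
    proof
      fix v assume v: "v \<in> X"
      then have vV: "v \<in> V" using cov by blast
      have "deg H v = card {e\<in>edges G. v \<in> e \<and> e \<inter> S = {} \<and> bad k P e}"
        unfolding deg_def Hs B_def by (rule arg_cong[where f = card]) auto
      then have 1: "\<beta> * real n ^ (r - 1) \<le> real (deg H v)" using XB[OF v] by simp
      have "L / \<beta> < n"
      proof -
        have "Suc (nat \<lceil>L / \<beta>\<rceil>) \<le> n" using big by (simp add: n0_def n_def V_def)
        then show ?thesis by linarith
      qed
      then have "L < \<beta> * n" using \<beta> by (simp add: field_simps)
      moreover have "0 < real n ^ (r - 2)" using bign by simp
      ultimately have "L * real n ^ (r - 2) < \<beta> * n * real n ^ (r - 2)" by (rule mult_strict_right_mono)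
      also have "\<dots> = \<beta> * real n ^ (r - 1)" using r by (simp add: Suc_diff_Suc numeral_2_eq_2 flip: power_Suc)
      finally have "real (L * n ^ (r - 2)) < real (deg H v)" using 1 by simp
      then have "L * n ^ (r - 2) < deg H v" by (simp only: of_nat_less_iff)
      then show "v \<in> S'" using vV by (simp add: S'_def Hs n_def)
    qed
    \<comment> \<open>\<open>Z\<close> takes the place of the added vertices of the construction:
      hyperedges meeting it are bounded trivially, and those avoiding it are transversal or
      bad.\<close>
    define Z where "Z = S \<union> S'"
    define i where "i = card Z"
    have fS': "finite S'" using finite_subset[OF S'V fin(1)] .
    have ci: "i = card S + card S'" unfolding i_def Z_def using fin(3) fS' S'S by (intro card_Un_disjoint) auto
    have ile: "i \<le> s - 1" using ci ms(1) sb by simp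
    have ZV: "Z \<subseteq> V" using SV S'V by (auto simp: Z_def)
    define P' where "P' j = P j - S'" for j
    define E1 where "E1 = {e. e \<subseteq> V \<and> card e = r \<and> e \<inter> Z \<noteq> {}}"
    define E2 where "E2 = transversals P' {..<k} r"
    define E3 where "E3 = {e\<in>edges H. e \<inter> S' = {}}"
    have finP': "finite (P' j)" if "j < k" for j using finP[OF that] by (simp add: P'_def)
    have fE: "finite E1" "finite E2" "finite E3"
    proof -
      show "finite E1" by (rule finite_subset[of _ "Pow V"]) (use fin in \<open>auto simp: E1_def\<close>)
      show "finite E2" by (rule finite_subset[of _ "Pow (\<Union>j<k. P' j)"]) (use finP' in \<open>auto simp: E2_def transversals_def\<close>)
      show "finite E3" using r_graphD(5)[OF H] by (simp add: E3_def)
    qed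
    have "edges G \<subseteq> E1 \<union> (E2 \<union> E3)"
    proof
      fix e assume e: "e \<in> edges G"
      have er: "e \<subseteq> V" "card e = r" "finite e" using r_graphD[OF G] e by (auto simp: V_def)
      show "e \<in> E1 \<union> (E2 \<union> E3)"
      proof (cases "e \<inter> Z = {}")
        case False
        then show ?thesis using er by (simp add: E1_def)
      next
        case True
        show ?thesis
        proof (cases "bad k P e")
          case bd: True
          then have "e \<in> E3" using e True by (auto simp: E3_def Hs B_def Z_def)
          then show ?thesis by blast
        next
          case False
          have "e \<in> E2" unfolding E2_def
          proof (rule transversals_memI[OF er(3,2)])
            show "e \<subseteq> (\<Union>j<k. P' j)"
            proof
              fix x assume x: "x \<in> e"
              then have xn: "x \<in> V" "x \<notin> S" "x \<notin> S'" using er True by (auto simp: Z_def)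
              then have "x \<in> X \<union> (\<Union>i<k. P i)" "x \<notin> X" using cov XS' by auto
              then obtain j where "j < k" "x \<in> P j" by auto
              then show "x \<in> (\<Union>j<k. P' j)" using xn by (auto simp: P'_def)
            qed
            show "x = y" if "j \<in> {..<k}" "x \<in> e" "y \<in> e" "x \<in> P' j" "y \<in> P' j" for j x y
              using False that by (auto simp: bad_def P'_def)
          qed
          then show ?thesis by blast
        qed
      qed
    qed
    then have "card (edges G) \<le> card (E1 \<union> (E2 \<union> E3))" using fE by (intro card_mono) auto
    also have "\<dots> \<le> card E1 + (card E2 + card E3)" by (meson add_left_mono card_Un_le le_trans)
    finally have tot: "card (edges G) \<le> card E1 + (card E2 + card E3)" .
    have djP': "disjoint_family_on P' {..<k}" using djP unfolding disjoint_family_on_def P'_def by blast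
    have cE1: "card E1 = (n choose r) - ((n - i) choose r)"
      using card_meeting_subsets[OF fin(1) ZV, of r] card_Diff_subset[of Z V] ZV finite_subset[OF ZV fin(1)]
      by (simp add: E1_def n_def i_def)
    have cE2: "card E2 \<le> esym (bal (n - i) k) {..<k} r"
    proof -
      have "card E2 = esym (\<lambda>j. card (P' j)) {..<k} r"
        unfolding E2_def using finP' djP' by (intro card_transversals) auto
      also have "\<dots> \<le> esym (bal (n - i) k) {..<k} r"
      proof (rule esym_le_bal[OF k(2)])
        have "(\<Sum>j<k. card (P' j)) = card (\<Union>j<k. P' j)"
          using finP' djP' by (intro card_UN_disjoint[symmetric]) (auto simp: disjoint_family_on_def)
        also have "(\<Union>j<k. P' j) = V - Z"
        proof -
          have "(\<Union>j<k. P' j) = (\<Union>j<k. P j) - S'" by (auto simp: P'_def)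
          also have "\<dots> = (X \<union> (\<Union>j<k. P j)) - S'" using XS' by blast
          also have "\<dots> = V - Z" unfolding cov Z_def by blast
          finally show ?thesis .
        qed
        also have "card (V - Z) = n - i"
          using card_Diff_subset[of Z V] ZV finite_subset[OF ZV fin(1)] by (simp add: n_def i_def)
        finally show "(\<Sum>j<k. card (P' j)) = n - i" .
      qed
      finally show ?thesis .
    qed
    have tot2: "card (edges G) \<le> turan_val r n k i + card E3" using tot cE1 cE2 by (simp add: turan_val_def)
    show "card (edges G) \<le> turan_val r (card (verts G)) k (s - 1)"
    \<comment> \<open>If \<open>Z\<close> has full size, no bad hyperedge avoids it. Otherwise those
      avoiding it number O(n^(r-2)), which is less than the gain from one more added vertex.\<close>
    proof (cases "i = s - 1")
      case True
      then have "card S' = b" using ci sb by simp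
      then have "E3 = {}" using ms(2) by (auto simp: E3_def)
      then have "card E3 = 0" by simp
      then show ?thesis using tot2 True by (simp add: n_def V_def)
    next
      case False
      then have lt: "i < s - 1" using ile by simp
      have "card E3 \<le> r * b * (L * n ^ (r - 2))" using ms(3) by (simp add: E3_def Hs n_def)
      also have "\<dots> \<le> r * s * (L * n ^ (r - 2))" using sb by (intro mult_le_mono1 mult_le_mono2) simp
      finally have 1: "card E3 \<le> r * s * L * n ^ (r - 2)" by (simp add: mult.assoc)
      have rr: "r - 1 - 1 = r - 2" by simp
      have "real (r * s * L) * real n ^ (r - 2) \<le> real (((n - s) div k) choose (r - 1))" using n3 bign(2) unfolding rr by blast
      then have "real (r * s * L * n ^ (r - 2)) \<le> real (((n - s) div k) choose (r - 1))" by simp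
      then have 2: "r * s * L * n ^ (r - 2) \<le> ((n - s) div k) choose (r - 1)" by (simp only: of_nat_le_iff)
      have 3: "((n - s) div k) choose (r - 1) \<le> ((n - Suc i) div k) choose (r - 1)"
        using lt by (intro binomial_right_mono div_le_mono) simp
      have "turan_val r n k i + (((n - Suc i) div k) choose (r - 1)) \<le> turan_val r n k (Suc i)"
        using lt bign by (intro turan_val_step_i k r) simp
      also have "\<dots> \<le> turan_val r n k (s - 1)" using lt bign by (intro turan_val_mono k r) simp_all
      finally show ?thesis using tot2 1 2 3 by (simp add: n_def V_def)
    qed
  qed
qed

lemma ex_number_critical:
  fixes F :: "'a hypergraph"
  assumes r: "2 \<le> r" "r \<le> k" and s: "1 \<le> s" and F: "graph F"
    and K: "card {C \<in> components F. chromatic_number C = k + 1} = s"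
    and crit: "\<forall>C\<in>components F. chromatic_number C = k + 1 \<longrightarrow> (\<exists>e. color_critical C e)"
    and rest: "\<forall>C\<in>components F. chromatic_number C \<noteq> k + 1 \<longrightarrow> chromatic_number C \<le> k"
  shows "\<forall>\<^sub>F n in sequentially. ex_number r n (expansion r F) = card (edges (turan_plus r n k (s - 1)))"
proof -
  have k: "1 \<le> k" "0 < k" using r by auto
  obtain cmp cx cy col where cd: "critical_decomposition F k {C \<in> components F. chromatic_number C = k + 1} cmp cx cy col"
    using critical_decomposition_exists[OF F k(1) crit rest] by (elim exE)
  obtain N where N: "\<forall>n\<ge>N. \<forall>G :: nat hypergraph. r_graph r G \<longrightarrow> card (verts G) = n \<longrightarrow>
    \<not> contains_copy G (expansion r F) \<longrightarrow> card (edges G) \<le> turan_val r n k (s - 1)"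
    using critical_upper_bound[OF cd r K s] by (rule exE)
  have "ex_number r n (expansion r F) = card (edges (turan_plus r n k (s - 1)))" if n: "N + s \<le> n" for n
  proof (rule ex_numberI)
    have i: "s - 1 \<le> n" using n by simp
    note tp = turan_plus_props[OF k(2) i, of r]
    show "r_graph r (turan_plus r n k (s - 1))" by (rule tp(2))
    show "card (verts (turan_plus r n k (s - 1))) = n" using tp(1) by simp
    show "\<not> contains_copy (turan_plus r n k (s - 1)) (expansion r F)"
      using s K by (intro turan_plus_free[OF F r(1) k(2) i]) simp
    show "card (edges G) \<le> card (edges (turan_plus r n k (s - 1)))"
      if "r_graph r G" "card (verts G) = n" "\<not> contains_copy G (expansion r F)" for G :: "nat hypergraph"
      using N n that tp(3) by simp
  qed simp
  then show ?thesis unfolding eventually_sequentially by blast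
qed

section \<open>Two cliques sharing a vertex\<close>

text \<open>\<open>contains_expansionI\<close> with candidates taken from almost completely joined
  parts according to a colouring. The colouring only has to be proper away from \<open>P0\<close>;
  fixed vertices enter through \<open>pre\<close> and \<open>mixed\<close>, which allows an edge in
  \<open>M\<close> to lie inside a part.\<close>

lemma partite_embedding:
  fixes F :: "'a hypergraph" and G :: "'b hypergraph"
  assumes F: "graph F" and G: "r_graph r G" and r: "2 \<le> r"
    and w: "card (verts F) + r * card (edges F) \<le> w"
    and M: "M \<subseteq> edges F" "\<Union>M \<subseteq> P0" and P0: "P0 \<subseteq> verts F"
    and f0: "inj_on f0 P0" "f0 ` P0 \<subseteq> verts G"
    and h: "\<And>e. e \<in> M \<Longrightarrow> h e \<in> edges G" "\<And>e. e \<in> M \<Longrightarrow> h e \<inter> f0 ` P0 = f0 ` e"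
    and dj: "\<And>e e'. e \<in> M \<Longrightarrow> e' \<in> M \<Longrightarrow> e \<noteq> e' \<Longrightarrow> (h e - f0 ` e) \<inter> (h e' - f0 ` e') = {}"
    and pre: "\<And>u v. u \<in> P0 \<Longrightarrow> v \<in> P0 \<Longrightarrow> {u, v} \<in> edges F \<Longrightarrow> {u, v} \<notin> M \<Longrightarrow> robust w G (f0 u) (f0 v)"
    and W: "finite W" "f0 ` P0 \<subseteq> W" "\<And>e. e \<in> M \<Longrightarrow> h e \<subseteq> W"
    and col: "\<And>z. z \<in> verts F \<Longrightarrow> col z < k"
      "\<And>z z'. z \<in> verts F - P0 \<Longrightarrow> z' \<in> verts F - P0 \<Longrightarrow> {z, z'} \<in> edges F \<Longrightarrow> col z \<noteq> col z'"
    and P: "\<And>i. i < k \<Longrightarrow> P i \<subseteq> verts G"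
      "\<And>i j a. i < k \<Longrightarrow> j < k \<Longrightarrow> i \<noteq> j \<Longrightarrow> a \<in> P i \<Longrightarrow> card {b\<in>P j. \<not> robust w G a b} \<le> B"
      "\<And>i. i < k \<Longrightarrow> card (verts F) * Suc B + card P0 * B + card W < card (P i)"
    and mixed: "\<And>u z. u \<in> P0 \<Longrightarrow> z \<in> verts F - P0 \<Longrightarrow> {u, z} \<in> edges F \<Longrightarrow>
      card {b\<in>P (col z). \<not> robust w G (f0 u) b} \<le> B"
  shows "contains_copy G (expansion r F)"
proof -
  let ?D = "robust w G"
  define Cd where "Cd z = {b\<in>P (col z). \<forall>u\<in>P0. {u, z} \<in> edges F \<longrightarrow> ?D (f0 u) b} - W" for z
  have finP0: "finite P0" using finite_subset[OF P0 r_graphD(1)[OF F]] .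
  have finP: "finite (P i)" if "i < k" for i using finite_subset[OF P(1)[OF that] r_graphD(1)[OF G]] .
  show ?thesis
  proof (rule contains_expansionI[OF F G r w M P0 f0, where h = h and Cd = Cd and B = "\<lambda>_. B"])
    fix z assume z: "z \<in> verts F - P0"
    then have ck: "col z < k" using col by simp
    show "Cd z \<subseteq> verts G" using P(1)[OF ck] by (auto simp: Cd_def)
    show "Cd z \<inter> f0 ` P0 = {}" using W(2) by (auto simp: Cd_def)
    show "Cd z \<inter> h e = {}" if "e \<in> M" for e using W(3)[OF that] by (auto simp: Cd_def)
    define N where "N = {u\<in>P0. {u, z} \<in> edges F}"
    have N: "finite N" "card N \<le> card P0" using finP0 by (auto simp: N_def intro: card_mono)
    define T where "T = {b\<in>P (col z). \<forall>u\<in>P0. {u, z} \<in> edges F \<longrightarrow> ?D (f0 u) b}"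
    have "P (col z) \<subseteq> T \<union> (\<Union>u\<in>N. {b\<in>P (col z). \<not> ?D (f0 u) b})" by (auto simp: T_def N_def)
    then have "card (P (col z)) \<le> card (T \<union> (\<Union>u\<in>N. {b\<in>P (col z). \<not> ?D (f0 u) b}))"
      using finP[OF ck] N by (intro card_mono) (auto simp: T_def)
    also have "\<dots> \<le> card T + card (\<Union>u\<in>N. {b\<in>P (col z). \<not> ?D (f0 u) b})" by (rule card_Un_le)
    also have "\<dots> \<le> card T + (\<Sum>u\<in>N. card {b\<in>P (col z). \<not> ?D (f0 u) b})"
      by (intro add_left_mono card_UN_le N)
    also have "\<dots> \<le> card T + (\<Sum>u\<in>N. B)"
      using mixed[OF _ z] by (intro add_left_mono sum_mono) (simp add: N_def)
    also have "\<dots> \<le> card T + card P0 * B" using N by simp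
    finally have "card (verts F) * Suc B + card W < card T" using P(3)[OF ck] by linarith
    moreover have "card T - card W \<le> card (T - W)" by (rule diff_card_le_card_Diff[OF W(1)])
    ultimately show "card (verts F) * Suc B < card (Cd z)" unfolding Cd_def T_def[symmetric] by linarith
  next
    fix u z b assume "u \<in> P0" "z \<in> verts F - P0" "{u, z} \<in> edges F" "b \<in> Cd z"
    then show "robust w G (f0 u) b" by (simp add: Cd_def)
  next
    fix z z' a assume z: "z \<in> verts F - P0" "z' \<in> verts F - P0" "{z, z'} \<in> edges F" and a: "a \<in> Cd z'"
    have ck: "col z < k" "col z' < k" using z col(1) by auto
    have "card {b\<in>Cd z. \<not> robust w G a b} \<le> card {b\<in>P (col z). \<not> robust w G a b}"
      using finP[OF ck(1)] by (intro card_mono) (auto simp: Cd_def)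
    also have "\<dots> \<le> B" using P(2)[OF ck(2,1)] col(2)[OF z] a by (auto simp: Cd_def)
    finally show "card {b\<in>Cd z. \<not> robust w G a b} \<le> B" .
  qed (use h dj pre in auto)
qed

lemma graph_two_cliques: "graph (two_cliques k)"
  by (auto simp: r_graph_def two_cliques_def)

lemma verts_two_cliques [simp]: "verts (two_cliques k) = {0..2 * k}"
  by (simp add: two_cliques_def)

lemma edge_two_cliques:
  "{u, v} \<in> edges (two_cliques k) \<longleftrightarrow> u \<noteq> v \<and> ((u \<le> k \<and> v \<le> k) \<or> (k \<le> u \<and> v \<ge> k \<and> u \<le> 2 * k \<and> v \<le> 2 * k))"
  by (auto simp: two_cliques_def card_2_iff doubleton_eq_iff)

text \<open>Used to recolour each of the two cliques so that prescribed vertices land in prescribed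
  parts.\<close>

lemma permutation_two_points:
  fixes a b c d :: nat
  assumes "a \<noteq> b" "c \<noteq> d" "a < k" "b < k" "c < k" "d < k"
  shows "\<exists>\<pi>. inj \<pi> \<and> (\<forall>x<k. \<pi> x < k) \<and> \<pi> a = c \<and> \<pi> b = d"
proof -
  define \<pi> where "\<pi> = transpose (transpose a c b) d \<circ> transpose a c"
  have "inj \<pi>" unfolding \<pi>_def by (intro inj_compose inj_transpose)
  moreover have "\<pi> x < k" if "x < k" for x using that assms by (auto simp: \<pi>_def transpose_def)
  moreover have "\<pi> a = c" "\<pi> b = d" using assms by (auto simp: \<pi>_def transpose_def)
  ultimately show ?thesis by blast
qed


text \<open>The shared vertex goes to \<open>v\<close> and both remaining \<open>k\<close>-cliques
  go into the blow-up around it. Hence the set \<open>S\<close> of the structure lemma is empty when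
  the expansion is excluded.\<close>

lemma blowup_imp_two_cliques:
  assumes G: "r_graph r G" and r: "2 \<le> r" and k: "2 \<le> k"
    and w: "card (verts (two_cliques k)) + r * card (edges (two_cliques k)) \<le> w"
    and t: "2 * k + 3 \<le> t" and v: "v \<in> verts G"
    and bl: "has_blowup (robust w G) (nbh (robust w G) (verts G) v) k t"
  shows "contains_copy G (expansion r (two_cliques k))"
proof -
  obtain A :: "nat \<Rightarrow> 'a set" where A: "\<And>i. i < k \<Longrightarrow> A i \<subseteq> nbh (robust w G) (verts G) v" "\<And>i. i < k \<Longrightarrow> card (A i) = t"
    and AA: "\<And>i j x y. i < k \<Longrightarrow> j < k \<Longrightarrow> i \<noteq> j \<Longrightarrow> x \<in> A i \<Longrightarrow> y \<in> A j \<Longrightarrow> robust w G x y"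
    using bl by (rule has_blowupE) (rule that)
  define col where "col z = (if z < k then z else if z = k then 0 else z - k - 1)" for z
  show ?thesis
  proof (rule partite_embedding[OF graph_two_cliques G r w, where M = "{}" and ?P0.0 = "{k}" and ?f0.0 = "\<lambda>_. v"
        and W = "{v}" and col = col and k = k and P = A and B = 0])
    show "col z < k" if "z \<in> verts (two_cliques k)" for z using that k by (auto simp: col_def)
    show "col z \<noteq> col z'" if "z \<in> verts (two_cliques k) - {k}" "z' \<in> verts (two_cliques k) - {k}"
      "{z, z'} \<in> edges (two_cliques k)" for z z' using that by (auto simp: col_def edge_two_cliques)
    show "A i \<subseteq> verts G" if "i < k" for i using A(1)[OF that] by (auto simp: nbh_def)
    show "card {b\<in>A j. \<not> robust w G a b} \<le> 0" if "i < k" "j < k" "i \<noteq> j" "a \<in> A i" for i j a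
    proof -
      have "\<And>b. b \<in> A j \<Longrightarrow> robust w G a b" using AA[OF that] .
      then have "{b\<in>A j. \<not> robust w G a b} = {}" by auto
      then show ?thesis by (simp only: card.empty le0)
    qed
    show "card (verts (two_cliques k)) * Suc 0 + card {k} * 0 + card {v} < card (A i)" if "i < k" for i
      using A(2)[OF that] t by simp
    show "card {b\<in>A (col z). \<not> robust w G v b} \<le> 0" if z: "z \<in> verts (two_cliques k) - {k}" for z
    proof -
      have "col z < k" using z k by (auto simp: col_def)
      from A(1)[OF this] have "\<And>b. b \<in> A (col z) \<Longrightarrow> robust w G v b" by (auto simp: nbh_def)
      then have "{b\<in>A (col z). \<not> robust w G v b} = {}" by auto
      then show ?thesis by (simp only: card.empty le0)
    qed
    show "robust w G v v" if "u \<in> {k}" "u' \<in> {k}" "{u, u'} \<in> edges (two_cliques k)" for u u'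
      using that(3) that(1,2) unfolding edge_two_cliques by simp
  qed (use v in auto)
qed

text \<open>The situation after the structure lemma, with the defect \<gamma> n rounded to a natural
  number \<open>B\<close>. The summands 4 B and 2 r leave room for four fixed vertices and two
  prescribed hyperedges.\<close>

locale near_partite =
  fixes G :: "'b hypergraph" and r k w B :: nat and P :: "nat \<Rightarrow> 'b set"
  assumes G: "r_graph r G" and r: "2 \<le> r" and k: "2 \<le> k"
    and w: "card (verts (two_cliques k)) + r * card (edges (two_cliques k)) \<le> w"
    and P: "\<And>i. i < k \<Longrightarrow> P i \<subseteq> verts G"
      "\<And>i j a. i < k \<Longrightarrow> j < k \<Longrightarrow> i \<noteq> j \<Longrightarrow> a \<in> P i \<Longrightarrow> card {b\<in>P j. \<not> robust w G a b} \<le> B"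
      "\<And>i. i < k \<Longrightarrow> card (verts (two_cliques k)) * Suc B + 4 * B + 2 * r < card (P i)"
    and free: "\<not> contains_copy G (expansion r (two_cliques k))"
begin

lemma edge_props: "e \<in> edges G \<Longrightarrow> e \<subseteq> verts G \<and> finite e \<and> card e = r"
  using r_graphD[OF G] by blast

lemma W_card: "e \<in> edges G \<Longrightarrow> e' \<in> edges G \<Longrightarrow> finite (e \<union> e') \<and> card (e \<union> e') \<le> 2 * r"
  using edge_props card_Un_le[of e e'] by auto

text \<open>The two hyperedges expand the edges {0, 1} and {k + 1, k + 2}, one from each clique and
  neither through the shared vertex \<open>k\<close>, which goes to a third part \<open>l\<close>.
  Apart from these two edges the colouring is proper.\<close>

lemma no_disjoint_bad:
  assumes e: "e \<in> edges G" "i < k" "x \<in> e \<inter> P i" "y \<in> e \<inter> P i" "x \<noteq> y"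
    and e': "e' \<in> edges G" "i' < k" "x' \<in> e' \<inter> P i'" "y' \<in> e' \<inter> P i'" "x' \<noteq> y'"
    and dj: "e \<inter> e' = {}" and l: "l < k" "l \<noteq> i" "l \<noteq> i'"
  shows False
proof -
  have "\<exists>\<pi>. inj \<pi> \<and> (\<forall>x<k. \<pi> x < k) \<and> \<pi> 0 = i \<and> \<pi> (k - 1) = l"
  proof (rule permutation_two_points)
    show "0 \<noteq> k - 1" "0 < k" "k - 1 < k" using k by linarith+
    show "i \<noteq> l" using l(2) by (rule not_sym)
  qed (fact e(2) l(1))+
  then obtain \<pi>1 where p1: "inj \<pi>1" "\<forall>x<k. \<pi>1 x < k" "\<pi>1 0 = i" "\<pi>1 (k - 1) = l"
    by (elim exE conjE) (rule that)
  have "\<exists>\<pi>. inj \<pi> \<and> (\<forall>x<k. \<pi> x < k) \<and> \<pi> 0 = l \<and> \<pi> 1 = i'"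
  proof (rule permutation_two_points)
    show "0 \<noteq> (1 :: nat)" by simp
    show "0 < k" "1 < k" using k by linarith+
  qed (fact e'(2) l)+
  then obtain \<pi>2 where p2: "inj \<pi>2" "\<forall>x<k. \<pi>2 x < k" "\<pi>2 0 = l" "\<pi>2 1 = i'"
    by (elim exE conjE) (rule that)
  \<comment> \<open>In the first clique 0 and 1 share the colour \<open>i\<close>, in the second k +
    1 and k + 2 share the colour of the second hyperedge; both permutations agree on the colour
    \<open>l\<close> for \<open>k\<close>.\<close>
  define col where "col v = (if v = 0 then i else if v \<le> k then \<pi>1 (v - 1) else if v = k + 1 then i' else \<pi>2 (v - k - 1))" for v
  define f0 where "f0 v = (if v = 0 then x else if v = 1 then y else if v = k + 1 then x' else y')" for v :: nat
  define h where "h m = (if 0 \<in> m then e else e')" for m :: "nat set"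
  have f0s: "f0 0 = x" "f0 1 = y" "f0 (k + 1) = x'" "f0 (k + 2) = y'" using k by (auto simp: f0_def)
  have cols: "col 0 = i" "col 1 = i" "col (k + 1) = i'" "col (k + 2) = i'" "col k = l"
    using k p1 p2 by (auto simp: col_def)
  have colne: "col u \<noteq> col v" if uv: "{u, v} \<in> edges (two_cliques k)" and "{u, v} \<noteq> {0, 1}" "{u, v} \<noteq> {k + 1, k + 2}" for u v
  proof -
    have main: "col u \<noteq> col v" if "u < v" "v \<le> k \<or> k \<le> u" "v \<le> 2 * k" "\<not> (u = 0 \<and> v = 1)" "\<not> (u = k + 1 \<and> v = k + 2)" for u v
    proof (cases "v \<le> k")
      case True
      then have cv: "col v = \<pi>1 (v - 1)" using that by (simp add: col_def)
      show ?thesis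
      proof (cases "u = 0")
        case True
        then have "v - 1 \<noteq> 0" using that by auto
        then have "\<pi>1 (v - 1) \<noteq> \<pi>1 0" by (simp only: inj_eq[OF p1(1)] simp_thms)
        then show ?thesis using cv True p1(3) by (simp add: col_def)
      next
        case False
        then have "u - 1 \<noteq> v - 1" using that by auto
        then have "\<pi>1 (u - 1) \<noteq> \<pi>1 (v - 1)" by (simp only: inj_eq[OF p1(1)] simp_thms)
        then show ?thesis using cv False that True by (simp add: col_def)
      qed
    next
      case False
      then have ku: "k \<le> u" using that by auto
      have c2: "col z = \<pi>2 (z - k - 1)" if "k + 1 < z" for z using that by (simp add: col_def)
      show ?thesis
      proof (cases "u = k")
        case True
        then have cu: "col u = \<pi>2 0" using cols(5) p2(3) by simp
        show ?thesis
        proof (cases "v = k + 1")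
          case True
          then show ?thesis using cu p2(3) cols(3) l(3) by simp
        next
          case ne: False
          then have "v - k - 1 \<noteq> 0" using False by auto
          then have "\<pi>2 (v - k - 1) \<noteq> \<pi>2 0" by (simp only: inj_eq[OF p2(1)] simp_thms)
          then show ?thesis using cu c2[of v] ne False by simp
        qed
      next
        case nk: False
        show ?thesis
        proof (cases "u = k + 1")
          case True
          then have "v - k - 1 \<noteq> 1" "k + 1 < v" using that by auto
          then have "\<pi>2 (v - k - 1) \<noteq> \<pi>2 1" by (simp only: inj_eq[OF p2(1)] simp_thms)
          then show ?thesis using True cols(3) p2(4) c2[of v] \<open>k + 1 < v\<close> by simp
        next
          case False
          then have uk: "k + 1 < u" using nk ku by auto
          then have "u - k - 1 \<noteq> v - k - 1" using that by auto
          then have "\<pi>2 (u - k - 1) \<noteq> \<pi>2 (v - k - 1)" by (simp only: inj_eq[OF p2(1)] simp_thms)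
          then show ?thesis using c2[OF uk] c2[of v] uk that by simp
        qed
      qed
    qed
    have "u \<noteq> v" using uv by (simp add: edge_two_cliques)
    then consider "u < v" | "v < u" by linarith
    then show ?thesis
    proof cases
      case 1
      then show ?thesis using uv that by (intro main) (auto simp: edge_two_cliques)
    next
      case 2
      then have "col v \<noteq> col u" using uv that by (intro main) (auto simp: edge_two_cliques)
      then show ?thesis by simp
    qed
  qed
  have fi: "f0 ` {0, 1, k + 1, k + 2} = {x, y, x', y'}" "f0 ` {0, 1} = {x, y}" "f0 ` {k + 1, k + 2} = {x', y'}" using f0s by (simp_all add: insert_commute)
  have hh: "h {0, 1} = e" "h {k + 1, k + 2} = e'" using k by (simp_all add: h_def)
  have "contains_copy G (expansion r (two_cliques k))"
  proof (rule partite_embedding[OF graph_two_cliques G r w, where M = "{{0, 1}, {k + 1, k + 2}}" and ?P0.0 = "{0, 1, k + 1, k + 2}"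
        and ?f0.0 = f0 and h = h and W = "e \<union> e'" and col = col and k = k and P = P and B = B])
    show "{{0, 1}, {k + 1, k + 2}} \<subseteq> edges (two_cliques k)" using k by (auto simp: edge_two_cliques)
    show "\<Union>{{0, 1}, {k + 1, k + 2}} \<subseteq> {0, 1, k + 1, k + 2}" by auto
    show "{0, 1, k + 1, k + 2} \<subseteq> verts (two_cliques k)" using k by auto
    show "inj_on f0 {0, 1, k + 1, k + 2}"
    proof -
      have "x \<noteq> x'" "x \<noteq> y'" "y \<noteq> x'" "y \<noteq> y'" using e(3,4) e'(3,4) dj by blast+
      then show ?thesis using e(5) e'(5) f0s by (simp add: inj_on_def)
    qed
    show "f0 ` {0, 1, k + 1, k + 2} \<subseteq> verts G"
      using e(3,4) e'(3,4) edge_props[OF e(1)] edge_props[OF e'(1)] f0s by auto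
    show "h m \<in> edges G" if "m \<in> {{0, 1}, {k + 1, k + 2}}" for m using e(1) e'(1) by (simp add: h_def)
    show "h m \<inter> f0 ` {0, 1, k + 1, k + 2} = f0 ` m" if "m \<in> {{0, 1}, {k + 1, k + 2}}" for m
    proof -
      have "e \<inter> {x, y, x', y'} = {x, y}" "e' \<inter> {x, y, x', y'} = {x', y'}"
        using e(3,4) e'(3,4) dj by blast+
      then show ?thesis using that unfolding fi by (elim insertE emptyE) (simp_all only: fi hh)
    qed
    show "(h m - f0 ` m) \<inter> (h m' - f0 ` m') = {}" if "m \<in> {{0, 1}, {k + 1, k + 2}}" "m' \<in> {{0, 1}, {k + 1, k + 2}}" "m \<noteq> m'" for m m'
    proof -
      have "h m \<inter> h m' = {}" using that dj by (elim insertE emptyE) (simp_all only: hh Int_commute[of e' e] simp_thms)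
      then show ?thesis by blast
    qed
    show "robust w G (f0 u) (f0 v)" if "u \<in> {0, 1, k + 1, k + 2}" "v \<in> {0, 1, k + 1, k + 2}"
      "{u, v} \<in> edges (two_cliques k)" "{u, v} \<notin> {{0, 1}, {k + 1, k + 2}}" for u v
      using that k by (auto simp: edge_two_cliques doubleton_eq_iff)
    show "finite (e \<union> e')" using W_card[OF e(1) e'(1)] by simp
    show "f0 ` {0, 1, k + 1, k + 2} \<subseteq> e \<union> e'" using e(3,4) e'(3,4) f0s by auto
    show "h m \<subseteq> e \<union> e'" for m by (auto simp: h_def)
    show "col z < k" if "z \<in> verts (two_cliques k)" for z
      using that p1(2) p2(2) e(2) e'(2) k by (auto simp: col_def)
    show "col z \<noteq> col z'" if "z \<in> verts (two_cliques k) - {0, 1, k + 1, k + 2}" "{z, z'} \<in> edges (two_cliques k)" for z z'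
      using that by (intro colne) (auto simp: doubleton_eq_iff)
    show "P i \<subseteq> verts G" if "i < k" for i by (rule P(1)[OF that])
    show "card {b\<in>P j. \<not> robust w G a b} \<le> B" if "i < k" "j < k" "i \<noteq> j" "a \<in> P i" for i j a by (rule P(2)[OF that])
    show "card (verts (two_cliques k)) * Suc B + card {0, 1, k + 1, k + 2} * B + card (e \<union> e') < card (P i)" if "i < k" for i
    proof -
      have "card {0, 1, k + 1, k + 2} * B \<le> 4 * B" using k by (intro mult_le_mono1) (auto simp: card_insert_if)
      then show ?thesis using P(3)[OF that] W_card[OF e(1) e'(1)] by linarith
    qed
    show "card {b\<in>P (col z). \<not> robust w G (f0 u) b} \<le> B" if u: "u \<in> {0, 1, k + 1, k + 2}"
      and z: "z \<in> verts (two_cliques k) - {0, 1, k + 1, k + 2}" and uz: "{u, z} \<in> edges (two_cliques k)" for u z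
    proof (rule P(2)[of "col u" "col z" "f0 u"])
      have zk: "z \<le> 2 * k" using z by simp
      show "col z < k" using zk p1(2) p2(2) e(2) e'(2) k by (auto simp: col_def)
      show "col u < k" using u cols e(2) e'(2) by auto
      show "f0 u \<in> P (col u)" using u f0s cols e(2,3,4) e'(2,3,4) by auto
      show "col u \<noteq> col z" using u z uz by (intro colne) (auto simp: doubleton_eq_iff)
    qed
  qed
  then show False using free by simp
qed

text \<open>Here both expanded edges, {0, k} and {k, k + 1}, contain the shared vertex
  \<open>k\<close>, which goes to \<open>a\<close>. All three fixed vertices lie in
  \<open>P i\<close>.\<close>

lemma no_sunflower_bad:
  assumes e: "e \<in> edges G" "e' \<in> edges G" and i: "i < k" and a: "a \<in> P i"
    and b: "b \<in> e \<inter> P i" "b \<noteq> a" "b' \<in> e' \<inter> P i" "b' \<noteq> a" and int: "e \<inter> e' = {a}"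
  shows False
proof -
  have 2: "\<exists>j<k. j \<noteq> i" using k i by (intro exI[of _ "if i = 0 then 1 else 0"]) auto
  then obtain j where j: "j < k" "j \<noteq> i" by blast
  have "\<exists>\<pi>. inj \<pi> \<and> (\<forall>x<k. \<pi> x < k) \<and> \<pi> (k - 1) = i \<and> \<pi> 0 = j"
  proof (rule permutation_two_points)
    show "k - 1 \<noteq> 0" "0 < k" "k - 1 < k" using k by linarith+
    show "i \<noteq> j" using j(2) by (rule not_sym)
  qed (fact i j(1))+
  then obtain \<pi>1 where p1: "inj \<pi>1" "\<forall>x<k. \<pi>1 x < k" "\<pi>1 (k - 1) = i"
    by (elim exE conjE) (rule that)
  have "\<exists>\<pi>. inj \<pi> \<and> (\<forall>x<k. \<pi> x < k) \<and> \<pi> 0 = i \<and> \<pi> 1 = j"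
  proof (rule permutation_two_points)
    show "0 \<noteq> (1 :: nat)" by simp
    show "0 < k" "1 < k" using k by linarith+
    show "i \<noteq> j" using j(2) by (rule not_sym)
  qed (fact i j(1))+
  then obtain \<pi>2 where p2: "inj \<pi>2" "\<forall>x<k. \<pi>2 x < k" "\<pi>2 0 = i"
    by (elim exE conjE) (rule that)
  define col where "col v = (if v = 0 then i else if v \<le> k then \<pi>1 (v - 1) else if v = k + 1 then i else \<pi>2 (v - k - 1))" for v
  define f0 where "f0 v = (if v = 0 then b else if v = k then a else b')" for v :: nat
  define h where "h m = (if 0 \<in> m then e else e')" for m :: "nat set"
  have ae: "a \<in> e" "a \<in> e'" using int by auto
  have f0s: "f0 0 = b" "f0 k = a" "f0 (k + 1) = b'" using k by (auto simp: f0_def)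
  have cols: "col 0 = i" "col k = i" "col (k + 1) = i" using k p1 by (auto simp: col_def)
  have be: "b \<notin> e'" "b' \<notin> e" "b \<noteq> b'" using b int by auto
  have colne: "col u \<noteq> col v" if uv: "{u, v} \<in> edges (two_cliques k)" and "{u, v} \<noteq> {0, k}" "{u, v} \<noteq> {k, k + 1}" for u v
  proof -
    have main: "col u \<noteq> col v" if "u < v" "v \<le> k \<or> k \<le> u" "v \<le> 2 * k" "\<not> (u = 0 \<and> v = k)" "\<not> (u = k \<and> v = k + 1)" for u v
    proof (cases "v \<le> k")
      case True
      then have cv: "col v = \<pi>1 (v - 1)" using that by (simp add: col_def)
      show ?thesis
      proof (cases "u = 0")
        case u0: True
        then have "v - 1 \<noteq> k - 1" using that True by auto
        then have "\<pi>1 (v - 1) \<noteq> \<pi>1 (k - 1)" by (simp only: inj_eq[OF p1(1)] simp_thms)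
        then show ?thesis using cv u0 p1(3) by (simp add: col_def)
      next
        case False
        then have "u - 1 \<noteq> v - 1" using that by auto
        then have "\<pi>1 (u - 1) \<noteq> \<pi>1 (v - 1)" by (simp only: inj_eq[OF p1(1)] simp_thms)
        then show ?thesis using cv False that True by (simp add: col_def)
      qed
    next
      case False
      then have ku: "k \<le> u" using that by auto
      have c2: "col z = \<pi>2 (z - k - 1)" if "k + 1 < z" for z using that by (simp add: col_def)
      show ?thesis
      proof (cases "u \<le> k + 1")
        case True
        then have cu: "col u = \<pi>2 0" using cols p2(3) ku by (metis Suc_eq_plus1 le_SucE le_antisym)
        have v: "k + 1 < v" using that False True by auto
        then have "v - k - 1 \<noteq> 0" by auto
        then have "\<pi>2 (v - k - 1) \<noteq> \<pi>2 0" by (simp only: inj_eq[OF p2(1)] simp_thms)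
        then show ?thesis using cu c2[OF v] by simp
      next
        case False
        then have uk: "k + 1 < u" by auto
        then have "u - k - 1 \<noteq> v - k - 1" using that by auto
        then have "\<pi>2 (u - k - 1) \<noteq> \<pi>2 (v - k - 1)" by (simp only: inj_eq[OF p2(1)] simp_thms)
        then show ?thesis using c2[OF uk] c2[of v] uk that by simp
      qed
    qed
    have "u \<noteq> v" using uv by (simp add: edge_two_cliques)
    then consider "u < v" | "v < u" by linarith
    then show ?thesis
    proof cases
      case 1
      then show ?thesis using uv that by (intro main) (auto simp: edge_two_cliques)
    next
      case 2
      then have "col v \<noteq> col u" using uv that by (intro main) (auto simp: edge_two_cliques)
      then show ?thesis by simp
    qed
  qed
  have fi: "f0 ` {0, k, k + 1} = {b, a, b'}" "f0 ` {0, k} = {b, a}" "f0 ` {k, k + 1} = {a, b'}" using f0s by (simp_all add: insert_commute)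
  have hh: "h {0, k} = e" "h {k, k + 1} = e'" using k by (simp_all add: h_def)
  have "contains_copy G (expansion r (two_cliques k))"
  proof (rule partite_embedding[OF graph_two_cliques G r w, where M = "{{0, k}, {k, k + 1}}" and ?P0.0 = "{0, k, k + 1}"
        and ?f0.0 = f0 and h = h and W = "e \<union> e'" and col = col and k = k and P = P and B = B])
    show "{{0, k}, {k, k + 1}} \<subseteq> edges (two_cliques k)" using k by (auto simp: edge_two_cliques)
    show "\<Union>{{0, k}, {k, k + 1}} \<subseteq> {0, k, k + 1}" by auto
    show "{0, k, k + 1} \<subseteq> verts (two_cliques k)" using k by auto
    show "inj_on f0 {0, k, k + 1}" using b be k by (auto simp: inj_on_def f0_def)
    show "f0 ` {0, k, k + 1} \<subseteq> verts G"
      using ae b(1,3) edge_props[OF e(1)] edge_props[OF e(2)] f0s by auto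
    show "h m \<in> edges G" if "m \<in> {{0, k}, {k, k + 1}}" for m using e by (simp add: h_def)
    show "h m \<inter> f0 ` {0, k, k + 1} = f0 ` m" if "m \<in> {{0, k}, {k, k + 1}}" for m
    proof -
      have "e \<inter> {b, a, b'} = {b, a}" "e' \<inter> {b, a, b'} = {a, b'}" using b(1,3) be ae by blast+
      then show ?thesis using that unfolding fi by (elim insertE emptyE) (simp_all only: fi hh)
    qed
    show "(h m - f0 ` m) \<inter> (h m' - f0 ` m') = {}" if "m \<in> {{0, k}, {k, k + 1}}" "m' \<in> {{0, k}, {k, k + 1}}" "m \<noteq> m'" for m m'
    proof -
      have "h m \<inter> h m' = {a}" using that int by (elim insertE emptyE) (simp_all only: hh Int_commute[of e' e] simp_thms)
      moreover have "a \<in> f0 ` m" using that(1) by (elim insertE emptyE) (simp_all only: fi insert_iff simp_thms)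
      ultimately show ?thesis by blast
    qed
    show "robust w G (f0 u) (f0 v)" if "u \<in> {0, k, k + 1}" "v \<in> {0, k, k + 1}"
      "{u, v} \<in> edges (two_cliques k)" "{u, v} \<notin> {{0, k}, {k, k + 1}}" for u v
      using that k by (auto simp: edge_two_cliques doubleton_eq_iff)
    show "finite (e \<union> e')" using W_card[OF e] by simp
    show "f0 ` {0, k, k + 1} \<subseteq> e \<union> e'" using ae b f0s by auto
    show "h m \<subseteq> e \<union> e'" for m by (auto simp: h_def)
    show "col z < k" if "z \<in> verts (two_cliques k)" for z
      using that p1(2) p2(2) i k by (auto simp: col_def)
    show "col z \<noteq> col z'" if "z \<in> verts (two_cliques k) - {0, k, k + 1}" "{z, z'} \<in> edges (two_cliques k)" for z z'
      using that by (intro colne) (auto simp: doubleton_eq_iff)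
    show "P i \<subseteq> verts G" if "i < k" for i by (rule P(1)[OF that])
    show "card {b\<in>P j. \<not> robust w G a b} \<le> B" if "i < k" "j < k" "i \<noteq> j" "a \<in> P i" for i j a by (rule P(2)[OF that])
    show "card (verts (two_cliques k)) * Suc B + card {0, k, k + 1} * B + card (e \<union> e') < card (P i)" if "i < k" for i
    proof -
      have "card {0, k, k + 1} * B \<le> 4 * B" using k by (intro mult_le_mono1) (auto simp: card_insert_if)
      then show ?thesis using P(3)[OF that] W_card[OF e] by linarith
    qed
    show "card {b\<in>P (col z). \<not> robust w G (f0 u) b} \<le> B" if u: "u \<in> {0, k, k + 1}"
      and z: "z \<in> verts (two_cliques k) - {0, k, k + 1}" and uz: "{u, z} \<in> edges (two_cliques k)" for u z
    proof (rule P(2)[of "col u" "col z" "f0 u"])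
      have zk: "z \<le> 2 * k" using z by simp
      show "col z < k" using zk p1(2) p2(2) i k by (auto simp: col_def)
      show "col u < k" using u cols i by auto
      show "f0 u \<in> P (col u)" using u f0s cols a b by auto
      show "col u \<noteq> col z" using u z uz by (intro colne) (auto simp: doubleton_eq_iff)
    qed
  qed
  then show False using free by simp
qed

text \<open>With two parts, and the bad hyperedges in different ones, no third part is left for the
  shared vertex. It is placed at x', which robust pairs join to \<open>x\<close> and
  \<open>y\<close>; the second triangle consists of x', y' and one further vertex from
  \<open>P i\<close>.\<close>

lemma no_bowtie:
  assumes k2: "k = 2" and e: "e \<in> edges G" "i < k" "x \<in> e \<inter> P i" "y \<in> e \<inter> P i" "x \<noteq> y"
    and e': "e' \<in> edges G" "i' < k" "x' \<in> e' \<inter> P i'" "y' \<in> e' \<inter> P i'" "x' \<noteq> y'"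
    and dj: "e \<inter> e' = {}" and i: "i \<noteq> i'" and D: "robust w G x x'" "robust w G y x'"
  shows False
proof -
  define f0 where "f0 v = (if v = 0 then x else if v = 1 then y else if v = 2 then x' else y')" for v :: nat
  define h where "h m = (if 0 \<in> m then e else e')" for m :: "nat set"
  have f0s: "f0 0 = x" "f0 1 = y" "f0 2 = x'" "f0 3 = y'" by (auto simp: f0_def)
  have P0: "{0, 1, 2, 3} = ({0, 1, 2, 3} :: nat set)" ..
  have z4: "z = 4" if "z \<in> verts (two_cliques k) - {0, 1, 2, 3}" for z using that k2 by auto
  have fi: "f0 ` {0, 1, 2, 3} = {x, y, x', y'}" "f0 ` {0, 1} = {x, y}" "f0 ` {2, 3} = {x', y'}" using f0s by (simp_all add: insert_commute)
  have hh: "h {0, 1} = e" "h {2, 3} = e'" using k by (simp_all add: h_def)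
  have "contains_copy G (expansion r (two_cliques k))"
  proof (rule partite_embedding[OF graph_two_cliques G r w, where M = "{{0, 1}, {2, 3}}" and ?P0.0 = "{0, 1, 2, 3}"
        and ?f0.0 = f0 and h = h and W = "e \<union> e'" and col = "\<lambda>_. i" and k = k and P = P and B = B])
    show "{{0, 1}, {2, 3}} \<subseteq> edges (two_cliques k)" using k2 by (auto simp: edge_two_cliques)
    show "\<Union>{{0, 1}, {2, 3}} \<subseteq> {0, 1, 2, 3 :: nat}" by auto
    show "{0, 1, 2, 3} \<subseteq> verts (two_cliques k)" using k2 by auto
    show "inj_on f0 {0, 1, 2, 3}"
    proof -
      have "x \<noteq> x'" "x \<noteq> y'" "y \<noteq> x'" "y \<noteq> y'" using e(3,4) e'(3,4) dj by blast+
      then show ?thesis using e(5) e'(5) f0s by (simp add: inj_on_def)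
    qed
    show "f0 ` {0, 1, 2, 3} \<subseteq> verts G"
      using e(3,4) e'(3,4) edge_props[OF e(1)] edge_props[OF e'(1)] f0s by auto
    show "h m \<in> edges G" if "m \<in> {{0, 1}, {2, 3}}" for m using e(1) e'(1) by (simp add: h_def)
    show "h m \<inter> f0 ` {0, 1, 2, 3} = f0 ` m" if "m \<in> {{0, 1}, {2, 3}}" for m
    proof -
      have "e \<inter> {x, y, x', y'} = {x, y}" "e' \<inter> {x, y, x', y'} = {x', y'}"
        using e(3,4) e'(3,4) dj by blast+
      then show ?thesis using that unfolding fi by (elim insertE emptyE) (simp_all only: fi hh)
    qed
    show "(h m - f0 ` m) \<inter> (h m' - f0 ` m') = {}" if "m \<in> {{0, 1}, {2, 3}}" "m' \<in> {{0, 1}, {2, 3}}" "m \<noteq> m'" for m m'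
    proof -
      have "h m \<inter> h m' = {}" using that dj by (elim insertE emptyE) (simp_all only: hh Int_commute[of e' e] simp_thms)
      then show ?thesis by blast
    qed
    show "robust w G (f0 u) (f0 v)" if "u \<in> {0, 1, 2, 3}" "v \<in> {0, 1, 2, 3}"
      "{u, v} \<in> edges (two_cliques k)" "{u, v} \<notin> {{0, 1}, {2, 3}}" for u v
    proof -
      have "(u \<in> {0, 1} \<and> v = 2) \<or> (v \<in> {0, 1} \<and> u = 2)"
        using that k2 by (auto simp: edge_two_cliques doubleton_eq_iff)
      then show ?thesis using D f0s symp_robust[of w G] by (auto simp: symp_def)
    qed
    show "finite (e \<union> e')" using W_card[OF e(1) e'(1)] by simp
    show "f0 ` {0, 1, 2, 3} \<subseteq> e \<union> e'" using e(3,4) e'(3,4) f0s by auto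
    show "h m \<subseteq> e \<union> e'" for m by (auto simp: h_def)
    show "i < k" by (rule e(2))
    show "i \<noteq> i" if "z \<in> verts (two_cliques k) - {0, 1, 2, 3}" "z' \<in> verts (two_cliques k) - {0, 1, 2, 3}" "{z, z'} \<in> edges (two_cliques k)" for z z'
    proof -
      have "z \<noteq> z'" using that(3) unfolding edge_two_cliques by blast
      then show ?thesis using z4[OF that(1)] z4[OF that(2)] by simp
    qed
    show "P i \<subseteq> verts G" if "i < k" for i by (rule P(1)[OF that])
    show "card {b\<in>P j. \<not> robust w G a b} \<le> B" if "i < k" "j < k" "i \<noteq> j" "a \<in> P i" for i j a by (rule P(2)[OF that])
    show "card (verts (two_cliques k)) * Suc B + card {0, 1, 2, 3 :: nat} * B + card (e \<union> e') < card (P i)" if "i < k" for i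
    proof -
      have "card {0, 1, 2, 3 :: nat} * B = 4 * B" by simp
      then show ?thesis using P(3)[OF that] W_card[OF e(1) e'(1)] by linarith
    qed
    show "card {b\<in>P i. \<not> robust w G (f0 u) b} \<le> B" if u: "u \<in> {0, 1, 2, 3}"
      and z: "z \<in> verts (two_cliques k) - {0, 1, 2, 3}" and uz: "{u, z} \<in> edges (two_cliques k)" for u z
    proof (rule P(2))
      have "u = 2 \<or> u = 3" using u uz z4[OF z] k2 by (auto simp: edge_two_cliques)
      then show "f0 u \<in> P i'" using f0s e'(3,4) by auto
    qed (use e(2) e'(2) i in auto)
  qed
  then show False using free by simp
qed

end

section \<open>Size and growth of the two-clique extremal count\<close>

lemma power_bound_choose: "(n choose m) \<le> n ^ m"
  by (cases "m \<le> n") (simp_all add: binomial_le_pow binomial_eq_0)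

text \<open>For p at least 2 the \<open>p\<close>-sets inside the part \<open>j\<close> are not
  transversal and hence come on top.\<close>

lemma esym_add_choose:
  assumes J: "finite J" "j \<in> J" and p: "2 \<le> p"
  shows "esym b J p + (b j choose p) \<le> (\<Sum>j\<in>J. b j) choose p"
proof -
  obtain q where q: "p = Suc q" using p by (cases p) auto
  define x where "x = (\<Sum>i\<in>J - {j}. b i)"
  have s: "(\<Sum>j\<in>J. b j) = b j + x" using J by (simp add: x_def sum.remove)
  have "esym b J p \<le> (x choose p) + b j * (x choose (p - 1))"
    unfolding q esym_remove[OF J] x_def using J by (simp add: add_mono mult_le_mono2 esym_le_binomial)
  then show ?thesis using choose_add_ge(2)[OF p, of x "b j"] s by simp
qed

lemma esym_le_H:
  assumes k: "2 \<le> k" and c: "(\<Sum>j<k. c j) = N"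
  shows "esym c {..<k} p \<le> esym (\<lambda>j. if j = 0 then c 0 else bal (N - c 0) (k - 1) (j - 1)) {..<k} p"
proof (cases p)
  case (Suc q)
  let ?b = "\<lambda>j. if j = 0 then c 0 else bal (N - c 0) (k - 1) (j - 1)"
  have J: "{..<k} - {0} = Suc ` {..<k - 1}"
  proof (intro equalityI subsetI)
    fix x assume "x \<in> {..<k} - {0}"
    then show "x \<in> Suc ` {..<k - 1}" by (intro image_eqI[of _ _ "x - 1"]) auto
  qed auto
  have z: "0 \<in> {..<k}" "finite {..<k}" using k by auto
  have "(\<Sum>j\<in>{..<k} - {0}. c j) = N - c 0" using c z by (simp add: sum.remove)
  then have s: "(\<Sum>i<k - 1. c (Suc i)) = N - c 0" unfolding J by (subst (asm) sum.reindex) auto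
  have "esym c ({..<k} - {0}) q \<le> esym ?b ({..<k} - {0}) q" for q
  proof -
    have "esym c ({..<k} - {0}) q = esym (\<lambda>i. c (Suc i)) {..<k - 1} q"
      unfolding J by (rule esym_reindex) simp
    also have "\<dots> \<le> esym (bal (N - c 0) (k - 1)) {..<k - 1} q" using k s by (intro esym_le_bal) auto
    also have "\<dots> = esym ?b ({..<k} - {0}) q"
      unfolding J by (subst esym_reindex) auto
    finally show ?thesis .
  qed
  then show ?thesis
    unfolding Suc esym_remove[OF z(2,1)] by (intro add_mono mult_le_mono) auto
qed (use k in auto)

definition H_max :: "nat \<Rightarrow> nat \<Rightarrow> nat \<Rightarrow> nat" where
  "H_max r n k = card (edges (H_extremal r n k))"

text \<open>The numbers \<open>c\<close> are the orders of the parts after removal of the special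
  vertex u, so \<open>V_1\<close> has order c 0 + 1 = m and the sum is n - 1.\<close>

lemma le_H_max:
  assumes k: "2 \<le> k" and r: "2 \<le> r" and c: "(\<Sum>j<k. c j) = n - 1" and m: "Suc (c 0) = m" "2 \<le> m" "m \<le> n"
  shows "esym c {..<k} r + ((n - m) choose (r - 1)) + ((n - 2) choose (r - 2)) \<le> H_max r n k"
proof -
  have e: "n - 1 - (m - 1) = n - m" "c 0 = m - 1" using m by auto
  have "esym c {..<k} r + ((n - m) choose (r - 1)) + ((n - 2) choose (r - 2)) \<le> H_val r n k m"
    using esym_le_H[OF k c, of r] unfolding H_val_def e by (simp only: e add_le_cancel_right)
  also have "\<dots> \<le> H_max r n k"
    unfolding H_max_def using H_extremal_props(2)[OF k _ r, of n m] m by simp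
  finally show ?thesis .
qed

text \<open>The balanced partition, with u taken from part 0, competes for the maximum. The link of
  u contains all (r-1)-sets outside part 0, so for \<open>r\<close> at least 3 also those inside
  another part; the hyperedges through u and v are a further gain. For \<open>r = 2\<close> the
  surplus over the Turan number is 1.\<close>

lemma H_max_ge:
  assumes k: "2 \<le> k" and r: "2 \<le> r" and n: "2 * k \<le> n"
  shows "esym (bal n k) {..<k} r + ((n - 2) choose (r - 2)) + (if r = 2 then 0 else (n div k) choose (r - 1)) \<le> H_max r n k"
proof -
  define m where "m = bal n k 0"
  obtain p where p: "r = Suc p" "1 \<le> p" using r by (cases r) auto
  have "2 \<le> n div k" using n k by (simp add: less_eq_div_iff_mult_less_eq)
  then have m2: "2 \<le> m" using bal_bounds(1)[of 0 k n] k by (simp add: m_def)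
  let ?J = "{..<k} - {0}"
  have z: "0 \<in> {..<k}" "finite {..<k}" using k by auto
  have sb: "m + (\<Sum>j\<in>?J. bal n k j) = n" using sum_bal[of k n] k unfolding sum.remove[OF z(2,1)] m_def by simp
  define c where "c = (bal n k)(0 := m - 1)"
  have cJ: "esym c ?J q = esym (bal n k) ?J q" for q by (intro esym_cong) (auto simp: c_def)
  have c0: "c 0 = m - 1" by (simp add: c_def)
  have sc: "(\<Sum>j<k. c j) = n - 1"
  proof -
    have "(\<Sum>j\<in>?J. c j) = (\<Sum>j\<in>?J. bal n k j)" by (intro sum.cong) (auto simp: c_def)
    then show ?thesis using sb m2 c0 unfolding sum.remove[OF z(2,1)] by simp
  qed
  obtain m' where m': "m = Suc m'" using m2 by (cases m) auto
  have E: "esym (bal n k) {..<k} r = esym c {..<k} r + esym (bal n k) ?J p"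
    unfolding p(1) esym_remove[OF z(2,1), of _ p] cJ c0 m_def[symmetric] m' by simp
  have "esym (bal n k) ?J p + (if r = 2 then 0 else (n div k) choose p) \<le> (n - m) choose p"
  proof -
    have x: "(\<Sum>j\<in>?J. bal n k j) = n - m" using sb by simp
    show ?thesis
    proof (cases "r = 2")
      case True
      then show ?thesis using esym_le_binomial[of ?J "bal n k" p] x by simp
    next
      case False
      then have "2 \<le> p" using p by simp
      moreover have "1 \<in> ?J" using k by simp
      ultimately have "esym (bal n k) ?J p + (bal n k 1 choose p) \<le> (n - m) choose p"
        using esym_add_choose[of ?J 1 p "bal n k"] x by simp
      moreover have "(n div k) choose p \<le> bal n k 1 choose p"
        using bal_bounds(1)[of 1 k n] k by (intro binomial_right_mono) auto
      ultimately show ?thesis using False by simp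
    qed
  qed
  moreover have "esym c {..<k} r + ((n - m) choose (r - 1)) + ((n - 2) choose (r - 2)) \<le> H_max r n k"
    using m2 c0 sb by (intro le_H_max[OF k r sc]) auto
  moreover have rp: "r - 1 = p" using p(1) by simp
  ultimately show ?thesis using E unfolding rp by linarith
qed

text \<open>By Euler's identity some part can be enlarged with a gain of at least the average degree.\<close>

lemma H_max_step_nat:
  assumes k: "2 \<le> k" and r: "2 \<le> r" and n: "2 * k \<le> n"
  shows "\<exists>g. H_max r n k + g \<le> H_max r (Suc n) k \<and> r * (((k choose r) * (n div k) ^ r)) \<le> g * n + r * (2 * n ^ (r - 1))"
proof -
  have n2: "2 \<le> n" using n k by simp
  obtain p where p: "r = Suc p" "1 \<le> p" using r by (cases r) auto
  obtain m where m: "2 \<le> m" "m \<le> n" "H_max r n k = H_val r n k m"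
    using H_extremal_props(1)[OF k n2 r] unfolding H_max_def by blast
  define c where "c j = (if j = 0 then m - 1 else bal (n - m) (k - 1) (j - 1))" for j
  let ?J = "{..<k}"
  have z: "0 \<in> ?J" "finite ?J" using k by auto
  have sc: "(\<Sum>j<k. c j) = n - 1"
  proof -
    have J: "{..<k} - {0} = Suc ` {..<k - 1}"
    proof (intro equalityI subsetI)
      fix x assume "x \<in> {..<k} - {0}"
      then show "x \<in> Suc ` {..<k - 1}" by (intro image_eqI[of _ _ "x - 1"]) auto
    qed auto
    have "(\<Sum>j\<in>{..<k} - {0}. c j) = (\<Sum>i<k - 1. bal (n - m) (k - 1) i)"
      unfolding J by (subst sum.reindex) (auto simp: c_def)
    also have "\<dots> = n - m" using k by (intro sum_bal) simp
    finally have "(\<Sum>j\<in>{..<k} - {0}. c j) = n - m" .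
    moreover have "c 0 = m - 1" by (simp add: c_def)
    ultimately show ?thesis using m unfolding sum.remove[OF z(2,1)] by simp
  qed
  have Hc: "H_max r n k = esym c ?J r + ((n - m) choose (r - 1)) + ((n - 2) choose (r - 2))"
    unfolding m(3) H_val_def c_def[abs_def] ..
  \<comment> \<open>The gains \<open>esym c (?J - {j}) p\<close> have, with weights
    \<open>c j\<close> of total n - 1, the weighted sum \<open>r * esym c ?J r\<close> by Euler. So
    some gain is at least a 1/n share of it.\<close>
  have "\<exists>j\<in>?J. r * esym c ?J r \<le> esym c (?J - {j}) p * n"
  proof (rule ccontr)
    assume "\<not> ?thesis"
    then have a: "\<And>j. j \<in> ?J \<Longrightarrow> esym c (?J - {j}) p * n < r * esym c ?J r" by force
    define Q where "Q = r * esym c ?J r"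
    have Q: "Q > 0" using a[OF z(1)] unfolding Q_def by linarith
    have "n * Q = n * (\<Sum>j\<in>?J. c j * esym c (?J - {j}) p)"
      unfolding Q_def p(1) esym_euler[OF z(2)] ..
    also have "\<dots> = (\<Sum>j\<in>?J. c j * (esym c (?J - {j}) p * n))" by (simp add: sum_distrib_left mult.commute mult.left_commute)
    also have "\<dots> \<le> (\<Sum>j\<in>?J. c j * Q)"
      using a by (intro sum_mono mult_le_mono2) (simp add: Q_def less_imp_le)
    also have "\<dots> = (n - 1) * Q" by (simp only: sum_distrib_right[symmetric] sc)
    finally show False using Q n2 by simp
  qed
  then obtain j where j: "j \<in> ?J" "r * esym c ?J r \<le> esym c (?J - {j}) p * n" by blast
  define g where "g = esym c (?J - {j}) p"
  define c' where "c' = c(j := Suc (c j))"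
  have sc': "(\<Sum>i<k. c' i) = Suc n - 1"
  proof -
    have "(\<Sum>i\<in>?J - {j}. c' i) = (\<Sum>i\<in>?J - {j}. c i)" by (intro sum.cong) (auto simp: c'_def)
    then have "(\<Sum>i<k. c' i) = Suc (\<Sum>i<k. c i)" using j z by (simp add: sum.remove[OF z(2) j(1)] c'_def)
    then show ?thesis using sc n2 by simp
  qed
  have cJ: "esym c' (?J - {j}) q = esym c (?J - {j}) q" for q by (intro esym_cong) (auto simp: c'_def)
  have E: "esym c' ?J r = esym c ?J r + g"
    unfolding p(1) esym_remove[OF z(2) j(1), of _ p] cJ g_def by (simp add: c'_def)
  define m' where "m' = Suc (c' 0)"
  have m': "m \<le> m'" "m' \<le> Suc m" using m by (auto simp: m'_def c'_def c_def)
  have "esym c' ?J r + ((Suc n - m') choose (r - 1)) + ((Suc n - 2) choose (r - 2)) \<le> H_max r (Suc n) k"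
    using m m' by (intro le_H_max[OF k r sc']) (auto simp: m'_def)
  moreover have "(n - m) choose (r - 1) \<le> (Suc n - m') choose (r - 1)" using m' by (intro binomial_right_mono) simp
  moreover have "(n - 2) choose (r - 2) \<le> (Suc n - 2) choose (r - 2)" by (intro binomial_right_mono) simp
  ultimately have step: "H_max r n k + g \<le> H_max r (Suc n) k" unfolding Hc E by linarith
  \<comment> \<open>The maximum is at least the balanced value and differs from
    \<open>esym c\<close> by at most 2 n^(r-1), which bounds \<open>esym c\<close> from
    below.\<close>
  have "(k choose r) * (n div k) ^ r = esym (\<lambda>_. n div k) ?J r" by (simp add: esym_const)
  also have "\<dots> \<le> esym (bal n k) ?J r" by (intro esym_mono) (auto intro: bal_bounds)
  also have "\<dots> \<le> H_max r n k" using H_max_ge[OF k r n] by linarith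
  also have "\<dots> \<le> esym c ?J r + 2 * n ^ (r - 1)"
  proof -
    have "(n - m) choose (r - 1) \<le> n choose (r - 1)" "(n - 2) choose (r - 2) \<le> n choose (r - 2)"
      by (intro binomial_right_mono; simp)+
    moreover have "n choose (r - 1) \<le> n ^ (r - 1)" "n choose (r - 2) \<le> n ^ (r - 2)" by (rule power_bound_choose)+
    moreover have "n ^ (r - 2) \<le> n ^ (r - 1)" using n2 by (intro power_increasing) auto
    ultimately show ?thesis unfolding Hc by linarith
  qed
  finally have "r * ((k choose r) * (n div k) ^ r) \<le> r * (esym c ?J r + 2 * n ^ (r - 1))" by (rule mult_le_mono2)
  also have "\<dots> = r * esym c ?J r + r * (2 * n ^ (r - 1))" by (rule add_mult_distrib2)
  also have "\<dots> \<le> g * n + r * (2 * n ^ (r - 1))" using j(2) unfolding g_def by (rule add_right_mono)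
  finally show ?thesis using step by blast
qed

text \<open>The step condition of \<open>progressive_induction\<close> for the second construction.
  By the absorption identity \<open>kr\<close> the main term r (k choose r) (n/k)^r / n is (k-1
  choose r-1) (n/k)^(r-1). One half of \<epsilon> covers the rounding in n div k, the other half the
  error 2 r n^(r-1).\<close>

lemma H_max_step:
  fixes \<epsilon> :: real
  assumes r: "2 \<le> r" "r \<le> k" and \<epsilon>: "0 < \<epsilon>" "\<epsilon> \<le> 1"
  shows "\<exists>n0. \<forall>n\<ge>n0. real (H_max r n k) + (1 - \<epsilon>) * real ((k - 1) choose (r - 1)) * (real (Suc n) / k) ^ (r - 1) \<le> real (H_max r (Suc n) k)"
proof -
  have k: "2 \<le> k" "0 < k" using r by auto
  define C where "C = real ((k - 1) choose (r - 1))"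
  have "1 \<le> (k - 1) choose (r - 1)" using r by (simp add: Suc_le_eq)
  from of_nat_mono[OF this, where 'a = real] have C: "1 \<le> C" by (simp add: C_def)
  define e where "e = \<epsilon> / 2"
  have e: "0 < e" "e \<le> 1" using \<epsilon> by (auto simp: e_def)
  obtain n1 where n1: "\<forall>n\<ge>n1. (1 - e) * (real (Suc n) / k) ^ r \<le> real ((n - 0) div k) ^ r"
    using div_power_ge[OF k(2) e, of r 0] by (rule exE)
  define n0 where "n0 = n1 + 2 * k + nat \<lceil>2 * r * real k ^ (r - 1) / e\<rceil>"
  show ?thesis
  proof (intro exI[of _ n0] allI impI)
    fix n assume n: "n0 \<le> n"
    then have n': "n1 \<le> n" "2 * k \<le> n" by (auto simp: n0_def)
    obtain g where g: "H_max r n k + g \<le> H_max r (Suc n) k" "r * (((k choose r) * (n div k) ^ r)) \<le> g * n + r * (2 * n ^ (r - 1))"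
      using H_max_step_nat[OF k(1) r(1) n'(2)] by blast
    define N where "N = real (Suc n)"
    define y where "y = (N / k) ^ (r - 1)"
    have N: "N > 0" "real n \<le> N" by (auto simp: N_def)
    have y: "y > 0" using N k by (simp add: y_def)
    have kr: "r * (k choose r) = k * ((k - 1) choose (r - 1))"
    proof -
      obtain a b where "k = Suc a" "r = Suc b" using r by (metis Suc_le_D k(1) numeral_2_eq_2)
      then show ?thesis using Suc_times_binomial_eq[of a b] by (simp add: mult.commute)
    qed
    have yr: "(N / k) ^ r = N / k * y"
      unfolding y_def using r by (simp add: power_eq_if)
    from of_nat_mono[OF g(2), where 'a = real]
    have "real (r * (k choose r)) * real (n div k) ^ r \<le> g * real n + r * (2 * real n ^ (r - 1))" by (simp add: mult.assoc)
    then have "k * C * real (n div k) ^ r \<le> g * real n + r * (2 * real n ^ (r - 1))" unfolding kr by (simp add: C_def)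
    also have "\<dots> \<le> g * N + r * (2 * N ^ (r - 1))"
      using N by (intro add_mono mult_left_mono power_mono) auto
    finally have 1: "k * C * real (n div k) ^ r \<le> g * N + 2 * r * N ^ (r - 1)" by simp
    have "(1 - e) * (N / k) ^ r \<le> real (n div k) ^ r" using n1[rule_format, OF n'(1)] by (simp add: N_def)
    then have "(1 - e) * (N / k * y) \<le> real (n div k) ^ r" unfolding yr .
    then have "k * C * ((1 - e) * (N / k * y)) \<le> k * C * real (n div k) ^ r" using C by (intro mult_left_mono) auto
    moreover have "k * C * ((1 - e) * (N / k * y)) = C * (1 - e) * y * N" using k by simp
    ultimately have 2: "C * (1 - e) * y * N \<le> g * N + 2 * r * N ^ (r - 1)" using 1 by linarith
    have "2 * r * real k ^ (r - 1) / e \<le> N" using n unfolding n0_def N_def by linarith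
    then have "2 * r * real k ^ (r - 1) \<le> e * N" using e by (simp add: field_simps)
    then have "2 * r * real k ^ (r - 1) * y \<le> e * N * y" using y by (intro mult_right_mono) auto
    also have "\<dots> \<le> C * (e * N * y)" using mult_right_mono[OF C, of "e * N * y"] e N y by simp
    also have "2 * r * real k ^ (r - 1) * y = 2 * r * N ^ (r - 1)" unfolding y_def using k by (simp add: power_divide)
    finally have 3: "2 * r * N ^ (r - 1) \<le> C * e * y * N" by (simp add: mult_ac)
    have "(C * (1 - \<epsilon>) * y) * N = C * (1 - e) * y * N - C * e * y * N" by (simp add: e_def algebra_simps)
    then have "(C * (1 - \<epsilon>) * y) * N \<le> g * N" using 2 3 by linarith
    then have "C * (1 - \<epsilon>) * y \<le> g" using N by simp
    then have "(1 - \<epsilon>) * C * y \<le> g" by (simp add: mult.commute)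
    moreover have "real (H_max r n k) + real g \<le> real (H_max r (Suc n) k)"
      using of_nat_mono[OF g(1), where 'a = real] by simp
    ultimately show "real (H_max r n k) + (1 - \<epsilon>) * real ((k - 1) choose (r - 1)) * (real (Suc n) / k) ^ (r - 1) \<le> real (H_max r (Suc n) k)"
      unfolding C_def y_def N_def by linarith
  qed
qed

text \<open>The Erdos-Ko-Rado bound for large ground sets. If the members share a vertex, they form
  a star. Otherwise every vertex \<open>v\<close> of a fixed member is missed by some other member,
  which all members through \<open>v\<close> must meet; so there are at most p^2 |V|^(p-2) members,
  and \<open>big\<close> compares this with a star.\<close>

lemma intersecting_family_le:
  assumes V: "finite V" and p: "2 \<le> p" and E: "\<And>e. e \<in> E \<Longrightarrow> e \<subseteq> V \<and> card e = p"
    and int: "\<And>e e'. e \<in> E \<Longrightarrow> e' \<in> E \<Longrightarrow> e \<inter> e' \<noteq> {}"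
    and big: "p * p * card V ^ (p - 2) \<le> (card V - 1) choose (p - 1)"
  shows "card E \<le> (card V - 1) choose (p - 1)"
proof (cases "\<exists>v\<in>V. \<forall>e\<in>E. v \<in> e")
  case True
  then obtain v where v: "v \<in> V" "\<forall>e\<in>E. v \<in> e" by blast
  have "card E \<le> card {f. f \<subseteq> V - {v} \<and> card f = p - 1}"
  proof (rule card_inj_on_le[where f = "\<lambda>e. e - {v}"])
    show "inj_on (\<lambda>e. e - {v}) E"
    proof (rule inj_onI)
      fix e e' assume "e \<in> E" "e' \<in> E" "e - {v} = e' - {v}"
      then show "e = e'" using v(2) by (metis insert_Diff)
    qed
    show "(\<lambda>e. e - {v}) ` E \<subseteq> {f. f \<subseteq> V - {v} \<and> card f = p - 1}"
    proof clarify
      fix e assume e: "e \<in> E"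
      then have "v \<in> e" using v(2) by blast
      then show "e - {v} \<subseteq> V - {v} \<and> card (e - {v}) = p - 1" using E[OF e] by auto
    qed
    show "finite {f. f \<subseteq> V - {v} \<and> card f = p - 1}" using V by simp
  qed
  also have "\<dots> = (card V - 1) choose (p - 1)" using V v by (simp add: n_subsets)
  finally show ?thesis .
next
  case False
  show ?thesis
  proof (cases "E = {}")
    case ne: False
    then obtain e0 where e0: "e0 \<in> E" by blast
    have fE: "finite E" by (rule finite_subset[of _ "Pow V"]) (use E V in auto)
    have f0: "finite e0" "card e0 = p" "e0 \<subseteq> V" using E[OF e0] V finite_subset by blast+
    let ?S = "\<lambda>v z. {e. e \<subseteq> V \<and> card e = p \<and> {v, z} \<subseteq> e}"
    have cS: "card (?S v z) \<le> card V ^ (p - 2)" if "v \<noteq> z" for v z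
    proof -
      have c2: "card {v, z} = 2" using that by simp
      show ?thesis using card_supersets_le[OF V, of "{v, z}" p] p unfolding c2 by simp
    qed
    have each: "card {e\<in>E. v \<in> e} \<le> p * card V ^ (p - 2)" if v: "v \<in> e0" for v
    proof -
      have "v \<in> V" using v f0 by blast
      then obtain f where f: "f \<in> E" "v \<notin> f" using False by blast
      have ff: "finite f" "card f = p" using E[OF f(1)] V finite_subset by blast+
      have "{e\<in>E. v \<in> e} \<subseteq> (\<Union>z\<in>f. ?S v z)"
      proof
        fix e assume e: "e \<in> {e\<in>E. v \<in> e}"
        then obtain z where "z \<in> e" "z \<in> f" using int[of e f] f(1) by blast
        then show "e \<in> (\<Union>z\<in>f. ?S v z)" using e E[of e] by auto
      qed
      then have "card {e\<in>E. v \<in> e} \<le> card (\<Union>z\<in>f. ?S v z)" using ff V by (intro card_mono) auto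
      also have "\<dots> \<le> (\<Sum>z\<in>f. card (?S v z))" by (rule card_UN_le[OF ff(1)])
      also have "\<dots> \<le> (\<Sum>z\<in>f. card V ^ (p - 2))"
      proof (rule sum_mono)
        fix z assume "z \<in> f"
        then have "v \<noteq> z" using f(2) by auto
        then show "card (?S v z) \<le> card V ^ (p - 2)" by (rule cS)
      qed
      finally show ?thesis using ff by simp
    qed
    have "E \<subseteq> (\<Union>v\<in>e0. {e\<in>E. v \<in> e})"
    proof
      fix e assume e: "e \<in> E"
      then obtain v where "v \<in> e" "v \<in> e0" using int[OF e e0] by blast
      then show "e \<in> (\<Union>v\<in>e0. {e\<in>E. v \<in> e})" using e by auto
    qed
    then have "card E \<le> card (\<Union>v\<in>e0. {e\<in>E. v \<in> e})" using f0 fE by (intro card_mono) auto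
    also have "\<dots> \<le> (\<Sum>v\<in>e0. card {e\<in>E. v \<in> e})" by (rule card_UN_le[OF f0(1)])
    also have "\<dots> \<le> (\<Sum>v\<in>e0. p * card V ^ (p - 2))" using each by (rule sum_mono)
    also have "\<dots> = p * p * card V ^ (p - 2)" using f0 by (simp add: mult.assoc)
    finally show ?thesis using big by linarith
  qed simp
qed

section \<open>Upper bounds for partitioned hypergraphs\<close>

lemma card_transversals_le_bal:
  assumes V: "finite V" and k: "0 < k" and dj: "disjoint_family_on P {..<k}" and cov: "(\<Union>j<k. P j) = V"
  shows "finite (transversals P {..<k} r)" "card (transversals P {..<k} r) \<le> esym (bal (card V) k) {..<k} r"
proof -
  show "finite (transversals P {..<k} r)"
    by (rule finite_subset[of _ "Pow V"]) (use V cov in \<open>auto simp: transversals_def\<close>)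
  have finP: "finite (P j)" if "j < k" for j using finite_subset[OF _ V, of "P j"] cov that by blast
  have "card (transversals P {..<k} r) = esym (\<lambda>j. card (P j)) {..<k} r"
    using finP dj by (intro card_transversals) auto
  also have "\<dots> \<le> esym (bal (card V) k) {..<k} r"
  proof (rule esym_le_bal[OF k])
    show "(\<Sum>j<k. card (P j)) = card V"
      unfolding cov[symmetric] using finP dj by (intro card_UN_disjoint[symmetric]) (auto simp: disjoint_family_on_def)
  qed
  finally show "card (transversals P {..<k} r) \<le> esym (bal (card V) k) {..<k} r" .
qed

lemma not_bad_transversal:
  assumes "r_graph r G" "e \<in> edges G" "e \<subseteq> (\<Union>j<k. P j)" "\<not> bad k P e"
  shows "e \<in> transversals P {..<k} r"
proof (rule transversals_memI)
  show "x = y" if "j \<in> {..<k}" "x \<in> e" "y \<in> e" "x \<in> P j" "y \<in> P j" for j x y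
    using assms(4) that by (auto simp: bad_def)
qed (use assms r_graphD[OF assms(1)] in auto)

text \<open>All hyperedges avoiding \<open>u\<close> are transversal, and \<open>dg\<close> bounds
  the degree of \<open>u\<close> by its value in the construction whose special part is
  \<open>P i\<close> together with \<open>u\<close>.\<close>

lemma card_edges_le_star:
  assumes G: "r_graph r G" and r: "2 \<le> r" and k: "2 \<le> k" and u: "u \<in> verts G"
    and dj: "disjoint_family_on P {..<k}" and cov: "(\<Union>j<k. P j) = verts G - {u}"
    and i: "i < k" "P i \<noteq> {}"
    and tr: "\<And>e. e \<in> edges G \<Longrightarrow> u \<notin> e \<Longrightarrow> e \<in> transversals P {..<k} r"
    and dg: "deg G u \<le> ((card (verts G) - Suc (card (P i))) choose (r - 1)) + ((card (verts G) - 2) choose (r - 2))"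
  shows "card (edges G) \<le> H_max r (card (verts G)) k"
proof -
  define n where "n = card (verts G)"
  \<comment> \<open>Part \<open>i\<close> is moved to index 0, where \<open>le_H_max\<close> expects
    the special part; \<open>esym\<close> is invariant under this.\<close>
  define c where "c j = card (P (transpose 0 i j))" for j
  have fin: "finite (verts G)" "finite (edges G)" using r_graphD[OF G] by auto
  have PV: "P j \<subseteq> verts G - {u}" if "j < k" for j using cov that by blast
  have finP: "finite (P j)" if "j < k" for j using finite_subset[OF PV[OF that]] fin by simp
  have inj: "inj_on (transpose 0 i) {..<k}" by (rule inj_on_subset[OF inj_transpose]) simp
  have tk: "transpose 0 i ` {..<k} = {..<k}"
    using i inj by (intro endo_inj_surj) (auto simp: transpose_def)
  have cE: "esym c {..<k} r = esym (\<lambda>j. card (P j)) {..<k} r"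
    using esym_reindex[OF inj, of "\<lambda>j. card (P j)" r] unfolding tk c_def[abs_def] by simp
  have sP: "(\<Sum>j<k. card (P j)) = n - 1"
  proof -
    have "(\<Sum>j<k. card (P j)) = card (\<Union>j<k. P j)"
      using finP dj by (intro card_UN_disjoint[symmetric]) (auto simp: disjoint_family_on_def)
    then show ?thesis unfolding cov n_def using u fin by simp
  qed
  have sc: "(\<Sum>j<k. c j) = n - 1"
    using sum.reindex[OF inj, of "\<lambda>j. card (P j)"] unfolding tk c_def[abs_def] sP by (simp add: comp_def)
  have c0: "c 0 = card (P i)" by (simp add: c_def)
  have m2: "1 \<le> card (P i)" using i finP[OF i(1)] by (simp add: Suc_le_eq card_gt_0_iff)
  have n1: "1 \<le> n" using u fin by (auto simp: n_def Suc_le_eq card_gt_0_iff)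
  have mn: "Suc (card (P i)) \<le> n"
  proof -
    have "card (P i) \<le> (\<Sum>j<k. card (P j))" using i by (intro member_le_sum) auto
    then show ?thesis unfolding sP using n1 by linarith
  qed
  have ft: "finite (transversals P {..<k} r)"
    by (rule finite_subset[of _ "Pow (verts G)"]) (use fin cov in \<open>auto simp: transversals_def\<close>)
  have ct: "card (transversals P {..<k} r) = esym (\<lambda>j. card (P j)) {..<k} r"
    using finP dj by (intro card_transversals) auto
  have "edges G \<subseteq> {e\<in>edges G. u \<in> e} \<union> transversals P {..<k} r" using tr by blast
  then have "card (edges G) \<le> card ({e\<in>edges G. u \<in> e} \<union> transversals P {..<k} r)"
    using fin ft by (intro card_mono) auto
  also have "\<dots> \<le> deg G u + esym c {..<k} r"
    unfolding cE ct[symmetric] deg_def by (rule card_Un_le)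
  also have "\<dots> \<le> esym c {..<k} r + ((n - Suc (card (P i))) choose (r - 1)) + ((n - 2) choose (r - 2))"
    using dg unfolding n_def by linarith
  also have "\<dots> \<le> H_max r n k"
    using m2 mn c0 by (intro le_H_max[OF k r sc]) auto
  finally show ?thesis unfolding n_def .
qed

lemma card_link_le:
  assumes V: "finite U" and E: "\<And>e. e \<in> E \<Longrightarrow> v \<in> e \<and> finite e \<and> card e = r \<and> e - {v} \<subseteq> U"
  shows "card E \<le> card U choose (r - 1)"
proof -
  have "card E \<le> card {f. f \<subseteq> U \<and> card f = r - 1}"
  proof (rule card_inj_on_le[where f = "\<lambda>e. e - {v}"])
    show "inj_on (\<lambda>e. e - {v}) E"
    proof (rule inj_onI)
      fix e e' assume "e \<in> E" "e' \<in> E" "e - {v} = e' - {v}"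
      then show "e = e'" using E by (metis insert_Diff)
    qed
    show "(\<lambda>e. e - {v}) ` E \<subseteq> {f. f \<subseteq> U \<and> card f = r - 1}"
    proof (rule image_subsetI)
      fix e assume e: "e \<in> E"
      then show "e - {v} \<in> {f. f \<subseteq> U \<and> card f = r - 1}" using E[OF e] by simp
    qed
    show "finite {f. f \<subseteq> U \<and> card f = r - 1}" using V by simp
  qed
  then show ?thesis using V by (simp add: n_subsets)
qed

text \<open>The other vertices of a hyperedge at \<open>v\<close> are robust neighbours of
  \<open>v\<close>, except in the at most w n^(r-2) hyperedges with a non-robust pair at
  \<open>v\<close>.\<close>

lemma deg_le_nbh:
  assumes G: "r_graph r G" and r: "2 \<le> r" and v: "v \<in> verts G"
  shows "deg G v \<le> (card (nbh (robust w G) (verts G) v) choose (r - 1)) + w * card (verts G) ^ (r - 2)"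
proof -
  define N where "N = nbh (robust w G) (verts G) v"
  define A where "A = {e\<in>edges G. v \<in> e \<and> e - {v} \<subseteq> N}"
  define B where "B = {e\<in>edges G. v \<in> e \<and> (\<exists>y\<in>e. y \<noteq> v \<and> \<not> robust w G v y)}"
  have fin: "finite (verts G)" "finite (edges G)" using r_graphD[OF G] by auto
  have n: "0 < card (verts G)" using v fin by (auto simp: card_gt_0_iff)
  have fN: "finite N" using fin by (simp add: N_def nbh_def)
  have sub: "{e\<in>edges G. v \<in> e} \<subseteq> A \<union> B"
  proof
    fix e assume e: "e \<in> {e\<in>edges G. v \<in> e}"
    then have "e \<subseteq> verts G" using r_graphD(2)[OF G] by simp
    then show "e \<in> A \<union> B" using e by (auto simp: A_def B_def N_def nbh_def)
  qed
  have "card A \<le> card N choose (r - 1)"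
    by (rule card_link_le[OF fN, where v = v]) (use r_graphD[OF G] in \<open>auto simp: A_def\<close>)
  moreover have "card B \<le> w * card (verts G) ^ (r - 2)"
  proof -
    have "card B * card (verts G) \<le> w * card (verts G) ^ (r - 1)"
      unfolding B_def by (rule card_light_link_le[OF G r v])
    moreover have "r - 1 = Suc (r - 2)" using r by simp
    ultimately have "card B * card (verts G) \<le> (w * card (verts G) ^ (r - 2)) * card (verts G)"
      by (simp add: mult_ac)
    then show ?thesis using n by simp
  qed
  moreover have "deg G v \<le> card (A \<union> B)"
    unfolding deg_def using fin sub by (intro card_mono) (auto simp: A_def B_def)
  moreover have "card (A \<union> B) \<le> card A + card B" by (rule card_Un_le)
  ultimately show ?thesis unfolding N_def by linarith
qed

lemma robust_edge:
  assumes "{x, y} \<in> edges G" "x \<noteq> y"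
  shows "robust w G x y"
  unfolding robust_def
proof (intro conjI allI impI)
  fix W assume "x \<notin> W" "y \<notin> W"
  then show "\<exists>e\<in>edges G. x \<in> e \<and> y \<in> e \<and> e \<inter> W = {}"
    using assms(1) by (intro bexI[of _ "{x, y}"]) auto
qed (rule assms(2))

context near_partite
begin

lemma bad_edges_meet:
  assumes k3: "3 \<le> k" and e: "e \<in> edges G" "bad k P e" and e': "e' \<in> edges G" "bad k P e'"
  shows "e \<inter> e' \<noteq> {}"
proof
  assume dj: "e \<inter> e' = {}"
  obtain i x y where i: "i < k" "x \<in> e \<inter> P i" "y \<in> e \<inter> P i" "x \<noteq> y" using e(2) unfolding bad_def by blast
  obtain i' x' y' where i': "i' < k" "x' \<in> e' \<inter> P i'" "y' \<in> e' \<inter> P i'" "x' \<noteq> y'"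
    using e'(2) unfolding bad_def by blast
  \<comment> \<open>One of three indices differs from both given parts; this is where
    \<open>k \<ge> 3\<close> enters.\<close>
  define l where "l = (if i \<noteq> 0 \<and> i' \<noteq> 0 then 0 else if i \<noteq> 1 \<and> i' \<noteq> 1 then 1 else 2 :: nat)"
  have "l < k" "l \<noteq> i" "l \<noteq> i'" using k3 by (auto simp: l_def)
  then show False by (rule no_disjoint_bad[OF e(1) i e'(1) i' dj])
qed

text \<open>Hyperedges meeting \<open>P i\<close> only in \<open>u\<close> give the first binomial.
  For the others, two hyperedges sharing only \<open>u\<close> are excluded by
  \<open>no_sunflower_bad\<close>; so with \<open>u\<close> removed they form an intersecting family
  of (r-1)-sets on n - 1 points.\<close>

lemma deg_in_part_le:
  assumes r3: "3 \<le> r" and i: "i < k" "u \<in> P i"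
    and big: "(r - 1) * (r - 1) * (card (verts G) - 1) ^ (r - 3) \<le> (card (verts G) - 2) choose (r - 2)"
  shows "deg G u \<le> ((card (verts G) - card (P i)) choose (r - 1)) + ((card (verts G) - 2) choose (r - 2))"
proof -
  define V where "V = verts G"
  define A where "A = {e\<in>edges G. u \<in> e \<and> e \<inter> P i = {u}}"
  define B where "B = {e\<in>edges G. u \<in> e \<and> e \<inter> P i \<noteq> {u}}"
  have fin: "finite V" "finite (edges G)" "finite (P i)"
    using r_graphD[OF G] P(1)[OF i(1)] finite_subset unfolding V_def by auto
  have uV: "u \<in> V" using P(1)[OF i(1)] i by (auto simp: V_def)
  have "card A \<le> card (V - P i) choose (r - 1)"
  proof (rule card_link_le[where v = u])
    fix e assume e: "e \<in> A"
    then have "e \<in> edges G" "u \<in> e" "e \<inter> P i = {u}" by (auto simp: A_def)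
    then show "u \<in> e \<and> finite e \<and> card e = r \<and> e - {u} \<subseteq> V - P i"
      using edge_props[of e] by (auto simp: V_def)
  qed (use fin in simp)
  also have "card (V - P i) = card V - card (P i)"
    using P(1)[OF i(1)] fin by (intro card_Diff_subset) (auto simp: V_def)
  finally have 1: "card A \<le> (card V - card (P i)) choose (r - 1)" .
  have inj: "inj_on (\<lambda>e. e - {u}) B"
  proof (rule inj_onI)
    fix e e' assume "e \<in> B" "e' \<in> B" "e - {u} = e' - {u}"
    then show "e = e'" unfolding B_def by (metis (mono_tags, lifting) insert_Diff mem_Collect_eq)
  qed
  have cVu: "card (V - {u}) = card V - 1" using uV fin by simp
  have n2: "card V - 1 - 1 = card V - 2" "r - 1 - 1 = r - 2" "r - 1 - 2 = r - 3" by simp_all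
  have "card ((\<lambda>e. e - {u}) ` B) \<le> (card (V - {u}) - 1) choose (r - 1 - 1)"
  proof (rule intersecting_family_le)
    show "finite (V - {u})" "2 \<le> r - 1" using fin r3 by auto
    show "(r - 1) * (r - 1) * card (V - {u}) ^ (r - 1 - 2) \<le> (card (V - {u}) - 1) choose (r - 1 - 1)"
      using big[folded V_def] unfolding cVu n2 .
    show "e \<subseteq> V - {u} \<and> card e = r - 1" if eB: "e \<in> (\<lambda>e. e - {u}) ` B" for e
    proof -
      obtain f where f: "e = f - {u}" "f \<in> B" using eB by (rule imageE)
      then have "f \<in> edges G" "u \<in> f" by (simp_all add: B_def)
      then show ?thesis using edge_props[of f] unfolding f(1) V_def by auto
    qed
    show "e \<inter> e' \<noteq> {}" if ee: "e \<in> (\<lambda>e. e - {u}) ` B" "e' \<in> (\<lambda>e. e - {u}) ` B" for e e'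
    proof
      assume dj: "e \<inter> e' = {}"
      obtain f where f: "e = f - {u}" "f \<in> edges G" "u \<in> f" "f \<inter> P i \<noteq> {u}" using ee(1) by (auto simp: B_def)
      obtain f' where f': "e' = f' - {u}" "f' \<in> edges G" "u \<in> f'" "f' \<inter> P i \<noteq> {u}" using ee(2) by (auto simp: B_def)
      obtain b where b: "b \<in> f \<inter> P i" "b \<noteq> u" using f(3,4) i by auto
      obtain b' where b': "b' \<in> f' \<inter> P i" "b' \<noteq> u" using f'(3,4) i by auto
      have "f \<inter> f' = {u}" using dj f(1,3) f'(1,3) by blast
      then show False using no_sunflower_bad[OF f(2) f'(2) i b b'] by simp
    qed
  qed
  then have 2: "card B \<le> (card V - 2) choose (r - 2)" unfolding card_image[OF inj] cVu n2 .
  have "{e\<in>edges G. u \<in> e} = A \<union> B" by (auto simp: A_def B_def)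
  then have "deg G u \<le> card A + card B" using card_Un_le[of A B] by (simp add: deg_def)
  then show ?thesis using 1 2 unfolding V_def by linarith
qed

text \<open>Two edges inside parts cannot share a vertex, and any further part would allow
  \<open>no_disjoint_bad\<close>; so two of them force \<open>k = 2\<close> and lie in different
  parts. Hence there are at most two, and if there are two, \<open>no_bowtie\<close> yields a
  missing edge between the parts that makes up for one of them.\<close>

lemma card_edges_le_graph:
  assumes r2: "r = 2" and dj: "disjoint_family_on P {..<k}" and cov: "(\<Union>i<k. P i) = verts G"
  shows "card (edges G) \<le> esym (bal (card (verts G)) k) {..<k} r + 1"
proof -
  define T where "T = transversals P {..<k} r"
  define Bd where "Bd = {e\<in>edges G. bad k P e}"
  have fin: "finite (verts G)" "finite (edges G)" using r_graphD[OF G] by auto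
  have fBd: "finite Bd" using fin by (simp add: Bd_def)
  have k0: "0 < k" using k by simp
  have T: "finite T" "card T \<le> esym (bal (card (verts G)) k) {..<k} r"
    unfolding T_def by (rule card_transversals_le_bal[OF fin(1) k0 dj cov])+
  have djP: "i = j" if "i < k" "j < k" "z \<in> P i" "z \<in> P j" for i j z
    using dj that unfolding disjoint_family_on_def by blast
  have sub: "edges G \<subseteq> T \<union> Bd"
  proof
    fix e assume e: "e \<in> edges G"
    then show "e \<in> T \<union> Bd"
      using not_bad_transversal[OF G e, of P k] edge_props[OF e] cov by (auto simp: T_def Bd_def)
  qed
  have "\<exists>i x y. i < k \<and> x \<in> e \<inter> P i \<and> y \<in> e \<inter> P i \<and> x \<noteq> y \<and> (\<forall>a\<in>e. a = x \<or> a = y)" if "e \<in> Bd" for e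
  proof -
    obtain i x y where i: "i < k" "x \<in> e \<inter> P i" "y \<in> e \<inter> P i" "x \<noteq> y"
      using \<open>e \<in> Bd\<close> unfolding Bd_def bad_def by blast
    have "finite e" "card e = 2" using edge_props[of e] that r2 by (auto simp: Bd_def)
    then have "{x, y} = e" using i by (intro card_subset_eq) auto
    then have "\<forall>a\<in>e. a = x \<or> a = y" by blast
    then show ?thesis using i by blast
  qed
  then obtain ip xp yp where bd: "\<And>e. e \<in> Bd \<Longrightarrow> ip e < k \<and> xp e \<in> e \<inter> P (ip e) \<and> yp e \<in> e \<inter> P (ip e) \<and>
      xp e \<noteq> yp e \<and> (\<forall>a\<in>e. a = xp e \<or> a = yp e)"
    by metis
  have inP: "a \<in> P (ip e)" if "e \<in> Bd" "a \<in> e" for e a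
    using bd[OF that(1)] that(2) by auto
  have other: "\<exists>z. z \<in> P (ip e) \<and> z \<noteq> a \<and> e = {a, z}" if "e \<in> Bd" "a \<in> e" for e a
  proof (cases "a = xp e")
    case True
    then show ?thesis using bd[OF that(1)] by (intro exI[of _ "yp e"]) auto
  next
    case False
    then show ?thesis using bd[OF that(1)] that(2) by (intro exI[of _ "xp e"]) auto
  qed
  have pair: "k = 2 \<and> ip e \<noteq> ip e' \<and> e \<inter> e' = {}" if e: "e \<in> Bd" "e' \<in> Bd" "e \<noteq> e'" for e e'
  proof -
    have eE: "e \<in> edges G" "e' \<in> edges G" using e by (auto simp: Bd_def)
    note b = bd[OF e(1)] and b' = bd[OF e(2)]
    have disj: "e \<inter> e' = {}"
    proof (rule ccontr)
      assume "e \<inter> e' \<noteq> {}"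
      then obtain a where a: "a \<in> e" "a \<in> e'" by blast
      have aP: "a \<in> P (ip e)" "a \<in> P (ip e')" using inP[OF e(1) a(1)] inP[OF e(2) a(2)] .
      moreover have "ip e < k" "ip e' < k" using b b' by blast+
      ultimately have ii: "ip e = ip e'" using djP by blast
      obtain z where z: "z \<in> P (ip e)" "z \<noteq> a" "e = {a, z}" using other[OF e(1) a(1)] by blast
      obtain z' where z': "z' \<in> P (ip e')" "z' \<noteq> a" "e' = {a, z'}" using other[OF e(2) a(2)] by blast
      have int: "e \<inter> e' = {a}" using z(2,3) z'(2,3) e(3) by auto
      have zz: "z \<in> e \<inter> P (ip e)" "z' \<in> e' \<inter> P (ip e)" using z(1) z'(1) ii unfolding z(3) z'(3) by auto
      have "ip e < k" using b by blast
      then show False using no_sunflower_bad[OF eE _ aP(1) zz(1) z(2) zz(2) z'(2) int] by blast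
    qed
    have nol: "\<not> (\<exists>l<k. l \<noteq> ip e \<and> l \<noteq> ip e')"
    proof
      assume "\<exists>l<k. l \<noteq> ip e \<and> l \<noteq> ip e'"
      then obtain l where l: "l < k" "l \<noteq> ip e" "l \<noteq> ip e'" by blast
      show False
        by (rule no_disjoint_bad[OF eE(1) _ _ _ _ eE(2) _ _ _ _ disj l, of "xp e" "yp e" "xp e'" "yp e'"]) (use b b' in auto)
    qed
    have "ip e \<noteq> ip e'"
    proof
      assume "ip e = ip e'"
      then have "(if ip e = 0 then 1 else 0) < k \<and> (if ip e = 0 then 1 else 0) \<noteq> ip e \<and> (if ip e = 0 then 1 else 0) \<noteq> ip e'"
        using k by auto
      then show False using nol by blast
    qed
    moreover have "k = 2"
    proof (rule ccontr)
      assume "k \<noteq> 2"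
      define l where "l = (if ip e \<noteq> 0 \<and> ip e' \<noteq> 0 then 0 else if ip e \<noteq> 1 \<and> ip e' \<noteq> 1 then 1 else 2 :: nat)"
      have "l < k" "l \<noteq> ip e" "l \<noteq> ip e'" using k \<open>k \<noteq> 2\<close> by (auto simp: l_def)
      then show False using nol by blast
    qed
    ultimately show ?thesis using disj by simp
  qed
  show ?thesis
  proof (cases "\<exists>e\<in>Bd. \<exists>e'\<in>Bd. e \<noteq> e'")
    case False
    then have "card Bd \<le> Suc 0" using fBd by (subst card_le_Suc0_iff_eq) auto
    moreover have "card (edges G) \<le> card (T \<union> Bd)" using sub T fBd by (intro card_mono) auto
    moreover have "card (T \<union> Bd) \<le> card T + card Bd" by (rule card_Un_le)
    ultimately show ?thesis using T(2) by linarith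
  next
    case True
    then obtain e e' where e: "e \<in> Bd" "e' \<in> Bd" "e \<noteq> e'" by blast
    note b = bd[OF e(1)] and b' = bd[OF e(2)] and p = pair[OF e]
    have eE: "e \<in> edges G" "e' \<in> edges G" using e by (auto simp: Bd_def)
    have "inj_on ip Bd" using pair by (meson inj_onI)
    then have "card Bd \<le> card {..<k}" using bd by (intro card_inj_on_le) auto
    then have cBd: "card Bd \<le> 2" using p by simp
    have "\<not> (robust w G (xp e) (xp e') \<and> robust w G (yp e) (xp e'))"
    proof
      assume D: "robust w G (xp e) (xp e') \<and> robust w G (yp e) (xp e')"
      show False
        by (rule no_bowtie[OF _ eE(1) _ _ _ _ eE(2), of "ip e" "xp e" "yp e" "ip e'" "xp e'" "yp e'"])
          (use b b' p D in auto)
    qed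
    then obtain z where z: "z \<in> P (ip e)" "\<not> robust w G z (xp e')" using b by blast
    have zx: "z \<noteq> xp e'" using djP[of "ip e" "ip e'" z] b b' p z by auto
    have nE: "{z, xp e'} \<notin> edges G" using robust_edge[OF _ zx, of G w] z(2) by blast
    have inT: "{z, xp e'} \<in> T" unfolding T_def
    proof (rule transversals_memI)
      show "finite {z, xp e'}" "card {z, xp e'} = r" using zx r2 by auto
      show "{z, xp e'} \<subseteq> (\<Union>j\<in>{..<k}. P j)" using z b b' by auto
      have ne: "\<not> (z \<in> P j \<and> xp e' \<in> P j)" if "j < k" for j
      proof
        assume "z \<in> P j \<and> xp e' \<in> P j"
        then have "ip e = j" "ip e' = j" using djP[of "ip e" j z] djP[of "ip e'" j "xp e'"] that b b' z by auto
        then show False using p by simp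
      qed
      show "x = y" if "j \<in> {..<k}" "x \<in> {z, xp e'}" "y \<in> {z, xp e'}" "x \<in> P j" "y \<in> P j" for j x y
        using ne[of j] that by auto
    qed
    have "edges G \<subseteq> (T - {{z, xp e'}}) \<union> Bd" using sub nE by blast
    then have "card (edges G) \<le> card ((T - {{z, xp e'}}) \<union> Bd)" using T fBd by (intro card_mono) auto
    moreover have "card ((T - {{z, xp e'}}) \<union> Bd) \<le> card (T - {{z, xp e'}}) + card Bd" by (rule card_Un_le)
    moreover have "Suc (card (T - {{z, xp e'}})) = card T" using card_Suc_Diff1[OF T(1) inT] .
    ultimately show ?thesis using T(2) cBd by linarith
  qed
qed

end

lemma two_cliques_upper_bound:
  assumes r: "2 \<le> r" "r \<le> k"
  shows "\<exists>N. \<forall>n\<ge>N. \<forall>G :: nat hypergraph. r_graph r G \<longrightarrow> card (verts G) = n \<longrightarrow>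
    \<not> contains_copy G (expansion r (two_cliques k)) \<longrightarrow> card (edges G) \<le> H_max r n k"
proof -
  define f where "f = card (verts (two_cliques k))"
  define w where "w = f + r * card (edges (two_cliques k))"
  define t where "t = 2 * k + 3"
  \<comment> \<open>Parts have at least (f + 7) \<gamma> n vertices, against f + 4 times the defect
    \<gamma> n plus a constant needed by \<open>near_partite\<close>.\<close>
  define \<gamma> where "\<gamma> = 1 / (real k * (real f + 8))"
  have k: "2 \<le> k" "0 < k" using r by auto
  have t1: "1 \<le> t" by (simp add: t_def)
  have kf: "0 < real k * (real f + 8)" using k by (intro mult_pos_pos) auto
  have "real k * 1 \<le> real k * (real f + 8)" by (intro mult_left_mono) auto
  then have "\<gamma> \<le> 1 / real k" unfolding \<gamma>_def using k kf by (intro divide_left_mono) auto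
  then have \<gamma>: "0 < \<gamma>" "\<gamma> \<le> 1 / real k" using kf by (simp_all add: \<gamma>_def)
  have \<gamma>f: "(real f + 8) * \<gamma> = 1 / real k" using k kf by (simp add: \<gamma>_def)
  \<comment> \<open>By \<open>blowup_imp_two_cliques\<close> no vertex has a blow-up in its
    neighbourhood.\<close>
  define c0 where "c0 = (0 :: nat)"
  from structure_lemma[OF r t1 \<gamma>, where w = w and ?c0.0 = c0 and 'a = nat]
  obtain \<epsilon>' \<beta> n1 where \<epsilon>': "0 < \<epsilon>'" and \<beta>: "0 < \<beta>" and struct:
    "\<forall>G :: nat hypergraph. r_graph r G \<longrightarrow> n1 \<le> card (verts G) \<longrightarrow>
    (\<forall>v\<in>verts G. (1 - \<epsilon>') * real ((k - 1) choose (r - 1)) * (real (card (verts G)) / real k) ^ (r - 1) \<le> real (deg G v)) \<longrightarrow>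
    card {v\<in>verts G. has_blowup (robust w G) (nbh (robust w G) (verts G) v) k t} \<le> c0 \<longrightarrow>
    (\<exists>P X S. S = {v\<in>verts G. has_blowup (robust w G) (nbh (robust w G) (verts G) v) k t} \<and>
      disjoint_family_on P {..<k} \<and> X \<inter> (\<Union>i<k. P i) = {} \<and> X \<union> (\<Union>i<k. P i) = verts G - S \<and>
      (\<forall>i<k. (1 / real k - \<gamma>) * real (card (verts G)) \<le> real (card (P i))) \<and>
      (\<forall>i<k. \<forall>j<k. i \<noteq> j \<longrightarrow> (\<forall>x\<in>P i. real (card (P j - nbh (robust w G) (verts G) x)) \<le> \<gamma> * real (card (verts G)))) \<and>
      (\<forall>v\<in>X. \<beta> * real (card (verts G)) ^ (r - 1) \<le> real (card {e\<in>edges G. v \<in> e \<and> e \<inter> S = {} \<and> bad k P e}) \<and>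
        (\<exists>i<k. real (card (nbh (robust w G) (verts G) v)) \<le> real (card (verts G)) - real (card (P i)) - \<beta> * real (card (verts G)))))"
    by (elim exE conjE)
  define \<epsilon> where "\<epsilon> = min \<epsilon>' 1"
  have \<epsilon>: "0 < \<epsilon>" "\<epsilon> \<le> 1" "\<epsilon> \<le> \<epsilon>'" using \<epsilon>' by (auto simp: \<epsilon>_def)
  define \<delta> where "\<delta> n = (1 - \<epsilon>) * real ((k - 1) choose (r - 1)) * (real n / k) ^ (r - 1)" for n :: nat
  obtain n2 where n2: "\<forall>n\<ge>n2. real (H_max r n k) + \<delta> (Suc n) \<le> real (H_max r (Suc n) k)"
    using H_max_step[OF r \<epsilon>(1,2)] unfolding \<delta>_def by (rule exE)
  define L where "L = r + (r + 1) * Suc 1"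
  \<comment> \<open>Chosen so that 2 (n div k') is at most \<beta> n; the (r-1)-sets on n div k'
    points later absorb the term w n^(r-2) of \<open>deg_le_nbh\<close>.\<close>
  define k' where "k' = Suc (nat \<lceil>2 / \<beta>\<rceil>)"
  have r1: "1 \<le> r - 1" "r - 1 - 1 = r - 2" using r by simp_all
  have rk: "r \<le> k" by (rule r(2))
  have k0: "0 < k" by (rule k(2))
  obtain n3 where n3: "\<forall>n\<ge>n3. real (r * L) * real n ^ (r - 2) \<le> real (((n - 0) div k) choose (r - 1))"
    using choose_dominates[OF k(2) r1(1), where c = "real (r * L)" and i = 0] unfolding r1(2) by (rule exE)
  have k'0: "0 < k'" by (simp add: k'_def)
  obtain n4 where n4: "\<forall>n\<ge>n4. real w * real n ^ (r - 2) \<le> real (((n - 0) div k') choose (r - 1))"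
    using choose_dominates[OF k'0 r1(1), where c = "real w" and i = 0] unfolding r1(2) by (rule exE)
  have "\<exists>n5. 3 \<le> r \<longrightarrow> (\<forall>n\<ge>n5. real ((r - 1) * (r - 1)) * real n ^ (r - 3) \<le> real (((n - 2) div k) choose (r - 2)))"
  proof (cases "3 \<le> r")
    case True
    have r2: "1 \<le> r - 2" "r - 2 - 1 = r - 3" using True by simp_all
    show ?thesis
      using choose_dominates[OF k(2) r2(1), where c = "real ((r - 1) * (r - 1))" and i = 2] unfolding r2(2) by blast
  qed simp
  then obtain n5 where n5: "3 \<le> r \<longrightarrow> (\<forall>n\<ge>n5. real ((r - 1) * (r - 1)) * real n ^ (r - 3) \<le> real (((n - 2) div k) choose (r - 2)))"
    by (rule exE)
  define n0 where "n0 = n1 + n2 + n3 + n4 + n5 + 2 * k + Suc (nat \<lceil>real (f + 2 * r) / \<gamma>\<rceil>) + nat \<lceil>L / \<beta>\<rceil> + k'"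
  show ?thesis
  proof (rule progressive_induction[where ?n0.0 = n0 and \<delta> = \<delta>])
    show "real (H_max r n k) + \<delta> (Suc n) \<le> real (H_max r (Suc n) k)" if "n0 \<le> n" for n
      using n2 that by (simp add: n0_def)
  next
    fix G :: "nat hypergraph"
    assume big: "n0 \<le> card (verts G)" and G: "r_graph r G" and free: "\<not> contains_copy G (expansion r (two_cliques k))"
      and md: "\<forall>v\<in>verts G. \<delta> (card (verts G)) \<le> real (deg G v)"
    define V where "V = verts G"
    define n where "n = card V"
    define D where "D = robust w G"
    have bign: "n1 \<le> n" "n3 \<le> n" "n4 \<le> n" "n5 \<le> n" "2 * k \<le> n" "k' \<le> n" "0 < n" using big k by (auto simp: n0_def n_def V_def)
    have fin: "finite V" "finite (edges G)" using r_graphD[OF G] by (auto simp: V_def)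
    have wF: "card (verts (two_cliques k)) + r * card (edges (two_cliques k)) \<le> w" unfolding w_def f_def ..
    have S0: "{v\<in>verts G. has_blowup (robust w G) (nbh (robust w G) (verts G) v) k t} = {}"
      using blowup_imp_two_cliques[OF G r(1) k(1) wF] free by (auto simp: t_def)
    have cS: "card {v\<in>verts G. has_blowup (robust w G) (nbh (robust w G) (verts G) v) k t} \<le> c0" unfolding S0 by simp
    have "\<forall>v\<in>verts G. (1 - \<epsilon>') * real ((k - 1) choose (r - 1)) * (real (card (verts G)) / real k) ^ (r - 1) \<le> real (deg G v)"
    proof
      fix v assume v: "v \<in> verts G"
      have "(1 - \<epsilon>') * (real ((k - 1) choose (r - 1)) * (real (card (verts G)) / real k) ^ (r - 1)) \<le> (1 - \<epsilon>) * (real ((k - 1) choose (r - 1)) * (real (card (verts G)) / real k) ^ (r - 1))"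
        using \<epsilon> by (intro mult_right_mono) auto
      then show "(1 - \<epsilon>') * real ((k - 1) choose (r - 1)) * (real (card (verts G)) / real k) ^ (r - 1) \<le> real (deg G v)"
        using bspec[OF md v] by (simp add: \<delta>_def mult.assoc)
    qed
    from struct[THEN spec, THEN mp, THEN mp, THEN mp, THEN mp, OF G _ this cS] bign(1)
    have "\<exists>P X S'. S' = {} \<and>
      disjoint_family_on P {..<k} \<and> X \<inter> (\<Union>i<k. P i) = {} \<and> X \<union> (\<Union>i<k. P i) = V - S' \<and>
      (\<forall>i<k. (1 / real k - \<gamma>) * real n \<le> real (card (P i))) \<and>
      (\<forall>i<k. \<forall>j<k. i \<noteq> j \<longrightarrow> (\<forall>x\<in>P i. real (card (P j - nbh D V x)) \<le> \<gamma> * real n)) \<and>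
      (\<forall>v\<in>X. \<beta> * real n ^ (r - 1) \<le> real (card {e\<in>edges G. v \<in> e \<and> e \<inter> S' = {} \<and> bad k P e}) \<and>
        (\<exists>i<k. real (card (nbh D V v)) \<le> real n - real (card (P i)) - \<beta> * real n))"
      unfolding S0 D_def n_def V_def by blast
    then obtain P X where djP: "disjoint_family_on P {..<k}" and XP: "X \<inter> (\<Union>i<k. P i) = {}"
      and cov: "X \<union> (\<Union>i<k. P i) = V"
      and Plow: "\<And>i. i < k \<Longrightarrow> (1 / real k - \<gamma>) * real n \<le> real (card (P i))"
      and Pmiss: "\<And>i j x. i < k \<Longrightarrow> j < k \<Longrightarrow> i \<noteq> j \<Longrightarrow> x \<in> P i \<Longrightarrow> real (card (P j - nbh D V x)) \<le> \<gamma> * real n"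
      and XB: "\<And>v. v \<in> X \<Longrightarrow> \<beta> * real n ^ (r - 1) \<le> real (card {e\<in>edges G. v \<in> e \<and> bad k P e})"
      and XN: "\<And>v. v \<in> X \<Longrightarrow> \<exists>i<k. real (card (nbh D V v)) \<le> real n - real (card (P i)) - \<beta> * real n"
      by (elim exE conjE) simp
    have PV: "P i \<subseteq> V" if "i < k" for i using cov that by blast
    have finP: "finite (P i)" if "i < k" for i using finite_subset[OF PV[OF that]] fin by simp
    define Bn where "Bn = nat \<lfloor>\<gamma> * real n\<rfloor>"
    have Bn: "real Bn \<le> \<gamma> * real n" using \<gamma> by (simp add: Bn_def)
    have big_part: "card (verts (two_cliques k)) * Suc Bn + 4 * Bn + 2 * r < card (P i)" if "i < k" for i
    proof -
      have "real (f + 2 * r) / \<gamma> < real n"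
      proof -
        have "Suc (nat \<lceil>real (f + 2 * r) / \<gamma>\<rceil>) \<le> n" using big by (simp add: n0_def n_def V_def)
        then show ?thesis by linarith
      qed
      then have 1: "real (f + 2 * r) < \<gamma> * real n" using \<gamma> by (simp add: field_simps)
      have "(1 / real k - \<gamma>) * real n = (real f + 7) * (\<gamma> * real n)"
        unfolding \<gamma>f[symmetric] by (simp add: algebra_simps)
      moreover have "(real f + 4) * real Bn \<le> (real f + 4) * (\<gamma> * real n)" using Bn by (intro mult_left_mono) auto
      moreover have "0 \<le> \<gamma> * real n" using \<gamma> by simp
      ultimately have "(real f + 4) * real Bn + real (f + 2 * r) < real (card (P i))"
        using Plow[OF that] 1 by (simp add: algebra_simps)
      moreover have "real ((f + 4) * Bn + (f + 2 * r)) = (real f + 4) * real Bn + real (f + 2 * r)"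
        by (simp add: algebra_simps)
      ultimately have "real ((f + 4) * Bn + (f + 2 * r)) < real (card (P i))" by linarith
      then have "(f + 4) * Bn + (f + 2 * r) < card (P i)" by (simp only: of_nat_less_iff)
      then show ?thesis by (simp add: f_def algebra_simps)
    qed
    interpret near_partite G r k w Bn P
    proof (rule near_partite.intro)
      show "P i \<subseteq> verts G" if "i < k" for i using PV[OF that] by (simp add: V_def)
      show "card {b\<in>P j. \<not> robust w G a b} \<le> Bn" if ij: "i < k" "j < k" "i \<noteq> j" and a: "a \<in> P i" for i j a
      proof -
        have "{b\<in>P j. \<not> robust w G a b} \<subseteq> P j - nbh D V a" by (auto simp: nbh_def D_def)
        then have "card {b\<in>P j. \<not> robust w G a b} \<le> card (P j - nbh D V a)"
          using finP[OF ij(2)] by (intro card_mono) auto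
        then show ?thesis using Pmiss[OF ij a] by (simp add: Bn_def le_nat_iff le_floor_iff)
      qed
    qed (fact G r(1) k(1) wF big_part free)+
    have Bpos: "0 < \<beta> * real n ^ (r - 1)" using \<beta> bign by simp
    have Lbig: "L * real n ^ (r - 2) < \<beta> * real n ^ (r - 1)"
    proof -
      have "L / \<beta> < n"
      proof -
        have "Suc (nat \<lceil>L / \<beta>\<rceil>) \<le> n" using big by (simp add: n0_def n_def V_def)
        then show ?thesis by linarith
      qed
      then have "L < \<beta> * n" using \<beta> by (simp add: field_simps)
      moreover have "0 < real n ^ (r - 2)" using bign by simp
      ultimately have "L * real n ^ (r - 2) < \<beta> * n * real n ^ (r - 2)" by (rule mult_strict_right_mono)
      also have "\<dots> = \<beta> * real n ^ (r - 1)" using r by (simp add: Suc_diff_Suc numeral_2_eq_2 flip: power_Suc)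
      finally show ?thesis .
    qed
    show "card (edges G) \<le> H_max r (card (verts G)) k"
    proof (cases "r = 2")
      case True
      \<comment> \<open>A bad edge at a vertex of \<open>X\<close> would contain that vertex and two
        vertices of one part, three in all.\<close>
      have "X = {}"
      proof (rule ccontr)
        assume "X \<noteq> {}"
        then obtain v where v: "v \<in> X" by blast
        have "{e\<in>edges G. v \<in> e \<and> bad k P e} \<noteq> {}"
        proof
          assume "{e\<in>edges G. v \<in> e \<and> bad k P e} = {}"
          then have "card {e\<in>edges G. v \<in> e \<and> bad k P e} = 0" by (simp only: card.empty)
          then show False using XB[OF v] Bpos by linarith
        qed
        then obtain e where e: "e \<in> edges G" "v \<in> e" "bad k P e" by blast
        obtain i x y where i: "i < k" "x \<in> e" "x \<in> P i" "y \<in> e" "y \<in> P i" "x \<noteq> y"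
          using e(3) unfolding bad_def by blast
        have "v \<noteq> x" "v \<noteq> y" using XP v i by blast+
        then have "card {v, x, y} = 3" using i by simp
        moreover have "card {v, x, y} \<le> card e" using edge_props[OF e(1)] e i by (intro card_mono) auto
        ultimately show False using edge_props[OF e(1)] True by simp
      qed
      then have "card (edges G) \<le> esym (bal n k) {..<k} r + 1"
        using card_edges_le_graph[OF True djP] cov by (simp add: V_def n_def)
      also have "\<dots> \<le> H_max r n k" using H_max_ge[OF k(1) r(1) bign(5)] True by simp
      finally show ?thesis by (simp add: n_def V_def)
    next
      case False
      then have r3: "3 \<le> r" "3 \<le> k" using r rk by auto
      define B where "B = {e\<in>edges G. bad k P e}"
      define H where "H = \<lparr>verts = V, edges = B\<rparr>"
      have H: "r_graph r H" using G by (auto simp: r_graph_def H_def B_def V_def)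
      have Hs: "verts H = V" "edges H = B" by (simp_all add: H_def)
      \<comment> \<open>Bad hyperedges pairwise meet, so \<open>matching_structure\<close> applies
        with b = 1: at most one vertex has large degree in \<open>H\<close>, and if there is one, it
        lies in every bad hyperedge.\<close>
      have nomatch: "card M \<noteq> Suc 1" if M: "M \<subseteq> edges H" "matching M" for M
      proof
        assume "card M = Suc 1"
        then have "card M = 2" by simp
        then obtain e e' where e: "M = {e, e'}" "e \<noteq> e'" unfolding card_2_iff by blast
        have "e \<inter> e' = {}" using M(2) e by (simp add: matching_def)
        moreover have "e \<inter> e' \<noteq> {}" using M(1) e by (intro bad_edges_meet[OF r3(2)]) (auto simp: Hs B_def)
        ultimately show False by simp
      qed
      have Lb: "r + (r + 1) * Suc 1 \<le> L" unfolding L_def ..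
      define S' where "S' = {v\<in>verts H. L * card (verts H) ^ (r - 2) < deg H v}"
      have ms1: "card S' \<le> 1" by (rule matching_structure(1)[OF H r(1) nomatch Lb, folded S'_def])
      have ms2: "e \<inter> S' \<noteq> {}" if "card S' = 1" "e \<in> edges H" for e
        by (rule matching_structure(2)[OF H r(1) nomatch Lb, folded S'_def, OF _ _ that])
      have ms3: "card {e\<in>edges H. e \<inter> S' = {}} \<le> r * 1 * (L * card (verts H) ^ (r - 2))"
        by (rule matching_structure(3)[OF H r(1) nomatch Lb, folded S'_def])
      have S'V: "S' \<subseteq> V" by (auto simp: S'_def Hs)
      have fS': "finite S'" using finite_subset[OF S'V fin(1)] .
      have XS': "X \<subseteq> S'"
      proof
        fix v assume v: "v \<in> X"
        then have vV: "v \<in> V" using cov by blast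
        have "deg H v = card {e\<in>edges G. v \<in> e \<and> bad k P e}"
          unfolding deg_def Hs B_def by (rule arg_cong[where f = card]) auto
        then have "real (L * n ^ (r - 2)) < real (deg H v)" using XB[OF v] Lbig by simp
        then have "L * n ^ (r - 2) < deg H v" by (simp only: of_nat_less_iff)
        then show "v \<in> S'" using vV by (simp add: S'_def Hs n_def)
      qed
      show ?thesis
      \<comment> \<open>Without a vertex of large bad degree there are O(n^(r-2)) bad hyperedges,
        fewer than the surplus of order n^(r-1) that \<open>H_max_ge\<close> gives over the Turan
        count.\<close>
      proof (cases "S' = {}")
        case True
        then have covP: "(\<Union>i<k. P i) = V" using XS' cov by blast
        note T = card_transversals_le_bal[OF fin(1) k0 djP covP, of r]
        have "edges G \<subseteq> transversals P {..<k} r \<union> B"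
        proof
          fix e assume e: "e \<in> edges G"
          then show "e \<in> transversals P {..<k} r \<union> B"
            using not_bad_transversal[OF G e, of P k] edge_props[OF e] covP by (auto simp: B_def V_def)
        qed
        then have "card (edges G) \<le> card (transversals P {..<k} r \<union> B)"
          using T(1) fin by (intro card_mono) (auto simp: B_def)
        also have "\<dots> \<le> card (transversals P {..<k} r) + card B" by (rule card_Un_le)
        finally have 1: "card (edges G) \<le> esym (bal n k) {..<k} r + card B" using T(2) by (simp add: n_def)
        have "card B \<le> r * L * n ^ (r - 2)" using ms3 unfolding True Hs by (simp add: n_def mult.assoc)
        moreover have "real (r * L) * real n ^ (r - 2) \<le> real ((n div k) choose (r - 1))" using n3 bign(2) by simp
        then have "real (r * L * n ^ (r - 2)) \<le> real ((n div k) choose (r - 1))" by simp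
        then have "r * L * n ^ (r - 2) \<le> (n div k) choose (r - 1)" by (simp only: of_nat_le_iff)
        moreover have "esym (bal n k) {..<k} r + ((n div k) choose (r - 1)) \<le> H_max r n k"
          using H_max_ge[OF k(1) r(1) bign(5)] False by simp
        ultimately show ?thesis using 1 by (simp add: n_def V_def)
      next
        case ne: False
        then have "card S' \<noteq> 0" using fS' by simp
        then have cS': "card S' = 1" using ms1 by simp
        then obtain u where u: "S' = {u}" by (rule card_1_singletonE)
        have uV: "u \<in> verts G" using S'V u by (simp add: V_def)
        have ub: "u \<in> e" if "e \<in> B" for e using ms2[OF cS', of e] that unfolding Hs u by blast
        define P' where "P' j = P j - {u}" for j
        have djP': "disjoint_family_on P' {..<k}" using djP unfolding disjoint_family_on_def P'_def by blast
        have covP': "(\<Union>j<k. P' j) = verts G - {u}"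
        proof -
          have "(\<Union>j<k. P' j) = (\<Union>j<k. P j) - {u}" by (auto simp: P'_def)
          also have "\<dots> = (X \<union> (\<Union>j<k. P j)) - {u}" using XS' u by blast
          finally show ?thesis unfolding cov V_def .
        qed
        have tr: "e \<in> transversals P' {..<k} r" if e: "e \<in> edges G" "u \<notin> e" for e
        proof (rule not_bad_transversal[OF G e(1)])
          show "e \<subseteq> (\<Union>j<k. P' j)" unfolding covP' using edge_props[OF e(1)] e(2) by blast
          have "\<not> bad k P e" using ub[of e] e by (auto simp: B_def)
          then show "\<not> bad k P' e" by (auto simp: bad_def P'_def)
        qed
        have Pbig: "2 \<le> card (P i)" if "i < k" for i using big_part[OF that] r by linarith
        have P'ne: "P' i \<noteq> {}" if i: "i < k" for i
        proof
          assume "P' i = {}"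
          then have "P i \<subseteq> {u}" by (auto simp: P'_def)
          then have "card (P i) \<le> card {u}" by (intro card_mono) simp_all
          then show False using Pbig[OF i] by simp
        qed
        show ?thesis
        \<comment> \<open>If \<open>u\<close> is in \<open>X\<close>, its robust neighbourhood falls
          short of n - |P i| by \<beta> n for some \<open>i\<close>, which outweighs the hyperedges
          with a non-robust pair at \<open>u\<close>. If \<open>u\<close> lies in a part,
          \<open>deg_in_part_le\<close> applies. Either way \<open>u\<close> acts as the special
          vertex of the construction.\<close>
        proof (cases "u \<in> X")
          case True
          then obtain i where i: "i < k" "real (card (nbh D V u)) \<le> real n - real (card (P i)) - \<beta> * real n"
            using XN by blast
          have "u \<notin> P i" using XP True i by blast
          then have Pi: "P' i = P i" by (simp add: P'_def)
          define a where "a = card (nbh D V u)"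
          define q where "q = n div k'"
          have "2 / \<beta> \<le> real k'" unfolding k'_def by linarith
          then have kb: "2 \<le> \<beta> * real k'" using \<beta> by (simp add: field_simps)
          have "\<beta> * real k' \<le> \<beta> * real n" using \<beta> bign(6) by (intro mult_left_mono) auto
          then have bn: "2 \<le> \<beta> * real n" using kb by linarith
          have "k' * q \<le> n" by (simp add: q_def)
          then have "real k' * real q \<le> real n" by (simp only: of_nat_le_iff flip: of_nat_mult)
          then have "\<beta> * (real k' * real q) \<le> \<beta> * real n" using \<beta> by (intro mult_left_mono) auto
          moreover have "2 * real q \<le> \<beta> * real k' * real q" using kb by (intro mult_right_mono) auto
          ultimately have "2 * real q \<le> \<beta> * real n" by (simp add: mult.assoc)
          \<comment> \<open>The spare unit is for \<open>u\<close>: it is not in \<open>P i\<close>,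
            so the special part has one vertex more than \<open>P i\<close>.\<close>
          then have "real a + real q + 1 + real (card (P i)) \<le> real n" using i(2) bn unfolding a_def by linarith
          then have "a + q + 1 + card (P i) \<le> n" by linarith
          then have aq: "a + q \<le> n - Suc (card (P i))" by linarith
          have "real w * real n ^ (r - 2) \<le> real (q choose (r - 1))" using n4 bign(3) by (simp add: q_def)
          then have "real (w * n ^ (r - 2)) \<le> real (q choose (r - 1))" by simp
          then have wq: "w * n ^ (r - 2) \<le> q choose (r - 1)" by (simp only: of_nat_le_iff)
          have "deg G u \<le> (a choose (r - 1)) + w * n ^ (r - 2)"
            using deg_le_nbh[OF G r(1) uV, of w] by (simp add: a_def D_def V_def n_def)
          also have "\<dots> \<le> (q choose (r - 1)) + (a choose (r - 1))" using wq by simp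
          also have "\<dots> \<le> (a + q) choose (r - 1)" by (rule choose_add_ge(1)[OF r1(1)])
          also have "\<dots> \<le> (n - Suc (card (P i))) choose (r - 1)" by (rule binomial_right_mono[OF aq])
          finally have "deg G u \<le> ((n - Suc (card (P i))) choose (r - 1)) + ((n - 2) choose (r - 2))" by linarith
          then have dg: "deg G u \<le> ((card (verts G) - Suc (card (P' i))) choose (r - 1)) + ((card (verts G) - 2) choose (r - 2))"
            unfolding Pi n_def V_def .
          show ?thesis
            by (rule card_edges_le_star[OF G r(1) k(1) uV djP' covP' i(1) P'ne[OF i(1)] _ dg]) (rule tr)
        next
          case uX: False
          then have "u \<in> (\<Union>i<k. P i)" using uV cov by (auto simp: V_def)
          then obtain i where i: "i < k" "u \<in> P i" by blast
          have Pi: "Suc (card (P' i)) = card (P i)"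
            unfolding P'_def by (rule card_Suc_Diff1[OF finP[OF i(1)] i(2)])
          have "(r - 1) * (r - 1) * (n - 1) ^ (r - 3) \<le> (r - 1) * (r - 1) * n ^ (r - 3)"
            by (intro mult_left_mono power_mono) auto
          also have "\<dots> \<le> ((n - 2) div k) choose (r - 2)"
          proof -
            have "real ((r - 1) * (r - 1)) * real n ^ (r - 3) \<le> real (((n - 2) div k) choose (r - 2))"
              using n5 r3(1) bign(4) by blast
            then have "real ((r - 1) * (r - 1) * n ^ (r - 3)) \<le> real (((n - 2) div k) choose (r - 2))"
              by (simp only: of_nat_mult of_nat_power)
            then show ?thesis by (simp only: of_nat_le_iff)
          qed
          also have "\<dots> \<le> (n - 2) choose (r - 2)" by (intro binomial_right_mono div_le_dividend)
          finally have "deg G u \<le> ((card (verts G) - card (P i)) choose (r - 1)) + ((card (verts G) - 2) choose (r - 2))"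
            unfolding n_def V_def by (rule deg_in_part_le[OF r3(1) i])
          then have dg: "deg G u \<le> ((card (verts G) - Suc (card (P' i))) choose (r - 1)) + ((card (verts G) - 2) choose (r - 2))"
            unfolding Pi .
          show ?thesis
            by (rule card_edges_le_star[OF G r(1) k(1) uV djP' covP' i(1) P'ne[OF i(1)] _ dg]) (rule tr)
        qed
      qed
    qed
  qed
qed

lemma ex_number_two_cliques:
  assumes r: "2 \<le> r" "r \<le> k"
  shows "\<forall>\<^sub>F n in sequentially. ex_number r n (expansion r (two_cliques k)) = card (edges (H_extremal r n k))"
proof -
  have k: "2 \<le> k" using r by simp
  obtain N where N: "\<forall>n\<ge>N. \<forall>G :: nat hypergraph. r_graph r G \<longrightarrow> card (verts G) = n \<longrightarrow>
    \<not> contains_copy G (expansion r (two_cliques k)) \<longrightarrow> card (edges G) \<le> H_max r n k"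
    using two_cliques_upper_bound[OF r] by (rule exE)
  have "ex_number r n (expansion r (two_cliques k)) = card (edges (H_extremal r n k))" if n: "N + 2 \<le> n" for n
  proof (rule ex_numberI)
    have "2 \<le> n" using n by simp
    from H_extremal_props(1)[OF k this r(1)] obtain m
      where m: "2 \<le> m" "m \<le> n" "H_extremal r n k = H_prime r n k m" by (elim exE conjE)
    show "r_graph r (H_extremal r n k)" "card (verts (H_extremal r n k)) = n"
      unfolding m(3) using H_prime_props[OF k m(1,2) r(1)] by simp_all
    show "\<not> contains_copy (H_extremal r n k) (expansion r (two_cliques k))"
      unfolding m(3) by (rule H_prime_free[OF k m(1,2) r(1)])
    show "card (edges G) \<le> card (edges (H_extremal r n k))"
      if "r_graph r G" "card (verts G) = n" "\<not> contains_copy G (expansion r (two_cliques k))" for G :: "nat hypergraph"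
      using N n that by (simp add: H_max_def)
  qed simp
  then show ?thesis unfolding eventually_sequentially by blast
qed

theorem theorem1p4:
  fixes k r :: nat
  assumes "2 \<le> r" and "r \<le> k"
  shows "(\<forall>(s::nat) (F::'a hypergraph).
            s \<ge> 1 \<and> graph F
            \<and> card {C \<in> components F. chromatic_number C = k + 1} = s
            \<and> (\<forall>C\<in>components F. chromatic_number C = k + 1 \<longrightarrow> (\<exists>e. color_critical C e))
            \<and> (\<forall>C\<in>components F. chromatic_number C \<noteq> k + 1 \<longrightarrow> chromatic_number C \<le> k)
            \<longrightarrow> (\<forall>\<^sub>F n in sequentially.
                  ex_number r n (expansion r F) = card (edges (turan_plus r n k (s - 1)))))
       \<and> (\<forall>\<^sub>F n in sequentially.
            ex_number r n (expansion r (two_cliques k)) = card (edges (H_extremal r n k)))"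
proof (intro conjI allI impI)
  fix s :: nat and F :: "'a hypergraph"
  assume "s \<ge> 1 \<and> graph F
    \<and> card {C \<in> components F. chromatic_number C = k + 1} = s
    \<and> (\<forall>C\<in>components F. chromatic_number C = k + 1 \<longrightarrow> (\<exists>e. color_critical C e))
    \<and> (\<forall>C\<in>components F. chromatic_number C \<noteq> k + 1 \<longrightarrow> chromatic_number C \<le> k)"
  then show "\<forall>\<^sub>F n in sequentially. ex_number r n (expansion r F) = card (edges (turan_plus r n k (s - 1)))"
    by (elim conjE) (rule ex_number_critical[OF assms])
qed (rule ex_number_two_cliques[OF assms])

end
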